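(* For $N=1$, $m\geq 3$ and $m$ even, $\mathrm{HH}^*(\Lambda_1)$ is a finitely generated $\mathbb{K}$-algebra with generators: - $1$ and $a_i\bar a_i$ for $i=0,1,\ldots,m-1$, in degree $0$; - $\varphi_{1,0},\ \psi_{1,0}$ in degree $1$; - $\chi_{2,0}$ in degree $2$; - $\varphi_{m-1,-1},\ \psi_{m-1,1}$ in degree $m-1$; - $\chi_{m,1},\ \chi_{m,-1}$ in degree $m$.
   Context: Let $\mathbb{K}$ be a field. Let $\mathcal{Q}$ be the quiver with vertices $0,1,\ldots,m-1$ and, for each $i$ (indices modulo $m$), arrows $a_i:i\to i+1$ and $\bar a_i:i+1\to i$. Paths are written from left to right; $e_i$ is the trivial path at $i$. $\Lambda_1=\mathbb{K}\mathcal{Q}/I_1$ where $I_1$ is generated by $a_ia_{i+1}$, $\bar a_{i-1}\bar a_{i-2}$, $a_i\bar a_i-\bar a_{i-1}a_{i-1}$ for all $i$. $\mathrm{HH}^*(\Lambda_1)=\mathrm{Ext}^*_{\Lambda_1^e}(\Lambda_1,\Lambda_1)$ with the Yoneda product; $\mathrm{HH}^0(\Lambda_1)$ is identified with the centre $Z(\Lambda_1)$. Write $\otimes=\otimes_{\mathbb{K}}$. A minimal projective bimodule resolution of $\Lambda_1$ is $(P^*,\partial^* )$ with $P^n=\bigoplus_{i=0}^{m-1}\bigoplus_{r=0}^n\Lambda_1e_i\otimes e_{i+n-2r}\Lambda_1$. Write $e_i\otimes_r e_{i+n-2r}$ for the generator of the $(i,r)$-summand of $P^n$ (first index modulo $m$;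 generators in $P^{n-1}$ with tensor subscript $-1$ or $n$ are $0$). Unsubscripted $a,\bar a$ denote the arrows of that type making the expression composable. $\partial^0$ is multiplication, and for $n\geq1$, $\partial^n(e_i\otimes_r e_{i+n-2r})=e_i\otimes_r e_{i+n-1-2r}a+(-1)^ne_i\otimes_{r-1}e_{i+n+1-2r}\bar a+(-1)^{n+r}\big(ae_{i+1}\otimes_re_{i+n-2r}+\bar ae_{i-1}\otimes_{r-1}e_{i+n-2r}\big)$. Classes in $\mathrm{HH}^n(\Lambda_1)$ are represented by cocycles in $\mathrm{Hom}_{\Lambda_1^e}(P^n,\Lambda_1)$; for a cocycle only the non-zero images of generators are listed. For $0\leq i\leq m-1$ and $k\in\mathbb{Z}$, $e_i\otimes e_{i+k}\in P^n$ means $e_i\otimes_r e_{i+n-2r}$ with $r=(n-k)/2$ ($k$ is not reduced modulo $m$). For all $i=0,\ldots,m-1$: $\varphi_{1,0}$: $e_i\otimes e_{i+1}\mapsto a_i$; $\psi_{1,0}$: $e_i\otimes e_{i-1}\mapsto\bar a_{i-1}$; $\chi_{2,0}$: $e_i\otimes e_i\mapsto(-1)^ie_i$; $\varphi_{m-1,-1}$: $e_i\otimes e_{i-m+1}\mapsto(-1)^ia_i$; $\psi_{m-1,1}$: $e_i\otimes e_{i+m-1}\mapsto(-1)^i\bar a_{i-1}$; $\chi_{m,1}$: $e_i\otimes e_{i+m}\mapsto e_i$; $\chi_{m,-1}$: $e_i\otimes e_{i-m}\mapsto e_i$. The first subscript of each symbol is its cohomological degree.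
   Formalization: The formal statement also assumes that the characteristic of K does not divide m; otherwise φ_{1,0} = −ψ_{1,0} in HH^1, which is 2-dimensional, so the listed elements do not generate (e.g. m = 4 and K of characteristic 2). *)

theory Defs
  imports
    "HOL-Algebra.QuotRing"
    "HOL-Algebra.Module"
    "HOL-Library.Poly_Mapping"
    "Graph_Theory.Arc_Walk"
begin

section \<open>Vector spaces and algebras over a field\<close>

text \<open>
  The base field is a type \<open>'k\<close> of class \<^class>\<open>field\<close>. A \<open>'k\<close>-vector space or a (not necessarily
  commutative) \<open>'k\<close>-algebra is given by a record of type \<open>('k, 'v) module\<close> whose scalars are all of
  \<open>'k\<close>. As usual for abelian groups in HOL-Algebra, the fields \<^const>\<open>mult\<close> and \<^const>\<open>one\<close> of a mere
  vector space carry no information.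
\<close>

definition free_space :: "'a set \<Rightarrow> ('k::field, 'a \<Rightarrow>\<^sub>0 'k) module" where
  "free_space S =
    \<lparr>carrier = {x. Poly_Mapping.keys x \<subseteq> S}, mult = undefined, one = undefined,
     zero = 0, add = (+), smult = (\<lambda>c. Poly_Mapping.map (\<lambda>y. c * y))\<rparr>"

inductive_set lin_span :: "('k, 'v, 'z) module_scheme \<Rightarrow> 'v set \<Rightarrow> 'v set"
  for V :: "('k, 'v, 'z) module_scheme" and S :: "'v set" where
  zero: "\<zero>\<^bsub>V\<^esub> \<in> lin_span V S"
| incl: "x \<in> S \<Longrightarrow> x \<in> lin_span V S"
| add: "x \<in> lin_span V S \<Longrightarrow> y \<in> lin_span V S \<Longrightarrow> x \<oplus>\<^bsub>V\<^esub> y \<in> lin_span V S"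
| smult: "x \<in> lin_span V S \<Longrightarrow> c \<odot>\<^bsub>V\<^esub> x \<in> lin_span V S"

inductive_set subalgebra_gen :: "('k, 'v, 'z) module_scheme \<Rightarrow> 'v set \<Rightarrow> 'v set"
  for A :: "('k, 'v, 'z) module_scheme" and S :: "'v set" where
  one: "\<one>\<^bsub>A\<^esub> \<in> subalgebra_gen A S"
| incl: "x \<in> S \<Longrightarrow> x \<in> subalgebra_gen A S"
| add: "x \<in> subalgebra_gen A S \<Longrightarrow> y \<in> subalgebra_gen A S \<Longrightarrow> x \<oplus>\<^bsub>A\<^esub> y \<in> subalgebra_gen A S"
| smult: "x \<in> subalgebra_gen A S \<Longrightarrow> c \<odot>\<^bsub>A\<^esub> x \<in> subalgebra_gen A S"
| mult: "x \<in> subalgebra_gen A S \<Longrightarrow> y \<in> subalgebra_gen A S \<Longrightarrow> x \<otimes>\<^bsub>A\<^esub> y \<in> subalgebra_gen A S"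

text \<open>
  The ring \<^const>\<open>FactRing\<close> together with the induced scalar multiplication. For a subspace \<open>W\<close> of a
  vector space \<open>V\<close> the same record is the quotient space \<open>V/W\<close>.
\<close>

definition quot :: "('k, 'v, 'z) module_scheme \<Rightarrow> 'v set \<Rightarrow> ('k, 'v set) module" where
  "quot V W =
    \<lparr>carrier = carrier (V Quot W), mult = mult (V Quot W), one = one (V Quot W),
     zero = zero (V Quot W), add = add (V Quot W),
     smult = (\<lambda>c X. \<Union>x\<in>X. W +>\<^bsub>V\<^esub> (c \<odot>\<^bsub>V\<^esub> x))\<rparr>"


section \<open>Tensor products\<close>

definition bilinear_rels ::
  "('k::field, 'u, 'y) module_scheme \<Rightarrow> ('k, 'v, 'z) module_scheme \<Rightarrow> ('u \<times> 'v \<Rightarrow>\<^sub>0 'k) set" where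
  "bilinear_rels U V =
     {Poly_Mapping.single (u \<oplus>\<^bsub>U\<^esub> u', v) 1
        - Poly_Mapping.single (u, v) 1 - Poly_Mapping.single (u', v) 1
      | u u' v. u \<in> carrier U \<and> u' \<in> carrier U \<and> v \<in> carrier V}
   \<union> {Poly_Mapping.single (u, v \<oplus>\<^bsub>V\<^esub> v') 1
        - Poly_Mapping.single (u, v) 1 - Poly_Mapping.single (u, v') 1
      | u v v'. u \<in> carrier U \<and> v \<in> carrier V \<and> v' \<in> carrier V}
   \<union> {Poly_Mapping.single (c \<odot>\<^bsub>U\<^esub> u, v) 1 - Poly_Mapping.single (u, v) c
      | c u v. u \<in> carrier U \<and> v \<in> carrier V}
   \<union> {Poly_Mapping.single (u, c \<odot>\<^bsub>V\<^esub> v) 1 - Poly_Mapping.single (u, v) c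
      | c u v. u \<in> carrier U \<and> v \<in> carrier V}"

definition pair_space ::
  "('k::field, 'u, 'y) module_scheme \<Rightarrow> ('k, 'v, 'z) module_scheme
     \<Rightarrow> ('k, 'u \<times> 'v \<Rightarrow>\<^sub>0 'k) module" where
  "pair_space U V = free_space (carrier U \<times> carrier V)"

definition tensor_kernel ::
  "('k::field, 'u, 'y) module_scheme \<Rightarrow> ('k, 'v, 'z) module_scheme \<Rightarrow> ('u \<times> 'v \<Rightarrow>\<^sub>0 'k) set" where
  "tensor_kernel U V = lin_span (pair_space U V) (bilinear_rels U V)"

definition tensor_class ::
  "('k::field, 'u, 'y) module_scheme \<Rightarrow> ('k, 'v, 'z) module_scheme
     \<Rightarrow> ('u \<times> 'v \<Rightarrow>\<^sub>0 'k) \<Rightarrow> ('u \<times> 'v \<Rightarrow>\<^sub>0 'k) set" where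
  "tensor_class U V t = tensor_kernel U V +>\<^bsub>pair_space U V\<^esub> t"

definition tensor_space ::
  "('k::field, 'u, 'y) module_scheme \<Rightarrow> ('k, 'v, 'z) module_scheme
     \<Rightarrow> ('k, ('u \<times> 'v \<Rightarrow>\<^sub>0 'k) set) module" where
  "tensor_space U V = quot (pair_space U V) (tensor_kernel U V)"

text \<open>The linear map between free spaces induced by a map of bases.\<close>

definition push :: "('a \<Rightarrow> 'b) \<Rightarrow> ('a \<Rightarrow>\<^sub>0 'k::field) \<Rightarrow> ('b \<Rightarrow>\<^sub>0 'k)" where
  "push h t =
     (\<Sum>x\<in>Poly_Mapping.keys t. Poly_Mapping.single (h x) (Poly_Mapping.lookup t x))"


section \<open>Bimodules\<close>

record ('k, 'a, 'v) bimodule = "('k, 'v) module" +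
  lact :: "'a \<Rightarrow> 'v \<Rightarrow> 'v"
  ract :: "'v \<Rightarrow> 'a \<Rightarrow> 'v"

definition regular_bimodule :: "('k, 'a) module \<Rightarrow> ('k, 'a, 'a) bimodule" where
  "regular_bimodule L =
    \<lparr>carrier = carrier L, mult = mult L, one = one L, zero = zero L, add = add L, smult = smult L,
     lact = mult L, ract = mult L\<rparr>"

definition left_principal :: "('k, 'a) module \<Rightarrow> 'a \<Rightarrow> ('k, 'a) module" where
  "left_principal L e = L\<lparr>carrier := (\<lambda>x. x \<otimes>\<^bsub>L\<^esub> e) ` carrier L\<rparr>"

definition right_principal :: "('k, 'a) module \<Rightarrow> 'a \<Rightarrow> ('k, 'a) module" where
  "right_principal L f = L\<lparr>carrier := (\<lambda>x. f \<otimes>\<^bsub>L\<^esub> x) ` carrier L\<rparr>"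

text \<open>The bimodule \<open>Le \<otimes> fL\<close>.\<close>

definition proj_bimodule ::
  "('k::field, 'a) module \<Rightarrow> 'a \<Rightarrow> 'a \<Rightarrow> ('k, 'a, ('a \<times> 'a \<Rightarrow>\<^sub>0 'k) set) bimodule" where
  "proj_bimodule L e f =
    (let U = left_principal L e; V = right_principal L f; T = tensor_space U V in
     \<lparr>carrier = carrier T, mult = mult T, one = one T, zero = zero T, add = add T, smult = smult T,
      lact = (\<lambda>x X. \<Union>t\<in>X. tensor_class U V (push (\<lambda>(u, v). (x \<otimes>\<^bsub>L\<^esub> u, v)) t)),
      ract = (\<lambda>X x. \<Union>t\<in>X. tensor_class U V (push (\<lambda>(u, v). (u, v \<otimes>\<^bsub>L\<^esub> x)) t))\<rparr>)"

text \<open>The direct sum over a finite index set.\<close>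

definition direct_sum ::
  "'i set \<Rightarrow> ('i \<Rightarrow> ('k, 'a, 'v) bimodule) \<Rightarrow> ('k, 'a, 'i \<Rightarrow> 'v) bimodule" where
  "direct_sum J M =
    \<lparr>carrier = (\<Pi>\<^sub>E j\<in>J. carrier (M j)), mult = undefined, one = undefined,
     zero = (\<lambda>j\<in>J. \<zero>\<^bsub>M j\<^esub>),
     add = (\<lambda>x y. \<lambda>j\<in>J. x j \<oplus>\<^bsub>M j\<^esub> y j),
     smult = (\<lambda>c x. \<lambda>j\<in>J. c \<odot>\<^bsub>M j\<^esub> x j),
     lact = (\<lambda>l x. \<lambda>j\<in>J. lact (M j) l (x j)),
     ract = (\<lambda>x l. \<lambda>j\<in>J. ract (M j) (x j) l)\<rparr>"

text \<open>Homomorphisms are extensional functions, so that equal homomorphisms are equal in HOL.\<close>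

definition bimodule_hom ::
  "('k, 'a) module \<Rightarrow> ('k, 'a, 'v) bimodule \<Rightarrow> ('k, 'a, 'w) bimodule \<Rightarrow> ('v \<Rightarrow> 'w) set" where
  "bimodule_hom L M N =
    {f \<in> carrier M \<rightarrow>\<^sub>E carrier N.
       (\<forall>x\<in>carrier M. \<forall>y\<in>carrier M. f (x \<oplus>\<^bsub>M\<^esub> y) = f x \<oplus>\<^bsub>N\<^esub> f y) \<and>
       (\<forall>c. \<forall>x\<in>carrier M. f (c \<odot>\<^bsub>M\<^esub> x) = c \<odot>\<^bsub>N\<^esub> f x) \<and>
       (\<forall>l\<in>carrier L. \<forall>x\<in>carrier M. f (lact M l x) = lact N l (f x)) \<and>
       (\<forall>l\<in>carrier L. \<forall>x\<in>carrier M. f (ract M x l) = ract N (f x) l)}"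

text \<open>The homomorphism with prescribed values \<open>w\<close> on the generators \<open>g j\<close>, \<open>j \<in> J\<close>.\<close>

definition hom_by_gens ::
  "('k, 'a) module \<Rightarrow> ('k, 'a, 'v) bimodule \<Rightarrow> ('k, 'a, 'w) bimodule
     \<Rightarrow> 'j set \<Rightarrow> ('j \<Rightarrow> 'v) \<Rightarrow> ('j \<Rightarrow> 'w) \<Rightarrow> 'v \<Rightarrow> 'w" where
  "hom_by_gens L M N J g w = (THE f. f \<in> bimodule_hom L M N \<and> (\<forall>j\<in>J. f (g j) = w j))"


section \<open>The algebra of self-extensions computed from a projective resolution\<close>

text \<open>
  \<open>\<dots> \<rightarrow> P 1 \<rightarrow> P 0 \<rightarrow> L \<rightarrow> 0\<close> is a projective bimodule resolution of the algebra \<open>L\<close>, with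
  \<open>d n : P n \<rightarrow> P (n - 1)\<close> for \<open>n \<ge> 1\<close> and augmentation \<open>\<epsilon> : P 0 \<rightarrow> L\<close>. The locale is a mere
  signature; the definitions have the intended meaning when the data form such a resolution.
\<close>

locale resolution_data =
  fixes L :: "('k::field, 'a) module"
    and P :: "nat \<Rightarrow> ('k, 'a, 'p) bimodule"
    and d :: "nat \<Rightarrow> 'p \<Rightarrow> 'p"
    and \<epsilon> :: "'p \<Rightarrow> 'a"
begin

definition cochains :: "nat \<Rightarrow> ('k, 'p \<Rightarrow> 'a) module" where
  "cochains n =
    \<lparr>carrier = bimodule_hom L (P n) (regular_bimodule L), mult = undefined, one = undefined,
     zero = (\<lambda>x\<in>carrier (P n). \<zero>\<^bsub>L\<^esub>),
     add = (\<lambda>f g. \<lambda>x\<in>carrier (P n). f x \<oplus>\<^bsub>L\<^esub> g x),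
     smult = (\<lambda>c f. \<lambda>x\<in>carrier (P n). c \<odot>\<^bsub>L\<^esub> f x)\<rparr>"

definition cocycles :: "nat \<Rightarrow> ('k, 'p \<Rightarrow> 'a) module" where
  "cocycles n = (cochains n)\<lparr>carrier :=
     {f \<in> carrier (cochains n). \<forall>x\<in>carrier (P (Suc n)). f (d (Suc n) x) = \<zero>\<^bsub>L\<^esub>}\<rparr>"

definition coboundaries :: "nat \<Rightarrow> ('p \<Rightarrow> 'a) set" where
  "coboundaries n =
    (if n = 0 then {\<zero>\<^bsub>cochains 0\<^esub>}
     else {\<lambda>x\<in>carrier (P n). g (d n x) | g. g \<in> carrier (cochains (n - 1))})"

definition Ext :: "nat \<Rightarrow> ('k, ('p \<Rightarrow> 'a) set) module" where
  "Ext n = quot (cocycles n) (coboundaries n)"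

definition coh_class :: "nat \<Rightarrow> ('p \<Rightarrow> 'a) \<Rightarrow> ('p \<Rightarrow> 'a) set" where
  "coh_class n f = coboundaries n +>\<^bsub>cocycles n\<^esub> f"

text \<open>Liftings of a cocycle \<open>g\<close> of degree \<open>q\<close> to a chain map \<open>P (q + n) \<rightarrow> P n\<close>.\<close>

definition is_lift :: "nat \<Rightarrow> ('p \<Rightarrow> 'a) \<Rightarrow> (nat \<Rightarrow> 'p \<Rightarrow> 'p) \<Rightarrow> bool" where
  "is_lift q g G \<longleftrightarrow>
     (\<forall>n. G n \<in> bimodule_hom L (P (q + n)) (P n)) \<and>
     (\<forall>x\<in>carrier (P q). \<epsilon> (G 0 x) = g x) \<and>
     (\<forall>n. \<forall>x\<in>carrier (P (q + Suc n)). d (Suc n) (G (Suc n) x) = G n (d (q + Suc n) x))"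

text \<open>
  The Yoneda product of \<open>X \<in> Ext p\<close> and \<open>Y \<in> Ext q\<close> is the class of \<open>f \<circ> G p\<close>, where \<open>f\<close> represents \<open>X\<close>
  and \<open>G\<close> lifts a representative of \<open>Y\<close>. Since this class does not depend on the choices, the union
  over all choices is that class (compare \<^const>\<open>rcoset_mult\<close>).
\<close>

definition yoneda :: "nat \<Rightarrow> nat \<Rightarrow> ('p \<Rightarrow> 'a) set \<Rightarrow> ('p \<Rightarrow> 'a) set \<Rightarrow> ('p \<Rightarrow> 'a) set" where
  "yoneda p q X Y =
     \<Union>{coh_class (p + q) (\<lambda>x\<in>carrier (P (p + q)). f (G p x)) | f g G.
          f \<in> X \<and> g \<in> Y \<and> is_lift q g G}"

text \<open>An element of the direct sum of all \<open>Ext n\<close> is the sequence of its homogeneous components.\<close>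

definition homog :: "nat \<Rightarrow> ('p \<Rightarrow> 'a) set \<Rightarrow> nat \<Rightarrow> ('p \<Rightarrow> 'a) set" where
  "homog n X = (\<lambda>k. if k = n then X else \<zero>\<^bsub>Ext k\<^esub>)"

definition Ext_algebra :: "('k, nat \<Rightarrow> ('p \<Rightarrow> 'a) set) module" where
  "Ext_algebra =
    \<lparr>carrier = {F. (\<forall>n. F n \<in> carrier (Ext n)) \<and> finite {n. F n \<noteq> \<zero>\<^bsub>Ext n\<^esub>}},
     mult = (\<lambda>F G n. \<Oplus>\<^bsub>Ext n\<^esub>p\<in>{..n}. yoneda p (n - p) (F p) (G (n - p))),
     one = homog 0 (coh_class 0 \<epsilon>),
     zero = (\<lambda>n. \<zero>\<^bsub>Ext n\<^esub>),
     add = (\<lambda>F G n. F n \<oplus>\<^bsub>Ext n\<^esub> G n),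
     smult = (\<lambda>c F n. c \<odot>\<^bsub>Ext n\<^esub> F n)\<rparr>"

text \<open>The element of degree \<open>0\<close> corresponding to an element \<open>z\<close> of the centre of \<open>L\<close>.\<close>

definition central :: "'a \<Rightarrow> nat \<Rightarrow> ('p \<Rightarrow> 'a) set" where
  "central z = homog 0 (coh_class 0 (\<lambda>x\<in>carrier (P 0). z \<otimes>\<^bsub>L\<^esub> \<epsilon> x))"

end


section \<open>Path algebras\<close>

text \<open>
  A quiver is a \<^type>\<open>pre_digraph\<close>; a path is a pair of its start vertex and a list of consecutive arcs
  (so the trivial path at \<open>v\<close> is \<open>(v, [])\<close>). Paths are composed from left to right.
\<close>

definition paths :: "('v, 'e) pre_digraph \<Rightarrow> ('v \<times> 'e list) set" where
  "paths G = {(u, p). \<exists>v. pre_digraph.awalk G u p v}"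

definition path_end :: "('v, 'e) pre_digraph \<Rightarrow> 'v \<times> 'e list \<Rightarrow> 'v" where
  "path_end G x = last (pre_digraph.awalk_verts G (fst x) (snd x))"

definition path_algebra ::
  "('v, 'e) pre_digraph \<Rightarrow> ('k::field, 'v \<times> 'e list \<Rightarrow>\<^sub>0 'k) module" where
  "path_algebra G = (free_space (paths G))
    \<lparr>mult := (\<lambda>x y. \<Sum>p\<in>Poly_Mapping.keys x. \<Sum>q\<in>Poly_Mapping.keys y.
        if path_end G p = fst q
        then Poly_Mapping.single (fst p, snd p @ snd q)
               (Poly_Mapping.lookup x p * Poly_Mapping.lookup y q)
        else 0),
     one := (\<Sum>v\<in>verts G. Poly_Mapping.single (v, []) 1)\<rparr>"


section \<open>The algebra \<open>\<Lambda>\<^sub>1\<close>\<close>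

text \<open>
  \<open>Fwd i\<close> is \<open>a\<^sub>i : i \<rightarrow> i + 1\<close> and \<open>Bwd i\<close> is its partner \<open>i + 1 \<rightarrow> i\<close>, for \<open>0 \<le> i < m\<close>. Below, all vertex
  indices are arbitrary integers that are read modulo \<open>m\<close>.
\<close>

datatype arrow = Fwd int | Bwd int

definition quiver :: "nat \<Rightarrow> (int, arrow) pre_digraph" where
  "quiver m =
    \<lparr>verts = {0..<int m},
     arcs = Fwd ` {0..<int m} \<union> Bwd ` {0..<int m},
     tail = (\<lambda>x. case x of Fwd i \<Rightarrow> i | Bwd i \<Rightarrow> (i + 1) mod int m),
     head = (\<lambda>x. case x of Fwd i \<Rightarrow> (i + 1) mod int m | Bwd i \<Rightarrow> i)\<rparr>"

type_synonym 'k pathalg = "int \<times> arrow list \<Rightarrow>\<^sub>0 'k"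
type_synonym 'k lam = "'k pathalg set"
type_synonym 'k pel = "int \<times> int \<Rightarrow> ('k lam \<times> 'k lam \<Rightarrow>\<^sub>0 'k) set"
type_synonym 'k hh = "nat \<Rightarrow> ('k pel \<Rightarrow> 'k lam) set"

definition KQ :: "nat \<Rightarrow> ('k::field, 'k pathalg) module" where
  "KQ m = path_algebra (quiver m)"

definition pe :: "nat \<Rightarrow> int \<Rightarrow> 'k::field pathalg" where
  "pe m i = Poly_Mapping.single (i mod int m, []) 1"

definition pa :: "nat \<Rightarrow> int \<Rightarrow> 'k::field pathalg" where
  "pa m i = Poly_Mapping.single (i mod int m, [Fwd (i mod int m)]) 1"

definition pabar :: "nat \<Rightarrow> int \<Rightarrow> 'k::field pathalg" where
  "pabar m i = Poly_Mapping.single ((i + 1) mod int m, [Bwd (i mod int m)]) 1"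

definition relations :: "nat \<Rightarrow> 'k::field pathalg set" where
  "relations m =
     (\<Union>i\<in>{0..<int m}.
       {pa m i \<otimes>\<^bsub>KQ m\<^esub> pa m (i + 1),
        pabar m (i - 1) \<otimes>\<^bsub>KQ m\<^esub> pabar m (i - 2),
        pa m i \<otimes>\<^bsub>KQ m\<^esub> pabar m i - pabar m (i - 1) \<otimes>\<^bsub>KQ m\<^esub> pa m (i - 1)})"

definition I1 :: "nat \<Rightarrow> 'k::field pathalg set" where
  "I1 m = Idl\<^bsub>KQ m\<^esub> (relations m)"

definition Lam :: "nat \<Rightarrow> ('k::field, 'k lam) module" where
  "Lam m = quot (KQ m) (I1 m)"

definition eL :: "nat \<Rightarrow> int \<Rightarrow> 'k::field lam" where
  "eL m i = I1 m +>\<^bsub>KQ m\<^esub> pe m i"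

definition aL :: "nat \<Rightarrow> int \<Rightarrow> 'k::field lam" where
  "aL m i = I1 m +>\<^bsub>KQ m\<^esub> pa m i"

definition abarL :: "nat \<Rightarrow> int \<Rightarrow> 'k::field lam" where
  "abarL m i = I1 m +>\<^bsub>KQ m\<^esub> pabar m i"


section \<open>The minimal projective bimodule resolution\<close>

definition idx :: "nat \<Rightarrow> nat \<Rightarrow> (int \<times> int) set" where
  "idx m n = {0..<int m} \<times> {0..int n}"

definition resP :: "nat \<Rightarrow> nat \<Rightarrow> ('k::field, 'k lam, 'k pel) bimodule" where
  "resP m n = direct_sum (idx m n)
     (\<lambda>(i, r). proj_bimodule (Lam m) (eL m i) (eL m (i + int n - 2 * r)))"

text \<open>
  The generator \<open>e\<^sub>i \<otimes>\<^sub>r e\<^sub>j\<close> of \<open>P\<^sup>n\<close>, where \<open>j = i + n - 2r\<close>; it is \<open>0\<close> unless \<open>0 \<le> r \<le> n\<close>.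
\<close>

definition rgen :: "nat \<Rightarrow> nat \<Rightarrow> int \<Rightarrow> int \<Rightarrow> 'k::field pel" where
  "rgen m n i r = (\<lambda>(i', r')\<in>idx m n.
     let U = left_principal (Lam m) (eL m i');
         V = right_principal (Lam m) (eL m (i' + int n - 2 * r')) in
     if i' = i mod int m \<and> r' = r
     then tensor_class U V (Poly_Mapping.single (eL m i', eL m (i' + int n - 2 * r')) 1)
     else \<zero>\<^bsub>tensor_space U V\<^esub>)"

definition resaug :: "nat \<Rightarrow> 'k::field pel \<Rightarrow> 'k lam" where
  "resaug m = hom_by_gens (Lam m) (resP m 0) (regular_bimodule (Lam m)) (idx m 0)
     (\<lambda>(i, r). rgen m 0 i r) (\<lambda>(i, r). eL m i \<otimes>\<^bsub>Lam m\<^esub> eL m i)"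

text \<open>For \<open>n \<ge> 1\<close>; on the right-hand side, all generators are those of \<open>P\<^bsup>n-1\<^esup>\<close>.\<close>

definition resd :: "nat \<Rightarrow> nat \<Rightarrow> 'k::field pel \<Rightarrow> 'k pel" where
  "resd m n =
     hom_by_gens (Lam m) (resP m n) (resP m (n - 1)) (idx m n) (\<lambda>(i, r). rgen m n i r)
       (\<lambda>(i, r). let Q = resP m (n - 1); g = rgen m (n - 1); j = i + int n - 2 * r in
          ract Q (g i r) (aL m (j - 1))
          \<oplus>\<^bsub>Q\<^esub> (- 1) ^ n \<odot>\<^bsub>Q\<^esub> ract Q (g i (r - 1)) (abarL m j)
          \<oplus>\<^bsub>Q\<^esub> (- 1) ^ (n + nat r) \<odot>\<^bsub>Q\<^esub>
               (lact Q (aL m i) (g (i + 1) r) \<oplus>\<^bsub>Q\<^esub> lact Q (abarL m (i - 1)) (g (i - 1) (r - 1))))"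


section \<open>The Hochschild cohomology ring and its generators\<close>

definition HH :: "nat \<Rightarrow> ('k::field, 'k hh) module" where
  "HH m = resolution_data.Ext_algebra (Lam m) (resP m) (resd m) (resaug m)"

definition hh_central :: "nat \<Rightarrow> 'k::field lam \<Rightarrow> 'k hh" where
  "hh_central m z = resolution_data.central (Lam m) (resP m) (resd m) (resaug m) z"

text \<open>
  The element of degree \<open>n\<close> represented by the homomorphism with \<open>e\<^sub>i \<otimes> e\<^bsub>i+k\<^esub> \<mapsto> w i\<close> for
  \<open>0 \<le> i < m\<close>, all other generators being mapped to \<open>0\<close>.
\<close>

definition hh_class :: "nat \<Rightarrow> nat \<Rightarrow> int \<Rightarrow> (int \<Rightarrow> 'k::field lam) \<Rightarrow> 'k hh" where
  "hh_class m n k w =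
     resolution_data.homog (Lam m) (resP m) (resd m) n
       (resolution_data.coh_class (Lam m) (resP m) (resd m) n
         (hom_by_gens (Lam m) (resP m n) (regular_bimodule (Lam m)) (idx m n) (\<lambda>(i, r). rgen m n i r)
           (\<lambda>(i, r). if int n - 2 * r = k then w i else \<zero>\<^bsub>Lam m\<^esub>)))"

definition phi_1_0 :: "nat \<Rightarrow> 'k::field hh" where
  "phi_1_0 m = hh_class m 1 1 (\<lambda>i. aL m i)"

definition psi_1_0 :: "nat \<Rightarrow> 'k::field hh" where
  "psi_1_0 m = hh_class m 1 (- 1) (\<lambda>i. abarL m (i - 1))"

definition chi_2_0 :: "nat \<Rightarrow> 'k::field hh" where
  "chi_2_0 m = hh_class m 2 0 (\<lambda>i. (- 1) ^ nat i \<odot>\<^bsub>Lam m\<^esub> eL m i)"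

definition phi_m1_neg :: "nat \<Rightarrow> 'k::field hh" where
  "phi_m1_neg m = hh_class m (m - 1) (1 - int m) (\<lambda>i. (- 1) ^ nat i \<odot>\<^bsub>Lam m\<^esub> aL m i)"

definition psi_m1_pos :: "nat \<Rightarrow> 'k::field hh" where
  "psi_m1_pos m = hh_class m (m - 1) (int m - 1) (\<lambda>i. (- 1) ^ nat i \<odot>\<^bsub>Lam m\<^esub> abarL m (i - 1))"

definition chi_m_pos :: "nat \<Rightarrow> 'k::field hh" where
  "chi_m_pos m = hh_class m m (int m) (\<lambda>i. eL m i)"

definition chi_m_neg :: "nat \<Rightarrow> 'k::field hh" where
  "chi_m_neg m = hh_class m m (- int m) (\<lambda>i. eL m i)"

definition HH_generators :: "nat \<Rightarrow> 'k::field hh set" where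
  "HH_generators m =
     {hh_central m \<one>\<^bsub>Lam m\<^esub>}
     \<union> {hh_central m (aL m i \<otimes>\<^bsub>Lam m\<^esub> abarL m i) | i. i \<in> {0..<int m}}
     \<union> {phi_1_0 m, psi_1_0 m, chi_2_0 m, phi_m1_neg m, psi_m1_pos m, chi_m_pos m, chi_m_neg m}"

end

theory Submission
  imports Defs "HOL-Library.Function_Algebras"
begin

text \<open>
  \<open>\<Lambda>\<^sub>1\<close> has the basis \<open>e\<^sub>i\<close>, \<open>a\<^sub>i\<close>, \<open>a'\<^sub>i\<close>, \<open>a\<^sub>i a'\<^sub>i\<close>, where \<open>a'\<^sub>i\<close> is the arrow \<open>i + 1 \<rightarrow> i\<close>.
  So elements of \<open>\<Lambda>\<^sub>1\<close> and of \<open>P\<^sup>n\<close> are coefficient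
  functions, \<open>P\<^sup>*\<close> has an explicit contracting homotopy of right modules, and the Yoneda product can
  be computed with any lifts. A cochain is the family of the coefficients of its values on the
  generators. A cocycle \<open>e\<^sub>i \<otimes>\<^sub>r e\<^sub>i \<mapsto> (-1)\<^bsup>ri\<^esup> e\<^sub>i\<close> lifts to a shift of the index \<open>r\<close>, so
  multiplication with it is a shift too. In even degrees, a cocycle is a combination of such
  classes and of their products with the socle elements. In odd degrees, adding a coboundary brings
  the coefficients of the \<open>a\<^sub>i\<close> into the form \<open>(-1)\<^bsup>ri\<^esup> \<beta>\<^sub>r\<close>, by averaging over \<open>\<int>/m\<close>; the cocycle condition forces
  the same shape on the coefficients of the \<open>a'\<^sub>i\<close>, and the result is a combination of shifts of
  \<open>\<phi>\<^bsub>1,0\<^esub>\<close>, \<open>\<psi>\<^bsub>1,0\<^esub>\<close>, \<open>\<phi>\<^bsub>m-1,-1\<^esub>\<close> and \<open>\<psi>\<^bsub>m-1,1\<^esub>\<close>.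
\<close>

section \<open>Coordinates for the algebra and its bimodule resolution\<close>

text \<open>Quotients, tensor products and maps prescribed on generators are opaque objects, and the
  Yoneda product and the actions on them are unions over representatives. In coordinates every
  identity becomes a finite check over the four path types. Signs shape the rest. The left-hand
  terms of the differential carry (-1)^(n+r), so vertex coefficients of a cocycle of even degree
  alternate like (-1)^(r i) in row r, which is well defined on \<int>/m since m is even. Evenness of
  m also ties the parity of the degree to that of the path length. A coboundary changes the suitably
  signed coefficients of the a_i in a row by differences u(i) - u(i+1), so their sum over \<int>/m
  is an invariant; spreading it evenly means dividing by m, whence the condition on the
  characteristic. For the a_i, coboundaries and products of phi_{1,0} with chi classes reach only
  the rows r < n; for the opposite arrows, products of psi_{1,0} reach only r > 0. These extreme
  rows are the reason for the two generators of degree m - 1.\<close>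

datatype bt = Vx | Fw | Bw | So

instantiation bt :: finite
begin
instance
proof
  have "(UNIV :: bt set) = {Vx, Fw, Bw, So}"
    using bt.exhaust by blast
  then show "finite (UNIV :: bt set)"
    by (metis finite.emptyI finite_insert)
qed
end

lemma UNIV_bt: "UNIV = {Vx, Fw, Bw, So}"
  using bt.exhaust by blast

lemma sum_bt: "(\<Sum>s\<in>UNIV. f s) = f Vx + f Fw + f Bw + f So"
  by (simp add: UNIV_bt add.assoc)

type_synonym 'k lm = "int \<Rightarrow> bt \<Rightarrow> 'k"
type_synonym 'k pm = "int \<Rightarrow> int \<Rightarrow> bt \<Rightarrow> bt \<Rightarrow> 'k"

text \<open>A power of -1 with integer exponent: the exponents below, such as \<open>r * i\<close>
  and \<open>int n + 1 + r\<close>, may be negative, and only their parity matters.\<close>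

definition sg :: "int \<Rightarrow> 'k::field" where
  "sg n = (if even n then 1 else - 1)"

lemma sg_simps [simp]:
  "sg 0 = 1" "sg 1 = - 1" "sg (- a) = sg a" "sg (a - b) = sg (a + b)" "sg (2 * a) = 1"
  "sg a * sg a = 1" "sg a * (sg a * x) = x"
  by (auto simp: sg_def)

lemma sg_add: "sg (a + b) = sg a * sg b"
  by (auto simp: sg_def)

lemma sg_mult_eq_1: "even a \<Longrightarrow> sg (a * b) = 1" "even b \<Longrightarrow> sg (a * b) = 1"
  by (auto simp: sg_def)

lemma power_m1_sg: "(- 1) ^ n = sg (int n)"
  by (auto simp: sg_def)

lemma sum_fun_apply: "(\<Sum>x\<in>X. f x) y = (\<Sum>x\<in>X. f x y)"
  by (induction X rule: infinite_finite_induct) auto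

text \<open>
  An element of the algebra is given by its coefficients: \<open>f i Vx\<close>, \<open>f i Fw\<close>, \<open>f i Bw\<close>, \<open>f i So\<close>
  belong to the basis elements starting at \<open>i\<close>, namely \<open>e\<^sub>i\<close>, \<open>a\<^sub>i\<close>, the arrow \<open>i \<rightarrow> i - 1\<close> and the
  socle element \<open>a\<^sub>i a'\<^sub>i\<close>. All coefficient functions are defined for every integer and are
  periodic with period \<open>m\<close>.
\<close>

definition rmul :: "(bt \<Rightarrow> 'k::field) \<Rightarrow> 'k lm \<Rightarrow> int \<Rightarrow> bt \<Rightarrow> 'k" where
  "rmul y l j t = (case t of
      Vx \<Rightarrow> y Vx * l j Vx
    | Fw \<Rightarrow> y Vx * l j Fw + y Fw * l (j + 1) Vx
    | Bw \<Rightarrow> y Vx * l j Bw + y Bw * l (j - 1) Vx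
    | So \<Rightarrow> y Vx * l j So + y Fw * l (j + 1) Bw + y Bw * l (j - 1) Fw + y So * l j Vx)"

text \<open>Mirror image of \<open>rmul\<close>: \<open>y\<close> is indexed by the type of the
  basis path that ends at \<open>i\<close>. An arrow ending at \<open>i\<close> starts at
  \<open>i - 1\<close> or \<open>i + 1\<close>, which is where \<open>l\<close> has to be
  read.\<close>

definition cmul :: "'k::field lm \<Rightarrow> (bt \<Rightarrow> 'k) \<Rightarrow> int \<Rightarrow> bt \<Rightarrow> 'k" where
  "cmul l y i s = (case s of
      Vx \<Rightarrow> l i Vx * y Vx
    | Fw \<Rightarrow> l (i - 1) Vx * y Fw + l (i - 1) Fw * y Vx
    | Bw \<Rightarrow> l (i + 1) Vx * y Bw + l (i + 1) Bw * y Vx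
    | So \<Rightarrow> l i Vx * y So + l i Fw * y Bw + l i Bw * y Fw + l i So * y Vx)"

definition lmul :: "'k::field lm \<Rightarrow> 'k lm \<Rightarrow> 'k lm" where
  "lmul f g i = rmul (f i) g i"

text \<open>Sorts the coefficients of \<open>f\<close> by end vertex instead of start vertex; these
  are the coordinates of the left tensor factor \<Lambda>e_i of a projective bimodule.\<close>

definition endc :: "'k::field lm \<Rightarrow> int \<Rightarrow> bt \<Rightarrow> 'k" where
  "endc f i s = (case s of Vx \<Rightarrow> f i Vx | Fw \<Rightarrow> f (i - 1) Fw | Bw \<Rightarrow> f (i + 1) Bw | So \<Rightarrow> f i So)"

definition lone :: "'k::field lm" where
  "lone i t = (if t = Vx then 1 else 0)"

definition lsc :: "'k::field \<Rightarrow> 'k lm \<Rightarrow> 'k lm" where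
  "lsc c f i t = c * f i t"

definition LM :: "nat \<Rightarrow> 'k::field lm set" where
  "LM m = {f. \<forall>i. f (i + int m) = f i}"

definition bas :: "nat \<Rightarrow> int \<Rightarrow> bt \<Rightarrow> 'k::field lm" where
  "bas m i t = (\<lambda>i' t'. if t' = t \<and> int m dvd i' - i then 1 else 0)"

definition ebas :: "nat \<Rightarrow> int \<Rightarrow> bt \<Rightarrow> 'k::field lm" where
  "ebas m i s = (case s of Vx \<Rightarrow> bas m i Vx | Fw \<Rightarrow> bas m (i - 1) Fw | Bw \<Rightarrow> bas m (i + 1) Bw
     | So \<Rightarrow> bas m i So)"

lemmas mul_defs = lmul_def rmul_def cmul_def

lemma fun2_eqI: "(\<And>i t. f i t = g i t) \<Longrightarrow> f = g"
  by (intro ext)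

lemma fun4_eqI: "(\<And>i r s t. f i r s t = g i r s t) \<Longrightarrow> f = g"
  by (intro ext)

lemma rmul_assoc: "rmul (rmul y l j) l' j = rmul y (lmul l l') j"
  by (rule ext, case_tac x) (simp_all add: mul_defs algebra_simps)

lemma cmul_assoc: "cmul l (cmul l' y i) i = cmul (lmul l l') y i"
  by (rule ext, case_tac x) (simp_all add: mul_defs algebra_simps)

lemma lmul_assoc: "lmul (lmul f g) h = lmul f (lmul g h)"
  by (rule fun2_eqI, case_tac t) (simp_all add: mul_defs algebra_simps)

lemma endc_lmul: "endc (lmul l f) i = cmul l (endc f i) i"
  by (rule ext, case_tac x) (simp_all add: mul_defs endc_def algebra_simps)

lemma rmul_add: "rmul (y + y') l j = rmul y l j + rmul y' l j" "rmul y (l + l') j = rmul y l j + rmul y l' j"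
  by (rule ext, case_tac x, simp_all add: mul_defs algebra_simps)+

lemma rmul_sc: "rmul (\<lambda>t. c * y t) l j t = c * rmul y l j t" "rmul y (lsc c l) j t = c * rmul y l j t"
  by (cases t, simp_all add: mul_defs lsc_def algebra_simps)+

lemma cmul_sc: "cmul l (\<lambda>t. c * y t) j t = c * cmul l y j t" "cmul (lsc c l) y j t = c * cmul l y j t"
  by (cases t, simp_all add: mul_defs lsc_def algebra_simps)+

lemma lmul_add: "lmul (f + f') g = lmul f g + lmul f' g" "lmul f (g + g') = lmul f g + lmul f g'"
  by (rule ext, simp add: lmul_def rmul_add)+

lemma lmul_sc: "lmul (lsc c f) g = lsc c (lmul f g)" "lmul f (lsc c g) = lsc c (lmul f g)"
  by (rule fun2_eqI, case_tac t, simp_all add: mul_defs lsc_def algebra_simps)+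

lemma lmul_one [simp]: "lmul lone f = f" "lmul f lone = f"
  by (rule fun2_eqI, case_tac t, simp_all add: mul_defs lone_def)+

lemma LM_D: "f \<in> LM m \<Longrightarrow> f (i + int m) = f i"
  by (simp add: LM_def)

lemma LM_add_mult: "f \<in> LM m \<Longrightarrow> f (i + int m * k) = f i"
proof -
  assume f: "f \<in> LM m"
  have *: "f (i + int m * int n) = f i" for i n
  proof (induction n)
    case (Suc n)
    have "f (i + int m * int (Suc n)) = f ((i + int m * int n) + int m)"
      by (simp add: algebra_simps)
    then show ?case
      using Suc LM_D[OF f] by simp
  qed simp
  show ?thesis
  proof (cases "k \<ge> 0")
    case True
    then show ?thesis using *[of i "nat k"] by simp
  next
    case False
    then show ?thesis using *[of "i + int m * k" "nat (- k)"] by simp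
  qed
qed

lemma LM_cong: "f \<in> LM m \<Longrightarrow> int m dvd i - j \<Longrightarrow> f i = f j"
  using LM_add_mult[of f m j] by (metis add.commute diff_add_cancel dvdE)

lemma LM_mod: "f \<in> LM m \<Longrightarrow> f (i mod int m) = f i"
  by (rule LM_cong, assumption) (metis mod_eq_dvd_iff mod_mod_trivial)

lemma LM_I: "(\<And>i. f (i + int m) = f i) \<Longrightarrow> f \<in> LM m"
  by (simp add: LM_def)

lemma dvd_shift: "int m dvd i + int m - j \<longleftrightarrow> int m dvd i - j"
  by (metis add_diff_eq diff_add_eq dvd_add_triv_right_iff)

lemma LM_closed:
  "0 \<in> LM m" "lone \<in> LM m" "f \<in> LM m \<Longrightarrow> g \<in> LM m \<Longrightarrow> f + g \<in> LM m" "f \<in> LM m \<Longrightarrow> - f \<in> LM m"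
  "f \<in> LM m \<Longrightarrow> lsc c f \<in> LM m" "bas m i t \<in> LM m" "ebas m i s \<in> LM m"
proof -
  show b: "bas m i t \<in> LM m" for i t
    by (simp add: LM_def bas_def dvd_shift)
  show "ebas m i s \<in> LM m"
    by (cases s) (simp_all add: ebas_def b)
qed (auto simp: LM_def lone_def lsc_def fun_eq_iff)

lemma LM_lmul: 
  assumes "f \<in> LM m" "g \<in> LM m" shows "lmul f g \<in> LM m"
proof (rule LM_I, rule ext)
  fix i t
  have "g (i + int m + 1) = g (i + 1)" "g (i + int m - 1) = g (i - 1)"
    using LM_D[OF assms(2), of "i + 1"] LM_D[OF assms(2), of "i - 1"] by (simp_all add: algebra_simps)
  then show "lmul f g (i + int m) t = lmul f g i t"
    using LM_D[OF assms(1), of i] LM_D[OF assms(2), of i]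
    by (cases t) (simp_all add: mul_defs)
qed

section \<open>The bimodules P^n in coordinates\<close>

definition psc :: "'k::field \<Rightarrow> 'k pm \<Rightarrow> 'k pm" where
  "psc c x i r s t = c * x i r s t"

definition plact :: "'k::field lm \<Rightarrow> 'k pm \<Rightarrow> 'k pm" where
  "plact l x i r s t = cmul l (\<lambda>s. x i r s t) i s"

definition pract :: "nat \<Rightarrow> 'k::field pm \<Rightarrow> 'k lm \<Rightarrow> 'k pm" where
  "pract n x l i r s = rmul (x i r s) l (i + int n - 2 * r)"

text \<open>\<open>x i r s t\<close> is the coefficient, in the (i, r)-summand, of the path of type
  \<open>s\<close> ending at \<open>i\<close> tensored with the path of type \<open>t\<close>
  starting at \<open>i + n - 2 r\<close>. Rows outside \<open>0 \<le> r \<le> n\<close> are present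
  but zero, which matches the convention for generators with such a subscript and makes equality of
  elements equality of functions.\<close>

definition PM :: "nat \<Rightarrow> nat \<Rightarrow> 'k::field pm set" where
  "PM m n = {x. (\<forall>i. x (i + int m) = x i) \<and> (\<forall>i r. r < 0 \<or> int n < r \<longrightarrow> x i r = 0)}"

definition pgen :: "nat \<Rightarrow> nat \<Rightarrow> int \<Rightarrow> int \<Rightarrow> 'k::field pm" where
  "pgen m n i r = (\<lambda>i' r' s t. if int m dvd i' - i \<and> r' = r \<and> 0 \<le> r \<and> r \<le> int n \<and> s = Vx \<and> t = Vx
     then 1 else 0)"

lemma PM_D: "x \<in> PM m n \<Longrightarrow> x (i + int m) = x i" "x \<in> PM m n \<Longrightarrow> r < 0 \<or> int n < r \<Longrightarrow> x i r s t = 0"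
  by (auto simp: PM_def)

lemma PM_I: "(\<And>i r s t. x (i + int m) r s t = x i r s t) \<Longrightarrow>
    (\<And>i r s t. r < 0 \<or> int n < r \<Longrightarrow> x i r s t = 0) \<Longrightarrow> x \<in> PM m n"
  by (auto simp: PM_def fun_eq_iff)

lemma PM_cong: 
  assumes "x \<in> PM m n" "int m dvd i - j" shows "x i = x j"
proof -
  have "(\<lambda>i t. x i r s t) \<in> LM m" for r s
    using assms(1) by (intro LM_I) (auto simp: PM_def)
  from LM_cong[OF this assms(2)] show ?thesis
    by (auto simp: fun_eq_iff)
qed

text \<open>A common frame for the two kinds of targets of homomorphisms, \<Lambda> and P^n. The
  identities hold for all coefficient functions, periodic or not, and only the closure properties
  mention \<open>S\<close>; so most computations carry no membership conditions.\<close>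

locale model_bimod =
  fixes m :: nat
    and sc :: "'k::field \<Rightarrow> 'n::ab_group_add \<Rightarrow> 'n"
    and l :: "'k lm \<Rightarrow> 'n \<Rightarrow> 'n"
    and r :: "'n \<Rightarrow> 'k lm \<Rightarrow> 'n"
    and S :: "'n set"
  assumes sc_add: "sc c (x + y) = sc c x + sc c y" "sc (c + d) x = sc c x + sc d x"
    and sc_mult: "sc c (sc d x) = sc (c * d) x"
    and sc_one: "sc 1 x = x"
    and l_add: "l a (x + y) = l a x + l a y" "l (a + b) x = l a x + l b x"
    and l_sc: "l a (sc c x) = sc c (l a x)" "l (lsc c a) x = sc c (l a x)"
    and l_mul: "l (lmul a b) x = l a (l b x)"
    and l_one: "l lone x = x"
    and r_add: "r (x + y) a = r x a + r y a" "r x (a + b) = r x a + r x b"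
    and r_sc: "r (sc c x) a = sc c (r x a)" "r x (lsc c a) = sc c (r x a)"
    and r_mul: "r x (lmul a b) = r (r x a) b"
    and r_one: "r x lone = x"
    and lr: "l a (r x b) = r (l a x) b"
    and S_zero: "0 \<in> S"
    and S_add: "x \<in> S \<Longrightarrow> y \<in> S \<Longrightarrow> x + y \<in> S"
    and S_sc: "x \<in> S \<Longrightarrow> sc c x \<in> S"
    and S_l: "a \<in> LM m \<Longrightarrow> x \<in> S \<Longrightarrow> l a x \<in> S"
    and S_r: "a \<in> LM m \<Longrightarrow> x \<in> S \<Longrightarrow> r x a \<in> S"
begin

lemma sc_zero [simp]: "sc 0 x = 0" "sc c 0 = 0"
  using sc_add(2)[of 0 0 x] sc_add(1)[of c 0 0] by auto

lemma sc_minus: "sc (- 1) x = - x"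
  using sc_add(2)[of 1 "- 1" x] sc_one by (simp add: eq_neg_iff_add_eq_0 add.commute)

lemma l_zero [simp]: "l a 0 = 0" "l 0 x = 0"
  using l_add(1)[of a 0 0] l_add(2)[of 0 0 x] by auto

lemma r_zero [simp]: "r 0 a = 0" "r x 0 = 0"
  using r_add(1)[of 0 0 a] r_add(2)[of x 0 0] by auto

lemma S_minus: "x \<in> S \<Longrightarrow> - x \<in> S"
  using S_sc[of x "- 1"] by (simp add: sc_minus)

lemma S_sum: "(\<And>x. x \<in> X \<Longrightarrow> f x \<in> S) \<Longrightarrow> sum f X \<in> S"
  by (induction X rule: infinite_finite_induct) (auto intro: S_zero S_add)

lemma l_sum: "l a (sum f X) = (\<Sum>x\<in>X. l a (f x))"
  by (induction X rule: infinite_finite_induct) (auto simp: l_add)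

lemma r_sum: "r (sum f X) a = (\<Sum>x\<in>X. r (f x) a)"
  by (induction X rule: infinite_finite_induct) (auto simp: r_add)

lemma sc_sum: "sc c (sum f X) = (\<Sum>x\<in>X. sc c (f x))"
  by (induction X rule: infinite_finite_induct) (auto simp: sc_add)

end

lemma model_bimod_LM: "model_bimod m lsc lmul lmul (LM m :: 'k::field lm set)"
  by unfold_locales
    (auto simp: lmul_add lmul_sc lmul_assoc LM_closed LM_lmul,
     auto simp: lsc_def fun_eq_iff algebra_simps)

lemma plact_LM: "l \<in> LM m \<Longrightarrow> x \<in> PM m n \<Longrightarrow> plact l x \<in> PM m n"
proof (rule PM_I)
  fix i r s t assume l: "l \<in> LM m" and x: "x \<in> PM m n"
  have "l (i + int m + 1) = l (i + 1)" "l (i + int m - 1) = l (i - 1)"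
    using LM_D[OF l, of "i + 1"] LM_D[OF l, of "i - 1"] by (simp_all add: algebra_simps)
  then show "plact l x (i + int m) r s t = plact l x i r s t"
    using PM_D(1)[OF x] LM_D[OF l] by (cases s) (simp_all add: plact_def cmul_def)
next
  fix i r s t assume "x \<in> PM m n" "r < 0 \<or> int n < r"
  then show "plact l x i r s t = 0"
    by (cases s) (simp_all add: plact_def cmul_def PM_D)
qed

lemma pract_LM: "l \<in> LM m \<Longrightarrow> x \<in> PM m n \<Longrightarrow> pract n x l \<in> PM m n"
proof (rule PM_I)
  fix i r s t assume l: "l \<in> LM m" and x: "x \<in> PM m n"
  have "l (i + int m + k) = l (i + k)" for k
    using LM_D[OF l, of "i + k"] by (simp_all add: algebra_simps)
  from this[of "int n - 2 * r"] this[of "int n - 2 * r + 1"] this[of "int n - 2 * r - 1"] 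
  show "pract n x l (i + int m) r s t = pract n x l i r s t"
    using PM_D(1)[OF x] by (cases t) (simp_all add: pract_def rmul_def algebra_simps)
next
  fix i r s t assume "x \<in> PM m n" "r < 0 \<or> int n < r"
  then show "pract n x l i r s t = 0"
    by (cases t) (simp_all add: pract_def rmul_def PM_D)
qed

lemma PM_closed:
  "0 \<in> PM m n" "x \<in> PM m n \<Longrightarrow> y \<in> PM m n \<Longrightarrow> x + y \<in> PM m n"
  "x \<in> PM m n \<Longrightarrow> psc c x \<in> PM m n"  "pgen m n i r \<in> PM m n"
  by (auto simp: PM_def psc_def pgen_def fun_eq_iff dvd_shift)

lemma plact_mul: "plact (lmul a b) x = plact a (plact b x)"
  by (rule fun4_eqI) (simp add: plact_def cmul_assoc[symmetric])

lemma pract_mul: "pract n x (lmul a b) = pract n (pract n x a) b"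
  by (intro ext) (simp add: pract_def rmul_assoc[symmetric])

lemma model_bimod_PM: "model_bimod m psc plact (pract n) (PM m n :: 'k::field pm set)"
proof unfold_locales
  show "plact a (pract n x b) = pract n (plact a x) b" for a b :: "'k lm" and x
    by (rule fun4_eqI, case_tac s; case_tac t) 
      (simp_all add: plact_def pract_def mul_defs algebra_simps)
  show "plact lone x = x" for x :: "'k pm"
    by (rule fun4_eqI, case_tac s) (simp_all add: plact_def mul_defs lone_def)
  show "pract n x lone = x" for x :: "'k pm"
    by (rule fun4_eqI, case_tac t) (simp_all add: pract_def mul_defs lone_def)
  show "plact (a + b) x = plact a x + plact b x" for a b :: "'k lm" and x
    by (rule fun4_eqI, case_tac s) (simp_all add: plact_def mul_defs algebra_simps)
  show "plact a (x + y) = plact a x + plact a y" for a :: "'k lm" and x y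
    by (rule fun4_eqI, case_tac s) (simp_all add: plact_def mul_defs algebra_simps)
  show "pract n x (a + b) = pract n x a + pract n x b" for a b :: "'k lm" and x
    by (rule fun4_eqI, case_tac t) (simp_all add: pract_def mul_defs algebra_simps)
  show "pract n (x + y) a = pract n x a + pract n y a" for a :: "'k lm" and x y
    by (rule fun4_eqI, case_tac t) (simp_all add: pract_def mul_defs algebra_simps)
  show "plact a (psc c x) = psc c (plact a x)" for a :: "'k lm" and x c
    by (rule fun4_eqI, case_tac s) (simp_all add: plact_def mul_defs psc_def algebra_simps)
  show "plact (lsc c a) x = psc c (plact a x)" for a :: "'k lm" and x c
    by (rule fun4_eqI, case_tac s) (simp_all add: plact_def mul_defs psc_def lsc_def algebra_simps)
  show "pract n (psc c x) a = psc c (pract n x a)" for a :: "'k lm" and x c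
    by (rule fun4_eqI, case_tac t) (simp_all add: pract_def mul_defs psc_def algebra_simps)
  show "pract n x (lsc c a) = psc c (pract n x a)" for a :: "'k lm" and x c
    by (rule fun4_eqI, case_tac t) (simp_all add: pract_def mul_defs psc_def lsc_def algebra_simps)
  show "psc c (psc d x) = psc (c * d) x" "psc (c + d) x = psc c x + psc d x"
     "psc c (x + y) = psc c x + psc c y"  "psc 1 x = x" for c d :: 'k and x y
    by (auto simp: psc_def fun_eq_iff algebra_simps)
qed (auto simp: plact_mul pract_mul PM_closed plact_LM pract_LM)

section \<open>Homomorphisms determined by the images of the generators\<close>

lemma plact_ebas:
  assumes l: "l \<in> LM m"
  shows "lmul l (ebas m i s) = (\<Sum>s'\<in>UNIV. lsc (cmul l (\<lambda>u. if u = s then 1 else 0) i s') (ebas m i s'))"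
proof (rule fun2_eqI)
  fix i' t
  have c: "l i' = l j" if "int m dvd i' - j" for j
    using LM_cong[OF l that] .
  have c1: "l i' = l (i - 1)" if "int m dvd i' + 1 - i"
    using LM_cong[OF l, of i' "i - 1"] that by (simp add: algebra_simps)
  have c2: "l i' = l (i + 1)" if "int m dvd i' - 1 - i"
    using LM_cong[OF l, of i' "i + 1"] that by (simp add: algebra_simps)
  show "lmul l (ebas m i s) i' t = (\<Sum>s'\<in>UNIV. lsc (cmul l (\<lambda>u. if u = s then 1 else 0) i s') (ebas m i s')) i' t"
    by (cases s; cases t)
      (auto simp: sum_bt mul_defs lsc_def ebas_def bas_def algebra_simps c c1[simplified algebra_simps] c2[simplified algebra_simps])
qed

lemma pract_bas:
  assumes l: "l \<in> LM m"
  shows "lmul (bas m j s) l = (\<Sum>s'\<in>UNIV. lsc (rmul (\<lambda>u. if u = s then 1 else 0) l j s') (bas m j s'))"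
proof (rule fun2_eqI)
  fix i' t
  have c: "l (i' + k) = l (j + k)" if "int m dvd i' - j" for k
    using LM_cong[OF l, of "i' + k" "j + k"] that by simp
  show "lmul (bas m j s) l i' t = (\<Sum>s'\<in>UNIV. lsc (rmul (\<lambda>u. if u = s then 1 else 0) l j s') (bas m j s')) i' t"
    using c[of 0] c[of 1] c[of "-1"]
    by (cases s; cases t)
      (auto simp: sum_bt mul_defs lsc_def bas_def algebra_simps)
qed

text \<open>
  The homomorphism from the model of \<open>P\<^sup>n\<close> which sends the \<open>(i, r)\<close>-th generator to
  \<open>e\<^sub>i (w i r) e\<^bsub>i+n-2r\<^esub>\<close>.
\<close>

definition (in model_bimod) gen_hom :: "nat \<Rightarrow> (int \<Rightarrow> int \<Rightarrow> 'n) \<Rightarrow> 'k pm \<Rightarrow> 'n" where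
  "gen_hom n w x = (\<Sum>i\<in>{0..<int m}. \<Sum>j\<in>{0..int n}. \<Sum>s\<in>UNIV. \<Sum>t\<in>UNIV.
     sc (x i j s t) (r (l (ebas m i s) (w i j)) (bas m (i + int n - 2 * j) t)))"

context model_bimod
begin

lemma gen_hom_add: "gen_hom n w (x + y) = gen_hom n w x + gen_hom n w y"
  by (simp add: gen_hom_def sc_add sum.distrib)

lemma gen_hom_sc: "gen_hom n w (psc c x) = sc c (gen_hom n w x)"
  by (simp add: gen_hom_def psc_def sc_sum sc_mult)

text \<open>Right multiplication of paths by \<open>v\<close> is left linear: by
  \<open>plact_ebas\<close>, the action \<open>cmul\<close> on coefficients is the one dual to
  multiplication of the basis paths ending at \<open>i\<close>.\<close>

lemma sum_cmul:
  assumes "a \<in> LM m"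
  shows "(\<Sum>s\<in>UNIV. sc (cmul a y i s) (l (ebas m i s) v)) = l a (\<Sum>s\<in>UNIV. sc (y s) (l (ebas m i s) v))"
proof -
  have "l a (l (ebas m i s) v) = 
     (\<Sum>s'\<in>UNIV. sc (cmul a (\<lambda>u. if u = s then 1 else 0) i s') (l (ebas m i s') v))" for s
    unfolding l_mul[symmetric] plact_ebas[OF assms] by (simp add: sum_bt l_add l_sc)
  then show ?thesis
    by (simp add: sum_bt l_add l_sc cmul_def sc_add sc_mult algebra_simps)
qed

lemma sum_rmul:
  assumes "a \<in> LM m"
  shows "(\<Sum>s\<in>UNIV. sc (rmul y a j s) (r v (bas m j s))) = r (\<Sum>s\<in>UNIV. sc (y s) (r v (bas m j s))) a"
proof -
  have "r (r v (bas m j s)) a = 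
     (\<Sum>s'\<in>UNIV. sc (rmul (\<lambda>u. if u = s then 1 else 0) a j s') (r v (bas m j s')))" for s
    unfolding r_mul[symmetric] pract_bas[OF assms] by (simp add: sum_bt r_add r_sc)
  then show ?thesis
    by (simp add: sum_bt r_add r_sc rmul_def sc_add sc_mult algebra_simps)
qed

lemma gen_hom_plact:
  assumes "a \<in> LM m"
  shows "gen_hom n w (plact a x) = l a (gen_hom n w x)"
proof -
  \<comment> \<open>The sum over the left factors is moved innermost, where \<open>sum_cmul\<close>
    applies; this uses that the two actions commute.\<close>
  have "gen_hom n w x = (\<Sum>i\<in>{0..<int m}. \<Sum>j\<in>{0..int n}. \<Sum>t\<in>UNIV.
       \<Sum>s\<in>UNIV. sc (x i j s t) (l (ebas m i s) (r (w i j) (bas m (i + int n - 2 * j) t))))" for x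
    unfolding gen_hom_def lr by (intro sum.cong refl sum.swap)
  then show ?thesis
    by (simp add: plact_def sum_cmul[OF assms] l_sum)
qed

lemma gen_hom_pract:
  assumes "a \<in> LM m"
  shows "gen_hom n w (pract n x a) = r (gen_hom n w x) a"
  by (simp add: gen_hom_def pract_def sum_rmul[OF assms] r_sum)

lemma gen_hom_S:
  "(\<And>i j. 0 \<le> i \<Longrightarrow> i < int m \<Longrightarrow> 0 \<le> j \<Longrightarrow> j \<le> int n \<Longrightarrow> w i j \<in> S) \<Longrightarrow> gen_hom n w x \<in> S"
  unfolding gen_hom_def
  by (intro S_sum S_sc S_r S_l LM_closed) auto

lemma gen_hom_pgen:
  assumes i: "0 \<le> i" "i < int m" and j: "0 \<le> j" "j \<le> int n"
    and w: "l (bas m i Vx) (w i j) = w i j" "r (w i j) (bas m (i + int n - 2 * j) Vx) = w i j"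
  shows "gen_hom n w (pgen m n i j) = w i j"
proof -
  have d: "int m dvd i' - i \<longleftrightarrow> i' = i" if "0 \<le> i'" "i' < int m" for i'
    using that i by (metis mod_eq_dvd_iff mod_pos_pos_trivial)
  have *: "(\<Sum>j'\<in>{0..int n}. \<Sum>s\<in>UNIV. \<Sum>t\<in>UNIV.
     sc (pgen m n i j i' j' s t) (r (l (ebas m i' s) (w i' j')) (bas m (i' + int n - 2 * j') t)))
     = (if i' = i then w i j else 0)" if "0 \<le> i'" "i' < int m" for i'
  proof -
    have "(\<Sum>j'\<in>{0..int n}. \<Sum>s\<in>UNIV. \<Sum>t\<in>UNIV.
     sc (pgen m n i j i' j' s t) (r (l (ebas m i' s) (w i' j')) (bas m (i' + int n - 2 * j') t)))
     = (\<Sum>j'\<in>{0..int n}. if j' = j then if i' = i then w i j else 0 else 0)"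
      by (intro sum.cong refl) (auto simp: sum_bt pgen_def d[OF that] j sc_one w ebas_def)
    then show ?thesis
      using j by simp
  qed
  have "gen_hom n w (pgen m n i j) = (\<Sum>i'\<in>{0..<int m}. if i' = i then w i j else 0)"
    unfolding gen_hom_def by (intro sum.cong refl *) auto
  then show ?thesis
    using i by simp
qed

end

text \<open>The products of a path, a generator and a path form a basis: since the generators range
  over one period of \<open>i\<close>, each coefficient is picked out by exactly one term.\<close>

lemma PM_expand:
  assumes x: "x \<in> PM m n" and m: "m > 0"
  shows "x = (\<Sum>i\<in>{0..<int m}. \<Sum>j\<in>{0..int n}. \<Sum>s\<in>UNIV. \<Sum>t\<in>UNIV.
     psc (x i j s t) (pract n (plact (ebas m i s) (pgen m n i j)) (bas m (i + int n - 2 * j) t)))" (is "_ = ?R")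
proof (intro ext)
  fix i j s t
  have b: "pract n (plact (ebas m i' s') (pgen m n i' j')) (bas m (i' + int n - 2 * j') t') i j s t
     = (if int m dvd i - i' \<and> j = j' \<and> 0 \<le> j \<and> j \<le> int n \<and> s' = s \<and> t' = t then 1 else 0)" for i' j' s' t'
  proof -
    have d: "int m dvd i + int n - 2 * j + k - (i' + int n - 2 * j + k) \<longleftrightarrow> int m dvd i - i'" 
        "int m dvd i + k - (i' + k) \<longleftrightarrow> int m dvd i - i'" for k
      by simp_all
    show ?thesis
      by (cases s; cases s'; cases t; cases t')
       (auto simp: pract_def plact_def mul_defs ebas_def bas_def pgen_def d)
  qed
  show "x i j s t = ?R i j s t"
  proof (cases "0 \<le> j \<and> j \<le> int n")
    case True
    have "?R i j s t = (\<Sum>i'\<in>{0..<int m}. \<Sum>j'\<in>{0..int n}. \<Sum>s'\<in>UNIV. \<Sum>t'\<in>UNIV.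
        x i' j' s' t' * (if int m dvd i - i' \<and> j = j' \<and> s' = s \<and> t' = t then 1 else 0))"
      unfolding sum_fun_apply psc_def b using True by simp
    also have "\<dots> = (\<Sum>i'\<in>{0..<int m}. \<Sum>j'\<in>{0..int n}. if j' = j then if int m dvd i - i' then x i' j s t else 0 else 0)"
      by (intro sum.cong refl) (cases s; cases t; auto simp: sum_bt)
    also have "\<dots> = (\<Sum>i'\<in>{0..<int m}. if int m dvd i - i' then x i' j s t else 0)"
      using True by simp
    also have "\<dots> = (\<Sum>i'\<in>{0..<int m}. if i' = i mod int m then x (i mod int m) j s t else 0)"
    proof (intro sum.cong refl)
      fix i' assume "i' \<in> {0..<int m}"
      then have "int m dvd i - i' \<longleftrightarrow> i' = i mod int m"
        by (metis atLeastLessThan_iff mod_eq_dvd_iff mod_pos_pos_trivial)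
      then show "(if int m dvd i - i' then x i' j s t else 0) = (if i' = i mod int m then x (i mod int m) j s t else 0)"
        by auto
    qed
    also have "\<dots> = x (i mod int m) j s t"
      using m by simp
    also have "\<dots> = x i j s t"
      using PM_cong[OF x, of "i mod int m" i] by (metis mod_eq_dvd_iff mod_mod_trivial)
    finally show ?thesis ..
  next
    case False
    then show ?thesis
      using PM_D(2)[OF x, of j i s t] unfolding sum_fun_apply psc_def b by auto
  qed
qed

lemma PM_induct:
  assumes x: "x \<in> PM m n" and m: "m > 0"
    and add: "\<And>x y. x \<in> Q \<Longrightarrow> y \<in> Q \<Longrightarrow> x + y \<in> Q"
    and sc: "\<And>c x. x \<in> Q \<Longrightarrow> psc c x \<in> Q"
    and l: "\<And>l x. l \<in> LM m \<Longrightarrow> x \<in> Q \<Longrightarrow> plact l x \<in> Q"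
    and r: "\<And>l x. l \<in> LM m \<Longrightarrow> x \<in> Q \<Longrightarrow> pract n x l \<in> Q"
    and gen: "\<And>i j. 0 \<le> i \<Longrightarrow> i < int m \<Longrightarrow> 0 \<le> j \<Longrightarrow> j \<le> int n \<Longrightarrow> pgen m n i j \<in> Q"
  shows "x \<in> Q"
proof -
  \<comment> \<open>Zero has to be produced from some generator, and one exists because
    \<open>m > 0\<close>.\<close>
  have "psc 0 (pgen m n 0 0) \<in> Q"
    using m by (intro sc gen) auto
  then have 0: "0 \<in> Q"
    by (simp add: psc_def[abs_def] zero_fun_def)
  have sum: "(\<And>x. x \<in> X \<Longrightarrow> f x \<in> Q) \<Longrightarrow> sum f X \<in> Q" for X :: "'c set" and f
    by (induction X rule: infinite_finite_induct) (auto intro: 0 add)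
  have sum': "(\<And>x. x \<in> X \<Longrightarrow> f x \<in> Q) \<Longrightarrow> sum f X \<in> Q" for X :: "bt set" and f
    by (induction X rule: infinite_finite_induct) (auto intro: 0 add)
  have sum'': "(\<And>x. x \<in> X \<Longrightarrow> f x \<in> Q) \<Longrightarrow> sum f X \<in> Q" for X :: "int set" and f
    by (induction X rule: infinite_finite_induct) (auto intro: 0 add)
  show ?thesis
    by (subst PM_expand[OF x m]) (intro sum' sum'' sc l r gen LM_closed, auto)
qed

section \<open>Quotient spaces\<close>

text \<open>Serves three quotients: \<Lambda> as a quotient of the path algebra, tensor products as
  quotients of free spaces, and Ext as cocycles modulo coboundaries.\<close>

locale quot_space = abelian_subgroup W V
  for W and V :: "('k, 'v, 'z) module_scheme" (structure) +
  assumes smult_closed: "x \<in> carrier V \<Longrightarrow> c \<odot> x \<in> carrier V"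
    and smult_W: "w \<in> W \<Longrightarrow> c \<odot> w \<in> W"
    and smult_r_distr: "x \<in> carrier V \<Longrightarrow> y \<in> carrier V \<Longrightarrow> c \<odot> (x \<oplus> y) = c \<odot> x \<oplus> c \<odot> y"
begin

lemma W_carrier: "w \<in> W \<Longrightarrow> w \<in> carrier V"
  using a_subset by auto

lemma mem_coset_iff:
  assumes "x \<in> carrier V"
  shows "y \<in> W +> x \<longleftrightarrow> y \<in> carrier V \<and> y \<ominus> x \<in> W"
proof
  assume "y \<in> W +> x"
  then obtain w where w: "w \<in> W" "y = w \<oplus> x"
    by (auto simp: a_r_coset_def')
  then have "y \<ominus> x = w"
    using W_carrier[of w] assms by (simp add: a_minus_def a_assoc r_neg)
  then show "y \<in> carrier V \<and> y \<ominus> x \<in> W"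
    using w W_carrier[of w] assms by auto
next
  assume y: "y \<in> carrier V \<and> y \<ominus> x \<in> W"
  then have "y = (y \<ominus> x) \<oplus> x"
    using assms by (simp add: a_minus_def a_assoc l_neg)
  then show "y \<in> W +> x"
    using y unfolding a_r_coset_def' by auto
qed

lemma coset_eqI:
  assumes "x \<in> carrier V" "y \<in> W +> x"
  shows "W +> y = W +> x"
  by (rule a_repr_independence[symmetric, OF assms(2,1) a_subgroup])

lemma coset_eq_iff:
  assumes "x \<in> carrier V" "y \<in> carrier V"
  shows "W +> x = W +> y \<longleftrightarrow> x \<ominus> y \<in> W"
  using assms mem_coset_iff[of y x] coset_eqI[of y x] a_rcos_self[of x] by auto

lemma quot_carrier: "carrier (quot V W) = (\<lambda>x. W +> x) ` carrier V"
  by (auto simp: quot_def FactRing_def A_RCOSETS_def')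

lemma coset_zero: "W +> \<zero> = W"
proof (rule Set.set_eqI)
  fix y
  have "y \<ominus> \<zero> = y" if "y \<in> carrier V"
    using that by (simp add: a_minus_def)
  then show "y \<in> W +> \<zero> \<longleftrightarrow> y \<in> W"
    using mem_coset_iff[of \<zero> y] W_carrier[of y] by auto
qed

lemma quot_zero: "\<zero>\<^bsub>quot V W\<^esub> = W"
  by (simp add: quot_def FactRing_def)

lemma quot_add:
  "x \<in> carrier V \<Longrightarrow> y \<in> carrier V \<Longrightarrow> (W +> x) \<oplus>\<^bsub>quot V W\<^esub> (W +> y) = W +> (x \<oplus> y)"
  by (simp add: quot_def FactRing_def a_rcos_sum)

lemma quot_smult:
  assumes "x \<in> carrier V"
  shows "c \<odot>\<^bsub>quot V W\<^esub> (W +> x) = W +> (c \<odot> x)"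
proof -
  have "W +> (c \<odot> y) = W +> (c \<odot> x)" if "y \<in> W +> x" for y
  proof (rule coset_eqI)
    obtain w where w: "w \<in> W" "y = w \<oplus> x"
      using \<open>y \<in> W +> x\<close> by (auto simp: a_r_coset_def')
    have "c \<odot> y = c \<odot> w \<oplus> c \<odot> x"
      using w W_carrier assms by (simp add: smult_r_distr)
    then show "c \<odot> y \<in> W +> (c \<odot> x)"
      using smult_W[OF w(1)] unfolding a_r_coset_def' by auto
  qed (simp add: smult_closed assms)
  \<comment> \<open>All members of the union are one and the same coset, and the index set is
    non-empty.\<close>
  then have "(\<Union>y\<in>W +> x. W +> (c \<odot> y)) = (\<Union>y\<in>W +> x. W +> (c \<odot> x))"
    by (intro SUP_cong refl)
  then show ?thesis
    using a_rcos_self[OF assms] by (auto simp: quot_def)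
qed

lemma quot_abelian_group: "abelian_group (quot V W)"
proof (rule abelian_groupI)
  show "X \<oplus>\<^bsub>quot V W\<^esub> Y \<in> carrier (quot V W)" "X \<oplus>\<^bsub>quot V W\<^esub> Y = Y \<oplus>\<^bsub>quot V W\<^esub> X"
    if XY: "X \<in> carrier (quot V W)" "Y \<in> carrier (quot V W)" for X Y
  proof -
    obtain x y where "x \<in> carrier V" "y \<in> carrier V" "X = W +> x" "Y = W +> y"
      using XY unfolding quot_carrier by blast
    then show "X \<oplus>\<^bsub>quot V W\<^esub> Y \<in> carrier (quot V W)" "X \<oplus>\<^bsub>quot V W\<^esub> Y = Y \<oplus>\<^bsub>quot V W\<^esub> X"
      by (auto simp: quot_add quot_carrier a_comm)
  qed
  show "X \<oplus>\<^bsub>quot V W\<^esub> Y \<oplus>\<^bsub>quot V W\<^esub> Z = X \<oplus>\<^bsub>quot V W\<^esub> (Y \<oplus>\<^bsub>quot V W\<^esub> Z)"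
    if XYZ: "X \<in> carrier (quot V W)" "Y \<in> carrier (quot V W)" "Z \<in> carrier (quot V W)" for X Y Z
  proof -
    obtain x y z where "x \<in> carrier V" "y \<in> carrier V" "z \<in> carrier V" "X = W +> x" "Y = W +> y" "Z = W +> z"
      using XYZ unfolding quot_carrier by blast
    then show ?thesis
      by (simp add: quot_add a_assoc)
  qed
  show "\<zero>\<^bsub>quot V W\<^esub> \<in> carrier (quot V W)"
    unfolding quot_zero quot_carrier using coset_zero by blast
  fix X assume "X \<in> carrier (quot V W)"
  then obtain x where x: "x \<in> carrier V" "X = W +> x"
    unfolding quot_carrier by blast
  then show "\<zero>\<^bsub>quot V W\<^esub> \<oplus>\<^bsub>quot V W\<^esub> X = X"
    using quot_add[of \<zero> x] by (simp add: coset_zero quot_zero)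
  show "\<exists>Y\<in>carrier (quot V W). Y \<oplus>\<^bsub>quot V W\<^esub> X = \<zero>\<^bsub>quot V W\<^esub>"
    using x quot_add[of "\<ominus> x" x] unfolding quot_carrier
    by (intro bexI[of _ "W +> (\<ominus> x)"]) (auto simp: l_neg coset_zero quot_zero)
qed

text \<open>Coordinates of a coset, read off from an arbitrary representative. When \<open>W\<close>
  is the kernel of \<open>\<kappa>\<close>, they do not depend on the choice and determine the
  coset.\<close>

definition class_coord :: "('v \<Rightarrow> 'c) \<Rightarrow> 'v set \<Rightarrow> 'c" where
  "class_coord \<kappa> X = \<kappa> (SOME x. x \<in> X)"

context
  fixes \<kappa> :: "'v \<Rightarrow> 'c::ab_group_add"
  assumes \<kappa>_add: "\<And>x y. x \<in> carrier V \<Longrightarrow> y \<in> carrier V \<Longrightarrow> \<kappa> (x \<oplus> y) = \<kappa> x + \<kappa> y"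
    and kernel: "W = {x \<in> carrier V. \<kappa> x = 0}"
begin

lemma coord_minus: "x \<in> carrier V \<Longrightarrow> y \<in> carrier V \<Longrightarrow> \<kappa> (x \<ominus> y) = \<kappa> x - \<kappa> y"
  using \<kappa>_add[of "x \<ominus> y" y] by (simp add: a_minus_def a_assoc l_neg)

lemma mem_kernel: "w \<in> W \<longleftrightarrow> w \<in> carrier V \<and> \<kappa> w = 0"
  by (subst kernel) simp

lemma mem_coset_coord:
  "x \<in> carrier V \<Longrightarrow> y \<in> W +> x \<longleftrightarrow> y \<in> carrier V \<and> \<kappa> y = \<kappa> x"
  using mem_coset_iff[of x y] coord_minus[of y x] mem_kernel[of "y \<ominus> x"] by auto

lemma coset_eq_coord:
  "x \<in> carrier V \<Longrightarrow> y \<in> carrier V \<Longrightarrow> W +> x = W +> y \<longleftrightarrow> \<kappa> x = \<kappa> y"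
  using coset_eq_iff[of x y] coord_minus[of x y] mem_kernel[of "x \<ominus> y"] by auto

lemma class_coord: 
  assumes "x \<in> carrier V" shows "class_coord \<kappa> (W +> x) = \<kappa> x"
proof -
  have "(SOME y. y \<in> W +> x) \<in> W +> x"
    using a_rcos_self[OF assms] by (rule someI)
  then show ?thesis
    using mem_coset_coord[OF assms] by (auto simp: class_coord_def)
qed

lemma bij_class_coord: "bij_betw (class_coord \<kappa>) (carrier (quot V W)) (\<kappa> ` carrier V)"
proof (rule bij_betw_imageI)
  show "inj_on (class_coord \<kappa>) (carrier (quot V W))"
  proof (rule inj_onI)
    fix X Y assume "X \<in> carrier (quot V W)" "Y \<in> carrier (quot V W)"
    then obtain x y where "x \<in> carrier V" "y \<in> carrier V" "X = W +> x" "Y = W +> y"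
      unfolding quot_carrier by blast
    then show "class_coord \<kappa> X = class_coord \<kappa> Y \<Longrightarrow> X = Y"
      by (simp add: class_coord coset_eq_coord)
  qed
  show "class_coord \<kappa> ` carrier (quot V W) = \<kappa> ` carrier V"
    unfolding quot_carrier image_image by (intro image_cong refl class_coord)
qed

text \<open>Evaluates operations defined as a union over all representatives, such as the actions on
  \<open>proj_bimodule\<close>: it is enough that the operation depends on coordinates only.\<close>

lemma UN_coset_coord:
  assumes "x \<in> carrier V" "\<And>y. y \<in> carrier V \<Longrightarrow> \<kappa> y = \<kappa> x \<Longrightarrow> g y = g x"
  shows "(\<Union>y\<in>W +> x. g y) = g x"
proof -
  have "g y = g x" if "y \<in> W +> x" for y
    using assms(2) mem_coset_coord[OF assms(1)] that by blast
  then have "(\<Union>y\<in>W +> x. g y) = (\<Union>y\<in>W +> x. g x)"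
    by (intro SUP_cong refl)
  then show ?thesis
    using a_rcos_self[OF assms(1)] by auto
qed

end

end

section \<open>Bimodules and their homomorphisms\<close>

locale bimod = abelian_group M
  for L :: "('k::field, 'a) module" and M :: "('k, 'a, 'v) bimodule" (structure) +
  assumes smult_closed: "x \<in> carrier M \<Longrightarrow> c \<odot> x \<in> carrier M"
    and smult_r_distr: "x \<in> carrier M \<Longrightarrow> y \<in> carrier M \<Longrightarrow> c \<odot> (x \<oplus> y) = c \<odot> x \<oplus> c \<odot> y"
    and smult_l_distr: "x \<in> carrier M \<Longrightarrow> (c + d) \<odot> x = c \<odot> x \<oplus> d \<odot> x"
    and smult_assoc: "x \<in> carrier M \<Longrightarrow> (c * d) \<odot> x = c \<odot> (d \<odot> x)"
    and smult_one: "x \<in> carrier M \<Longrightarrow> 1 \<odot> x = x"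
    and lact_closed: "l \<in> carrier L \<Longrightarrow> x \<in> carrier M \<Longrightarrow> lact M l x \<in> carrier M"
    and lact_add: "l \<in> carrier L \<Longrightarrow> x \<in> carrier M \<Longrightarrow> y \<in> carrier M \<Longrightarrow>
           lact M l (x \<oplus> y) = lact M l x \<oplus> lact M l y"
    and lact_smult: "l \<in> carrier L \<Longrightarrow> x \<in> carrier M \<Longrightarrow> lact M l (c \<odot> x) = c \<odot> lact M l x"
    and ract_closed: "l \<in> carrier L \<Longrightarrow> x \<in> carrier M \<Longrightarrow> ract M x l \<in> carrier M"
    and ract_add: "l \<in> carrier L \<Longrightarrow> x \<in> carrier M \<Longrightarrow> y \<in> carrier M \<Longrightarrow>
           ract M (x \<oplus> y) l = ract M x l \<oplus> ract M y l"
    and ract_smult: "l \<in> carrier L \<Longrightarrow> x \<in> carrier M \<Longrightarrow> ract M (c \<odot> x) l = c \<odot> ract M x l"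
begin

lemma smult_zero: "c \<odot> \<zero> = \<zero>"
  using smult_r_distr[of \<zero> \<zero> c] smult_closed[of \<zero> c] by simp

lemma zero_smult: "x \<in> carrier M \<Longrightarrow> 0 \<odot> x = \<zero>"
  using smult_l_distr[of x 0 0] smult_closed[of x 0] by simp

lemma smult_m1: 
  assumes "x \<in> carrier M" shows "(- 1) \<odot> x = \<ominus> x"
proof (rule minus_equality[symmetric])
  show "(- 1) \<odot> x \<oplus> x = \<zero>"
    using smult_l_distr[of x "- 1" 1] assms by (simp add: smult_one zero_smult)
qed (simp_all add: smult_closed assms)

lemma lact_zero: "l \<in> carrier L \<Longrightarrow> lact M l \<zero> = \<zero>"
  using lact_add[of l \<zero> \<zero>] lact_closed[of l \<zero>] by simp

lemma ract_zero: "l \<in> carrier L \<Longrightarrow> ract M \<zero> l = \<zero>"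
  using ract_add[of l \<zero> \<zero>] ract_closed[of l \<zero>] by simp

end

lemma homI:
  assumes "\<And>x. x \<in> carrier M \<Longrightarrow> f x \<in> carrier N" "f \<in> extensional (carrier M)"
    "\<And>x y. x \<in> carrier M \<Longrightarrow> y \<in> carrier M \<Longrightarrow> f (x \<oplus>\<^bsub>M\<^esub> y) = f x \<oplus>\<^bsub>N\<^esub> f y"
    "\<And>c x. x \<in> carrier M \<Longrightarrow> f (c \<odot>\<^bsub>M\<^esub> x) = c \<odot>\<^bsub>N\<^esub> f x"
    "\<And>l x. l \<in> carrier L \<Longrightarrow> x \<in> carrier M \<Longrightarrow> f (lact M l x) = lact N l (f x)"
    "\<And>l x. l \<in> carrier L \<Longrightarrow> x \<in> carrier M \<Longrightarrow> f (ract M x l) = ract N (f x) l"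
  shows "f \<in> bimodule_hom L M N"
  using assms by (auto simp: bimodule_hom_def PiE_def)

lemma homD:
  assumes "f \<in> bimodule_hom L M N"
  shows "x \<in> carrier M \<Longrightarrow> f x \<in> carrier N" "f \<in> extensional (carrier M)"
    "x \<in> carrier M \<Longrightarrow> y \<in> carrier M \<Longrightarrow> f (x \<oplus>\<^bsub>M\<^esub> y) = f x \<oplus>\<^bsub>N\<^esub> f y"
    "x \<in> carrier M \<Longrightarrow> f (c \<odot>\<^bsub>M\<^esub> x) = c \<odot>\<^bsub>N\<^esub> f x"
    "l \<in> carrier L \<Longrightarrow> x \<in> carrier M \<Longrightarrow> f (lact M l x) = lact N l (f x)"
    "l \<in> carrier L \<Longrightarrow> x \<in> carrier M \<Longrightarrow> f (ract M x l) = ract N (f x) l"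
  using assms by (auto simp: bimodule_hom_def PiE_def)

lemma hom_eqI:
  assumes "f \<in> bimodule_hom L M N" "g \<in> bimodule_hom L M N" "\<And>x. x \<in> carrier M \<Longrightarrow> f x = g x"
  shows "f = g"
  using homD(2)[OF assms(1)] homD(2)[OF assms(2)] assms(3) by (rule extensionalityI)

locale bimod_pair = M: bimod L M + N: bimod L N
  for L :: "('k::field, 'a) module" and M :: "('k, 'a, 'v) bimodule" and N :: "('k, 'a, 'w) bimodule"
begin

lemma hom_zero: "(\<lambda>x\<in>carrier M. \<zero>\<^bsub>N\<^esub>) \<in> bimodule_hom L M N"
  by (rule homI) (auto simp: M.smult_closed M.lact_closed M.ract_closed N.smult_zero N.lact_zero N.ract_zero)

lemma hom_add:
  assumes f: "f \<in> bimodule_hom L M N" and g: "g \<in> bimodule_hom L M N"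
  shows "(\<lambda>x\<in>carrier M. f x \<oplus>\<^bsub>N\<^esub> g x) \<in> bimodule_hom L M N"
  by (rule homI) (auto simp: homD[OF f] homD[OF g] M.smult_closed M.lact_closed M.ract_closed 
     N.smult_r_distr N.lact_add N.ract_add N.a_ac)

lemma hom_smult:
  assumes f: "f \<in> bimodule_hom L M N"
  shows "(\<lambda>x\<in>carrier M. c \<odot>\<^bsub>N\<^esub> f x) \<in> bimodule_hom L M N"
  by (rule homI) (auto simp: homD[OF f] M.smult_closed M.lact_closed M.ract_closed 
     N.smult_r_distr N.lact_smult N.ract_smult N.smult_closed N.smult_assoc[symmetric] mult.commute)

lemma hom_minus:
  assumes f: "f \<in> bimodule_hom L M N" and g: "g \<in> bimodule_hom L M N"
  shows "(\<lambda>x\<in>carrier M. f x \<ominus>\<^bsub>N\<^esub> g x) \<in> bimodule_hom L M N"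
proof -
  have "(\<lambda>x\<in>carrier M. f x \<ominus>\<^bsub>N\<^esub> g x) = (\<lambda>x\<in>carrier M. f x \<oplus>\<^bsub>N\<^esub> (\<lambda>x\<in>carrier M. (- 1) \<odot>\<^bsub>N\<^esub> g x) x)"
    by (auto simp: fun_eq_iff restrict_def a_minus_def N.smult_m1 homD(1)[OF g])
  then show ?thesis
    using hom_add[OF f hom_smult[OF g]] by simp
qed

lemma hom_of_zero:
  assumes f: "f \<in> bimodule_hom L M N"
  shows "f \<zero>\<^bsub>M\<^esub> = \<zero>\<^bsub>N\<^esub>"
  using homD(4)[OF f M.zero_closed, of 0] homD(1)[OF f M.zero_closed]
  by (simp add: M.zero_smult N.zero_smult)

lemma hom_of_minus:
  assumes f: "f \<in> bimodule_hom L M N" and "x \<in> carrier M" "y \<in> carrier M"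
  shows "f (x \<ominus>\<^bsub>M\<^esub> y) = f x \<ominus>\<^bsub>N\<^esub> f y"
  using assms homD(4)[OF f, of y "- 1"] homD(3)[OF f, of x "\<ominus>\<^bsub>M\<^esub> y"] homD(1)[OF f]
  by (simp add: a_minus_def M.smult_m1 N.smult_m1)

end

lemma hom_comp:
  assumes M: "bimod L M" and f: "f \<in> bimodule_hom L M N" and g: "g \<in> bimodule_hom L N K"
  shows "(\<lambda>x\<in>carrier M. g (f x)) \<in> bimodule_hom L M K"
proof -
  interpret bimod L M by fact
  show ?thesis
    by (rule homI) (auto simp: homD[OF f] homD[OF g] smult_closed lact_closed ract_closed)
qed

lemma regular_simps [simp]:
  "carrier (regular_bimodule L) = carrier L" "zero (regular_bimodule L) = zero L"
  "add (regular_bimodule L) = add L" "smult (regular_bimodule L) = smult L"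
  "lact (regular_bimodule L) = mult L" "ract (regular_bimodule L) = mult L"
  by (simp_all add: regular_bimodule_def)

lemma (in bimod) minus_zero_self: "x \<in> carrier M \<Longrightarrow> x \<ominus> (x \<ominus> \<zero>) = \<zero>"
proof -
  have z: "\<ominus> \<zero> = \<zero>"
    by (rule minus_equality) simp_all
  show "x \<in> carrier M \<Longrightarrow> x \<ominus> (x \<ominus> \<zero>) = \<zero>"
    by (simp add: a_minus_def z r_neg)
qed

section \<open>The algebra of self-extensions\<close>

text \<open>Projectivity and exactness enter in combination, as three lifting properties: a
  homomorphism from some \<open>P n\<close> into the complex that is killed by the next map factors
  through the previous one. This is the form in which the comparison theorem uses them.\<close>

locale ext_resolution = resolution_data L P d \<epsilon>
  for L :: "('k::field, 'a) module" and P :: "nat \<Rightarrow> ('k, 'a, 'p) bimodule"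
    and d :: "nat \<Rightarrow> 'p \<Rightarrow> 'p" and \<epsilon> :: "'p \<Rightarrow> 'a" +
  assumes L_bimod: "bimod L (regular_bimodule L)"
    and P_bimod: "\<And>n. bimod L (P n)"
    and d_hom: "\<And>n. d (Suc n) \<in> bimodule_hom L (P (Suc n)) (P n)"
    and aug_hom: "\<epsilon> \<in> bimodule_hom L (P 0) (regular_bimodule L)"
    and dd: "\<And>x n. x \<in> carrier (P (Suc (Suc n))) \<Longrightarrow> d (Suc n) (d (Suc (Suc n)) x) = \<zero>\<^bsub>P n\<^esub>"
    and aug_d: "\<And>x. x \<in> carrier (P (Suc 0)) \<Longrightarrow> \<epsilon> (d (Suc 0) x) = \<zero>\<^bsub>L\<^esub>"
    and lift_aug: "\<And>h n. h \<in> bimodule_hom L (P n) (regular_bimodule L) \<Longrightarrow>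
        \<exists>H\<in>bimodule_hom L (P n) (P 0). \<forall>x\<in>carrier (P n). \<epsilon> (H x) = h x"
    and lift_0: "\<And>h n. h \<in> bimodule_hom L (P n) (P 0) \<Longrightarrow> (\<And>x. x \<in> carrier (P n) \<Longrightarrow> \<epsilon> (h x) = \<zero>\<^bsub>L\<^esub>) \<Longrightarrow>
        \<exists>H\<in>bimodule_hom L (P n) (P (Suc 0)). \<forall>x\<in>carrier (P n). d (Suc 0) (H x) = h x"
    and lift_Suc: "\<And>h n k. h \<in> bimodule_hom L (P n) (P (Suc k)) \<Longrightarrow>
        (\<And>x. x \<in> carrier (P n) \<Longrightarrow> d (Suc k) (h x) = \<zero>\<^bsub>P k\<^esub>) \<Longrightarrow>
        \<exists>H\<in>bimodule_hom L (P n) (P (Suc (Suc k))). \<forall>x\<in>carrier (P n). d (Suc (Suc k)) (H x) = h x"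
begin

interpretation R: bimod L "regular_bimodule L"
  by (rule L_bimod)

interpretation P: bimod L "P n" for n
  by (rule P_bimod)

interpretation PP: bimod_pair L "P n" "P k" for n k
  by unfold_locales

interpretation PL: bimod_pair L "P n" "regular_bimodule L" for n
  by unfold_locales

section \<open>Cochains, cocycles and Ext as vector spaces\<close>

abbreviation "RL \<equiv> regular_bimodule L"

abbreviation cocyc :: "nat \<Rightarrow> ('p \<Rightarrow> 'a) set" where
  "cocyc n \<equiv> carrier (cocycles n)"

lemma cochains_simps:
  "carrier (cochains n) = bimodule_hom L (P n) RL"
  "zero (cochains n) = (\<lambda>x\<in>carrier (P n). \<zero>\<^bsub>L\<^esub>)"
  "add (cochains n) f g = (\<lambda>x\<in>carrier (P n). f x \<oplus>\<^bsub>L\<^esub> g x)"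
  "smult (cochains n) c f = (\<lambda>x\<in>carrier (P n). c \<odot>\<^bsub>L\<^esub> f x)"
  "zero (cocycles n) = zero (cochains n)" "add (cocycles n) = add (cochains n)"
  "smult (cocycles n) = smult (cochains n)"
  by (simp_all add: cochains_def cocycles_def)

lemma cocyc_iff: "f \<in> cocyc n \<longleftrightarrow> f \<in> bimodule_hom L (P n) RL \<and>
    (\<forall>x\<in>carrier (P (Suc n)). f (d (Suc n) x) = \<zero>\<^bsub>L\<^esub>)"
  by (simp add: cocycles_def cochains_simps(1))

lemma cocycD:
  assumes "f \<in> cocyc n"
  shows "f \<in> bimodule_hom L (P n) RL" "x \<in> carrier (P (Suc n)) \<Longrightarrow> f (d (Suc n) x) = \<zero>\<^bsub>L\<^esub>"
  using assms by (auto simp: cocyc_iff)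

lemma d_closed: "x \<in> carrier (P (Suc n)) \<Longrightarrow> d (Suc n) x \<in> carrier (P n)"
  using homD(1)[OF d_hom] .

lemma L_group: "abelian_group L"
proof (rule abelian_groupI)
  show "\<exists>y\<in>carrier L. y \<oplus>\<^bsub>L\<^esub> x = \<zero>\<^bsub>L\<^esub>" if "x \<in> carrier L" for x
    using that R.l_neg[of x] R.a_inv_closed[of x] by auto
qed (use R.a_closed R.a_assoc R.a_comm R.l_zero R.zero_closed in simp_all)

interpretation L: abelian_group L
  by (rule L_group)

lemma RL_simps [simp]: "a_inv RL x = a_inv L x" "x \<ominus>\<^bsub>RL\<^esub> y = x \<ominus>\<^bsub>L\<^esub> y"
  by (simp_all add: a_minus_def a_inv_def m_inv_def)

lemma coboundaries_0: "coboundaries 0 = {\<lambda>x\<in>carrier (P 0). \<zero>\<^bsub>L\<^esub>}"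
  by (simp add: coboundaries_def cochains_simps)

lemma coboundaries_Suc:
  "coboundaries (Suc n) = {\<lambda>x\<in>carrier (P (Suc n)). g (d (Suc n) x) | g. g \<in> bimodule_hom L (P n) RL}"
  by (simp add: coboundaries_def cochains_simps)

lemma hom_comp_d: "g \<in> bimodule_hom L (P n) K \<Longrightarrow>
    (\<lambda>x\<in>carrier (P (Suc n)). g (d (Suc n) x)) \<in> bimodule_hom L (P (Suc n)) K"
  by (rule hom_comp[OF P_bimod d_hom])

lemma coboundary_cocyc: "f \<in> coboundaries n \<Longrightarrow> f \<in> cocyc n"
proof (cases n)
  case 0
  then show "f \<in> coboundaries n \<Longrightarrow> ?thesis"
    using PL.hom_zero[of n] by (auto simp: coboundaries_0 cocyc_iff d_closed)
next
  case (Suc k)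
  assume "f \<in> coboundaries n"
  then obtain g where "g \<in> bimodule_hom L (P k) RL" "f = (\<lambda>x\<in>carrier (P (Suc k)). g (d (Suc k) x))"
    using Suc by (auto simp: coboundaries_Suc)
  then show ?thesis
    using hom_comp_d[of g k RL] PL.hom_of_zero[of g k] Suc by (auto simp: cocyc_iff d_closed dd)
qed

lemma cochain_closed: "f \<in> bimodule_hom L (P n) RL \<Longrightarrow> x \<in> carrier (P n) \<Longrightarrow> f x \<in> carrier L"
  using homD(1)[of f L "P n" RL x] by simp

lemma cochains_group: "abelian_group (cochains n)"
proof (rule abelian_groupI)
  fix f assume f: "f \<in> carrier (cochains n)"
  then have f': "f \<in> bimodule_hom L (P n) RL"
    by (simp add: cochains_simps)
  show "\<zero>\<^bsub>cochains n\<^esub> \<oplus>\<^bsub>cochains n\<^esub> f = f"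
    by (rule extensionalityI[OF _ homD(2)[OF f']]) (use f' cochain_closed in \<open>auto simp: cochains_simps\<close>)
  show "\<exists>g\<in>carrier (cochains n). g \<oplus>\<^bsub>cochains n\<^esub> f = \<zero>\<^bsub>cochains n\<^esub>"
    using f' cochain_closed[OF f'] PL.hom_smult[OF f', of "- 1"] R.smult_m1
    by (intro bexI[of _ "- 1 \<odot>\<^bsub>cochains n\<^esub> f"]) (auto simp: cochains_simps fun_eq_iff restrict_def L.l_neg)
next
  fix f g assume "f \<in> carrier (cochains n)" "g \<in> carrier (cochains n)"
  then have fg: "f \<in> bimodule_hom L (P n) RL" "g \<in> bimodule_hom L (P n) RL"
    by (simp_all add: cochains_simps)
  show "f \<oplus>\<^bsub>cochains n\<^esub> g \<in> carrier (cochains n)"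
    using PL.hom_add[OF fg] by (simp add: cochains_simps)
  show "f \<oplus>\<^bsub>cochains n\<^esub> g = g \<oplus>\<^bsub>cochains n\<^esub> f"
    using fg cochain_closed by (auto simp: cochains_simps L.a_comm intro!: restrict_ext)
  fix h assume "h \<in> carrier (cochains n)"
  then have h: "h \<in> bimodule_hom L (P n) RL"
    by (simp add: cochains_simps)
  show "f \<oplus>\<^bsub>cochains n\<^esub> g \<oplus>\<^bsub>cochains n\<^esub> h = f \<oplus>\<^bsub>cochains n\<^esub> (g \<oplus>\<^bsub>cochains n\<^esub> h)"
    using fg h cochain_closed by (auto simp: cochains_simps L.a_assoc intro!: restrict_ext)
next
  show "\<zero>\<^bsub>cochains n\<^esub> \<in> carrier (cochains n)"
    using PL.hom_zero[of n] by (simp add: cochains_simps)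
qed

lemma cocyc_cochain: "f \<in> cocyc n \<Longrightarrow> f \<in> carrier (cochains n)"
  by (simp add: cocyc_iff cochains_simps)

lemma cocyc_smult: "f \<in> cocyc n \<Longrightarrow> c \<odot>\<^bsub>cochains n\<^esub> f \<in> cocyc n"
  using PL.hom_smult[of f n c] R.smult_zero by (auto simp: cocyc_iff cochains_simps d_closed)

lemma cocyc_add: "f \<in> cocyc n \<Longrightarrow> g \<in> cocyc n \<Longrightarrow> f \<oplus>\<^bsub>cochains n\<^esub> g \<in> cocyc n"
  using PL.hom_add[of f n g] by (auto simp: cocyc_iff cochains_simps d_closed)

lemma cocyc_zero: "\<zero>\<^bsub>cochains n\<^esub> \<in> cocyc n"
  using PL.hom_zero[of n] by (auto simp: cocyc_iff cochains_simps d_closed)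

lemma cochain_neg: "f \<in> carrier (cochains n) \<Longrightarrow> (- 1 \<odot>\<^bsub>cochains n\<^esub> f) \<oplus>\<^bsub>cochains n\<^esub> f = \<zero>\<^bsub>cochains n\<^esub>"
  using cochain_closed[of f n] R.smult_m1 by (auto simp: cochains_simps fun_eq_iff restrict_def L.l_neg)

lemma cocycles_group: "abelian_group (cocycles n)"
proof -
  interpret C: abelian_group "cochains n" by (rule cochains_group)
  show ?thesis
  proof (rule abelian_groupI, unfold cochains_simps(5,6))
    show "\<exists>g\<in>cocyc n. g \<oplus>\<^bsub>cochains n\<^esub> f = \<zero>\<^bsub>cochains n\<^esub>" if "f \<in> cocyc n" for f
      using cochain_neg[OF cocyc_cochain[OF that]] cocyc_smult[OF that] by blast
  qed (auto simp: cocyc_zero cocyc_add C.a_ac cocyc_cochain)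
qed

lemma coboundaryI: "g \<in> bimodule_hom L (P n) RL \<Longrightarrow>
    (\<lambda>x\<in>carrier (P (Suc n)). g (d (Suc n) x)) \<in> coboundaries (Suc n)"
  unfolding coboundaries_Suc by blast

lemma coboundary_zero: "\<zero>\<^bsub>cochains n\<^esub> \<in> coboundaries n"
proof (cases n)
  case 0
  then show ?thesis by (simp add: coboundaries_0 cochains_simps)
next
  case (Suc k)
  have "\<zero>\<^bsub>cochains n\<^esub> = (\<lambda>x\<in>carrier (P (Suc k)). (\<lambda>x\<in>carrier (P k). \<zero>\<^bsub>L\<^esub>) (d (Suc k) x))"
    using Suc by (auto simp: cochains_simps d_closed intro!: restrict_ext)
  then show ?thesis
    using coboundaryI[OF PL.hom_zero] Suc by simp
qed

lemma coboundary_add: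
  assumes "f \<in> coboundaries n" "g \<in> coboundaries n"
  shows "f \<oplus>\<^bsub>cochains n\<^esub> g \<in> coboundaries n"
proof (cases n)
  case 0
  then show ?thesis using assms by (auto simp: coboundaries_0 cochains_simps intro!: restrict_ext)
next
  case (Suc k)
  obtain f' g' where fg: "f' \<in> bimodule_hom L (P k) RL" "g' \<in> bimodule_hom L (P k) RL"
    "f = (\<lambda>x\<in>carrier (P (Suc k)). f' (d (Suc k) x))" "g = (\<lambda>x\<in>carrier (P (Suc k)). g' (d (Suc k) x))"
    using assms unfolding Suc coboundaries_Suc by blast
  have "f \<oplus>\<^bsub>cochains n\<^esub> g = 
      (\<lambda>x\<in>carrier (P (Suc k)). (\<lambda>x\<in>carrier (P k). f' x \<oplus>\<^bsub>L\<^esub> g' x) (d (Suc k) x))"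
    unfolding cochains_simps Suc fg(3,4) by (auto simp: d_closed intro!: restrict_ext)
  then show ?thesis
    using coboundaryI[OF PL.hom_add[OF fg(1,2)]] Suc by simp
qed

lemma coboundary_smult:
  assumes "f \<in> coboundaries n"
  shows "c \<odot>\<^bsub>cochains n\<^esub> f \<in> coboundaries n"
proof (cases n)
  case 0
  then show ?thesis using assms R.smult_zero by (auto simp: coboundaries_0 cochains_simps intro!: restrict_ext)
next
  case (Suc k)
  obtain f' where f: "f' \<in> bimodule_hom L (P k) RL"
    "f = (\<lambda>x\<in>carrier (P (Suc k)). f' (d (Suc k) x))"
    using assms unfolding Suc coboundaries_Suc by blast
  have "c \<odot>\<^bsub>cochains n\<^esub> f = 
      (\<lambda>x\<in>carrier (P (Suc k)). (\<lambda>x\<in>carrier (P k). c \<odot>\<^bsub>L\<^esub> f' x) (d (Suc k) x))"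
    unfolding cochains_simps Suc f(2) by (auto simp: d_closed intro!: restrict_ext)
  then show ?thesis
    using coboundaryI[OF PL.hom_smult[OF f(1), of c]] Suc by simp
qed

lemma quot_space_Ext: "quot_space (coboundaries n) (cocycles n)"
proof -
  interpret C: abelian_group "cocycles n" by (rule cocycles_group)
  have inv: "\<ominus>\<^bsub>cocycles n\<^esub> f = - 1 \<odot>\<^bsub>cochains n\<^esub> f" if "f \<in> cocyc n" for f
  proof (rule C.minus_equality)
    show "(- 1 \<odot>\<^bsub>cochains n\<^esub> f) \<oplus>\<^bsub>cocycles n\<^esub> f = \<zero>\<^bsub>cocycles n\<^esub>"
      using cochain_neg[OF cocyc_cochain[OF that]] by (simp add: cochains_simps(5,6))
  qed (use that cocyc_smult in auto)
  have "additive_subgroup (coboundaries n) (cocycles n)"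
  proof (intro additive_subgroup.intro subgroup.intro, unfold monoid_record_simps)
    show "coboundaries n \<subseteq> cocyc n"
      using coboundary_cocyc by auto
    show "inv\<^bsub>add_monoid (cocycles n)\<^esub> f \<in> coboundaries n" if "f \<in> coboundaries n" for f
      using inv[OF coboundary_cocyc[OF that]] coboundary_smult[OF that] by (simp add: a_inv_def)
  qed (auto simp: cochains_simps(5,6) coboundary_add coboundary_zero)
  then have "abelian_subgroup (coboundaries n) (cocycles n)"
    by (rule abelian_subgroupI3[OF _ cocycles_group])
  moreover have "quot_space_axioms (coboundaries n) (cocycles n)"
  proof
    fix c f g assume "f \<in> cocyc n" "g \<in> cocyc n"
    then show "c \<odot>\<^bsub>cocycles n\<^esub> (f \<oplus>\<^bsub>cocycles n\<^esub> g) = c \<odot>\<^bsub>cocycles n\<^esub> f \<oplus>\<^bsub>cocycles n\<^esub> c \<odot>\<^bsub>cocycles n\<^esub> g"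
      using cochain_closed R.smult_r_distr
      by (auto simp: cochains_simps cocyc_iff intro!: restrict_ext)
  qed (simp_all add: cochains_simps(7) cocyc_smult coboundary_smult)
  ultimately show ?thesis
    by (rule quot_space.intro)
qed

sublocale Q: quot_space "coboundaries n" "cocycles n" for n
  by (rule quot_space_Ext)

lemma cocycle_minus: 
  assumes "f \<in> cocyc n" "g \<in> cocyc n"
  shows "f \<ominus>\<^bsub>cocycles n\<^esub> g = (\<lambda>x\<in>carrier (P n). f x \<ominus>\<^bsub>L\<^esub> g x)"
proof -
  have "\<ominus>\<^bsub>cocycles n\<^esub> g = - 1 \<odot>\<^bsub>cochains n\<^esub> g"
  proof (rule abelian_group.minus_equality[OF cocycles_group])
    show "(- 1 \<odot>\<^bsub>cochains n\<^esub> g) \<oplus>\<^bsub>cocycles n\<^esub> g = \<zero>\<^bsub>cocycles n\<^esub>"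
      using cochain_neg[OF cocyc_cochain[OF assms(2)]] by (simp add: cochains_simps(5,6))
  qed (use assms cocyc_smult in auto)
  then show ?thesis
    using cochain_closed[OF cocycD(1)[OF assms(2)]] R.smult_m1
    by (auto simp: a_minus_def[of "cocycles n"] cochains_simps a_minus_def[of L] intro!: restrict_ext)
qed

lemma coh_class_eq_iff:
  assumes "f \<in> cocyc n" "g \<in> cocyc n"
  shows "coh_class n f = coh_class n g \<longleftrightarrow> (\<lambda>x\<in>carrier (P n). f x \<ominus>\<^bsub>L\<^esub> g x) \<in> coboundaries n"
  using Q.coset_eq_iff[OF assms] cocycle_minus[OF assms] by (simp add: coh_class_def)

lemma mem_coh_class:
  assumes "f \<in> cocyc n"
  shows "g \<in> coh_class n f \<longleftrightarrow> g \<in> cocyc n \<and> coh_class n g = coh_class n f"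
  using Q.mem_coset_iff[OF assms, of g] Q.coset_eq_iff[OF _ assms, of g] by (auto simp: coh_class_def)

lemma Ext_carrier: "carrier (Ext n) = coh_class n ` cocyc n"
  unfolding Ext_def Q.quot_carrier coh_class_def ..

lemma Ext_add: "f \<in> cocyc n \<Longrightarrow> g \<in> cocyc n \<Longrightarrow> 
    coh_class n f \<oplus>\<^bsub>Ext n\<^esub> coh_class n g = coh_class n (f \<oplus>\<^bsub>cochains n\<^esub> g)"
  unfolding Ext_def coh_class_def using Q.quot_add by (simp add: cochains_simps(6))

lemma Ext_smult: "f \<in> cocyc n \<Longrightarrow> c \<odot>\<^bsub>Ext n\<^esub> coh_class n f = coh_class n (c \<odot>\<^bsub>cochains n\<^esub> f)"
  unfolding Ext_def coh_class_def using Q.quot_smult by (simp add: cochains_simps(7))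

lemma Ext_zero: "\<zero>\<^bsub>Ext n\<^esub> = coh_class n \<zero>\<^bsub>cochains n\<^esub>"
  unfolding Ext_def coh_class_def Q.quot_zero using Q.coset_zero by (simp add: cochains_simps(5))

lemma Ext_group: "abelian_group (Ext n)"
  unfolding Ext_def by (rule Q.quot_abelian_group)

section \<open>Comparison theorem and independence of the Yoneda product of choices\<close>

lemma is_liftD:
  assumes "is_lift q g G"
  shows "G n \<in> bimodule_hom L (P (q + n)) (P n)" "x \<in> carrier (P q) \<Longrightarrow> \<epsilon> (G 0 x) = g x"
    "x \<in> carrier (P (Suc (q + n))) \<Longrightarrow> d (Suc n) (G (Suc n) x) = G n (d (Suc (q + n)) x)"
  using assms by (auto simp: is_lift_def)

text \<open>Recursion on the degree: \<open>G (Suc n)\<close> is a lift of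
  \<open>G n \<circ> d\<close> through \<open>d\<close>, which exists because that composite is
  killed by the next map of the complex.\<close>

lemma lift_exists:
  assumes g: "g \<in> cocyc q"
  shows "\<exists>G. is_lift q g G"
proof -
  \<comment> \<open>The vanishing needed for the next lift is part of the recursion invariant. In
    degree 0 it is measured by \<open>\<epsilon>\<close>, in higher degrees by
    \<open>d n\<close>.\<close>
  define good where "good n H \<longleftrightarrow> H \<in> bimodule_hom L (P (q + n)) (P n) \<and>
     (case n of 0 \<Rightarrow> \<forall>x\<in>carrier (P (Suc q)). \<epsilon> (H (d (Suc q) x)) = \<zero>\<^bsub>L\<^esub>
      | Suc k \<Rightarrow> \<forall>x\<in>carrier (P (Suc (q + n))). d n (H (d (Suc (q + n)) x)) = \<zero>\<^bsub>P k\<^esub>)" for n H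
  obtain G0 where G0: "G0 \<in> bimodule_hom L (P q) (P 0)" "\<And>x. x \<in> carrier (P q) \<Longrightarrow> \<epsilon> (G0 x) = g x"
    using lift_aug[OF cocycD(1)[OF g]] by blast
  have good0: "good 0 G0"
    using G0 cocycD(2)[OF g] by (simp add: good_def d_closed)
  have step: "\<exists>H'. good (Suc n) H' \<and> (\<forall>x\<in>carrier (P (Suc (q + n))). d (Suc n) (H' x) = H (d (Suc (q + n)) x))"
    if H: "good n H" for n H
  proof -
    define h where "h = (\<lambda>x\<in>carrier (P (Suc (q + n))). H (d (Suc (q + n)) x))"
    have h: "h \<in> bimodule_hom L (P (Suc (q + n))) (P n)"
      using H hom_comp_d[of H "q + n" "P n"] by (simp add: good_def h_def)
    obtain H' where H': "H' \<in> bimodule_hom L (P (Suc (q + n))) (P (Suc n))"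
       "\<And>x. x \<in> carrier (P (Suc (q + n))) \<Longrightarrow> d (Suc n) (H' x) = h x"
    proof (cases n)
      case 0
      then show ?thesis
        using lift_0[of h "Suc q"] h H that by (auto simp: good_def h_def)
    next
      case (Suc k)
      then show ?thesis
        using lift_Suc[of h "Suc (q + n)" k] h H that by (auto simp: good_def h_def)
    qed
    have "d (Suc n) (H' (d (Suc (Suc (q + n))) x)) = \<zero>\<^bsub>P n\<^esub>" if "x \<in> carrier (P (Suc (Suc (q + n))))" for x
    proof -
      have "d (Suc n) (H' (d (Suc (Suc (q + n))) x)) = H (d (Suc (q + n)) (d (Suc (Suc (q + n))) x))"
        using H'(2)[OF d_closed[OF that]] d_closed[OF that] by (simp add: h_def)
      also have "\<dots> = \<zero>\<^bsub>P n\<^esub>"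
        using H dd[OF that] PP.hom_of_zero[of H "q + n" n] by (simp add: good_def)
      finally show ?thesis .
    qed
    then have "good (Suc n) H'"
      using H'(1) by (simp add: good_def)
    then show ?thesis
      using H'(2) by (auto simp: h_def)
  qed
  obtain G where G: "G 0 = G0" "\<And>n. good n (G n)"
    "\<And>n. \<forall>x\<in>carrier (P (Suc (q + n))). d (Suc n) (G (Suc n) x) = G n (d (Suc (q + n)) x)"
  proof -
    \<comment> \<open>Dependent choice along the invariant: each stage selects some good
      continuation of the previous one.\<close>
    define G where "G = rec_nat G0 (\<lambda>n H. SOME H'. good (Suc n) H' \<and> 
      (\<forall>x\<in>carrier (P (Suc (q + n))). d (Suc n) (H' x) = H (d (Suc (q + n)) x)))"
    have Suc: "G (Suc n) = (SOME H'. good (Suc n) H' \<and> 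
      (\<forall>x\<in>carrier (P (Suc (q + n))). d (Suc n) (H' x) = G n (d (Suc (q + n)) x)))" for n
      by (simp add: G_def)
    have good: "good n (G n)" for n
    proof (induction n)
      case 0
      then show ?case by (simp add: G_def good0)
    next
      case (Suc n)
      show ?case
        using someI_ex[OF step[OF Suc]] unfolding \<open>\<And>n. G (Suc n) = _ n\<close> by blast
    qed
    show ?thesis
    proof (rule that[of G])
      show "G 0 = G0" by (simp add: G_def)
      show "good n (G n)" for n by (rule good)
      show "\<forall>x\<in>carrier (P (Suc (q + n))). d (Suc n) (G (Suc n) x) = G n (d (Suc (q + n)) x)" for n
        using someI_ex[OF step[OF good[of n]]] unfolding Suc by blast
    qed
  qed
  then have "is_lift q g G"
    using G0(2) by (simp add: is_lift_def good_def)
  then show ?thesis by blast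
qed

lemma restrict_coboundary_0:
  assumes "(\<lambda>x\<in>carrier (P 0). f x) \<in> coboundaries 0" "x \<in> carrier (P 0)"
  shows "f x = \<zero>\<^bsub>L\<^esub>"
proof -
  have "(\<lambda>x\<in>carrier (P 0). f x) = (\<lambda>x\<in>carrier (P 0). \<zero>\<^bsub>L\<^esub>)"
    using assms(1) by (simp add: coboundaries_0)
  from fun_cong[OF this, of x] show ?thesis
    using assms(2) by simp
qed

lemma L_eq_of_minus_zero:
  assumes "a \<in> carrier L" "b \<in> carrier L" "a \<ominus>\<^bsub>L\<^esub> b = \<zero>\<^bsub>L\<^esub>"
  shows "a = b"
proof -
  have "a = (a \<ominus>\<^bsub>L\<^esub> b) \<oplus>\<^bsub>L\<^esub> b"
    using assms(1,2) by (simp add: a_minus_def L.a_assoc L.l_neg)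
  then show ?thesis
    using assms by simp
qed

text \<open>
  Two lifts of cohomologous cocycles are homotopic. The map \<open>K\<close> below stands for the term
  \<open>h\<^bsub>n-1\<^esub> \<circ> d\<close> of the homotopy equation \<open>d \<circ> h\<^sub>n + h\<^bsub>n-1\<^esub> \<circ> d = G' - G\<close>.
\<close>

definition null_part :: "nat \<Rightarrow> nat \<Rightarrow> ('p \<Rightarrow> 'p) \<Rightarrow> bool" where
  "null_part N n K \<longleftrightarrow> (case N of 0 \<Rightarrow> \<forall>x\<in>carrier (P 0). K x = \<zero>\<^bsub>P n\<^esub>
     | Suc k \<Rightarrow> \<exists>h\<in>bimodule_hom L (P k) (P n). \<forall>x\<in>carrier (P (Suc k)). K x = h (d (Suc k) x))"

lemma null_part_d:
  assumes "null_part N n K" "x \<in> carrier (P (Suc N))"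
  shows "K (d (Suc N) x) = \<zero>\<^bsub>P n\<^esub>"
proof (cases N)
  case 0
  then show ?thesis
    using assms d_closed[of x 0] by (auto simp: null_part_def)
next
  case (Suc k)
  then obtain h where h: "h \<in> bimodule_hom L (P k) (P n)" "\<forall>x\<in>carrier (P (Suc k)). K x = h (d (Suc k) x)"
    using assms by (auto simp: null_part_def)
  then show ?thesis
    using assms(2) d_closed[of x "Suc k"] dd[of x k] PP.hom_of_zero[OF h(1)] unfolding Suc by simp
qed

text \<open>For \<open>q > 0\<close> the difference \<open>g' - g\<close> may be a nonzero
  coboundary \<open>c \<circ> d\<close>. Then the homotopy equation already has a second term in
  degree 0, namely \<open>C \<circ> d\<close> with \<open>C\<close> a lift of \<open>c\<close>
  through the augmentation. Carrying that term as \<open>K\<close> avoids a homotopy indexed from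
  -1.\<close>

lemma lift_homotopy:
  assumes g: "g \<in> cocyc q" "g' \<in> cocyc q" "(\<lambda>x\<in>carrier (P q). g' x \<ominus>\<^bsub>L\<^esub> g x) \<in> coboundaries q"
    and G: "is_lift q g G" and G': "is_lift q g' G'"
  shows "\<exists>K\<in>bimodule_hom L (P (q + n)) (P n). null_part (q + n) n K \<and>
    (\<exists>h\<in>bimodule_hom L (P (q + n)) (P (Suc n)). 
      \<forall>x\<in>carrier (P (q + n)). d (Suc n) (h x) = (G' n x \<ominus>\<^bsub>P n\<^esub> G n x) \<ominus>\<^bsub>P n\<^esub> K x)"
proof (induction n)
  note GD = is_liftD[OF G] and GD' = is_liftD[OF G']
  have cl: "G n x \<in> carrier (P n)" "G' n x \<in> carrier (P n)" if "x \<in> carrier (P (q + n))" for n x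
    using homD(1)[OF GD(1) that] homD(1)[OF GD'(1) that] by auto
  {
    case 0
    obtain K where K: "K \<in> bimodule_hom L (P q) (P 0)" "null_part q 0 K"
        "\<And>x. x \<in> carrier (P q) \<Longrightarrow> \<epsilon> (K x) = g' x \<ominus>\<^bsub>L\<^esub> g x"
    proof (cases q)
      case 0
      then have *: "g' x \<ominus>\<^bsub>L\<^esub> g x = \<zero>\<^bsub>L\<^esub>" if "x \<in> carrier (P 0)" for x
        using restrict_coboundary_0[of "\<lambda>x. g' x \<ominus>\<^bsub>L\<^esub> g x" x] g(3) that by simp
      show ?thesis
        by (rule that[of "\<lambda>x\<in>carrier (P q). \<zero>\<^bsub>P 0\<^esub>"])
          (use PP.hom_zero[of q 0] PL.hom_of_zero[OF aug_hom] 0 * in \<open>auto simp: null_part_def\<close>)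
    next
      case (Suc k)
      obtain c where c: "c \<in> bimodule_hom L (P k) RL" 
         "(\<lambda>x\<in>carrier (P q). g' x \<ominus>\<^bsub>L\<^esub> g x) = (\<lambda>x\<in>carrier (P (Suc k)). c (d (Suc k) x))"
        using g(3) unfolding Suc coboundaries_Suc by blast
      obtain C where C: "C \<in> bimodule_hom L (P k) (P 0)" "\<And>x. x \<in> carrier (P k) \<Longrightarrow> \<epsilon> (C x) = c x"
        using lift_aug[OF c(1)] by blast
      show ?thesis
      proof (rule that[of "\<lambda>x\<in>carrier (P (Suc k)). C (d (Suc k) x)"])
        show "\<epsilon> ((\<lambda>x\<in>carrier (P (Suc k)). C (d (Suc k) x)) x) = g' x \<ominus>\<^bsub>L\<^esub> g x" if "x \<in> carrier (P q)" for x
          using fun_cong[OF c(2), of x] that C(2)[of "d (Suc k) x"] d_closed[of x k] Suc by simp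
      qed (use hom_comp_d[OF C(1)] C(1) Suc in \<open>auto simp: null_part_def\<close>)
    qed
    define D where "D = (\<lambda>x\<in>carrier (P q). (\<lambda>x\<in>carrier (P q). G' 0 x \<ominus>\<^bsub>P 0\<^esub> G 0 x) x \<ominus>\<^bsub>P 0\<^esub> K x)"
    have D: "D \<in> bimodule_hom L (P q) (P 0)"
      unfolding D_def using PP.hom_minus[OF PP.hom_minus K(1)] GD(1)[of 0] GD'(1)[of 0] by simp
    have "\<epsilon> (D x) = \<zero>\<^bsub>L\<^esub>" if x: "x \<in> carrier (P q)" for x
      using x cl[of x 0] homD(1)[OF K(1) x] K(3)[OF x] GD(2)[OF x] GD'(2)[OF x]
        cochain_closed[OF cocycD(1)[OF g(1)] x] cochain_closed[OF cocycD(1)[OF g(2)] x]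
      by (simp add: D_def PL.hom_of_minus[OF aug_hom] a_minus_def[of L] L.r_neg)
    from lift_0[OF D this] obtain h where "h \<in> bimodule_hom L (P q) (P (Suc 0))"
      "\<And>x. x \<in> carrier (P q) \<Longrightarrow> d (Suc 0) (h x) = D x"
      by blast
    then show ?case
      using K(1,2) by (intro bexI[of _ K] conjI bexI[of _ h]) (auto simp: D_def)
  next
    case (Suc n)
    obtain K h where K: "K \<in> bimodule_hom L (P (q + n)) (P n)" "null_part (q + n) n K"
      and h: "h \<in> bimodule_hom L (P (q + n)) (P (Suc n))" "\<And>x. x \<in> carrier (P (q + n)) \<Longrightarrow>
         d (Suc n) (h x) = (G' n x \<ominus>\<^bsub>P n\<^esub> G n x) \<ominus>\<^bsub>P n\<^esub> K x"
      using Suc by blast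
    define K' where "K' = (\<lambda>x\<in>carrier (P (Suc (q + n))). h (d (Suc (q + n)) x))"
    have K': "K' \<in> bimodule_hom L (P (Suc (q + n))) (P (Suc n))"
      unfolding K'_def by (rule hom_comp_d[OF h(1)])
    define D where "D = (\<lambda>x\<in>carrier (P (Suc (q + n))).
       (\<lambda>x\<in>carrier (P (Suc (q + n))). G' (Suc n) x \<ominus>\<^bsub>P (Suc n)\<^esub> G (Suc n) x) x \<ominus>\<^bsub>P (Suc n)\<^esub> K' x)"
    have D: "D \<in> bimodule_hom L (P (Suc (q + n))) (P (Suc n))"
      unfolding D_def using PP.hom_minus[OF PP.hom_minus K'] GD(1)[of "Suc n"] GD'(1)[of "Suc n"] by simp
    have "d (Suc n) (D x) = \<zero>\<^bsub>P n\<^esub>" if x: "x \<in> carrier (P (Suc (q + n)))" for x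
    proof -
      note dx = d_closed[OF x]
      have c: "G n (d (Suc (q + n)) x) \<in> carrier (P n)" "G' n (d (Suc (q + n)) x) \<in> carrier (P n)"
        using cl[OF dx] by auto
      have "d (Suc n) (D x) = (d (Suc n) (G' (Suc n) x) \<ominus>\<^bsub>P n\<^esub> d (Suc n) (G (Suc n) x)) \<ominus>\<^bsub>P n\<^esub> d (Suc n) (K' x)"
        using x cl[of x "Suc n"] homD(1)[OF K' x] by (simp add: D_def PP.hom_of_minus[OF d_hom])
      \<comment> \<open>\<open>K' x\<close> is \<open>h (d x)\<close>, so its boundary is given by
        the previous homotopy equation at \<open>d x\<close>. The two differences cancel and
        \<open>K (d x)\<close> remains, which vanishes by \<open>null_part_d\<close>.\<close>
      also have "\<dots> = (G' n (d (Suc (q + n)) x) \<ominus>\<^bsub>P n\<^esub> G n (d (Suc (q + n)) x)) \<ominus>\<^bsub>P n\<^esub> 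
          ((G' n (d (Suc (q + n)) x) \<ominus>\<^bsub>P n\<^esub> G n (d (Suc (q + n)) x)) \<ominus>\<^bsub>P n\<^esub> K (d (Suc (q + n)) x))"
        using x dx GD(3) GD'(3) h(2) by (simp add: K'_def)
      also have "\<dots> = \<zero>\<^bsub>P n\<^esub>"
      proof -
        note P.minus_zero_self[OF P.minus_closed[OF c(2,1)]]
        then show ?thesis
          unfolding null_part_d[OF K(2) x] .
      qed
      finally show ?thesis .
    qed
    from lift_Suc[OF D this] obtain h' where "h' \<in> bimodule_hom L (P (Suc (q + n))) (P (Suc (Suc n)))"
      "\<And>x. x \<in> carrier (P (Suc (q + n))) \<Longrightarrow> d (Suc (Suc n)) (h' x) = D x"
      by blast
    then show ?case
      using K' h(1) by (intro bexI[of _ K'] conjI bexI[of _ h']) (auto simp: D_def null_part_def K'_def)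
  }
qed

definition comp_lift :: "nat \<Rightarrow> nat \<Rightarrow> ('p \<Rightarrow> 'a) \<Rightarrow> (nat \<Rightarrow> 'p \<Rightarrow> 'p) \<Rightarrow> 'p \<Rightarrow> 'a" where
  "comp_lift p q f G = (\<lambda>x\<in>carrier (P (p + q)). f (G p x))"

lemma comp_lift_hom:
  assumes "f \<in> bimodule_hom L (P p) RL" "is_lift q g G"
  shows "comp_lift p q f G \<in> bimodule_hom L (P (p + q)) RL"
  unfolding comp_lift_def
  using hom_comp[OF P_bimod is_liftD(1)[OF assms(2), of p] assms(1)] by (simp add: add.commute)

lemma comp_lift_cocyc:
  assumes f: "f \<in> cocyc p" and G: "is_lift q g G"
  shows "comp_lift p q f G \<in> cocyc (p + q)"
proof -
  have "f (G p (d (Suc (p + q)) x)) = \<zero>\<^bsub>L\<^esub>" if x: "x \<in> carrier (P (Suc (p + q)))" for x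
  proof -
    have x': "x \<in> carrier (P (Suc (q + p)))" 
      using x by (simp add: add.commute)
    have "G (Suc p) x \<in> carrier (P (Suc p))"
      using homD(1)[OF is_liftD(1)[OF G, of "Suc p"]] x' by simp
    then show ?thesis
      using is_liftD(3)[OF G x'] cocycD(2)[OF f, of "G (Suc p) x"] by (simp add: add.commute)
  qed
  then show ?thesis
    using comp_lift_hom[OF cocycD(1)[OF f] G] by (simp add: cocyc_iff comp_lift_def d_closed)
qed

text \<open>The difference is split as (f' - f) G' + f (G' - G). If f' - f = b d, the first summand
  is b d G' = b G' d. In the second, f kills the boundary in the homotopy equation and f K is left.
  Both are coboundaries.\<close>

lemma comp_lift_unique:
  assumes f: "f \<in> cocyc p" "f' \<in> cocyc p" "(\<lambda>x\<in>carrier (P p). f' x \<ominus>\<^bsub>L\<^esub> f x) \<in> coboundaries p"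
    and g: "g \<in> cocyc q" "g' \<in> cocyc q" "(\<lambda>x\<in>carrier (P q). g' x \<ominus>\<^bsub>L\<^esub> g x) \<in> coboundaries q"
    and G: "is_lift q g G" and G': "is_lift q g' G'"
  shows "coh_class (p + q) (comp_lift p q f' G') = coh_class (p + q) (comp_lift p q f G)"
proof -
  let ?N = "p + q"
  have pq: "q + p = ?N" by simp
  have cl: "G p x \<in> carrier (P p)" "G' p x \<in> carrier (P p)" if "x \<in> carrier (P ?N)" for x
    using homD(1)[OF is_liftD(1)[OF G, of p]] homD(1)[OF is_liftD(1)[OF G', of p]] that unfolding pq by auto
  obtain K h where K: "K \<in> bimodule_hom L (P ?N) (P p)" "null_part ?N p K"
     and h: "h \<in> bimodule_hom L (P ?N) (P (Suc p))" "\<And>x. x \<in> carrier (P ?N) \<Longrightarrow>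
         d (Suc p) (h x) = (G' p x \<ominus>\<^bsub>P p\<^esub> G p x) \<ominus>\<^bsub>P p\<^esub> K x"
    using lift_homotopy[OF g G G', of p] unfolding pq by blast
  have 1: "f (G' p x) \<ominus>\<^bsub>L\<^esub> f (G p x) = f (K x)" if x: "x \<in> carrier (P ?N)" for x
  proof -
    have fc: "f (G' p x) \<in> carrier L" "f (G p x) \<in> carrier L" "f (K x) \<in> carrier L"
      using cl[OF x] homD(1)[OF K(1) x] cochain_closed[OF cocycD(1)[OF f(1)]] by auto
    have "\<zero>\<^bsub>L\<^esub> = f (d (Suc p) (h x))"
      using cocycD(2)[OF f(1), of "h x"] homD(1)[OF h(1) x] by simp
    also have "\<dots> = (f (G' p x) \<ominus>\<^bsub>L\<^esub> f (G p x)) \<ominus>\<^bsub>L\<^esub> f (K x)"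
      using cl[OF x] homD(1)[OF K(1) x] by (simp add: h(2)[OF x] PL.hom_of_minus[OF cocycD(1)[OF f(1)]])
    finally show ?thesis
      using fc L_eq_of_minus_zero[of "f (G' p x) \<ominus>\<^bsub>L\<^esub> f (G p x)" "f (K x)"] by simp
  qed
  have 2: "(\<lambda>x\<in>carrier (P ?N). f (K x)) \<in> coboundaries ?N"
  proof (cases ?N)
    case 0
    then show ?thesis
      using K(2) PL.hom_of_zero[OF cocycD(1)[OF f(1)]] 
      by (auto simp: null_part_def coboundaries_0 intro!: restrict_ext)
  next
    case (Suc k)
    obtain c where c: "c \<in> bimodule_hom L (P k) (P p)" "\<forall>x\<in>carrier (P (Suc k)). K x = c (d (Suc k) x)"
      using K(2) unfolding Suc null_part_def by auto
    have "(\<lambda>x\<in>carrier (P (Suc k)). f (K x)) = (\<lambda>x\<in>carrier (P (Suc k)). (\<lambda>y\<in>carrier (P k). f (c y)) (d (Suc k) x))"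
      using c(2) by (auto simp: d_closed intro!: restrict_ext)
    then show ?thesis
      unfolding Suc using coboundaryI[OF hom_comp[OF P_bimod c(1) cocycD(1)[OF f(1)]]] by simp
  qed
  have 3: "(\<lambda>x\<in>carrier (P ?N). f' (G' p x) \<ominus>\<^bsub>L\<^esub> f (G' p x)) \<in> coboundaries ?N"
  proof (cases p)
    case 0
    have "f' x \<ominus>\<^bsub>L\<^esub> f x = \<zero>\<^bsub>L\<^esub>" if "x \<in> carrier (P 0)" for x
      using restrict_coboundary_0[of "\<lambda>x. f' x \<ominus>\<^bsub>L\<^esub> f x" x] f(3) that 0 by simp
    then have "(\<lambda>x\<in>carrier (P ?N). f' (G' p x) \<ominus>\<^bsub>L\<^esub> f (G' p x)) = \<zero>\<^bsub>cochains ?N\<^esub>"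
      using cl(2) 0 by (auto simp: cochains_simps intro!: restrict_ext)
    then show ?thesis
      using coboundary_zero by simp
  next
    case (Suc k)
    obtain b where b: "b \<in> bimodule_hom L (P k) RL" 
       "(\<lambda>x\<in>carrier (P p). f' x \<ominus>\<^bsub>L\<^esub> f x) = (\<lambda>x\<in>carrier (P (Suc k)). b (d (Suc k) x))"
      using f(3) unfolding Suc coboundaries_Suc by blast
    have "f' (G' p x) \<ominus>\<^bsub>L\<^esub> f (G' p x) = b (G' k (d (Suc (k + q)) x))" if x: "x \<in> carrier (P (Suc (k + q)))" for x
    proof -
      have "f' (G' p x) \<ominus>\<^bsub>L\<^esub> f (G' p x) = b (d (Suc k) (G' p x))"
        using fun_cong[OF b(2), of "G' p x"] cl(2)[of x] x Suc by simp
      then show ?thesis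
        using is_liftD(3)[OF G', of x k] x Suc by (simp add: add.commute)
    qed
    moreover have "G' k \<in> bimodule_hom L (P (k + q)) (P k)"
      using is_liftD(1)[OF G', of k] by (simp add: add.commute)
    ultimately have "(\<lambda>x\<in>carrier (P ?N). f' (G' p x) \<ominus>\<^bsub>L\<^esub> f (G' p x)) =
       (\<lambda>x\<in>carrier (P (Suc (k + q))). (\<lambda>y\<in>carrier (P (k + q)). b (G' k y)) (d (Suc (k + q)) x))"
      using Suc by (auto simp: d_closed intro!: restrict_ext)
    then show ?thesis
      using coboundaryI[OF hom_comp[OF P_bimod \<open>G' k \<in> _\<close> b(1)]] Suc by simp
  qed
  have "(\<lambda>x\<in>carrier (P ?N). comp_lift p q f' G' x \<ominus>\<^bsub>L\<^esub> comp_lift p q f G x) =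
     (\<lambda>x\<in>carrier (P ?N). f' (G' p x) \<ominus>\<^bsub>L\<^esub> f (G' p x)) \<oplus>\<^bsub>cochains ?N\<^esub> (\<lambda>x\<in>carrier (P ?N). f (K x))"
    unfolding cochains_simps(3)
  proof (rule restrict_ext)
    fix x assume x: "x \<in> carrier (P ?N)"
    have c: "f' (G' p x) \<in> carrier L" "f (G p x) \<in> carrier L" "f (G' p x) \<in> carrier L"
      using cl[OF x] cochain_closed[OF cocycD(1)[OF f(1)]] cochain_closed[OF cocycD(1)[OF f(2)]] by auto
    have "(a \<ominus>\<^bsub>L\<^esub> b) \<oplus>\<^bsub>L\<^esub> (b \<ominus>\<^bsub>L\<^esub> c) = a \<ominus>\<^bsub>L\<^esub> c" if "a \<in> carrier L" "b \<in> carrier L" "c \<in> carrier L" for a b c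
      using that L.r_neg1[of b "\<ominus>\<^bsub>L\<^esub> c"] L.r_neg2 by (simp add: a_minus_def L.a_assoc) 
    then show "comp_lift p q f' G' x \<ominus>\<^bsub>L\<^esub> comp_lift p q f G x =
         (\<lambda>x\<in>carrier (P ?N). f' (G' p x) \<ominus>\<^bsub>L\<^esub> f (G' p x)) x \<oplus>\<^bsub>L\<^esub> (\<lambda>x\<in>carrier (P ?N). f (K x)) x"
      using x 1[OF x] c by (simp add: comp_lift_def flip: 1[OF x])
  qed
  then show ?thesis
    using coh_class_eq_iff[OF comp_lift_cocyc[OF f(2) G'] comp_lift_cocyc[OF f(1) G]]
      coboundary_add[OF 3 2] by simp
qed

text \<open>By \<open>comp_lift_unique\<close> the union defining the product has only one distinct
  member, and the given lift shows that it is not empty.\<close>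

lemma yoneda_class:
  assumes f: "f \<in> cocyc p" and g: "g \<in> cocyc q" and G: "is_lift q g G"
  shows "yoneda p q (coh_class p f) (coh_class q g) = coh_class (p + q) (comp_lift p q f G)"
proof -
  have "coh_class (p + q) (comp_lift p q f' G') = coh_class (p + q) (comp_lift p q f G)"
    if "f' \<in> coh_class p f" "g' \<in> coh_class q g" "is_lift q g' G'" for f' g' G'
    using comp_lift_unique[OF f _ _ g _ _ G that(3), of f'] that(1,2) 
      coh_class_eq_iff[of f' p f] coh_class_eq_iff[of g' q g] f g by (auto simp: mem_coh_class)
  moreover have "f \<in> coh_class p f" "g \<in> coh_class q g"
    using f g by (auto simp: mem_coh_class)
  ultimately have "{coh_class (p + q) (comp_lift p q f' G') | f' g' G'.
      f' \<in> coh_class p f \<and> g' \<in> coh_class q g \<and> is_lift q g' G'} = {coh_class (p + q) (comp_lift p q f G)}"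
    using G by blast
  then show ?thesis
    unfolding yoneda_def comp_lift_def[symmetric] by (metis cSup_singleton)
qed

section \<open>The graded algebra of extensions\<close>

interpretation E: abelian_group "Ext n" for n
  by (rule Ext_group)

lemma Ext_cases:
  assumes "X \<in> carrier (Ext n)"
  obtains f where "f \<in> cocyc n" "X = coh_class n f"
  using assms unfolding Ext_carrier by blast

lemma yoneda_closed:
  assumes "X \<in> carrier (Ext p)" "Y \<in> carrier (Ext q)"
  shows "yoneda p q X Y \<in> carrier (Ext (p + q))"
proof -
  obtain f g where fg: "f \<in> cocyc p" "X = coh_class p f" "g \<in> cocyc q" "Y = coh_class q g"
    using assms by (metis Ext_cases)
  obtain G where G: "is_lift q g G"
    using lift_exists[OF fg(3)] by blast
  show ?thesis
    unfolding fg yoneda_class[OF fg(1,3) G] Ext_carrier using comp_lift_cocyc[OF fg(1) G] by blast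
qed

lemma zero_cochain_apply [simp]: "x \<in> carrier (P n) \<Longrightarrow> \<zero>\<^bsub>cochains n\<^esub> x = \<zero>\<^bsub>L\<^esub>"
  by (simp add: cochains_simps)

lemma yoneda_zero_left:
  assumes "Y \<in> carrier (Ext q)"
  shows "yoneda p q \<zero>\<^bsub>Ext p\<^esub> Y = \<zero>\<^bsub>Ext (p + q)\<^esub>"
proof -
  obtain g where g: "g \<in> cocyc q" "Y = coh_class q g"
    using assms by (metis Ext_cases)
  obtain G where G: "is_lift q g G"
    using lift_exists[OF g(1)] by blast
  have "G p x \<in> carrier (P p)" if "x \<in> carrier (P (p + q))" for x
    using homD(1)[OF is_liftD(1)[OF G, of p], of x] that by (simp add: add.commute)
  then have "comp_lift p q \<zero>\<^bsub>cochains p\<^esub> G = \<zero>\<^bsub>cochains (p + q)\<^esub>"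
    unfolding comp_lift_def cochains_simps(2)[of "p + q"] by (intro restrict_ext) simp
  then show ?thesis
    unfolding g(2) Ext_zero yoneda_class[OF cocyc_zero g(1) G] by simp
qed

lemma yoneda_zero_right:
  assumes "X \<in> carrier (Ext p)"
  shows "yoneda p q X \<zero>\<^bsub>Ext q\<^esub> = \<zero>\<^bsub>Ext (p + q)\<^esub>"
proof -
  obtain f where f: "f \<in> cocyc p" "X = coh_class p f"
    using assms by (metis Ext_cases)
  \<comment> \<open>The zero cocycle has the zero chain map as a lift.\<close>
  define G where "G n = (\<lambda>x\<in>carrier (P (q + n)). \<zero>\<^bsub>P n\<^esub>)" for n
  have G: "is_lift q \<zero>\<^bsub>cochains q\<^esub> G"
    using PP.hom_zero PL.hom_of_zero[OF aug_hom] PP.hom_of_zero[OF d_hom]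
    by (auto simp: is_lift_def G_def d_closed)
  have "comp_lift p q f G = \<zero>\<^bsub>cochains (p + q)\<^esub>"
    unfolding comp_lift_def cochains_simps(2) 
    using PL.hom_of_zero[OF cocycD(1)[OF f(1)]] by (intro restrict_ext) (simp add: G_def add.commute)
  then show ?thesis
    unfolding f(2) Ext_zero yoneda_class[OF f(1) cocyc_zero G] by simp
qed

abbreviation "EA \<equiv> Ext_algebra"

lemma EA_simps:
  "carrier EA = {F. (\<forall>n. F n \<in> carrier (Ext n)) \<and> finite {n. F n \<noteq> \<zero>\<^bsub>Ext n\<^esub>}}"
  "\<zero>\<^bsub>EA\<^esub> = (\<lambda>n. \<zero>\<^bsub>Ext n\<^esub>)"
  "\<one>\<^bsub>EA\<^esub> = homog 0 (coh_class 0 \<epsilon>)"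
  "F \<oplus>\<^bsub>EA\<^esub> G = (\<lambda>n. F n \<oplus>\<^bsub>Ext n\<^esub> G n)"
  "c \<odot>\<^bsub>EA\<^esub> F = (\<lambda>n. c \<odot>\<^bsub>Ext n\<^esub> F n)"
  "F \<otimes>\<^bsub>EA\<^esub> G = (\<lambda>n. \<Oplus>\<^bsub>Ext n\<^esub>p\<in>{..n}. yoneda p (n - p) (F p) (G (n - p)))"
  by (simp_all add: Ext_algebra_def)

lemma Ext_smult_closed: "X \<in> carrier (Ext n) \<Longrightarrow> c \<odot>\<^bsub>Ext n\<^esub> X \<in> carrier (Ext n)"
  by (erule Ext_cases) (simp add: Ext_smult Ext_carrier cocyc_smult)

lemma smult_zero_cochain: "c \<odot>\<^bsub>cochains n\<^esub> \<zero>\<^bsub>cochains n\<^esub> = \<zero>\<^bsub>cochains n\<^esub>"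
  by (auto simp: cochains_simps R.smult_zero[simplified] intro!: restrict_ext)

lemma Ext_smult_zero: "c \<odot>\<^bsub>Ext n\<^esub> \<zero>\<^bsub>Ext n\<^esub> = \<zero>\<^bsub>Ext n\<^esub>"
  unfolding Ext_zero Ext_smult[OF cocyc_zero] smult_zero_cochain ..

lemma homog_closed: "X \<in> carrier (Ext n) \<Longrightarrow> homog n X \<in> carrier EA"
  unfolding EA_simps homog_def
  by (auto intro!: finite_subset[of _ "{n}"] E.zero_closed)

lemma EA_add_closed: 
  assumes "F \<in> carrier EA" "G \<in> carrier EA" shows "F \<oplus>\<^bsub>EA\<^esub> G \<in> carrier EA"
proof -
  have "{n. F n \<oplus>\<^bsub>Ext n\<^esub> G n \<noteq> \<zero>\<^bsub>Ext n\<^esub>} \<subseteq> {n. F n \<noteq> \<zero>\<^bsub>Ext n\<^esub>} \<union> {n. G n \<noteq> \<zero>\<^bsub>Ext n\<^esub>}"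
    by auto
  then show ?thesis
    using assms by (auto simp: EA_simps intro: finite_subset)
qed

lemma EA_smult_closed: 
  assumes "F \<in> carrier EA" shows "c \<odot>\<^bsub>EA\<^esub> F \<in> carrier EA"
proof -
  have "{n. c \<odot>\<^bsub>Ext n\<^esub> F n \<noteq> \<zero>\<^bsub>Ext n\<^esub>} \<subseteq> {n. F n \<noteq> \<zero>\<^bsub>Ext n\<^esub>}"
    by (rule Collect_mono) (metis Ext_smult_zero)
  then show ?thesis
    using assms by (auto simp: EA_simps Ext_smult_closed intro: finite_subset)
qed

text \<open>If \<open>F\<close> vanishes above degree a and \<open>G\<close> above degree b, each
  summand in a degree above a + b has a zero factor, so the product is again finitely
  supported.\<close>

lemma EA_mult_closed:
  assumes F: "F \<in> carrier EA" and G: "G \<in> carrier EA"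
  shows "F \<otimes>\<^bsub>EA\<^esub> G \<in> carrier EA"
proof -
  have c: "F n \<in> carrier (Ext n)" "G n \<in> carrier (Ext n)" for n
    using F G by (auto simp: EA_simps)
  have y: "yoneda p (n - p) (F p) (G (n - p)) \<in> carrier (Ext n)" if "p \<le> n" for p n
    using yoneda_closed[OF c(1)[of p] c(2)[of "n - p"]] that by simp
  obtain a b where ab: "\<And>n. n > a \<Longrightarrow> F n = \<zero>\<^bsub>Ext n\<^esub>" "\<And>n. n > b \<Longrightarrow> G n = \<zero>\<^bsub>Ext n\<^esub>"
  proof -
    have "finite {n. F n \<noteq> \<zero>\<^bsub>Ext n\<^esub>}" "finite {n. G n \<noteq> \<zero>\<^bsub>Ext n\<^esub>}"
      using F G by (auto simp: EA_simps)
    then obtain a b where a: "\<forall>n\<in>{n. F n \<noteq> \<zero>\<^bsub>Ext n\<^esub>}. n \<le> a" and b: "\<forall>n\<in>{n. G n \<noteq> \<zero>\<^bsub>Ext n\<^esub>}. n \<le> b"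
      unfolding finite_nat_set_iff_bounded_le by blast
    show ?thesis
    proof (rule that[of a b])
      show "F n = \<zero>\<^bsub>Ext n\<^esub>" if "n > a" for n
        by (rule ccontr) (use a that in auto)
      show "G n = \<zero>\<^bsub>Ext n\<^esub>" if "n > b" for n
        by (rule ccontr) (use b that in auto)
    qed
  qed
  have z: "(\<Oplus>\<^bsub>Ext n\<^esub>p\<in>{..n}. yoneda p (n - p) (F p) (G (n - p))) = \<zero>\<^bsub>Ext n\<^esub>" if "n > a + b" for n
  proof -
    have "yoneda p (n - p) (F p) (G (n - p)) = \<zero>\<^bsub>Ext n\<^esub>" if "p \<le> n" for p
    proof (cases "p > a")
      case True
      then show ?thesis
        using yoneda_zero_left[OF c(2)[of "n - p"], of p] that by (simp add: ab)
    next
      case False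
      then have "n - p > b"
        using \<open>n > a + b\<close> by linarith
      then show ?thesis
        using yoneda_zero_right[OF c(1)[of p], of "n - p"] that by (simp add: ab)
    qed
    then show ?thesis
      by (intro E.add.finprod_one_eqI) auto
  qed
  have "{n. (\<Oplus>\<^bsub>Ext n\<^esub>p\<in>{..n}. yoneda p (n - p) (F p) (G (n - p))) \<noteq> \<zero>\<^bsub>Ext n\<^esub>} \<subseteq> {..a + b}"
    by (rule subsetI, rule ccontr) (auto simp: z not_le)
  then have "finite {n. (\<Oplus>\<^bsub>Ext n\<^esub>p\<in>{..n}. yoneda p (n - p) (F p) (G (n - p))) \<noteq> \<zero>\<^bsub>Ext n\<^esub>}"
    by (rule finite_subset) simp
  moreover have "(\<Oplus>\<^bsub>Ext n\<^esub>p\<in>{..n}. yoneda p (n - p) (F p) (G (n - p))) \<in> carrier (Ext n)" for n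
    by (rule E.finsum_closed) (auto intro: y)
  ultimately show ?thesis
    unfolding EA_simps by simp
qed

definition hclass :: "nat \<Rightarrow> ('p \<Rightarrow> 'a) \<Rightarrow> nat \<Rightarrow> ('p \<Rightarrow> 'a) set" where
  "hclass n f = homog n (coh_class n f)"

lemma hclass_closed: "f \<in> cocyc n \<Longrightarrow> hclass n f \<in> carrier EA"
  unfolding hclass_def by (rule homog_closed) (simp add: Ext_carrier)

lemma hclass_add: 
  assumes "f \<in> cocyc n" "g \<in> cocyc n"
  shows "hclass n f \<oplus>\<^bsub>EA\<^esub> hclass n g = hclass n (f \<oplus>\<^bsub>cochains n\<^esub> g)"
  by (auto simp: EA_simps hclass_def homog_def fun_eq_iff Ext_add assms)

lemma hclass_smult: 
  assumes "f \<in> cocyc n"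
  shows "c \<odot>\<^bsub>EA\<^esub> hclass n f = hclass n (c \<odot>\<^bsub>cochains n\<^esub> f)"
  by (auto simp: EA_simps hclass_def homog_def fun_eq_iff Ext_smult Ext_smult_zero assms)

lemma hclass_zero: "hclass n \<zero>\<^bsub>cochains n\<^esub> = \<zero>\<^bsub>EA\<^esub>"
  unfolding EA_simps(2) hclass_def homog_def Ext_zero[symmetric] by (rule ext) auto

lemma hclass_cong:
  assumes "f \<in> cocyc n" "g \<in> cocyc n" "(\<lambda>x\<in>carrier (P n). f x \<ominus>\<^bsub>L\<^esub> g x) \<in> coboundaries n"
  shows "hclass n f = hclass n g"
  using coh_class_eq_iff[OF assms(1,2)] assms(3) by (simp add: hclass_def)

lemma hclass_mult:
  assumes f: "f \<in> cocyc p" and g: "g \<in> cocyc q" and G: "is_lift q g G"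
  shows "hclass p f \<otimes>\<^bsub>EA\<^esub> hclass q g = hclass (p + q) (comp_lift p q f G)"
proof
  fix n
  let ?X = "coh_class p f" and ?Y = "coh_class q g"
  have XY: "?X \<in> carrier (Ext p)" "?Y \<in> carrier (Ext q)"
    using f g by (auto simp: Ext_carrier)
  have h: "hclass p f k \<in> carrier (Ext k)" "hclass q g k \<in> carrier (Ext k)" for k
    using hclass_closed[OF f] hclass_closed[OF g] by (auto simp: EA_simps)
  have y: "yoneda k (n - k) (hclass p f k) (hclass q g (n - k)) =
     (if p = k then if n = p + q then coh_class n (comp_lift p q f G) else \<zero>\<^bsub>Ext n\<^esub> else \<zero>\<^bsub>Ext n\<^esub>)" if "k \<le> n" for k
  proof (cases "p = k")
    case True
    show ?thesis
    proof (cases "n = p + q")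
      case True
      then show ?thesis
        using \<open>p = k\<close> yoneda_class[OF f g G] by (simp add: hclass_def homog_def)
    next
      case False
      then have "hclass q g (n - k) = \<zero>\<^bsub>Ext (n - k)\<^esub>"
        using \<open>p = k\<close> that by (auto simp: hclass_def homog_def)
      then show ?thesis
        using yoneda_zero_right[OF h(1)[of k], of "n - k"] that \<open>p = k\<close> False by simp
    qed
  next
    case False
    then show ?thesis
      using yoneda_zero_left[OF h(2)[of "n - k"], of k] that by (simp add: hclass_def homog_def)
  qed
  have "(hclass p f \<otimes>\<^bsub>EA\<^esub> hclass q g) n = (\<Oplus>\<^bsub>Ext n\<^esub>k\<in>{..n}. 
    (if p = k then if n = p + q then coh_class n (comp_lift p q f G) else \<zero>\<^bsub>Ext n\<^esub> else \<zero>\<^bsub>Ext n\<^esub>))"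
    unfolding EA_simps 
    using comp_lift_cocyc[OF f G]
    by (intro E.finsum_cong') (auto simp: y Ext_carrier E.zero_closed[unfolded Ext_carrier])
  also have "\<dots> = (if n = p + q then coh_class n (comp_lift p q f G) else \<zero>\<^bsub>Ext n\<^esub>)"
  proof (cases "p \<le> n")
    case True
    then show ?thesis
      using comp_lift_cocyc[OF f G] 
        E.finsum_singleton[of p "{..n}" "\<lambda>_. if n = p + q then coh_class n (comp_lift p q f G) else \<zero>\<^bsub>Ext n\<^esub>" n]
      by (auto simp: Ext_carrier E.zero_closed[unfolded Ext_carrier])
  next
    case False
    then show ?thesis
      by (intro trans[OF E.add.finprod_one_eqI]) auto
  qed
  also have "\<dots> = hclass (p + q) (comp_lift p q f G) n"
    by (simp add: hclass_def homog_def)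
  finally show "(hclass p f \<otimes>\<^bsub>EA\<^esub> hclass q g) n = hclass (p + q) (comp_lift p q f G) n" .
qed

text \<open>Finite support makes every element a finite sum of homogeneous classes, so generation
  can be tested on single cocycles; the sum is built up by induction on the set of degrees that are
  kept.\<close>

lemma subalgebra_gen_EA:
  assumes S: "S \<subseteq> carrier EA" and gen: "\<And>n f. f \<in> cocyc n \<Longrightarrow> hclass n f \<in> subalgebra_gen EA S"
  shows "subalgebra_gen EA S = carrier EA"
proof
  have aug: "\<epsilon> \<in> cocyc 0"
    using aug_hom aug_d by (simp add: cocyc_iff)
  show "subalgebra_gen EA S \<subseteq> carrier EA"
  proof
    fix F assume "F \<in> subalgebra_gen EA S"
    then show "F \<in> carrier EA"
    proof induction
      case one
      then show ?case
        using hclass_closed[OF aug] by (simp add: EA_simps(3) hclass_def)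
    qed (use S EA_add_closed EA_smult_closed EA_mult_closed in auto)
  qed
  show "carrier EA \<subseteq> subalgebra_gen EA S"
  proof
    fix F assume F: "F \<in> carrier EA"
    have cut: "(\<lambda>k. if k \<in> N then F k else \<zero>\<^bsub>Ext k\<^esub>) \<in> subalgebra_gen EA S" if "finite N" for N
      using that
    proof (induction N rule: finite_induct)
      case empty
      have "hclass 0 \<zero>\<^bsub>cochains 0\<^esub> \<in> subalgebra_gen EA S"
        by (rule gen[OF cocyc_zero])
      then show ?case
        by (simp add: hclass_zero EA_simps(2))
    next
      case (insert n N)
      have Fk: "F k \<in> carrier (Ext k)" for k
        using F by (auto simp: EA_simps)
      obtain f where f: "f \<in> cocyc n" "F n = coh_class n f"
        using Fk[of n] by (rule Ext_cases)
      have "(\<lambda>k. if k \<in> insert n N then F k else \<zero>\<^bsub>Ext k\<^esub>) = 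
         hclass n f \<oplus>\<^bsub>EA\<^esub> (\<lambda>k. if k \<in> N then F k else \<zero>\<^bsub>Ext k\<^esub>)"
        unfolding EA_simps(4) hclass_def homog_def f(2)[symmetric]
      proof (rule ext)
        fix k
        show "(if k \<in> insert n N then F k else \<zero>\<^bsub>Ext k\<^esub>) = (if k = n then F n else \<zero>\<^bsub>Ext k\<^esub>)
            \<oplus>\<^bsub>Ext k\<^esub> (if k \<in> N then F k else \<zero>\<^bsub>Ext k\<^esub>)"
          using insert(2) E.r_zero[OF Fk[of n]] E.l_zero[OF Fk[of k]] by (cases "k = n") auto
      qed
      then show ?case
        using insert.IH gen[OF f(1)] by (simp add: subalgebra_gen.add)
    qed
    have "finite {n. F n \<noteq> \<zero>\<^bsub>Ext n\<^esub>}"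
      using F by (auto simp: EA_simps)
    moreover have "(\<lambda>k. if k \<in> {n. F n \<noteq> \<zero>\<^bsub>Ext n\<^esub>} then F k else \<zero>\<^bsub>Ext k\<^esub>) = F"
    proof (rule ext)
      fix k
      show "(if k \<in> {n. F n \<noteq> \<zero>\<^bsub>Ext n\<^esub>} then F k else \<zero>\<^bsub>Ext k\<^esub>) = F k"
      proof (cases "F k = \<zero>\<^bsub>Ext k\<^esub>")
        case True
        then have "k \<notin> {n. F n \<noteq> \<zero>\<^bsub>Ext n\<^esub>}"
          by blast
        then show ?thesis
          by (rule trans[OF if_not_P True[symmetric]])
      next
        case False
        then have "k \<in> {n. F n \<noteq> \<zero>\<^bsub>Ext n\<^esub>}"
          by blast
        then show ?thesis
          by (rule if_P)
      qed
    qed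
    ultimately show "F \<in> subalgebra_gen EA S"
      using cut[OF \<open>finite _\<close>] by (simp only:)
  qed
qed

end

lemma sg_2 [simp]: "sg 2 = 1"
  by (simp add: sg_def)

subsection \<open>The differential and a contracting homotopy\<close>

text \<open>Multiplication by the composable arrow \<open>a\<close>: it sends e to a and the
  opposite arrow to the socle. From the left and from the right the formula is the same, so it
  serves both tensor factors.\<close>

definition mulF :: "(bt \<Rightarrow> 'k::field) \<Rightarrow> bt \<Rightarrow> 'k" where
  "mulF y t = (case t of Fw \<Rightarrow> y Vx | So \<Rightarrow> y Bw | _ \<Rightarrow> 0)"

definition mulB :: "(bt \<Rightarrow> 'k::field) \<Rightarrow> bt \<Rightarrow> 'k" where
  "mulB y t = (case t of Bw \<Rightarrow> y Vx | So \<Rightarrow> y Fw | _ \<Rightarrow> 0)"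

text \<open>Transpose of the formula on generators: the (i, r)-component collects what comes from
  the generators (i, r), (i, r+1), (i-1, r) and (i+1, r+1). The sign of the last contribution is
  (-1)^(n+r+1), whence the minus.\<close>

definition pdiff :: "nat \<Rightarrow> 'k::field pm \<Rightarrow> 'k pm" where
  "pdiff n x i r s t = (if 0 \<le> r \<and> r < int n then
      mulF (x i r s) t + sg (int n) * mulB (x i (r + 1) s) t
      + sg (int n + r) * (mulF (\<lambda>s. x (i - 1) r s t) s - mulB (\<lambda>s. x (i + 1) (r + 1) s t) s) else 0)"

definition paug :: "'k::field pm \<Rightarrow> 'k lm" where
  "paug x i t = (case t of
      Vx \<Rightarrow> x i 0 Vx Vx
    | Fw \<Rightarrow> x i 0 Vx Fw + x (i + 1) 0 Fw Vx
    | Bw \<Rightarrow> x i 0 Vx Bw + x (i - 1) 0 Bw Vx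
    | So \<Rightarrow> x i 0 Vx So + x i 0 So Vx + x (i + 1) 0 Fw Bw + x (i - 1) 0 Bw Fw)"

text \<open>The right linear section of the augmentation that sends \<open>f\<close> to 1 \<otimes>
  f, that is, to the sum of the elements e_i \<otimes> e_i f.\<close>

definition psec :: "'k::field lm \<Rightarrow> 'k pm" where
  "psec f i r s t = (if r = 0 \<and> s = Vx then f i t else 0)"

text \<open>
  The augmented complex is contractible as a complex of right modules: \<open>phtp\<close> strips an arrow
  off the left tensor factor.
\<close>

definition phtp :: "nat \<Rightarrow> 'k::field pm \<Rightarrow> 'k pm" where
  "phtp n x i r s t = (if 0 \<le> r \<and> r \<le> int n + 1 then case s of
      Vx \<Rightarrow> if r = int n + 1 then x (i - 1) (int n) Bw t + mulF (x i (int n) So) t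
             else sg (int n + 1 + r) * x (i + 1) r Fw t
    | Bw \<Rightarrow> if r = int n + 1 then 0 else sg (int n + 1 + r) * x (i + 1) r So t
    | _ \<Rightarrow> 0 else 0)"

lemmas diff_defs = mulF_def mulB_def pdiff_def paug_def psec_def phtp_def

lemma pdiff_pdiff: "pdiff n (pdiff (Suc n) x) = 0"
  by (rule fun4_eqI, case_tac s; case_tac t) (simp_all add: diff_defs sg_add algebra_simps)

lemma paug_pdiff: "paug (pdiff 1 x) = 0"
  by (rule fun2_eqI, case_tac t) (simp_all add: diff_defs sg_add algebra_simps)

lemma mul_simps [simp]:
  "mulF y Vx = 0" "mulF y Fw = y Vx" "mulF y Bw = 0" "mulF y So = y Bw"
  "mulB y Vx = 0" "mulB y Bw = y Vx" "mulB y Fw = 0" "mulB y So = y Fw"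
  by (simp_all add: mulF_def mulB_def)

lemma mul_linear:
  "mulF (\<lambda>t. y t + z t) u = mulF y u + mulF z u" "mulF (\<lambda>t. c * y t) u = c * mulF y u"
  "mulF (\<lambda>t. y t - z t) u = mulF y u - mulF z u" "mulF (\<lambda>t. - y t) u = - mulF y u"
  "mulB (\<lambda>t. y t + z t) u = mulB y u + mulB z u" "mulB (\<lambda>t. c * y t) u = c * mulB y u"
  "mulB (\<lambda>t. y t - z t) u = mulB y u - mulB z u" "mulB (\<lambda>t. - y t) u = - mulB y u"
  "mulF (\<lambda>t. 0) u = 0" "mulB (\<lambda>t. 0) u = 0" "mulF (mulF y) u = 0" "mulB (mulB y) u = 0"
  "mulB (mulF y) u = mulF (mulB y) u"
  by (cases u; simp)+

lemma phtp_row: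
  "0 \<le> r \<Longrightarrow> r \<le> int n \<Longrightarrow> phtp n x i r Vx = (\<lambda>t. sg (int n + 1 + r) * x (i + 1) r Fw t)"
  "0 \<le> r \<Longrightarrow> r \<le> int n \<Longrightarrow> phtp n x i r Bw = (\<lambda>t. sg (int n + 1 + r) * x (i + 1) r So t)"
  "phtp n x i (int n + 1) Vx = (\<lambda>t. x (i - 1) (int n) Bw t + mulF (x i (int n) So) t)"
  "phtp n x i (int n + 1) Bw = (\<lambda>t. 0)"
  "phtp n x i r Fw = (\<lambda>t. 0)" "phtp n x i r So = (\<lambda>t. 0)"
  by (auto simp: phtp_def fun_eq_iff)

lemma pdiff_row:
  "0 \<le> r \<Longrightarrow> r < int n \<Longrightarrow> pdiff n x i r s = (\<lambda>t.
      mulF (x i r s) t + sg (int n) * mulB (x i (r + 1) s) t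
      + sg (int n + r) * (mulF (\<lambda>s. x (i - 1) r s t) s - mulB (\<lambda>s. x (i + 1) (r + 1) s t) s))"
  by (simp add: pdiff_def fun_eq_iff)

text \<open>A left factor that ends in \<open>a\<close>, including the socle, is stripped in every
  row; a single backward arrow is stripped only into the last row n + 1. In lower rows backward
  arrows are recovered from \<open>phtp (pdiff x)\<close>. Hence the top row r = n is a case of its
  own.\<close>

lemma pdiff_phtp:
  assumes "x \<in> PM m n" "n > 0"
  shows "pdiff (Suc n) (phtp n x) + phtp (n - 1) (pdiff n x) = x"
proof (rule fun4_eqI)
  fix i r s t
  have n: "int (n - 1) = int n - 1" 
    using assms(2) by simp
  consider "r < 0 \<or> int n < r" | "r = int n" | "0 \<le> r" "r < int n"
    by linarith
  then show "(pdiff (Suc n) (phtp n x) + phtp (n - 1) (pdiff n x)) i r s t = x i r s t"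
  proof cases
    case 1
    then have r: "\<not> (0 \<le> r \<and> r < int (Suc n))" "\<not> (0 \<le> r \<and> r \<le> int (n - 1) + 1)"
      using n by linarith+
    have "pdiff (Suc n) (phtp n x) i r s t = 0"
      unfolding pdiff_def by (rule if_not_P[OF r(1)])
    moreover have "phtp (n - 1) (pdiff n x) i r s t = 0"
      unfolding phtp_def by (rule if_not_P[OF r(2)])
    ultimately show ?thesis
      using PM_D(2)[OF assms(1) 1] by simp
  next
    case 2
    have r: "0 \<le> r" "r < int (Suc n)" "r \<le> int n"
      using 2 by auto
    have h: "phtp (n - 1) (pdiff n x) i r Vx t = pdiff n x (i - 1) (r - 1) Bw t + mulF (pdiff n x i (r - 1) So) t"
       "phtp (n - 1) (pdiff n x) i r Bw t = 0" "phtp (n - 1) (pdiff n x) i r Fw t = 0" 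
       "phtp (n - 1) (pdiff n x) i r So t = 0"
      using phtp_row(3-6)[of "n - 1" "pdiff n x" i] n 2 by auto
    have q: "0 \<le> r - 1" "r - 1 < int n"
      using 2 assms(2) by auto
    have sgs: "sg (int (Suc n)) = - sg r" "sg (int n) = sg r" "sg (int n + 1 + r) = - 1" "sg (int (Suc n) + r) = - 1"
       "sg (int n + (r - 1)) = - 1"
      using 2 by (simp_all add: sg_def)
    have p: "phtp n x j (r + 1) Vx = (\<lambda>t. x (j - 1) r Bw t + mulF (x j r So) t)" 
       "phtp n x j (r + 1) Bw = (\<lambda>t. 0)" for j
      using phtp_row(3,4)[of n x j] 2 by auto
    show ?thesis
      unfolding pdiff_row[OF r(1,2)] plus_fun_apply
      by (cases s) (simp_all only: phtp_row(1,2)[OF r(1,3)] p phtp_row(5,6) h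
            pdiff_row[OF q] mul_linear mul_simps sgs diff_add_cancel, simp_all add: algebra_simps)
  next
    case 3
    have r: "r < int (Suc n)" "r \<le> int n" "r + 1 \<le> int n" "0 \<le> r + 1" "r \<le> int (n - 1)"
      using 3 n by auto
    show ?thesis
      unfolding pdiff_row[OF 3(1) r(1)] plus_fun_apply
      by (cases s) (simp_all only: phtp_row(1,2)[OF 3(1) r(2)] phtp_row(1,2)[OF r(4) r(3)] phtp_row(5,6)
            phtp_row(1,2)[OF 3(1) r(5)] pdiff_row[OF 3] mul_linear mul_simps diff_add_cancel add_diff_cancel n,
            simp_all add: sg_add n algebra_simps)
  qed
qed

lemma pdiff_phtp_0:
  assumes "x \<in> PM m 0"
  shows "pdiff 1 (phtp 0 x) + psec (paug x) = x"
proof (rule fun4_eqI)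
  fix i r s t
  show "(pdiff 1 (phtp 0 x) + psec (paug x)) i r s t = x i r s t"
  proof (cases "r = 0")
    case True
    then show ?thesis 
      by (cases s; cases t) (auto simp add: diff_defs sg_add algebra_simps)
  next
    case False
    then have "r < 0 \<or> 0 < r"
      by linarith
    then have "x i r s t = 0"
      using PM_D(2)[OF assms(1), of r i s t] False by auto
    then show ?thesis
      using False by (cases s; cases t) (auto simp add: diff_defs)
  qed
qed

lemma paug_psec: "paug (psec f) = f"
  by (rule fun2_eqI, case_tac t) (simp_all add: diff_defs)

lemma PM_shift: 
  assumes "x \<in> PM m n" 
  shows "x (i + int m) = x i" "x (i + int m + 1) = x (i + 1)" "x (i + int m - 1) = x (i - 1)"
    "x (int m + i) = x i" "x (1 + (i + int m)) = x (1 + i)" "x (i + (int m - 1)) = x (i - 1)"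
  using PM_D(1)[OF assms, of i] PM_D(1)[OF assms, of "i + 1"] PM_D(1)[OF assms, of "i - 1"]
  by (simp_all add: algebra_simps)

lemma phtp_PM: "x \<in> PM m n \<Longrightarrow> phtp n x \<in> PM m (Suc n)"
  by (rule PM_I; case_tac s) (auto simp: phtp_def mulF_def PM_shift split: bt.splits)

lemma psec_PM: "f \<in> LM m \<Longrightarrow> psec f \<in> PM m 0"
  by (rule PM_I) (auto simp: psec_def LM_D)

lemma paug_LM: "x \<in> PM m 0 \<Longrightarrow> paug x \<in> LM m"
  by (rule LM_I, rule ext) (auto simp: paug_def PM_shift split: bt.split)

lemma pdiff_PM: "x \<in> PM m (Suc n) \<Longrightarrow> pdiff (Suc n) x \<in> PM m n"
  by (rule PM_I) (auto simp: pdiff_def mulF_def mulB_def PM_shift split: bt.splits)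

lemma pdiff_add: "pdiff n (x + y) = pdiff n x + pdiff n y"
  by (rule fun4_eqI, case_tac s; case_tac t) (simp_all add: diff_defs algebra_simps)

lemma pdiff_psc: "pdiff n (psc c x) = psc c (pdiff n x)"
  by (rule fun4_eqI, case_tac s; case_tac t) (simp_all add: diff_defs psc_def algebra_simps)

text \<open>Associativity with the arrow on the other side; the vertex moves by one because the
  arrow changes the end point at which coefficients are sorted.\<close>

lemma mul_cmul_rmul:
  "mulF (cmul l y (i - 1)) = cmul l (mulF y) i" "mulB (cmul l y (i + 1)) = cmul l (mulB y) i"
  "mulF (rmul y l (i + 1)) = rmul (mulF y) l i" "mulB (rmul y l (i - 1)) = rmul (mulB y) l i"
  by (rule ext, case_tac x, simp_all add: mulF_def mulB_def cmul_def rmul_def)+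

lemma mul_cmul_pointwise:
  "mulF (\<lambda>t. cmul l (\<lambda>s. z s t) i s) u = cmul l (\<lambda>s. mulF (z s) u) i s"
  "mulB (\<lambda>t. cmul l (\<lambda>s. z s t) i s) u = cmul l (\<lambda>s. mulB (z s) u) i s"
  by (cases u; cases s; simp add: mulF_def mulB_def cmul_def)+

lemma mul_rmul_pointwise:
  "mulF (\<lambda>s. rmul (z s) l i t) u = rmul (\<lambda>t. mulF (\<lambda>s. z s t) u) l i t"
  "mulB (\<lambda>s. rmul (z s) l i t) u = rmul (\<lambda>t. mulB (\<lambda>s. z s t) u) l i t"
  by (cases u; cases t; simp add: mulF_def mulB_def rmul_def)+

lemma cmul_lincomb:
  "cmul l (\<lambda>s. A s + c * B s + d * (C s - D s)) i s
     = cmul l A i s + c * cmul l B i s + d * (cmul l C i s - cmul l D i s)"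
  by (cases s) (simp_all add: cmul_def algebra_simps)

lemma rmul_lincomb:
  "rmul (\<lambda>s. A s + c * B s + d * (C s - D s)) l i s
     = rmul A l i s + c * rmul B l i s + d * (rmul C l i s - rmul D l i s)"
  by (cases s) (simp_all add: rmul_def algebra_simps)

lemma cmul_rmul_zero: "cmul l (\<lambda>s. 0) i s = 0" "rmul (\<lambda>s. 0) l i s = 0"
  by (cases s, simp_all add: cmul_def rmul_def)+

lemma pdiff_plact: "pdiff n (plact a x) = plact a (pdiff n x)"
proof (rule fun4_eqI)
  fix i r s t
  have p: "plact a x i r s = (\<lambda>t. cmul a (\<lambda>s. x i r s t) i s)" for i r s
    by (simp add: fun_eq_iff plact_def)
  show "pdiff n (plact a x) i r s t = plact a (pdiff n x) i r s t"
  proof (cases "0 \<le> r \<and> r < int n")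
    case True
    then show ?thesis
      by (simp add: pdiff_def plact_def[of a "pdiff n x"] p mul_cmul_rmul mul_cmul_pointwise cmul_lincomb)
  next
    case False
    have z: "pdiff n x i r s t = 0" for x s
      using False by (auto simp: pdiff_def)
    show ?thesis
      by (simp add: z plact_def cmul_rmul_zero)
  qed
qed

lemma pdiff_pract: "pdiff (Suc n) (pract (Suc n) x a) = pract n (pdiff (Suc n) x) a"
proof (rule fun4_eqI)
  fix i r s t
  define j where "j = i + int n - 2 * r"
  have j: "i + int (Suc n) - 2 * r = j + 1" "i + int (Suc n) - 2 * (r + 1) = j - 1"
    "i - 1 + int (Suc n) - 2 * r = j" "i + 1 + int (Suc n) - 2 * (r + 1) = j" "i + int n - 2 * r = j"
    by (auto simp: j_def)
  show "pdiff (Suc n) (pract (Suc n) x a) i r s t = pract n (pdiff (Suc n) x) a i r s t"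
  proof (cases "0 \<le> r \<and> r < int (Suc n)")
    case True
    have d: "pdiff (Suc n) x i r s = (\<lambda>t. mulF (x i r s) t + sg (int (Suc n)) * mulB (x i (r + 1) s) t
      + sg (int (Suc n) + r) * (mulF (\<lambda>s. x (i - 1) r s t) s - mulB (\<lambda>s. x (i + 1) (r + 1) s t) s))"
      using True by (simp add: fun_eq_iff pdiff_def)
    have "pract n (pdiff (Suc n) x) a i r s t = rmul (mulF (x i r s)) a j t + sg (int (Suc n)) * rmul (mulB (x i (r + 1) s)) a j t
      + sg (int (Suc n) + r) * (mulF (\<lambda>s. rmul (x (i - 1) r s) a j t) s - mulB (\<lambda>s. rmul (x (i + 1) (r + 1) s) a j t) s)"
      unfolding pract_def j d rmul_lincomb mul_rmul_pointwise ..
    moreover have "pdiff (Suc n) (pract (Suc n) x a) i r s t = \<dots>"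
      using True unfolding pdiff_def pract_def j mul_cmul_rmul by simp
    ultimately show ?thesis
      by simp
  next
    case False
    have z: "pdiff (Suc n) x i r s = (\<lambda>_. 0)" for x
      using False by (auto simp: pdiff_def)
    show ?thesis
      by (simp add: z pract_def cmul_rmul_zero)
  qed
qed

lemma paug_add: "paug (x + y) = paug x + paug y"
  by (rule fun2_eqI, case_tac t) (simp_all add: diff_defs algebra_simps)

lemma paug_psc: "paug (psc c x) = lsc c (paug x)"
  by (rule fun2_eqI, case_tac t) (simp_all add: diff_defs psc_def lsc_def algebra_simps)

lemma paug_plact: "paug (plact a x) = lmul a (paug x)"
  by (rule fun2_eqI, case_tac t) (simp_all add: diff_defs plact_def mul_defs algebra_simps)

lemma paug_pract: "paug (pract 0 x a) = lmul (paug x) a"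
  by (rule fun2_eqI, case_tac t) (simp_all add: diff_defs pract_def mul_defs algebra_simps)

section \<open>Free spaces\<close>

lemma lookup_map_mult: "Poly_Mapping.lookup (Poly_Mapping.map (\<lambda>y. c * y) p) k = (c::'k::field) * Poly_Mapping.lookup p k"
  by transfer (auto simp: when_def)

lemma map_mult_single: "Poly_Mapping.map (\<lambda>y. (c::'k::field) * y) (Poly_Mapping.single p d) = Poly_Mapping.single p (c * d)"
  by (rule poly_mapping_eqI) (simp add: lookup_map_mult lookup_single when_def)

lemma map_mult_add: "Poly_Mapping.map (\<lambda>y. (c::'k::field) * y) (p + q) = 
    Poly_Mapping.map (\<lambda>y. c * y) p + Poly_Mapping.map (\<lambda>y. c * y) q"
  by (rule poly_mapping_eqI) (simp add: lookup_map_mult lookup_add distrib_left)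

lemma map_mult_zero [simp]: "Poly_Mapping.map (\<lambda>y. (c::'k::field) * y) 0 = 0"
  by (rule poly_mapping_eqI) (simp add: lookup_map_mult)

lemma keys_map_mult: "Poly_Mapping.keys (Poly_Mapping.map (\<lambda>y. (c::'k::field) * y) p) \<subseteq> Poly_Mapping.keys p"
  by (auto simp: in_keys_iff lookup_map_mult)

lemma sum_single_lookup: "(\<Sum>p\<in>Poly_Mapping.keys x. Poly_Mapping.single p (Poly_Mapping.lookup x p)) = x"
  by (rule poly_mapping_eqI) (auto simp: lookup_sum lookup_single when_def in_keys_iff)

lemma keys_sum_subset: "(\<And>a. a \<in> A \<Longrightarrow> Poly_Mapping.keys (f a) \<subseteq> S) \<Longrightarrow> Poly_Mapping.keys (sum f A) \<subseteq> S"
  by (induction A rule: infinite_finite_induct) (auto dest!: subsetD[OF keys_add])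

lemma keys_minus_subset: "Poly_Mapping.keys x \<subseteq> S \<Longrightarrow> Poly_Mapping.keys (- x :: 'a \<Rightarrow>\<^sub>0 'k::field) \<subseteq> S"
  by (auto simp: in_keys_iff)

lemma keys_add_subset: "Poly_Mapping.keys x \<subseteq> S \<Longrightarrow> Poly_Mapping.keys y \<subseteq> S \<Longrightarrow> Poly_Mapping.keys (x + y) \<subseteq> S"
  using keys_add[of x y] by auto

lemma keys_diff_subset: "Poly_Mapping.keys x \<subseteq> S \<Longrightarrow> Poly_Mapping.keys y \<subseteq> S \<Longrightarrow>
    Poly_Mapping.keys (x - y :: 'a \<Rightarrow>\<^sub>0 'k::field) \<subseteq> S"
  by (metis diff_conv_add_uminus keys_add_subset keys_minus_subset)

lemma poly_mapping_span_induct [consumes 1, case_names zero single add]: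
  fixes x :: "'a \<Rightarrow>\<^sub>0 'k::field"
  assumes "Poly_Mapping.keys x \<subseteq> S" "Q 0" "\<And>p c. p \<in> S \<Longrightarrow> Q (Poly_Mapping.single p c)"
    "\<And>x y. Q x \<Longrightarrow> Q y \<Longrightarrow> Q (x + y)"
  shows "Q x"
proof -
  have "A \<subseteq> S \<Longrightarrow> Q (\<Sum>p\<in>A. Poly_Mapping.single p (Poly_Mapping.lookup x p))" for A
    by (induction A rule: infinite_finite_induct) (auto intro: assms)
  from this[OF assms(1)] show ?thesis
    by (simp add: sum_single_lookup)
qed

lemma free_space_simps [simp]:
  "carrier (free_space S) = {x. Poly_Mapping.keys x \<subseteq> S}" "zero (free_space S) = 0"
  "add (free_space S) = (+)" "smult (free_space S) = (\<lambda>c. Poly_Mapping.map (\<lambda>y. c * y))"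
  by (simp_all add: free_space_def)

definition lext :: "('a \<Rightarrow> 'k::field) \<Rightarrow> ('a \<Rightarrow>\<^sub>0 'k) \<Rightarrow> 'k" where
  "lext g x = (\<Sum>p\<in>Poly_Mapping.keys x. Poly_Mapping.lookup x p * g p)"

lemma lext_add: "lext g (x + y) = lext g x + lext g y"
  unfolding lext_def by (rule setsum_keys_plus_distrib) (simp_all add: algebra_simps)

lemma lext_single [simp]: "lext g (Poly_Mapping.single p c) = c * g p"
  by (simp add: lext_def)

lemma lext_zero [simp]: "lext g 0 = 0"
  by (simp add: lext_def)

lemma lext_minus: "lext g (x - y) = lext g x - lext g y"
  using lext_add[of g "x - y" y] by simp

lemma lext_smult: "lext g (Poly_Mapping.map (\<lambda>y. c * y) x) = c * lext g x"
  by (rule poly_mapping_span_induct[of x UNIV])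
    (simp_all add: map_mult_add map_mult_single lext_add distrib_left mult.assoc)

lemma lext_sum: "lext g (sum f A) = (\<Sum>a\<in>A. lext g (f a))"
  by (induction A rule: infinite_finite_induct) (auto simp: lext_add)

lemma free_space_like_group:
  assumes "carrier V = {x. Poly_Mapping.keys x \<subseteq> S}" "zero V = (0 :: 'a \<Rightarrow>\<^sub>0 'k::field)" "add V = (+)"
  shows "abelian_group V"
proof (rule abelian_groupI)
  show "\<exists>y\<in>carrier V. y \<oplus>\<^bsub>V\<^esub> x = \<zero>\<^bsub>V\<^esub>" if "x \<in> carrier V" for x
    using that by (intro bexI[of _ "- x"]) (auto simp: assms in_keys_iff)
qed (auto simp: assms algebra_simps dest!: subsetD[OF keys_add])

section \<open>The path algebra\<close>

definition pmul :: "('v, 'e) pre_digraph \<Rightarrow> ('v \<times> 'e list \<Rightarrow>\<^sub>0 'k::field) \<Rightarrow> ('v \<times> 'e list \<Rightarrow>\<^sub>0 'k) \<Rightarrow> ('v \<times> 'e list \<Rightarrow>\<^sub>0 'k)" where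
  "pmul G x y = (\<Sum>p\<in>Poly_Mapping.keys x. \<Sum>q\<in>Poly_Mapping.keys y.
        if path_end G p = fst q
        then Poly_Mapping.single (fst p, snd p @ snd q)
               (Poly_Mapping.lookup x p * Poly_Mapping.lookup y q)
        else 0)"

lemma path_algebra_simps [simp]:
  "carrier (path_algebra G) = {x. Poly_Mapping.keys x \<subseteq> paths G}" "zero (path_algebra G) = 0"
  "add (path_algebra G) = (+)" "mult (path_algebra G) = pmul G"
  "smult (path_algebra G) = (\<lambda>c. Poly_Mapping.map (\<lambda>y. c * y))"
  "one (path_algebra G) = (\<Sum>v\<in>verts G. Poly_Mapping.single (v, []) 1)"
  by (simp_all add: path_algebra_def pmul_def fun_eq_iff)

lemma pmul_add_left: "pmul G (x + y) z = pmul G x z + pmul G y z"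
  unfolding pmul_def
  by (rule setsum_keys_plus_distrib)
    (auto simp: algebra_simps single_add sum.distrib[symmetric] intro!: sum.neutral sum.cong)

lemma pmul_add_right: "pmul G z (x + y) = pmul G z x + pmul G z y"
  unfolding pmul_def sum.distrib[symmetric]
  by (intro sum.cong refl, rule setsum_keys_plus_distrib)
    (auto simp: algebra_simps single_add)

lemma pmul_zero [simp]: "pmul G 0 z = 0" "pmul G z 0 = 0"
  by (simp_all add: pmul_def)

lemma pmul_single: "pmul G (Poly_Mapping.single p c) (Poly_Mapping.single q d) = 
    (if path_end G p = fst q then Poly_Mapping.single (fst p, snd p @ snd q) (c * d) else 0)"
  by (auto simp: pmul_def)

lemma pmul_minus_left: "pmul G (x - y) z = pmul G x z - pmul G y z"
  using pmul_add_left[of G "x - y" y z] by simp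

lemma pmul_minus_right: "pmul G z (x - y) = pmul G z x - pmul G z y"
  using pmul_add_right[of G z "x - y" y] by simp

lemma pmul_sum_left: "pmul G (sum f A) z = (\<Sum>a\<in>A. pmul G (f a) z)"
  by (induction A rule: infinite_finite_induct) (auto simp: pmul_add_left)

lemma pmul_sum_right: "pmul G z (sum f A) = (\<Sum>a\<in>A. pmul G z (f a))"
  by (induction A rule: infinite_finite_induct) (auto simp: pmul_add_right)

lemma path_end_simp: "path_end G (u, xs) = (if xs = [] then u else head G (last xs))"
  by (simp add: path_end_def pre_digraph.awalk_verts_conv)

lemma path_end_append: "path_end G p = fst q \<Longrightarrow> path_end G (fst p, snd p @ snd q) = path_end G q"
  by (cases p; cases q) (auto simp: path_end_simp split: if_splits)

text \<open>Both sides are additive in each argument, so it suffices to compare them on scalar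
  multiples of single paths.\<close>

lemma pmul_assoc: "pmul G (pmul G x y) z = pmul G x (pmul G y z)"
proof (rule poly_mapping_span_induct[of x UNIV])
  fix p c
  show "pmul G (pmul G (Poly_Mapping.single p c) y) z = pmul G (Poly_Mapping.single p c) (pmul G y z)"
  proof (rule poly_mapping_span_induct[of y UNIV])
    fix q d
    show "pmul G (pmul G (Poly_Mapping.single p c) (Poly_Mapping.single q d)) z
       = pmul G (Poly_Mapping.single p c) (pmul G (Poly_Mapping.single q d) z)"
    proof (rule poly_mapping_span_induct[of z UNIV])
      fix r e
      show "pmul G (pmul G (Poly_Mapping.single p c) (Poly_Mapping.single q d)) (Poly_Mapping.single r e)
       = pmul G (Poly_Mapping.single p c) (pmul G (Poly_Mapping.single q d) (Poly_Mapping.single r e))"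
        by (auto simp: pmul_single path_end_append mult.assoc)
    qed (auto simp: pmul_add_right)
  qed (auto simp: pmul_add_left pmul_add_right)
qed (auto simp: pmul_add_left)

lemma pmul_smult_left: "pmul G (Poly_Mapping.map (\<lambda>y. c * y) x) z = Poly_Mapping.map (\<lambda>y. c * y) (pmul G x z)"
proof (rule poly_mapping_span_induct[of x UNIV])
  fix p d
  show "pmul G (Poly_Mapping.map (\<lambda>y. c * y) (Poly_Mapping.single p d)) z = Poly_Mapping.map (\<lambda>y. c * y) (pmul G (Poly_Mapping.single p d) z)"
    by (rule poly_mapping_span_induct[of z UNIV])
      (simp_all add: pmul_add_right map_mult_add map_mult_single pmul_single mult.assoc)
qed (simp_all add: pmul_add_left map_mult_add)

lemma cas_path_end: "pre_digraph.cas G u xs v \<Longrightarrow> v = path_end G (u, xs)"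
  by (induction xs arbitrary: u) (auto simp: path_end_simp pre_digraph.cas.simps)

lemma in_paths: "(u, xs) \<in> paths G \<longleftrightarrow> u \<in> verts G \<and> set xs \<subseteq> arcs G \<and> pre_digraph.cas G u xs (path_end G (u, xs))"
  using cas_path_end by (fastforce simp: paths_def pre_digraph.awalk_def)

lemma cas_append: "pre_digraph.cas G u (xs @ ys) v \<longleftrightarrow> 
    pre_digraph.cas G u xs (path_end G (u, xs)) \<and> pre_digraph.cas G (path_end G (u, xs)) ys v"
proof (induction xs arbitrary: u)
  case (Cons x xs)
  have "path_end G (u, x # xs) = path_end G (head G x, xs)"
    by (simp add: path_end_simp)
  then show ?case
    using Cons by (simp add: pre_digraph.cas.simps)
qed (simp add: path_end_simp pre_digraph.cas.simps)

lemma paths_append: 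
  assumes "p \<in> paths G" "q \<in> paths G" "path_end G p = fst q"
  shows "(fst p, snd p @ snd q) \<in> paths G"
  using assms path_end_append[OF assms(3)]
  by (cases p; cases q) (auto simp: in_paths cas_append)

lemma pmul_closed:
  assumes x: "Poly_Mapping.keys x \<subseteq> paths G" and y: "Poly_Mapping.keys y \<subseteq> paths G"
  shows "Poly_Mapping.keys (pmul G x y) \<subseteq> paths G"
  unfolding pmul_def
proof (intro keys_sum_subset)
  fix p q assume "p \<in> Poly_Mapping.keys x" "q \<in> Poly_Mapping.keys y"
  then have "p \<in> paths G" "q \<in> paths G"
    using x y by auto
  from paths_append[OF this] show "Poly_Mapping.keys (if path_end G p = fst q
     then Poly_Mapping.single (fst p, snd p @ snd q) (Poly_Mapping.lookup x p * Poly_Mapping.lookup y q) else 0) \<subseteq> paths G"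
    by auto
qed

locale fin_quiver =
  fixes G :: "('v, 'e) pre_digraph"
  assumes finite_verts: "finite (verts G)" and head_in_verts: "e \<in> arcs G \<Longrightarrow> head G e \<in> verts G"
begin

lemma path_end_in_verts: "p \<in> paths G \<Longrightarrow> path_end G p \<in> verts G"
  by (cases p; cases "snd p = []") (auto simp: in_paths path_end_simp intro!: head_in_verts subsetD[OF _ last_in_set])

lemma pmul_one:
  fixes x :: "'v \<times> 'e list \<Rightarrow>\<^sub>0 'k::field"
  assumes "Poly_Mapping.keys x \<subseteq> paths G"
  shows "pmul G (\<Sum>v\<in>verts G. Poly_Mapping.single (v, []) 1) x = x"
    and "pmul G x (\<Sum>v\<in>verts G. Poly_Mapping.single (v, []) 1) = x"
proof -
  have "(\<Sum>v\<in>verts G. if v = w then y else 0) = y" if "w \<in> verts G" for w and y :: "'v \<times> 'e list \<Rightarrow>\<^sub>0 'k"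
    using that finite_verts by simp
  note s = this
  show "pmul G (\<Sum>v\<in>verts G. Poly_Mapping.single (v, []) 1) x = x"
    using assms
  proof (induction rule: poly_mapping_span_induct)
    case (single p c)
    have "pmul G (\<Sum>v\<in>verts G. Poly_Mapping.single (v, []) 1) (Poly_Mapping.single p c) =
       (\<Sum>v\<in>verts G. if v = fst p then Poly_Mapping.single p c else 0)"
      by (cases p) (auto simp: pmul_sum_left pmul_single path_end_simp intro!: sum.cong)
    then show ?case
      using single s[of "fst p"] by (cases p) (auto simp: in_paths)
  qed (auto simp: pmul_add_right)
  show "pmul G x (\<Sum>v\<in>verts G. Poly_Mapping.single (v, []) 1) = x"
    using assms
  proof (induction rule: poly_mapping_span_induct)
    case (single p c)
    have "pmul G (Poly_Mapping.single p c) (\<Sum>v\<in>verts G. Poly_Mapping.single (v, []) 1) =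
       (\<Sum>v\<in>verts G. if v = path_end G p then Poly_Mapping.single p c else 0)"
      by (cases p) (auto simp: pmul_sum_right pmul_single intro!: sum.cong)
    then show ?case
      using single s[of "path_end G p"] path_end_in_verts by auto
  qed (auto simp: pmul_add_left)
qed

lemma path_algebra_ring: "ring (path_algebra G :: ('k::field, _) module)"
proof (rule ringI)
  show "abelian_group (path_algebra G :: ('k::field, _) module)"
    by (rule free_space_like_group) auto
  show "monoid (path_algebra G :: ('k::field, _) module)"
  proof (rule monoidI)
    show "\<one>\<^bsub>path_algebra G\<^esub> \<in> carrier (path_algebra G :: ('k::field, _) module)"
      unfolding path_algebra_simps mem_Collect_eq
      by (intro keys_sum_subset) (simp add: in_paths pre_digraph.cas.simps path_end_simp)
  qed (simp_all add: pmul_assoc pmul_one pmul_closed)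
qed (simp_all add: pmul_add_left pmul_add_right)

end

section \<open>Coordinates for \<open>\<Lambda>\<^sub>1\<close>\<close>

lemma dvd_diff_cong: "int m dvd a - b \<Longrightarrow> int m dvd a + c \<longleftrightarrow> int m dvd b + c"
  by (metis add_diff_cancel_right dvd_add_right_iff diff_add_cancel add.commute)

lemma bas_cong: "int m dvd i - j \<Longrightarrow> bas m i t = bas m j t"
proof (rule fun2_eqI)
  fix i' t' assume "int m dvd i - j"
  then have "int m dvd i' - i \<longleftrightarrow> int m dvd i' - j"
    by (metis diff_add_cancel diff_diff_eq2 dvd_add_left_iff add_diff_eq)
  then show "bas m i t i' t' = bas m j t i' t'"
    by (simp add: bas_def)
qed

lemma bas_mod: "bas m (i mod int m) t = bas m i t"
  by (rule bas_cong) (metis mod_eq_dvd_iff mod_mod_trivial)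

lemma bas_Vx_mult: "lmul (bas m i Vx) f = (\<lambda>i' t. if int m dvd i' - i then f i' t else 0)"
  by (rule fun2_eqI, case_tac t) (auto simp: mul_defs bas_def)

lemma bas_mult_Vx:
  "lmul (bas m i Vx) (bas m j Vx) = (if int m dvd i - j then bas m i Vx else 0 :: 'k::field lm)"
  "lmul (bas m i Fw) (bas m j Vx) = (if int m dvd i + 1 - j then bas m i Fw else 0 :: 'k::field lm)"
  "lmul (bas m i Bw) (bas m j Vx) = (if int m dvd i - 1 - j then bas m i Bw else 0 :: 'k::field lm)"
  "lmul (bas m i So) (bas m j Vx) = (if int m dvd i - j then bas m i So else 0 :: 'k::field lm)"
  and bas_mult_arrows:
  "lmul (bas m i Fw) (bas m j Fw) = (0 :: 'k::field lm)" "lmul (bas m i Bw) (bas m j Bw) = (0 :: 'k::field lm)"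
  "lmul (bas m i Fw) (bas m j Bw) = (if int m dvd i + 1 - j then bas m i So else 0 :: 'k::field lm)"
  "lmul (bas m i Bw) (bas m j Fw) = (if int m dvd i - 1 - j then bas m i So else 0 :: 'k::field lm)"
proof -
  have "(lmul (bas m i Vx) (bas m j Vx) i' t = ((if int m dvd i - j then bas m i Vx else 0) i' t :: 'k)) \<and>
    (lmul (bas m i Fw) (bas m j Vx) i' t = ((if int m dvd i + 1 - j then bas m i Fw else 0) i' t :: 'k)) \<and>
    (lmul (bas m i Bw) (bas m j Vx) i' t = ((if int m dvd i - 1 - j then bas m i Bw else 0) i' t :: 'k)) \<and>
    (lmul (bas m i So) (bas m j Vx) i' t = ((if int m dvd i - j then bas m i So else 0) i' t :: 'k)) \<and>
    lmul (bas m i Fw) (bas m j Fw) i' t = (0 :: 'k) \<and> lmul (bas m i Bw) (bas m j Bw) i' t = (0 :: 'k) \<and>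
    (lmul (bas m i Fw) (bas m j Bw) i' t = ((if int m dvd i + 1 - j then bas m i So else 0) i' t :: 'k)) \<and>
    (lmul (bas m i Bw) (bas m j Fw) i' t = ((if int m dvd i - 1 - j then bas m i So else 0) i' t :: 'k))" for i' t
  proof (cases "int m dvd i' - i")
    case True
    have d: "int m dvd i' + c - j \<longleftrightarrow> int m dvd i + c - j" for c
      using dvd_diff_cong[OF True, of "c - j"] by (simp add: algebra_simps)
    show ?thesis
      using True d[of 0] d[of 1] d[of "- 1"]
      by (cases t) (simp_all add: mul_defs bas_def)
  next
    case False
    then show ?thesis
      by (cases t) (simp_all add: mul_defs bas_def)
  qed
  note * = this
  show
    "lmul (bas m i Vx) (bas m j Vx) = (if int m dvd i - j then bas m i Vx else 0 :: 'k::field lm)"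
    "lmul (bas m i Fw) (bas m j Vx) = (if int m dvd i + 1 - j then bas m i Fw else 0 :: 'k::field lm)"
    "lmul (bas m i Bw) (bas m j Vx) = (if int m dvd i - 1 - j then bas m i Bw else 0 :: 'k::field lm)"
    "lmul (bas m i So) (bas m j Vx) = (if int m dvd i - j then bas m i So else 0 :: 'k::field lm)"
    "lmul (bas m i Fw) (bas m j Fw) = (0 :: 'k::field lm)" "lmul (bas m i Bw) (bas m j Bw) = (0 :: 'k::field lm)"
    "lmul (bas m i Fw) (bas m j Bw) = (if int m dvd i + 1 - j then bas m i So else 0 :: 'k::field lm)"
    "lmul (bas m i Bw) (bas m j Fw) = (if int m dvd i - 1 - j then bas m i So else 0 :: 'k::field lm)"
    by (rule fun2_eqI, simp only: * zero_fun_apply)+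
qed

lemma lmul_zero [simp]: "lmul 0 f = 0" "lmul f 0 = 0"
  by (rule fun2_eqI, case_tac t, simp_all add: mul_defs)+

section \<open>Evaluation of paths in the coordinate model\<close>

fun arrm :: "nat \<Rightarrow> arrow \<Rightarrow> 'k::field lm" where
  "arrm m (Fwd i) = bas m i Fw"
| "arrm m (Bwd i) = bas m (i + 1) Bw"

fun evl :: "nat \<Rightarrow> arrow list \<Rightarrow> 'k::field lm" where
  "evl m [] = lone"
| "evl m (x # xs) = lmul (arrm m x) (evl m xs)"

definition ev :: "nat \<Rightarrow> int \<times> arrow list \<Rightarrow> 'k::field lm" where
  "ev m p = lmul (bas m (fst p) Vx) (evl m (snd p))"

text \<open>Linear extension of path evaluation, a homomorphism from the path algebra to the
  coordinate model. Its kernel turns out to be the ideal I_1, which identifies \<Lambda>_1 with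
  \<open>LM m\<close>.\<close>

definition kap :: "nat \<Rightarrow> 'k::field pathalg \<Rightarrow> 'k lm" where
  "kap m x i t = lext (\<lambda>p. ev m p i t) x"

lemma evl_append: "evl m (xs @ ys) = lmul (evl m xs) (evl m ys)"
  by (induction xs) (simp_all add: lmul_assoc)

lemma quiver_simps [simp]:
  "verts (quiver m) = {0..<int m}" "arcs (quiver m) = Fwd ` {0..<int m} \<union> Bwd ` {0..<int m}"
  "tail (quiver m) (Fwd i) = i" "tail (quiver m) (Bwd i) = (i + 1) mod int m"
  "head (quiver m) (Fwd i) = (i + 1) mod int m" "head (quiver m) (Bwd i) = i"
  by (simp_all add: quiver_def)

lemma mod_dvd_diff: "int m dvd i - j mod int m \<longleftrightarrow> int m dvd i - j"
  by (metis mod_eq_dvd_iff mod_mod_trivial)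

lemma ev_path_end: "lmul (ev m (u, xs)) (bas m (path_end (quiver m) (u, xs)) Vx) = (ev m (u, xs) :: 'k::field lm)"
proof (cases xs rule: rev_cases)
  case Nil
  then show ?thesis
    by (simp add: ev_def path_end_simp bas_mult_Vx)
next
  case (snoc ys x)
  have "lmul (arrm m x) (bas m (head (quiver m) x) Vx) = (arrm m x :: 'k lm)"
    by (cases x) (simp_all add: bas_mult_Vx mod_dvd_diff)
  then show ?thesis
    by (simp add: snoc ev_def path_end_simp evl_append lmul_assoc)
qed

text \<open>The idempotent at the end of \<open>p\<close> is absorbed by \<open>ev m p\<close>;
  multiplied by the idempotent at the start of \<open>q\<close> it gives zero unless the two
  vertices agree. Both lie in one period, so congruence is equality.\<close>

lemma ev_mult:
  assumes p: "p \<in> paths (quiver m)" and q: "q \<in> paths (quiver m)" and f: "fin_quiver (quiver m)"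
  shows "lmul (ev m p) (ev m q) = (if path_end (quiver m) p = fst q then ev m (fst p, snd p @ snd q) else 0 :: 'k::field lm)"
proof -
  obtain u xs w ys where [simp]: "p = (u, xs)" "q = (w, ys)"
    by (cases p; cases q)
  note pq = \<open>p = (u, xs)\<close>
  let ?e = "path_end (quiver m) (u, xs)"
  have r: "?e \<in> {0..<int m}" "w \<in> {0..<int m}"
    using fin_quiver.path_end_in_verts[OF f p] q by (auto simp: in_paths)
  have "lmul (ev m p) (ev m q) = (lmul (lmul (ev m p) (bas m ?e Vx)) (ev m q) :: 'k lm)"
    by (simp add: ev_path_end)
  also have "\<dots> = lmul (ev m p) (lmul (lmul (bas m ?e Vx) (bas m w Vx)) (evl m ys))"
    by (simp add: ev_def lmul_assoc)
  also have "\<dots> = (if ?e = w then lmul (lmul (ev m p) (bas m ?e Vx)) (evl m ys) else 0)"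
  proof (cases "?e = w")
    case False
    then have "\<not> int m dvd ?e - w"
      using r by (metis atLeastLessThan_iff mod_eq_dvd_iff mod_pos_pos_trivial)
    then show ?thesis
      using False by (simp add: bas_mult_Vx)
  qed (simp add: bas_mult_Vx lmul_assoc)
  also have "\<dots> = (if ?e = w then ev m (u, xs @ ys) else 0)"
  proof -
    have "lmul (lmul (ev m p) (bas m ?e Vx)) (evl m ys) = (ev m (u, xs @ ys) :: 'k lm)"
      unfolding pq ev_path_end by (simp add: ev_def evl_append lmul_assoc)
    then show ?thesis
      by (simp only:)
  qed
  finally show ?thesis
    by simp
qed

lemma kap_add: "kap m (x + y) = kap m x + kap m y"
  by (rule fun2_eqI) (simp add: kap_def lext_add)

lemma kap_minus: "kap m (x - y) = kap m x - kap m y"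
  by (rule fun2_eqI) (simp add: kap_def lext_minus)

lemma kap_zero [simp]: "kap m 0 = 0"
  by (rule fun2_eqI) (simp add: kap_def)

lemma kap_single: "kap m (Poly_Mapping.single p c) = lsc c (ev m p)"
  by (rule fun2_eqI) (simp add: kap_def lsc_def)

lemma kap_smult: "kap m (Poly_Mapping.map (\<lambda>y. c * y) x) = lsc c (kap m x)"
  by (rule fun2_eqI) (simp add: kap_def lext_smult lsc_def)

lemma kap_sum: "kap m (sum f A) = (\<Sum>a\<in>A. kap m (f a))"
  by (induction A rule: infinite_finite_induct) (auto simp: kap_add)

lemma arrm_LM: "arrm m x \<in> LM m"
  by (cases x) (simp_all add: LM_closed)

lemma evl_LM: "evl m xs \<in> LM m"
  by (induction xs) (simp_all add: LM_closed LM_lmul arrm_LM)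

lemma ev_LM: "ev m p \<in> LM m"
  unfolding ev_def by (intro LM_lmul LM_closed evl_LM)

lemma kap_LM: "kap m x \<in> LM m"
proof (rule LM_I, rule ext)
  fix i t
  show "kap m x (i + int m) t = kap m x i t"
    by (simp add: kap_def LM_D[OF ev_LM])
qed

lemma lsc_lsc: "lsc c (lsc d f) = lsc (c * d) f" "lsc c 0 = 0"
  by (auto simp: lsc_def fun_eq_iff)

lemma kap_pmul:
  assumes "Poly_Mapping.keys x \<subseteq> paths (quiver m)" "Poly_Mapping.keys y \<subseteq> paths (quiver m)"
    and f: "fin_quiver (quiver m)"
  shows "kap m (pmul (quiver m) x y) = lmul (kap m x) (kap m y)"
  using assms(1)
proof (induction rule: poly_mapping_span_induct)
  case (single p c)
  from assms(2) show ?case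
  proof (induction rule: poly_mapping_span_induct)
    case (single q d)
    then show ?case
      by (cases "path_end (quiver m) p = fst q")
        (simp_all add: pmul_single kap_single lmul_sc lsc_lsc ev_mult[OF \<open>p \<in> _\<close> \<open>q \<in> _\<close> f] mult.commute)
  qed (simp_all only: pmul_add_right kap_add lmul_add pmul_zero kap_zero lmul_zero)
qed (simp_all only: pmul_add_left kap_add lmul_add pmul_zero kap_zero lmul_zero)

text \<open>Representatives of the four basis types in the path algebra; the backward arrow that
  starts at \<open>i\<close> carries the index \<open>i - 1\<close>.\<close>

definition std :: "nat \<Rightarrow> int \<Rightarrow> bt \<Rightarrow> 'k::field pathalg" where
  "std m i t = (case t of Vx \<Rightarrow> pe m i | Fw \<Rightarrow> pa m i | Bw \<Rightarrow> pabar m (i - 1)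
     | So \<Rightarrow> pmul (quiver m) (pa m i) (pabar m i))"

definition nform :: "nat \<Rightarrow> 'k::field lm \<Rightarrow> 'k pathalg" where
  "nform m f = (\<Sum>i\<in>{0..<int m}. \<Sum>t\<in>UNIV. Poly_Mapping.map (\<lambda>y. f i t * y) (std m i t))"

lemma LM_expand:
  assumes f: "f \<in> LM m" and m: "m > 0"
  shows "(\<Sum>i\<in>{0..<int m}. \<Sum>t\<in>UNIV. lsc (f i t) (bas m i t)) = f"
proof (rule fun2_eqI)
  fix i' t'
  have "(\<Sum>i\<in>{0..<int m}. \<Sum>t\<in>UNIV. lsc (f i t) (bas m i t)) i' t' = 
     (\<Sum>i\<in>{0..<int m}. if i = i' mod int m then f (i' mod int m) t' else 0)"
    unfolding sum_fun_apply
  proof (intro sum.cong refl)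
    fix i assume "i \<in> {0..<int m}"
    then have "int m dvd i' - i \<longleftrightarrow> i = i' mod int m"
      by (metis atLeastLessThan_iff mod_eq_dvd_iff mod_pos_pos_trivial)
    then show "(\<Sum>t\<in>UNIV. lsc (f i t) (bas m i t) i' t') = (if i = i' mod int m then f (i' mod int m) t' else 0)"
      by (cases t') (auto simp: sum_bt lsc_def bas_def)
  qed
  also have "\<dots> = f i' t'"
    using m LM_mod[OF f, of i'] by simp
  finally show "(\<Sum>i\<in>{0..<int m}. \<Sum>t\<in>UNIV. lsc (f i t) (bas m i t)) i' t' = f i' t'" .
qed

locale zigzag =
  fixes m :: nat and K :: "'k::field itself"
  assumes m3: "m \<ge> 3"
begin

abbreviation "kq \<equiv> KQ m :: ('k, 'k pathalg) module"
abbreviation "pm \<equiv> pmul (quiver m)"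
abbreviation "J \<equiv> I1 m :: 'k pathalg set"

lemma m_pos: "m > 0"
  using m3 by simp

lemma fin_quiver: "fin_quiver (quiver m)"
  using m_pos by unfold_locales auto

lemma KQ_simps [simp]:
  "carrier kq = {x. Poly_Mapping.keys x \<subseteq> paths (quiver m)}" "zero kq = 0"
  "add kq = (+)" "mult kq = pm" "smult kq = (\<lambda>c. Poly_Mapping.map (\<lambda>y. c * y))"
  "one kq = (\<Sum>v\<in>{0..<int m}. Poly_Mapping.single (v, []) 1)"
  by (simp_all add: KQ_def)

lemma KQ_ring: "ring kq"
  unfolding KQ_def by (rule fin_quiver.path_algebra_ring[OF fin_quiver])

interpretation kq: ring kq
  by (rule KQ_ring)

lemma KQ_neg: "x \<in> carrier kq \<Longrightarrow> \<ominus>\<^bsub>kq\<^esub> x = - x"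
  by (rule kq.minus_equality) (auto simp: in_keys_iff)

lemma gens_closed:
  "Poly_Mapping.keys (pe m i :: 'k pathalg) \<subseteq> paths (quiver m)"
  "Poly_Mapping.keys (pa m i :: 'k pathalg) \<subseteq> paths (quiver m)"
  "Poly_Mapping.keys (pabar m i :: 'k pathalg) \<subseteq> paths (quiver m)"
  using m_pos by (auto simp: pe_def pa_def pabar_def in_paths path_end_simp pre_digraph.cas.simps mod_simps)

lemma kap_gens:
  "kap m (pe m i) = (bas m i Vx :: 'k lm)" "kap m (pa m i) = (bas m i Fw :: 'k lm)"
  "kap m (pabar m i) = (bas m (i + 1) Bw :: 'k lm)"
proof -
  have b: "bas m ((i + 1) mod int m) t = bas m (i mod int m + 1) t" for t
    by (rule bas_cong) (metis mod_add_left_eq mod_eq_dvd_iff mod_mod_trivial)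
  have b': "bas m (i mod int m + 1) t = bas m (i + 1) t" for t
    using b bas_mod[of m "i + 1"] by metis
  have l: "lsc 1 f = f" for f :: "'k lm"
    by (simp add: lsc_def fun_eq_iff)
  show "kap m (pe m i) = (bas m i Vx :: 'k lm)"
    by (simp add: pe_def kap_single ev_def bas_mod l)
  show "kap m (pa m i) = (bas m i Fw :: 'k lm)"
    by (simp add: pa_def kap_single ev_def bas_mod l bas_Vx_mult) (auto simp: fun_eq_iff bas_def)
  show "kap m (pabar m i) = (bas m (i + 1) Bw :: 'k lm)"
    by (simp add: pabar_def kap_single ev_def bas_mod l bas_Vx_mult b') (auto simp: fun_eq_iff bas_def)
qed

lemma kap_std: "kap m (std m i t) = (bas m i t :: 'k lm)"
  by (cases t) (simp_all add: std_def kap_gens kap_pmul[OF gens_closed(2,3) fin_quiver] bas_mult_arrows)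

lemma std_closed: "Poly_Mapping.keys (std m i t :: 'k pathalg) \<subseteq> paths (quiver m)"
  by (cases t) (simp_all add: std_def gens_closed pmul_closed)

lemma gens_mod: "pe m (i mod int m) = (pe m i :: 'k pathalg)" "pa m (i mod int m) = (pa m i :: 'k pathalg)"
  "pabar m (i mod int m) = (pabar m i :: 'k pathalg)"
  by (simp_all add: pe_def pa_def pabar_def mod_simps)

lemma gens_cong:
  assumes "i mod int m = j mod int m"
  shows "pe m i = (pe m j :: 'k pathalg)" "pa m i = (pa m j :: 'k pathalg)" "pabar m i = (pabar m j :: 'k pathalg)"
  by (metis assms gens_mod)+

lemma std_cong: "i mod int m = j mod int m \<Longrightarrow> std m i t = (std m j t :: 'k pathalg)"
proof -
  assume ij: "i mod int m = j mod int m"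
  then have "(i - 1) mod int m = (j - 1) mod int m"
    by (metis mod_diff_left_eq)
  from gens_cong[OF ij] gens_cong[OF this] show ?thesis
    by (cases t) (simp_all add: std_def)
qed

lemma relations_closed: "relations m \<subseteq> carrier kq"
proof
  fix x :: "'k pathalg" assume "x \<in> relations m"
  then show "x \<in> carrier kq"
    unfolding relations_def KQ_simps mem_Collect_eq
    by (elim UN_E insertE emptyE) (simp_all add: pmul_closed gens_closed keys_diff_subset)
qed

lemma ideal_J: "ideal J kq"
  unfolding I1_def by (rule kq.genideal_ideal[OF relations_closed])

interpretation J: ideal J kq
  by (rule ideal_J)

lemma J_facts:
  "0 \<in> J" "x \<in> J \<Longrightarrow> y \<in> J \<Longrightarrow> x + y \<in> J" "x \<in> J \<Longrightarrow> y \<in> J \<Longrightarrow> x - y \<in> J"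
  "x \<in> J \<Longrightarrow> Poly_Mapping.keys x \<subseteq> paths (quiver m)"
  "x \<in> J \<Longrightarrow> Poly_Mapping.keys r \<subseteq> paths (quiver m) \<Longrightarrow> pm r x \<in> J"
  "x \<in> J \<Longrightarrow> Poly_Mapping.keys r \<subseteq> paths (quiver m) \<Longrightarrow> pm x r \<in> J"
proof -
  show "0 \<in> J" using J.zero_closed by simp
  show c: "x \<in> J \<Longrightarrow> Poly_Mapping.keys x \<subseteq> paths (quiver m)" for x
    using J.a_Hcarr[of x] by simp
  show "x \<in> J \<Longrightarrow> y \<in> J \<Longrightarrow> x + y \<in> J"
    using J.a_closed[of x y] by simp
  show "x \<in> J \<Longrightarrow> y \<in> J \<Longrightarrow> x - y \<in> J"
    using J.a_closed[of x "- y"] J.a_inv_closed[of y] KQ_neg[of y] c by simp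
  show "x \<in> J \<Longrightarrow> Poly_Mapping.keys r \<subseteq> paths (quiver m) \<Longrightarrow> pm r x \<in> J"
    "x \<in> J \<Longrightarrow> Poly_Mapping.keys r \<subseteq> paths (quiver m) \<Longrightarrow> pm x r \<in> J"
    using J.I_l_closed[of x r] J.I_r_closed[of x r] by simp_all
qed

text \<open>The defining relations are listed for indices in one period; they carry over to all
  integers because arrows depend on the index modulo \<open>m\<close> only.\<close>

lemma relations_J:
  "pm (pa m i) (pa m (i + 1)) \<in> J" "pm (pabar m (i + 1)) (pabar m i) \<in> J"
  "pm (pa m i) (pabar m i) - pm (pabar m (i - 1)) (pa m (i - 1)) \<in> J"
proof -
  have r: "relations m \<subseteq> J"
    unfolding I1_def by (rule kq.genideal_self[OF relations_closed])
  have rel: "pm (pa m j) (pa m (j + 1)) \<in> J" "pm (pabar m (j - 1)) (pabar m (j - 2)) \<in> J"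
    "pm (pa m j) (pabar m j) - pm (pabar m (j - 1)) (pa m (j - 1)) \<in> J" if "j \<in> {0..<int m}" for j
    by (rule subsetD[OF r], unfold relations_def KQ_simps, rule UN_I[OF that], simp)+
  have m: "i mod int m \<in> {0..<int m}" "(i + 2) mod int m \<in> {0..<int m}"
    using m_pos by auto
  have c: "pa m (i mod int m) = (pa m i :: 'k pathalg)" "pa m (i mod int m + 1) = (pa m (i + 1) :: 'k pathalg)" "pabar m (i mod int m) = (pabar m i :: 'k pathalg)"
    "pabar m ((i + 2) mod int m - 1) = (pabar m (i + 1) :: 'k pathalg)" "pabar m ((i + 2) mod int m - 2) = (pabar m i :: 'k pathalg)"
    "pabar m (i mod int m - 1) = (pabar m (i - 1) :: 'k pathalg)" "pa m (i mod int m - 1) = (pa m (i - 1) :: 'k pathalg)"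
    by (rule gens_cong, simp add: mod_simps add.commute)+
  show "pm (pa m i) (pa m (i + 1)) \<in> J" "pm (pabar m (i + 1)) (pabar m i) \<in> J"
     "pm (pa m i) (pabar m i) - pm (pabar m (i - 1)) (pa m (i - 1)) \<in> J"
    using rel(1)[OF m(1)] rel(2)[OF m(2)] rel(3)[OF m(1)] unfolding c by auto
qed

lemma kernel_ideal: "ideal {x \<in> carrier kq. kap m x = 0} kq"
proof (rule idealI[OF KQ_ring])
  show "subgroup {x \<in> carrier kq. kap m x = 0} (add_monoid kq)"
  proof (unfold_locales, unfold monoid_record_simps)
    fix x assume x: "x \<in> {x \<in> carrier kq. kap m x = 0}"
    then show "inv\<^bsub>add_monoid kq\<^esub> x \<in> {x \<in> carrier kq. kap m x = 0}"
      using KQ_neg[of x] kap_minus[of m 0 x] unfolding a_inv_def by (auto simp: keys_minus_subset[THEN subsetD])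
  qed (auto simp: kap_add dest!: subsetD[OF keys_add])
qed (auto simp: kap_pmul fin_quiver intro: pmul_closed[THEN subsetD])

text \<open>The kernel of \<open>kap\<close> is an ideal that contains the defining relations, so it
  contains the ideal they generate.\<close>

lemma kap_J: "x \<in> J \<Longrightarrow> kap m x = 0"
proof -
  have "relations m \<subseteq> {x \<in> carrier kq. kap m x = (0 :: 'k lm)}"
  proof -
    have "kap m x = (0 :: 'k lm)" if "x \<in> relations m" for x
      using that by (auto simp: relations_def kap_minus kap_pmul[OF _ _ fin_quiver] gens_closed kap_gens bas_mult_arrows)
    then show ?thesis
      using relations_closed by auto
  qed
  from kq.genideal_minimal[OF kernel_ideal this] show "x \<in> J \<Longrightarrow> kap m x = 0"
    unfolding I1_def by auto
qed

section \<open>Normal forms modulo the defining ideal\<close>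

lemma nform_add: "nform m (f + g) = nform m f + nform m g"
  unfolding nform_def sum.distrib[symmetric]
  by (intro sum.cong refl poly_mapping_eqI) (simp add: lookup_add lookup_map_mult algebra_simps)

lemma nform_lsc: "nform m (lsc c f) = Poly_Mapping.map (\<lambda>y. c * y) (nform m f)"
  by (rule poly_mapping_eqI) 
    (simp add: nform_def lookup_sum lookup_map_mult lsc_def sum_distrib_left, simp add: mult.assoc)

lemma nform_closed: "Poly_Mapping.keys (nform m f :: 'k pathalg) \<subseteq> paths (quiver m)"
  unfolding nform_def 
  by (intro keys_sum_subset order.trans[OF keys_map_mult] std_closed)

lemma kap_nform: "f \<in> LM m \<Longrightarrow> kap m (nform m f) = (f :: 'k lm)"
  using LM_expand[OF _ m_pos, of f] by (simp add: nform_def kap_sum kap_smult kap_std)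

lemma nform_bas: "nform m (bas m i t) = (std m i t :: 'k pathalg)"
proof -
  have "nform m (bas m i t) = (\<Sum>i'\<in>{0..<int m}. if i' = i mod int m then std m i t else 0 :: 'k pathalg)"
    unfolding nform_def
  proof (intro sum.cong refl)
    fix i' assume i': "i' \<in> {0..<int m}"
    then have "int m dvd i' - i \<longleftrightarrow> i' = i mod int m"
      by (metis atLeastLessThan_iff mod_eq_dvd_iff mod_pos_pos_trivial)
    moreover have "i' = i mod int m \<Longrightarrow> std m i' s = (std m i s :: 'k pathalg)" for s
      by (rule std_cong) simp
    moreover have "Poly_Mapping.map ((*) 0) y = 0" "Poly_Mapping.map ((*) 1) y = y" for y :: "'k pathalg"
      by (rule poly_mapping_eqI, simp add: lookup_map_mult)+
    ultimately show "(\<Sum>s\<in>UNIV. Poly_Mapping.map (\<lambda>y. bas m i t i' s * y) (std m i' s)) = 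
        (if i' = i mod int m then std m i t else 0 :: 'k pathalg)"
      by (cases t) (auto simp: sum_bt bas_def)
  qed
  then show ?thesis
    using m_pos by simp
qed

text \<open>Elements congruent modulo \<open>J\<close> to the normal form of their coordinates. That
  everything is reduced is the spanning half of the claim that the four types of paths give a basis
  of \<Lambda>_1; independence comes from \<open>kap\<close>.\<close>

definition reduced :: "'k pathalg set" where
  "reduced = {x. Poly_Mapping.keys x \<subseteq> paths (quiver m) \<and> x - nform m (kap m x) \<in> J}"

text \<open>A ring ideal of an algebra with unit is closed under scalars, since c x = (c 1)
  x.\<close>

lemma J_smult: "x \<in> J \<Longrightarrow> Poly_Mapping.map (\<lambda>y. c * y) x \<in> J"
proof -
  assume x: "x \<in> J"
  have "Poly_Mapping.map (\<lambda>y. c * y) x = pm (Poly_Mapping.map (\<lambda>y. c * y) \<one>\<^bsub>kq\<^esub>) x"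
    unfolding pmul_smult_left using kq.l_one[of x] J_facts(4)[OF x] by (simp del: KQ_simps(6))
  moreover have "Poly_Mapping.keys (Poly_Mapping.map (\<lambda>y. c * y) \<one>\<^bsub>kq\<^esub>) \<subseteq> paths (quiver m)"
    using order.trans[OF keys_map_mult] kq.one_closed by (simp del: KQ_simps(6))
  ultimately show ?thesis
    using J_facts(5)[OF x] by simp
qed

lemma reduced_add: "x \<in> reduced \<Longrightarrow> y \<in> reduced \<Longrightarrow> x + y \<in> reduced"
  using J_facts(2)[of "x - nform m (kap m x)" "y - nform m (kap m y)"] keys_add_subset[of x _ y]
  by (auto simp: reduced_def kap_add nform_add algebra_simps)

lemma reduced_smult: "x \<in> reduced \<Longrightarrow> Poly_Mapping.map (\<lambda>y. c * y) x \<in> reduced"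
proof -
  have "Poly_Mapping.map (\<lambda>y. c * y) x - Poly_Mapping.map (\<lambda>y. c * y) y = Poly_Mapping.map (\<lambda>y. c * y) (x - y)"
    for y :: "'k pathalg"
    by (rule poly_mapping_eqI) (simp add: lookup_map_mult lookup_minus right_diff_distrib)
  then show "x \<in> reduced \<Longrightarrow> ?thesis"
    using J_smult[of "x - nform m (kap m x)" c] 
    by (simp add: reduced_def kap_smult nform_lsc order.trans[OF keys_map_mult])
qed

lemma reduced_J: "x \<in> J \<Longrightarrow> x \<in> reduced"
proof -
  have "nform m 0 = (0 :: 'k pathalg)"
    using nform_add[of 0 0] by simp
  then show "x \<in> J \<Longrightarrow> ?thesis"
    using kap_J J_facts(4) by (simp add: reduced_def)
qed

lemma reduced_std: "std m i t \<in> reduced"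
  using std_closed J_facts(1) by (simp add: reduced_def kap_std nform_bas)

lemma reduced_zero: "0 \<in> reduced"
  by (rule reduced_J) (rule J_facts)

lemma reduced_sum: "(\<And>a. a \<in> A \<Longrightarrow> f a \<in> reduced) \<Longrightarrow> sum f A \<in> reduced"
  by (induction A rule: infinite_finite_induct) (auto intro: reduced_add reduced_zero)

text \<open>Modulo \<open>J\<close>, appending an arrow to a basis path gives zero or another basis
  path. Induction on the length then reduces every path.\<close>

lemma std_mult_arrow: "pm (std m i t) (pa m j) \<in> reduced" "pm (std m i t) (pabar m j) \<in> reduced"
proof -
  have e: "path_end (quiver m) (u, []) = u" "path_end (quiver m) (u, [Fwd v]) = (v + 1) mod int m"
    "path_end (quiver m) (u, [Bwd v]) = v" for u v
    by (auto simp: path_end_simp)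
  note s = pe_def pa_def pabar_def pmul_single e mod_simps
  have ind: "i mod int m = j mod int m \<longleftrightarrow> (i + 1) mod int m = (j + 1) mod int m" for i j
    by (simp add: mod_eq_dvd_iff)
  have aa: "pm (pa m i) (pa m j) \<in> J" for i j
  proof (cases "(i + 1) mod int m = j mod int m")
    case True
    then show ?thesis using relations_J(1)[of i] gens_cong(2)[of "i + 1" j] by simp
  next
    case False
    then show ?thesis using J_facts(1) by (simp add: s)
  qed
  have bb: "pm (pabar m i) (pabar m j) \<in> J" for i j
  proof (cases "(j + 1) mod int m = i mod int m")
    case True
    then show ?thesis using relations_J(2)[of j] gens_cong(3)[of "j + 1" i] by simp
  next
    case False
    then show ?thesis using J_facts(1) by (auto simp: s)
  qed
  have ab: "pm (pa m i) (pabar m j) = (if i mod int m = j mod int m then std m i So else 0 :: 'k pathalg)" for i j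
  proof (cases "i mod int m = j mod int m")
    case True
    then show ?thesis using gens_cong(3)[of i j] by (simp add: std_def)
  next
    case False
    then show ?thesis using ind[of i j] by (simp add: s)
  qed
  have ba: "pm (pabar m i) (pa m j) \<in> reduced" for i j
  proof (cases "i mod int m = j mod int m")
    case True
    \<comment> \<open>The commutativity relation at the vertex i + 1, solved for the product that
      starts with the backward arrow.\<close>
    have "pm (pabar m i) (pa m i) = std m (i + 1) So + Poly_Mapping.map ((*) (- 1)) (pm (pa m (i + 1)) (pabar m (i + 1)) - pm (pabar m i) (pa m i) :: 'k pathalg)"
      by (rule poly_mapping_eqI) (simp add: std_def lookup_add lookup_minus lookup_map_mult)
    also have "\<dots> \<in> reduced"
      using reduced_J[OF relations_J(3)[of "i + 1"]] by (intro reduced_add reduced_std reduced_smult) simp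
    finally show ?thesis
      using gens_cong(2)[OF True] by simp
  next
    case False
    then show ?thesis using reduced_zero by (simp add: s)
  qed
  have va: "pm (pe m i) (pa m j) \<in> reduced" for i j
    using reduced_std[of j Fw] reduced_zero by (auto simp: std_def s)
  have vb: "pm (pe m i) (pabar m j) \<in> reduced" for i j
    using reduced_std[of "j + 1" Bw] reduced_zero by (auto simp: std_def s)
  have aba: "pm (pm (pa m i) (pabar m i)) (pa m j) \<in> reduced" for i j
  proof (cases "i mod int m = j mod int m")
    case True
    \<comment> \<open>Multiplying the commutativity relation at i + 1 by a_i from the left gives a_i
      a_{i+1} abar_{i+1} - a_i abar_i a_i. The first path contains a_i a_{i+1}, so the second lies
      in \<open>J\<close> as well.\<close>
    let ?r = "pm (pa m (i + 1)) (pabar m (i + 1)) - pm (pabar m i) (pa m i) :: 'k pathalg"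
    have "pm (pa m i) ?r \<in> J"
      using relations_J(3)[of "i + 1"] by (intro J_facts(5) gens_closed) simp
    moreover have "pm (pa m i) (pm (pa m (i + 1)) (pabar m (i + 1))) \<in> J"
      unfolding pmul_assoc[symmetric] by (intro J_facts(6) aa gens_closed)
    ultimately have "pm (pa m i) (pm (pabar m i) (pa m i)) \<in> J"
      using J_facts(3) by (fastforce simp: pmul_minus_right)
    then show ?thesis
      using gens_cong(2)[OF True] reduced_J by (simp add: pmul_assoc)
  next
    case False
    then show ?thesis using reduced_zero by (simp add: s path_end_simp)
  qed
  have abb: "pm (pm (pa m i) (pabar m i)) (pabar m j) \<in> J" for i j
    unfolding pmul_assoc by (intro J_facts(5) bb gens_closed)
  have z: "(if P then std m i So else 0) \<in> reduced" for P i
    using reduced_std reduced_zero by simp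
  show "pm (std m i t) (pa m j) \<in> reduced"
  proof (cases t)
    case Vx
    then show ?thesis using va by (simp only: std_def bt.case)
  next
    case Fw
    then show ?thesis using reduced_J[OF aa] by (simp only: std_def bt.case)
  next
    case Bw
    then show ?thesis using ba by (simp only: std_def bt.case)
  next
    case So
    then show ?thesis using aba by (simp only: std_def bt.case)
  qed
  show "pm (std m i t) (pabar m j) \<in> reduced"
  proof (cases t)
    case Vx
    then show ?thesis using vb by (simp only: std_def bt.case)
  next
    case Fw
    have "pm (pa m i) (pabar m j) \<in> reduced"
      unfolding ab by (rule z)
    then show ?thesis using Fw by (simp only: std_def bt.case)
  next
    case Bw
    then show ?thesis using reduced_J[OF bb] by (simp only: std_def bt.case)
  next
    case So
    then show ?thesis using reduced_J[OF abb] by (simp only: std_def bt.case)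
  qed
qed

lemma reduced_mult:
  assumes x: "x \<in> reduced" and y: "\<And>i t. pm (std m i t) y \<in> reduced" "Poly_Mapping.keys y \<subseteq> paths (quiver m)"
  shows "pm x y \<in> reduced"
proof -
  have "pm (nform m f) y \<in> reduced" for f
    unfolding nform_def pmul_sum_left pmul_smult_left by (intro reduced_sum reduced_smult y)
  moreover have "pm (x - nform m (kap m x)) y \<in> reduced"
    using x y(2) by (intro reduced_J J_facts(6)) (auto simp: reduced_def)
  ultimately show ?thesis
    using reduced_add[of "pm (x - nform m (kap m x)) y" "pm (nform m (kap m x)) y"] by (simp add: pmul_minus_left)
qed

lemma reduced_path: "(u, xs) \<in> paths (quiver m) \<Longrightarrow> Poly_Mapping.single (u, xs) (1::'k) \<in> reduced"
proof (induction xs rule: rev_induct)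
  case Nil
  then show ?case
    using reduced_std[of u Vx] by (simp add: std_def pe_def in_paths)
next
  case (snoc x xs)
  have p: "(u, xs) \<in> paths (quiver m)" "x \<in> arcs (quiver m)" "path_end (quiver m) (u, xs) = tail (quiver m) x"
    using snoc.prems by (auto simp: in_paths cas_append pre_digraph.cas.simps)
  have s: "Poly_Mapping.single (u, xs @ [x]) (1::'k) = 
     pm (Poly_Mapping.single (u, xs) 1) (Poly_Mapping.single (tail (quiver m) x, [x]) 1)"
    using p(3) by (simp add: pmul_single)
  show ?case
  proof (cases x)
    case (Fwd i)
    then have "Poly_Mapping.single (tail (quiver m) x, [x]) (1::'k) = pa m i"
      using p(2) by (auto simp: pa_def)
    then show ?thesis
      unfolding s by (simp add: reduced_mult[OF snoc.IH[OF p(1)]] std_mult_arrow gens_closed)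
  next
    case (Bwd i)
    then have "Poly_Mapping.single (tail (quiver m) x, [x]) (1::'k) = pabar m i"
      using p(2) by (auto simp: pabar_def)
    then show ?thesis
      unfolding s by (simp add: reduced_mult[OF snoc.IH[OF p(1)]] std_mult_arrow gens_closed)
  qed
qed

lemma all_reduced: "Poly_Mapping.keys x \<subseteq> paths (quiver m) \<Longrightarrow> x \<in> reduced"
proof (induction rule: poly_mapping_span_induct)
  case (single p c)
  then show ?case
    using reduced_smult[OF reduced_path[of "fst p" "snd p"], of c] by (simp add: map_mult_single)
qed (auto intro: reduced_zero reduced_add)

text \<open>An element with zero coordinates has normal form 0, and being reduced then means lying
  in \<open>J\<close>.\<close>

lemma J_kernel: "J = {x \<in> carrier kq. kap m x = 0}"
proof (intro equalityI subsetI)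
  fix x assume x: "x \<in> {x \<in> carrier kq. kap m x = 0}"
  have "nform m 0 = (0 :: 'k pathalg)"
    using nform_add[of 0 0] by simp
  then show "x \<in> J"
    using x all_reduced[of x] by (simp add: reduced_def)
qed (use kap_J J_facts(4) in auto)

lemma kap_carrier: "kap m ` carrier kq = LM m"
proof (intro equalityI subsetI)
  fix f :: "'k lm" assume "f \<in> LM m"
  then show "f \<in> kap m ` carrier kq"
    using kap_nform nform_closed by (intro image_eqI[of _ _ "nform m f"]) simp_all
qed (use kap_LM in auto)

lemma quot_space_J: "quot_space J kq"
proof (intro quot_space.intro quot_space_axioms.intro)
  show "abelian_subgroup J kq" ..
  show "x \<in> carrier kq \<Longrightarrow> c \<odot>\<^bsub>kq\<^esub> x \<in> carrier kq" for x c
    using order.trans[OF keys_map_mult] by simp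
  show "x \<in> J \<Longrightarrow> c \<odot>\<^bsub>kq\<^esub> x \<in> J" for x c
    using J_smult by simp
qed (simp add: map_mult_add)

section \<open>The coordinate isomorphism of \<Lambda>_1\<close>

interpretation Q: quot_space J kq
  by (rule quot_space_J)

abbreviation "\<Lambda> \<equiv> Lam m :: ('k, 'k lam) module"

definition rho :: "'k lam \<Rightarrow> 'k lm" where
  "rho = Q.class_coord (kap m)"

lemma kap_add': "x \<in> carrier kq \<Longrightarrow> y \<in> carrier kq \<Longrightarrow> kap m (x \<oplus>\<^bsub>kq\<^esub> y) = kap m x + kap m y"
  by (simp add: kap_add)

lemma rho_coset: "x \<in> carrier kq \<Longrightarrow> rho (J +>\<^bsub>kq\<^esub> x) = kap m x"
  unfolding rho_def by (rule Q.class_coord[OF kap_add' J_kernel])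

lemma rho_bij: "bij_betw rho (carrier \<Lambda>) (LM m)"
  unfolding rho_def Lam_def kap_carrier[symmetric] by (rule Q.bij_class_coord[OF kap_add' J_kernel])

lemma Lam_cases:
  assumes "X \<in> carrier \<Lambda>"
  obtains x where "x \<in> carrier kq" "X = J +>\<^bsub>kq\<^esub> x"
  using assms unfolding Lam_def Q.quot_carrier by blast

lemma coset_Lam: "x \<in> carrier kq \<Longrightarrow> J +>\<^bsub>kq\<^esub> x \<in> carrier \<Lambda>"
  unfolding Lam_def Q.quot_carrier by blast

lemma rho_LM: "X \<in> carrier \<Lambda> \<Longrightarrow> rho X \<in> LM m"
  using rho_bij by (auto simp: bij_betw_def)

lemma rho_eqI: "X \<in> carrier \<Lambda> \<Longrightarrow> Y \<in> carrier \<Lambda> \<Longrightarrow> rho X = rho Y \<Longrightarrow> X = Y"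
  using rho_bij by (auto simp: bij_betw_def dest: inj_onD)

lemma Lam_add:
  assumes "X \<in> carrier \<Lambda>" "Y \<in> carrier \<Lambda>"
  shows "X \<oplus>\<^bsub>\<Lambda>\<^esub> Y \<in> carrier \<Lambda>" "rho (X \<oplus>\<^bsub>\<Lambda>\<^esub> Y) = rho X + rho Y"
proof -
  obtain x y where "x \<in> carrier kq" "X = J +>\<^bsub>kq\<^esub> x" "y \<in> carrier kq" "Y = J +>\<^bsub>kq\<^esub> y"
    using assms by (metis Lam_cases)
  moreover from this have "X \<oplus>\<^bsub>\<Lambda>\<^esub> Y = J +>\<^bsub>kq\<^esub> (x \<oplus>\<^bsub>kq\<^esub> y)"
    unfolding Lam_def by (simp only: Q.quot_add)
  ultimately show "X \<oplus>\<^bsub>\<Lambda>\<^esub> Y \<in> carrier \<Lambda>" "rho (X \<oplus>\<^bsub>\<Lambda>\<^esub> Y) = rho X + rho Y"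
    using kq.a_closed[of x y] by (simp_all only: coset_Lam rho_coset kap_add')
qed

lemma Lam_mult:
  assumes "X \<in> carrier \<Lambda>" "Y \<in> carrier \<Lambda>"
  shows "X \<otimes>\<^bsub>\<Lambda>\<^esub> Y \<in> carrier \<Lambda>" "rho (X \<otimes>\<^bsub>\<Lambda>\<^esub> Y) = lmul (rho X) (rho Y)"
proof -
  obtain x y where xy: "x \<in> carrier kq" "X = J +>\<^bsub>kq\<^esub> x" "y \<in> carrier kq" "Y = J +>\<^bsub>kq\<^esub> y"
    using assms by (metis Lam_cases)
  then have "X \<otimes>\<^bsub>\<Lambda>\<^esub> Y = J +>\<^bsub>kq\<^esub> (x \<otimes>\<^bsub>kq\<^esub> y)"
    using J.rcoset_mult_add[of x y] by (simp add: Lam_def quot_def FactRing_def)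
  moreover have "kap m (x \<otimes>\<^bsub>kq\<^esub> y) = lmul (kap m x) (kap m y)"
    using xy kap_pmul[OF _ _ fin_quiver] by simp
  ultimately show "X \<otimes>\<^bsub>\<Lambda>\<^esub> Y \<in> carrier \<Lambda>" "rho (X \<otimes>\<^bsub>\<Lambda>\<^esub> Y) = lmul (rho X) (rho Y)"
    using kq.m_closed[of x y] xy by (simp_all only: coset_Lam rho_coset)
qed

lemma Lam_smult:
  assumes "X \<in> carrier \<Lambda>"
  shows "c \<odot>\<^bsub>\<Lambda>\<^esub> X \<in> carrier \<Lambda>" "rho (c \<odot>\<^bsub>\<Lambda>\<^esub> X) = lsc c (rho X)"
proof -
  obtain x where x: "x \<in> carrier kq" "X = J +>\<^bsub>kq\<^esub> x"
    using assms by (metis Lam_cases)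
  then have "c \<odot>\<^bsub>\<Lambda>\<^esub> X = J +>\<^bsub>kq\<^esub> (c \<odot>\<^bsub>kq\<^esub> x)"
    unfolding Lam_def by (simp only: Q.quot_smult)
  moreover have "kap m (c \<odot>\<^bsub>kq\<^esub> x) = lsc c (kap m x)"
    by (simp add: kap_smult)
  ultimately show "c \<odot>\<^bsub>\<Lambda>\<^esub> X \<in> carrier \<Lambda>" "rho (c \<odot>\<^bsub>\<Lambda>\<^esub> X) = lsc c (rho X)"
    using Q.smult_closed[OF x(1), of c] x by (simp_all only: coset_Lam rho_coset)
qed

lemma Lam_zero: "\<zero>\<^bsub>\<Lambda>\<^esub> \<in> carrier \<Lambda>" "rho \<zero>\<^bsub>\<Lambda>\<^esub> = 0"
proof -
  have "\<zero>\<^bsub>\<Lambda>\<^esub> = J +>\<^bsub>kq\<^esub> \<zero>\<^bsub>kq\<^esub>"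
    unfolding Lam_def Q.quot_zero Q.coset_zero ..
  then show "\<zero>\<^bsub>\<Lambda>\<^esub> \<in> carrier \<Lambda>" "rho \<zero>\<^bsub>\<Lambda>\<^esub> = 0"
    using coset_Lam[OF kq.zero_closed] rho_coset[OF kq.zero_closed] by simp_all
qed

lemma Lam_one: "\<one>\<^bsub>\<Lambda>\<^esub> \<in> carrier \<Lambda>" "rho \<one>\<^bsub>\<Lambda>\<^esub> = lone"
proof -
  have one: "\<one>\<^bsub>\<Lambda>\<^esub> = J +>\<^bsub>kq\<^esub> \<one>\<^bsub>kq\<^esub>"
    by (simp add: Lam_def quot_def FactRing_def)
  have "kap m \<one>\<^bsub>kq\<^esub> = (\<Sum>v\<in>{0..<int m}. bas m v Vx)"
    by (simp add: kap_sum kap_single ev_def lsc_def[abs_def])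
  also have "\<dots> = lone"
  proof -
    have "lone \<in> LM m" by (rule LM_closed)
    from LM_expand[OF this m_pos] show ?thesis
      by (simp add: sum_bt lone_def lsc_def[abs_def] zero_fun_def[symmetric])
  qed
  finally show "\<one>\<^bsub>\<Lambda>\<^esub> \<in> carrier \<Lambda>" "rho \<one>\<^bsub>\<Lambda>\<^esub> = lone"
    using coset_Lam[OF kq.one_closed] rho_coset[OF kq.one_closed] one by simp_all
qed

lemma Lam_gens:
  "eL m i \<in> carrier \<Lambda>" "rho (eL m i) = bas m i Vx"
  "aL m i \<in> carrier \<Lambda>" "rho (aL m i) = bas m i Fw"
  "abarL m i \<in> carrier \<Lambda>" "rho (abarL m i) = bas m (i + 1) Bw"
  using gens_closed coset_Lam rho_coset kap_gens by (simp_all add: eL_def aL_def abarL_def)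

end

section \<open>Coordinates for tensor products\<close>

lemma push_add: "push h (x + y) = push h x + push h y"
  unfolding push_def by (rule setsum_keys_plus_distrib) (simp_all add: single_add)

lemma push_single [simp]: "push h (Poly_Mapping.single p c) = Poly_Mapping.single (h p) c"
  by (simp add: push_def)

lemma push_zero [simp]: "push h 0 = 0"
  by (simp add: push_def)

text \<open>Both factors have a basis indexed by the four path types. The aim is that the sixteen
  pairs give a basis of the quotient by the bilinearity relations, with \<open>tcoord\<close> as
  coordinates.\<close>

locale tensor_coord =
  fixes U :: "('k::field, 'u) module" and V :: "('k, 'v) module"
    and cU :: "'u \<Rightarrow> bt \<Rightarrow> 'k" and cV :: "'v \<Rightarrow> bt \<Rightarrow> 'k" and bU :: "bt \<Rightarrow> 'u" and bV :: "bt \<Rightarrow> 'v"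
  assumes U_add: "u \<in> carrier U \<Longrightarrow> u' \<in> carrier U \<Longrightarrow> u \<oplus>\<^bsub>U\<^esub> u' \<in> carrier U"
    and U_smult: "u \<in> carrier U \<Longrightarrow> c \<odot>\<^bsub>U\<^esub> u \<in> carrier U"
    and V_add: "v \<in> carrier V \<Longrightarrow> v' \<in> carrier V \<Longrightarrow> v \<oplus>\<^bsub>V\<^esub> v' \<in> carrier V"
    and V_smult: "v \<in> carrier V \<Longrightarrow> c \<odot>\<^bsub>V\<^esub> v \<in> carrier V"
    and bU: "bU s \<in> carrier U" and bV: "bV s \<in> carrier V"
    and cU_add: "u \<in> carrier U \<Longrightarrow> u' \<in> carrier U \<Longrightarrow> cU (u \<oplus>\<^bsub>U\<^esub> u') s = cU u s + cU u' s"
    and cV_add: "v \<in> carrier V \<Longrightarrow> v' \<in> carrier V \<Longrightarrow> cV (v \<oplus>\<^bsub>V\<^esub> v') s = cV v s + cV v' s"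
    and cU_smult: "u \<in> carrier U \<Longrightarrow> cU (c \<odot>\<^bsub>U\<^esub> u) s = c * cU u s"
    and cV_smult: "v \<in> carrier V \<Longrightarrow> cV (c \<odot>\<^bsub>V\<^esub> v) s = c * cV v s"
    and U_expand: "u \<in> carrier U \<Longrightarrow> u = (cU u Vx \<odot>\<^bsub>U\<^esub> bU Vx) \<oplus>\<^bsub>U\<^esub> ((cU u Fw \<odot>\<^bsub>U\<^esub> bU Fw) \<oplus>\<^bsub>U\<^esub>
        ((cU u Bw \<odot>\<^bsub>U\<^esub> bU Bw) \<oplus>\<^bsub>U\<^esub> (cU u So \<odot>\<^bsub>U\<^esub> bU So)))"
    and V_expand: "v \<in> carrier V \<Longrightarrow> v = (cV v Vx \<odot>\<^bsub>V\<^esub> bV Vx) \<oplus>\<^bsub>V\<^esub> ((cV v Fw \<odot>\<^bsub>V\<^esub> bV Fw) \<oplus>\<^bsub>V\<^esub>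
        ((cV v Bw \<odot>\<^bsub>V\<^esub> bV Bw) \<oplus>\<^bsub>V\<^esub> (cV v So \<odot>\<^bsub>V\<^esub> bV So)))"
    and cU_bU: "cU (bU s) s' = (if s = s' then 1 else 0)"
    and cV_bV: "cV (bV s) s' = (if s = s' then 1 else 0)"
begin

abbreviation "TP \<equiv> pair_space U V"
abbreviation "TK \<equiv> tensor_kernel U V"
abbreviation "sgl u v c \<equiv> Poly_Mapping.single (u, v) (c :: 'k)"

definition kt :: "('u \<times> 'v \<Rightarrow>\<^sub>0 'k) \<Rightarrow> bt \<Rightarrow> bt \<Rightarrow> 'k" where
  "kt t s s' = lext (\<lambda>(u, v). cU u s * cV v s') t"

lemma TP_simps:
  "carrier TP = {t. Poly_Mapping.keys t \<subseteq> carrier U \<times> carrier V}" "zero TP = 0" "add TP = (+)"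
  "smult TP = (\<lambda>c. Poly_Mapping.map (\<lambda>y. c * y))"
  by (simp_all add: pair_space_def)

lemma TP_group: "abelian_group TP"
  by (rule free_space_like_group) (simp_all add: TP_simps)

lemma kt_add: "kt (x + y) = kt x + kt y"
  by (intro ext) (simp add: kt_def lext_add)

lemma kt_single: "kt (sgl u v c) = (\<lambda>s s'. c * (cU u s * cV v s'))"
  by (intro ext) (simp add: kt_def)

lemma kt_smult: "kt (Poly_Mapping.map (\<lambda>y. c * y) x) = (\<lambda>s s'. c * kt x s s')"
  by (intro ext) (simp add: kt_def lext_smult)

lemma sgl_closed: "u \<in> carrier U \<Longrightarrow> v \<in> carrier V \<Longrightarrow> sgl u v c \<in> carrier TP"
  by (simp add: TP_simps)

lemma rels_closed: "x \<in> bilinear_rels U V \<Longrightarrow> x \<in> carrier TP"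
  unfolding bilinear_rels_def TP_simps mem_Collect_eq
  by (elim UnE CollectE exE conjE; hypsubst; intro keys_diff_subset)
    (auto simp: U_add V_add U_smult V_smult)

lemma rels_kt: "x \<in> bilinear_rels U V \<Longrightarrow> kt x = 0"
  unfolding bilinear_rels_def
  by (elim UnE CollectE exE conjE; rule ext; rule ext)
    (simp_all add: kt_def lext_minus cU_add cV_add cU_smult cV_smult distrib_left distrib_right mult.assoc)

lemma TK_closed: "x \<in> TK \<Longrightarrow> x \<in> carrier TP \<and> kt x = 0"
  unfolding tensor_kernel_def
proof (induction rule: lin_span.induct)
  case (incl x)
  then show ?case by (simp add: rels_closed rels_kt)
next
  case (smult x c)
  then show ?case
    using order.trans[OF keys_map_mult, of x] by (auto simp: TP_simps kt_smult fun_eq_iff)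
qed (auto simp: TP_simps kt_add kt_def fun_eq_iff dest!: subsetD[OF keys_add])

lemma TK_facts:
  "0 \<in> TK" "x \<in> TK \<Longrightarrow> y \<in> TK \<Longrightarrow> x + y \<in> TK" "x \<in> TK \<Longrightarrow> Poly_Mapping.map (\<lambda>y. c * y) x \<in> TK"
  using lin_span.zero[of TP] lin_span.add[of x TP _ y] lin_span.smult[of x TP _ c]
  by (auto simp: tensor_kernel_def TP_simps)

lemma TK_rels: "x \<in> bilinear_rels U V \<Longrightarrow> x \<in> TK"
  by (simp add: tensor_kernel_def lin_span.incl)

lemma map_mult_diff: "Poly_Mapping.map (\<lambda>y. (c::'k) * y) (p - q) = 
    Poly_Mapping.map (\<lambda>y. c * y) p - Poly_Mapping.map (\<lambda>y. c * y) q"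
  by (rule poly_mapping_eqI) (simp add: lookup_map_mult lookup_minus right_diff_distrib)

lemma TK_add_left:
  assumes "u \<in> carrier U" "u' \<in> carrier U" "v \<in> carrier V"
  shows "sgl (u \<oplus>\<^bsub>U\<^esub> u') v c - sgl u v c - sgl u' v c \<in> TK"
proof -
  have "sgl (u \<oplus>\<^bsub>U\<^esub> u') v 1 - sgl u v 1 - sgl u' v 1 \<in> TK"
    by (rule TK_rels) (use assms in \<open>auto simp: bilinear_rels_def\<close>)
  from TK_facts(3)[OF this, of c] show ?thesis
    by (simp add: map_mult_diff map_mult_single)
qed

lemma TK_add_right:
  assumes "u \<in> carrier U" "v \<in> carrier V" "v' \<in> carrier V"
  shows "sgl u (v \<oplus>\<^bsub>V\<^esub> v') c - sgl u v c - sgl u v' c \<in> TK"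
proof -
  have "sgl u (v \<oplus>\<^bsub>V\<^esub> v') 1 - sgl u v 1 - sgl u v' 1 \<in> TK"
    by (rule TK_rels) (use assms in \<open>auto simp: bilinear_rels_def\<close>)
  from TK_facts(3)[OF this, of c] show ?thesis
    by (simp add: map_mult_diff map_mult_single)
qed

lemma TK_smult_left:
  assumes "u \<in> carrier U" "v \<in> carrier V"
  shows "sgl (d \<odot>\<^bsub>U\<^esub> u) v c - sgl u v (c * d) \<in> TK"
proof -
  have "sgl (d \<odot>\<^bsub>U\<^esub> u) v 1 - sgl u v d \<in> TK"
    by (rule TK_rels) (use assms in \<open>auto simp: bilinear_rels_def\<close>)
  from TK_facts(3)[OF this, of c] show ?thesis
    by (simp add: map_mult_diff map_mult_single)
qed

lemma TK_smult_right:
  assumes "u \<in> carrier U" "v \<in> carrier V"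
  shows "sgl u (d \<odot>\<^bsub>V\<^esub> v) c - sgl u v (c * d) \<in> TK"
proof -
  have "sgl u (d \<odot>\<^bsub>V\<^esub> v) 1 - sgl u v d \<in> TK"
    by (rule TK_rels) (use assms in \<open>auto simp: bilinear_rels_def\<close>)
  from TK_facts(3)[OF this, of c] show ?thesis
    by (simp add: map_mult_diff map_mult_single)
qed

lemma TK_step_left:
  assumes "u \<in> carrier U" "u' \<in> carrier U" "v \<in> carrier V" "sgl u' v c - w \<in> TK"
  shows "sgl ((d \<odot>\<^bsub>U\<^esub> u) \<oplus>\<^bsub>U\<^esub> u') v c - (sgl u v (c * d) + w) \<in> TK"
  using TK_facts(2)[OF TK_facts(2)[OF TK_add_left[OF U_smult[OF assms(1), of d] assms(2,3), of c] 
      TK_smult_left[OF assms(1,3), of d c]] assms(4)]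
  by (simp add: algebra_simps)

lemma TK_step_right:
  assumes "u \<in> carrier U" "v \<in> carrier V" "v' \<in> carrier V" "sgl u v' c - w \<in> TK"
  shows "sgl u ((d \<odot>\<^bsub>V\<^esub> v) \<oplus>\<^bsub>V\<^esub> v') c - (sgl u v (c * d) + w) \<in> TK"
  using TK_facts(2)[OF TK_facts(2)[OF TK_add_right[OF assms(1) V_smult[OF assms(2), of d] assms(3), of c] 
      TK_smult_right[OF assms(1,2), of d c]] assms(4)]
  by (simp add: algebra_simps)

lemma TK_expand_left:
  assumes u: "u \<in> carrier U" and v: "v \<in> carrier V"
  shows "sgl u v c - (\<Sum>s\<in>UNIV. sgl (bU s) v (c * cU u s)) \<in> TK"
proof -
  have "sgl u v c - (sgl (bU Vx) v (c * cU u Vx) + (sgl (bU Fw) v (c * cU u Fw) +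
      (sgl (bU Bw) v (c * cU u Bw) + sgl (bU So) v (c * cU u So)))) \<in> TK"
    by (subst U_expand[OF u]) (intro TK_step_left TK_smult_left bU v U_add U_smult)
  then show ?thesis
    by (simp add: sum_bt add.assoc)
qed

lemma TK_expand_right:
  assumes u: "u \<in> carrier U" and v: "v \<in> carrier V"
  shows "sgl u v c - (\<Sum>s\<in>UNIV. sgl u (bV s) (c * cV v s)) \<in> TK"
proof -
  have "sgl u v c - (sgl u (bV Vx) (c * cV v Vx) + (sgl u (bV Fw) (c * cV v Fw) +
      (sgl u (bV Bw) (c * cV v Bw) + sgl u (bV So) (c * cV v So)))) \<in> TK"
    by (subst V_expand[OF v]) (intro TK_step_right TK_smult_right bV u V_add V_smult)
  then show ?thesis
    by (simp add: sum_bt add.assoc)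
qed

lemma TK_sum: "(\<And>a. a \<in> A \<Longrightarrow> f a - g a \<in> TK) \<Longrightarrow> sum f A - sum g A \<in> TK"
proof (induction A rule: infinite_finite_induct)
  case (insert a A)
  then have "(f a - g a) + (sum f A - sum g A) \<in> TK"
    by (intro TK_facts(2)) auto
  with insert(1,2) show ?case
    by (simp add: algebra_simps)
qed (auto simp: TK_facts(1))

definition tnf :: "(bt \<Rightarrow> bt \<Rightarrow> 'k) \<Rightarrow> ('u \<times> 'v \<Rightarrow>\<^sub>0 'k)" where
  "tnf f = (\<Sum>s\<in>UNIV. \<Sum>s'\<in>UNIV. sgl (bU s) (bV s') (f s s'))"

lemma tnf_add: "tnf (f + g) = tnf f + tnf g"
  by (simp add: tnf_def single_add sum.distrib)

lemma tnf_zero: "tnf 0 = 0"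
  by (simp add: tnf_def)

lemma tnf_closed: "tnf f \<in> carrier TP"
  unfolding tnf_def TP_simps mem_Collect_eq by (intro keys_sum_subset) (auto simp: bU bV)

lemma kt_sum: "kt (sum f A) s s' = (\<Sum>a\<in>A. kt (f a) s s')"
  by (simp add: kt_def lext_sum)

lemma kt_tnf: "kt (tnf f) = f"
proof (intro ext)
  fix s s'
  show "kt (tnf f) s s' = f s s'"
    unfolding tnf_def kt_sum kt_single cU_bU cV_bV by (cases s; cases s') (simp_all add: sum_bt)
qed

text \<open>For a single pair, the left factor is expanded in its basis modulo the bilinearity
  relations, and then the right factor of each resulting term.\<close>

lemma tnf_kt: "Poly_Mapping.keys t \<subseteq> carrier U \<times> carrier V \<Longrightarrow> t - tnf (kt t) \<in> TK"
proof (induction rule: poly_mapping_span_induct)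
  case zero
  have "kt 0 = 0"
    by (simp add: kt_def fun_eq_iff)
  then show ?case
    using TK_facts(1) by (simp only: tnf_zero diff_zero)
next
  case (single p c)
  obtain u v where p: "p = (u, v)" "u \<in> carrier U" "v \<in> carrier V"
    using single by (cases p) auto
  have "(\<Sum>s\<in>UNIV. sgl (bU s) v (c * cU u s)) - (\<Sum>s\<in>UNIV. \<Sum>s'\<in>UNIV. sgl (bU s) (bV s') (c * cU u s * cV v s')) \<in> TK"
    by (intro TK_sum TK_expand_right bU p)
  from TK_facts(2)[OF TK_expand_left[OF p(2,3), of c] this]
  show ?case
    by (simp add: p(1) tnf_def kt_single mult.assoc)
next
  case (add x y)
  from TK_facts(2)[OF add] have "x + y - (tnf (kt x) + tnf (kt y)) \<in> TK"
    by (simp add: algebra_simps)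
  then show ?case
    by (simp only: kt_add tnf_add)
qed

lemma TK_kernel: "TK = {t \<in> carrier TP. kt t = 0}"
proof (intro equalityI subsetI)
  fix t assume "t \<in> {t \<in> carrier TP. kt t = 0}"
  then show "t \<in> TK"
    using tnf_kt[of t] by (simp add: TP_simps tnf_zero)
qed (use TK_closed in auto)

lemma quot_space_TK: "quot_space TK TP"
proof (intro quot_space.intro quot_space_axioms.intro)
  have neg: "\<ominus>\<^bsub>TP\<^esub> x = - x" if "x \<in> carrier TP" for x
    by (rule abelian_group.minus_equality[OF TP_group]) (use that in \<open>auto simp: TP_simps in_keys_iff\<close>)
  have "additive_subgroup TK TP"
  proof (intro additive_subgroup.intro subgroup.intro, unfold monoid_record_simps)
    fix x assume x: "x \<in> TK"
    have e: "Poly_Mapping.map (\<lambda>y. (- 1 :: 'k) * y) x = - x"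
      by (rule poly_mapping_eqI) (subst lookup_map_mult, simp)
    show "inv\<^bsub>add_monoid TP\<^esub> x \<in> TK"
      using neg[of x] TK_closed[OF x] TK_facts(3)[OF x, of "- 1"] unfolding e a_inv_def by simp
  qed (use TK_closed TK_facts in \<open>auto simp: TP_simps\<close>)
  then show "abelian_subgroup TK TP"
    by (rule abelian_subgroupI3[OF _ TP_group])
  show "x \<in> carrier TP \<Longrightarrow> c \<odot>\<^bsub>TP\<^esub> x \<in> carrier TP" for x c
    using order.trans[OF keys_map_mult] by (simp add: TP_simps)
  show "x \<in> TK \<Longrightarrow> c \<odot>\<^bsub>TP\<^esub> x \<in> TK" for x c
    using TK_facts(3) by (simp add: TP_simps)
qed (simp add: TP_simps map_mult_add)

sublocale T: quot_space TK TP
  by (rule quot_space_TK)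

definition tcoord :: "('u \<times> 'v \<Rightarrow>\<^sub>0 'k) set \<Rightarrow> bt \<Rightarrow> bt \<Rightarrow> 'k" where
  "tcoord = T.class_coord kt"

lemma kt_add': "x \<in> carrier TP \<Longrightarrow> y \<in> carrier TP \<Longrightarrow> kt (x \<oplus>\<^bsub>TP\<^esub> y) = kt x + kt y"
  by (simp add: TP_simps kt_add)

lemma tcoord_class: "t \<in> carrier TP \<Longrightarrow> tcoord (tensor_class U V t) = kt t"
  unfolding tcoord_def tensor_class_def by (rule T.class_coord[OF kt_add' TK_kernel])

lemma tensor_class_eq_iff: "t \<in> carrier TP \<Longrightarrow> t' \<in> carrier TP \<Longrightarrow>
    tensor_class U V t = tensor_class U V t' \<longleftrightarrow> kt t = kt t'"
  unfolding tensor_class_def by (rule T.coset_eq_coord[OF kt_add' TK_kernel])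

lemma tcoord_bij: "bij_betw tcoord (carrier (tensor_space U V)) UNIV"
proof -
  have "kt ` carrier TP = UNIV"
    using kt_tnf tnf_closed by (metis UNIV_eq_I image_eqI)
  then show ?thesis
    using T.bij_class_coord[OF kt_add' TK_kernel] by (simp add: tcoord_def tensor_space_def)
qed

lemma tensor_cases:
  assumes "X \<in> carrier (tensor_space U V)"
  obtains t where "t \<in> carrier TP" "X = tensor_class U V t"
  using assms unfolding tensor_space_def T.quot_carrier tensor_class_def by blast

lemma tensor_class_closed: "t \<in> carrier TP \<Longrightarrow> tensor_class U V t \<in> carrier (tensor_space U V)"
  unfolding tensor_space_def T.quot_carrier tensor_class_def by blast

lemma tensor_add:
  assumes "X \<in> carrier (tensor_space U V)" "Y \<in> carrier (tensor_space U V)"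
  shows "X \<oplus>\<^bsub>tensor_space U V\<^esub> Y \<in> carrier (tensor_space U V)"
    "tcoord (X \<oplus>\<^bsub>tensor_space U V\<^esub> Y) = tcoord X + tcoord Y"
proof -
  obtain x y where xy: "x \<in> carrier TP" "X = tensor_class U V x" "y \<in> carrier TP" "Y = tensor_class U V y"
    using assms by (metis tensor_cases)
  have "X \<oplus>\<^bsub>tensor_space U V\<^esub> Y = tensor_class U V (x \<oplus>\<^bsub>TP\<^esub> y)"
    unfolding xy(2,4) tensor_space_def tensor_class_def by (rule T.quot_add[OF xy(1,3)])
  then show "X \<oplus>\<^bsub>tensor_space U V\<^esub> Y \<in> carrier (tensor_space U V)"
    "tcoord (X \<oplus>\<^bsub>tensor_space U V\<^esub> Y) = tcoord X + tcoord Y"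
    using xy T.a_closed[OF xy(1,3)] by (simp_all add: tensor_class_closed tcoord_class kt_add')
qed

lemma tensor_smult:
  assumes "X \<in> carrier (tensor_space U V)"
  shows "c \<odot>\<^bsub>tensor_space U V\<^esub> X \<in> carrier (tensor_space U V)"
    "tcoord (c \<odot>\<^bsub>tensor_space U V\<^esub> X) = (\<lambda>s s'. c * tcoord X s s')"
proof -
  obtain x where x: "x \<in> carrier TP" "X = tensor_class U V x"
    using assms by (metis tensor_cases)
  have "c \<odot>\<^bsub>tensor_space U V\<^esub> X = tensor_class U V (c \<odot>\<^bsub>TP\<^esub> x)"
    unfolding x(2) tensor_space_def tensor_class_def by (rule T.quot_smult[OF x(1)])
  moreover have "kt (c \<odot>\<^bsub>TP\<^esub> x) = (\<lambda>s s'. c * kt x s s')"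
    by (simp add: TP_simps kt_smult)
  ultimately show "c \<odot>\<^bsub>tensor_space U V\<^esub> X \<in> carrier (tensor_space U V)"
    "tcoord (c \<odot>\<^bsub>tensor_space U V\<^esub> X) = (\<lambda>s s'. c * tcoord X s s')"
    using x T.smult_closed[OF x(1), of c] by (simp_all add: tensor_class_closed tcoord_class)
qed

lemma tensor_zero: "\<zero>\<^bsub>tensor_space U V\<^esub> \<in> carrier (tensor_space U V)" "tcoord \<zero>\<^bsub>tensor_space U V\<^esub> = 0"
proof -
  have z: "\<zero>\<^bsub>tensor_space U V\<^esub> = tensor_class U V \<zero>\<^bsub>TP\<^esub>"
    unfolding tensor_space_def tensor_class_def T.quot_zero T.coset_zero ..
  have "kt 0 = 0"
    by (simp add: kt_def fun_eq_iff)
  then show "\<zero>\<^bsub>tensor_space U V\<^esub> \<in> carrier (tensor_space U V)" "tcoord \<zero>\<^bsub>tensor_space U V\<^esub> = 0"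
    using T.zero_closed unfolding z by (simp_all add: tensor_class_closed tcoord_class TP_simps)
qed

text \<open>Computes the actions on a tensor product. A map \<open>h\<close> of pairs whose effect
  on the coordinates of pure tensors is the linear map \<open>\<Phi>\<close> induces
  \<open>\<Phi>\<close> on all coordinates; since coordinates determine classes, the result does not
  depend on the representative.\<close>

lemma tensor_push:
  assumes h: "\<And>u v. u \<in> carrier U \<Longrightarrow> v \<in> carrier V \<Longrightarrow> h (u, v) \<in> carrier U \<times> carrier V"
    and \<Phi>: "\<And>u v. u \<in> carrier U \<Longrightarrow> v \<in> carrier V \<Longrightarrow>
        (\<lambda>s s'. cU (fst (h (u, v))) s * cV (snd (h (u, v))) s') = \<Phi> (\<lambda>s s'. cU u s * cV v s')"
    and \<Phi>_add: "\<And>f g. \<Phi> (f + g) = \<Phi> f + \<Phi> g" 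
    and \<Phi>_sc: "\<And>c f. \<Phi> (\<lambda>s s'. c * f s s') = (\<lambda>s s'. c * \<Phi> f s s')"
    and X: "X \<in> carrier (tensor_space U V)"
  shows "(\<Union>t\<in>X. tensor_class U V (push h t)) \<in> carrier (tensor_space U V)"
    "tcoord (\<Union>t\<in>X. tensor_class U V (push h t)) = \<Phi> (tcoord X)"
proof -
  obtain x where x: "x \<in> carrier TP" "X = tensor_class U V x"
    using X by (metis tensor_cases)
  have \<Phi>0: "\<Phi> 0 = 0"
    using \<Phi>_add[of 0 0] by simp
  have p: "push h t \<in> carrier TP \<and> kt (push h t) = \<Phi> (kt t)" if "t \<in> carrier TP" for t
    using that unfolding TP_simps mem_Collect_eq
  proof (induction rule: poly_mapping_span_induct)
    case zero
    have "kt 0 = 0"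
      by (simp add: kt_def fun_eq_iff)
    then show ?case
      unfolding push_zero \<open>kt 0 = 0\<close> \<Phi>0 by simp
  next
    case (single p c)
    obtain u v where p: "p = (u, v)" "u \<in> carrier U" "v \<in> carrier V"
      using single by (cases p) auto
    obtain u' v' where h': "h (u, v) = (u', v')"
      by (cases "h (u, v)")
    show ?case
      using h[OF p(2,3)] \<Phi>[OF p(2,3)] by (auto simp: p(1) h' kt_single \<Phi>_sc dest: sym)
  next
    case (add x y)
    then have "push h x + push h y \<in> carrier TP"
      by (simp add: TP_simps keys_add_subset)
    with add show ?case
      by (simp only: push_add kt_add \<Phi>_add TP_simps mem_Collect_eq)
  qed
  have "(\<Union>t\<in>X. tensor_class U V (push h t)) = tensor_class U V (push h x)"
    unfolding x(2) unfolding tensor_class_def[of U V x]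
  proof (rule T.UN_coset_coord[OF kt_add' TK_kernel x(1)])
    fix y assume "y \<in> carrier TP" "kt y = kt x"
    then show "tensor_class U V (push h y) = tensor_class U V (push h x)"
      using p[of y] p[OF x(1)] by (simp add: tensor_class_eq_iff)
  qed
  then show "(\<Union>t\<in>X. tensor_class U V (push h t)) \<in> carrier (tensor_space U V)"
    "tcoord (\<Union>t\<in>X. tensor_class U V (push h t)) = \<Phi> (tcoord X)"
    using p[OF x(1)] x by (simp_all add: tensor_class_closed tcoord_class)
qed

end

section \<open>Coordinates for the resolution\<close>

lemma endc_simps:
  "endc (f + g) i s = endc f i s + endc g i s" "endc (lsc c f) i s = c * endc f i s"
  by (cases s; simp add: endc_def lsc_def)+

lemma expand_end: "f \<in> LM m \<Longrightarrow> lmul f (bas m i Vx) = (\<Sum>s\<in>UNIV. lsc (endc f i s) (ebas m i s))"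
proof -
  assume "f \<in> LM m"
  moreover have "cmul f (\<lambda>u. if u = Vx then 1 else 0) i s = endc f i s" for s
    by (cases s) (simp_all add: cmul_def endc_def)
  ultimately show ?thesis
    using plact_ebas[of f m i Vx] by (simp add: ebas_def[of m i Vx])
qed

lemma expand_start: "f \<in> LM m \<Longrightarrow> lmul (bas m j Vx) f = (\<Sum>s\<in>UNIV. lsc (f j s) (bas m j s))"
proof -
  assume "f \<in> LM m"
  moreover have "rmul (\<lambda>u. if u = Vx then 1 else 0) f j s = f j s" for s
    by (cases s) (simp_all add: rmul_def)
  ultimately show ?thesis
    using pract_bas[of f m j Vx] by simp
qed

lemma ebas_end: "lmul (ebas m i s) (bas m i Vx) = ebas m i s"
  by (cases s) (simp_all add: ebas_def bas_mult_Vx)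

lemma bas_start: "lmul (bas m j Vx) (bas m j s) = bas m j s"
  unfolding bas_Vx_mult by (rule fun2_eqI) (auto simp: bas_def)

lemma endc_ebas: "endc (ebas m i s) i s' = (if s = s' then 1 else 0)"
  by (cases s; cases s') (simp_all add: endc_def ebas_def bas_def)

context zigzag
begin

definition lamb :: "'k lm \<Rightarrow> 'k lam" where
  "lamb f = inv_into (carrier \<Lambda>) rho f"

lemma lamb: "f \<in> LM m \<Longrightarrow> lamb f \<in> carrier \<Lambda>" "f \<in> LM m \<Longrightarrow> rho (lamb f) = f"
  using rho_bij inv_into_into[of f rho "carrier \<Lambda>"] bij_betw_inv_into_right[OF rho_bij, of f]
  by (auto simp: lamb_def bij_betw_def)

abbreviation "LP i \<equiv> left_principal \<Lambda> (eL m i)"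
abbreviation "RP j \<equiv> right_principal \<Lambda> (eL m j)"

lemma LP_simps [simp]: "add (LP i) = add \<Lambda>" "smult (LP i) = smult \<Lambda>" "add (RP i) = add \<Lambda>" "smult (RP i) = smult \<Lambda>"
  by (simp_all add: left_principal_def right_principal_def)

lemma LP_iff: "u \<in> carrier (LP i) \<longleftrightarrow> u \<in> carrier \<Lambda> \<and> lmul (rho u) (bas m i Vx) = rho u"
proof
  assume "u \<in> carrier (LP i)"
  then obtain x where "x \<in> carrier \<Lambda>" "u = x \<otimes>\<^bsub>\<Lambda>\<^esub> eL m i"
    by (auto simp: left_principal_def)
  then show "u \<in> carrier \<Lambda> \<and> lmul (rho u) (bas m i Vx) = rho u"
    by (simp add: Lam_mult Lam_gens lmul_assoc bas_mult_Vx)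
next
  assume u: "u \<in> carrier \<Lambda> \<and> lmul (rho u) (bas m i Vx) = rho u"
  then have "u = u \<otimes>\<^bsub>\<Lambda>\<^esub> eL m i"
    by (intro rho_eqI) (simp_all add: Lam_mult Lam_gens)
  then show "u \<in> carrier (LP i)"
    using u by (auto simp: left_principal_def)
qed

lemma RP_iff: "u \<in> carrier (RP i) \<longleftrightarrow> u \<in> carrier \<Lambda> \<and> lmul (bas m i Vx) (rho u) = rho u"
proof
  assume "u \<in> carrier (RP i)"
  then obtain x where "x \<in> carrier \<Lambda>" "u = eL m i \<otimes>\<^bsub>\<Lambda>\<^esub> x"
    by (auto simp: right_principal_def)
  then show "u \<in> carrier \<Lambda> \<and> lmul (bas m i Vx) (rho u) = rho u"
    by (simp add: Lam_mult Lam_gens lmul_assoc[symmetric] bas_mult_Vx)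
next
  assume u: "u \<in> carrier \<Lambda> \<and> lmul (bas m i Vx) (rho u) = rho u"
  then have "u = eL m i \<otimes>\<^bsub>\<Lambda>\<^esub> u"
    by (intro rho_eqI) (simp_all add: Lam_mult Lam_gens)
  then show "u \<in> carrier (RP i)"
    using u by (auto simp: right_principal_def)
qed

text \<open>Paths ending at \<open>i\<close> are a basis of the left factor and paths starting at
  \<open>j\<close> one of the right factor, in agreement with the indexing of
  \<open>PM\<close>.\<close>

lemma tensor_coord_principal:
  "tensor_coord (LP i) (RP j) (\<lambda>u. endc (rho u) i) (\<lambda>v. rho v j) (\<lambda>s. lamb (ebas m i s)) (\<lambda>s. lamb (bas m j s))"
proof
  have e: "lamb (ebas m i s) \<in> carrier \<Lambda>" "rho (lamb (ebas m i s)) = ebas m i s"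
    "lamb (bas m j s) \<in> carrier \<Lambda>" "rho (lamb (bas m j s)) = bas m j s" for s
    by (simp_all add: lamb LM_closed)
  show "lamb (ebas m i s) \<in> carrier (LP i)" "lamb (bas m j s) \<in> carrier (RP j)" for s
    by (simp_all add: LP_iff RP_iff e ebas_end bas_start)
  show "endc (rho (lamb (ebas m i s))) i s' = (if s = s' then 1 else 0)"
    "rho (lamb (bas m j s)) j s' = (if s = s' then 1 else 0)" for s s'
    by (simp_all add: e endc_ebas, simp add: bas_def)
  show "u = (endc (rho u) i Vx \<odot>\<^bsub>LP i\<^esub> lamb (ebas m i Vx)) \<oplus>\<^bsub>LP i\<^esub> ((endc (rho u) i Fw \<odot>\<^bsub>LP i\<^esub> lamb (ebas m i Fw)) \<oplus>\<^bsub>LP i\<^esub>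
        ((endc (rho u) i Bw \<odot>\<^bsub>LP i\<^esub> lamb (ebas m i Bw)) \<oplus>\<^bsub>LP i\<^esub> (endc (rho u) i So \<odot>\<^bsub>LP i\<^esub> lamb (ebas m i So))))"
    if u: "u \<in> carrier (LP i)" for u
  proof (rule rho_eqI)
    have u: "u \<in> carrier \<Lambda>" "lmul (rho u) (bas m i Vx) = rho u"
      using u by (simp_all add: LP_iff)
    show "u \<in> carrier \<Lambda>" by (fact u)
    show "rho u = rho ((endc (rho u) i Vx \<odot>\<^bsub>LP i\<^esub> lamb (ebas m i Vx)) \<oplus>\<^bsub>LP i\<^esub> ((endc (rho u) i Fw \<odot>\<^bsub>LP i\<^esub> lamb (ebas m i Fw)) \<oplus>\<^bsub>LP i\<^esub>
        ((endc (rho u) i Bw \<odot>\<^bsub>LP i\<^esub> lamb (ebas m i Bw)) \<oplus>\<^bsub>LP i\<^esub> (endc (rho u) i So \<odot>\<^bsub>LP i\<^esub> lamb (ebas m i So)))))"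
      using expand_end[OF rho_LM[OF u(1)], of i] u(2) by (simp add: Lam_add Lam_smult e sum_bt add.assoc)
  qed (simp add: Lam_add Lam_smult e)
  show "v = (rho v j Vx \<odot>\<^bsub>RP j\<^esub> lamb (bas m j Vx)) \<oplus>\<^bsub>RP j\<^esub> ((rho v j Fw \<odot>\<^bsub>RP j\<^esub> lamb (bas m j Fw)) \<oplus>\<^bsub>RP j\<^esub>
        ((rho v j Bw \<odot>\<^bsub>RP j\<^esub> lamb (bas m j Bw)) \<oplus>\<^bsub>RP j\<^esub> (rho v j So \<odot>\<^bsub>RP j\<^esub> lamb (bas m j So))))"
    if v: "v \<in> carrier (RP j)" for v
  proof (rule rho_eqI)
    have v: "v \<in> carrier \<Lambda>" "lmul (bas m j Vx) (rho v) = rho v"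
      using v by (simp_all add: RP_iff)
    show "v \<in> carrier \<Lambda>" by (fact v)
    show "rho v = rho ((rho v j Vx \<odot>\<^bsub>RP j\<^esub> lamb (bas m j Vx)) \<oplus>\<^bsub>RP j\<^esub> ((rho v j Fw \<odot>\<^bsub>RP j\<^esub> lamb (bas m j Fw)) \<oplus>\<^bsub>RP j\<^esub>
        ((rho v j Bw \<odot>\<^bsub>RP j\<^esub> lamb (bas m j Bw)) \<oplus>\<^bsub>RP j\<^esub> (rho v j So \<odot>\<^bsub>RP j\<^esub> lamb (bas m j So)))))"
      using expand_start[OF rho_LM[OF v(1)], of j] v(2) by (simp add: Lam_add Lam_smult e sum_bt add.assoc)
  qed (simp add: Lam_add Lam_smult e)
qed (simp_all add: LP_iff RP_iff Lam_add Lam_smult lmul_add lmul_sc endc_simps, simp add: lsc_def)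

interpretation T: tensor_coord "LP i" "RP j" "\<lambda>u. endc (rho u) i" "\<lambda>v. rho v j" "\<lambda>s. lamb (ebas m i s)" "\<lambda>s. lamb (bas m j s)"
  for i j
  by (rule tensor_coord_principal)

abbreviation "PB i j \<equiv> proj_bimodule \<Lambda> (eL m i) (eL m j)"

lemma PB_simps:
  "carrier (PB i j) = carrier (tensor_space (LP i) (RP j))" "add (PB i j) = add (tensor_space (LP i) (RP j))"
  "zero (PB i j) = zero (tensor_space (LP i) (RP j))" "smult (PB i j) = smult (tensor_space (LP i) (RP j))"
  "lact (PB i j) = (\<lambda>x X. \<Union>t\<in>X. tensor_class (LP i) (RP j) (push (\<lambda>(u, v). (x \<otimes>\<^bsub>\<Lambda>\<^esub> u, v)) t))"
  "ract (PB i j) = (\<lambda>X x. \<Union>t\<in>X. tensor_class (LP i) (RP j) (push (\<lambda>(u, v). (u, v \<otimes>\<^bsub>\<Lambda>\<^esub> x)) t))"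
  by (simp_all add: proj_bimodule_def Let_def)

definition tc :: "int \<Rightarrow> int \<Rightarrow> ('k lam \<times> 'k lam \<Rightarrow>\<^sub>0 'k) set \<Rightarrow> bt \<Rightarrow> bt \<Rightarrow> 'k" where
  "tc i j = T.tcoord i j"

lemma PB_add: "X \<in> carrier (PB i j) \<Longrightarrow> Y \<in> carrier (PB i j) \<Longrightarrow> X \<oplus>\<^bsub>PB i j\<^esub> Y \<in> carrier (PB i j)"
   "X \<in> carrier (PB i j) \<Longrightarrow> Y \<in> carrier (PB i j) \<Longrightarrow> tc i j (X \<oplus>\<^bsub>PB i j\<^esub> Y) = tc i j X + tc i j Y"
  unfolding PB_simps tc_def by (fact T.tensor_add)+

lemma PB_smult: "X \<in> carrier (PB i j) \<Longrightarrow> c \<odot>\<^bsub>PB i j\<^esub> X \<in> carrier (PB i j)"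
   "X \<in> carrier (PB i j) \<Longrightarrow> tc i j (c \<odot>\<^bsub>PB i j\<^esub> X) = (\<lambda>s s'. c * tc i j X s s')"
  unfolding PB_simps tc_def by (fact T.tensor_smult)+

lemma PB_zero: "\<zero>\<^bsub>PB i j\<^esub> \<in> carrier (PB i j)" "tc i j \<zero>\<^bsub>PB i j\<^esub> = 0"
  unfolding PB_simps tc_def by (fact T.tensor_zero)+

lemma PB_bij: "bij_betw (tc i j) (carrier (PB i j)) UNIV"
  unfolding PB_simps tc_def by (fact T.tcoord_bij)

lemma PB_lact:
  assumes l: "l \<in> carrier \<Lambda>" and X: "X \<in> carrier (PB i j)"
  shows "lact (PB i j) l X \<in> carrier (PB i j)"
    "tc i j (lact (PB i j) l X) = (\<lambda>s s'. cmul (rho l) (\<lambda>s. tc i j X s s') i s)"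
proof -
  define h where "h = (\<lambda>(u, v :: 'k lam). (l \<otimes>\<^bsub>\<Lambda>\<^esub> u, v))"
  define \<Phi> where "\<Phi> f = (\<lambda>s s'. cmul (rho l) (\<lambda>s. f s s') i s)" for f :: "bt \<Rightarrow> bt \<Rightarrow> 'k"
  have h1: "h (u, v) \<in> carrier (LP i) \<times> carrier (RP j)" if "u \<in> carrier (LP i)" "v \<in> carrier (RP j)" for u v
    using that l by (simp add: h_def LP_iff Lam_mult lmul_assoc)
  have h2: "(\<lambda>s s'. endc (rho (fst (h (u, v)))) i s * rho (snd (h (u, v))) j s') = \<Phi> (\<lambda>s s'. endc (rho u) i s * rho v j s')"
    if "u \<in> carrier (LP i)" "v \<in> carrier (RP j)" for u v
    using that l cmul_sc(1)[of "rho l" "rho v j _" "endc (rho u) i" i]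
    by (intro ext) (simp add: h_def \<Phi>_def LP_iff Lam_mult endc_lmul mult.commute)
  have h3: "\<Phi> (f + g) = \<Phi> f + \<Phi> g" for f g
    by (intro ext) (rename_tac s s', case_tac s, simp_all add: \<Phi>_def cmul_def algebra_simps)
  have h4: "\<Phi> (\<lambda>s s'. c * f s s') = (\<lambda>s s'. c * \<Phi> f s s')" for c f
    by (intro ext) (simp add: \<Phi>_def cmul_sc)
  have X': "X \<in> carrier (tensor_space (LP i) (RP j))"
    using X by (simp add: PB_simps)
  show "lact (PB i j) l X \<in> carrier (PB i j)"
    "tc i j (lact (PB i j) l X) = (\<lambda>s s'. cmul (rho l) (\<lambda>s. tc i j X s s') i s)"
    using T.tensor_push[of i j h \<Phi>, OF h1 h2 h3 h4 X'] by (simp_all add: PB_simps tc_def h_def \<Phi>_def)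
qed

lemma PB_ract:
  assumes l: "l \<in> carrier \<Lambda>" and X: "X \<in> carrier (PB i j)"
  shows "ract (PB i j) X l \<in> carrier (PB i j)"
    "tc i j (ract (PB i j) X l) = (\<lambda>s. rmul (tc i j X s) (rho l) j)"
proof -
  define h where "h = (\<lambda>(u :: 'k lam, v). (u, v \<otimes>\<^bsub>\<Lambda>\<^esub> l))"
  define \<Phi> where "\<Phi> f = (\<lambda>s. rmul (f s) (rho l) j)" for f :: "bt \<Rightarrow> bt \<Rightarrow> 'k"
  have h1: "h (u, v) \<in> carrier (LP i) \<times> carrier (RP j)" if "u \<in> carrier (LP i)" "v \<in> carrier (RP j)" for u v
    using that l by (simp add: h_def RP_iff Lam_mult lmul_assoc[symmetric])
  have h2: "(\<lambda>s s'. endc (rho (fst (h (u, v)))) i s * rho (snd (h (u, v))) j s') = \<Phi> (\<lambda>s s'. endc (rho u) i s * rho v j s')"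
    if "u \<in> carrier (LP i)" "v \<in> carrier (RP j)" for u v
    using that l by (intro ext) (simp add: h_def \<Phi>_def RP_iff Lam_mult rmul_sc lmul_def)
  have h3: "\<Phi> (f + g) = \<Phi> f + \<Phi> g" for f g
    by (intro ext) (simp add: \<Phi>_def rmul_add)
  have h4: "\<Phi> (\<lambda>s s'. c * f s s') = (\<lambda>s s'. c * \<Phi> f s s')" for c f
    by (intro ext) (simp add: \<Phi>_def rmul_sc)
  have X': "X \<in> carrier (tensor_space (LP i) (RP j))"
    using X by (simp add: PB_simps)
  show "ract (PB i j) X l \<in> carrier (PB i j)"
    "tc i j (ract (PB i j) X l) = (\<lambda>s. rmul (tc i j X s) (rho l) j)"
    using T.tensor_push[of i j h \<Phi>, OF h1 h2 h3 h4 X'] by (simp_all add: PB_simps tc_def h_def \<Phi>_def)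
qed

lemma tc_gen:
  "tensor_class (LP i) (RP j) (Poly_Mapping.single (eL m i, eL m j) 1) \<in> carrier (PB i j)"
  "tc i j (tensor_class (LP i) (RP j) (Poly_Mapping.single (eL m i, eL m j) 1)) =
     (\<lambda>s s'. if s = Vx \<and> s' = Vx then 1 else 0)"
proof -
  have "eL m i \<in> carrier (LP i)" "eL m j \<in> carrier (RP j)"
    by (simp_all add: LP_iff RP_iff Lam_gens bas_mult_Vx)
  note c = T.sgl_closed[OF this, of 1]
  show "tensor_class (LP i) (RP j) (Poly_Mapping.single (eL m i, eL m j) 1) \<in> carrier (PB i j)"
    unfolding PB_simps by (rule T.tensor_class_closed[OF c])
  have "bas m j Vx j s' = (if s' = Vx then 1 else 0 :: 'k)" "endc (bas m i Vx) i s = (if s = Vx then 1 else 0 :: 'k)" for s s'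
    by (auto simp: bas_def endc_def split: bt.split)
  then show "tc i j (tensor_class (LP i) (RP j) (Poly_Mapping.single (eL m i, eL m j) 1)) =
     (\<lambda>s s'. if s = Vx \<and> s' = Vx then 1 else 0)"
    unfolding tc_def T.tcoord_class[OF c] T.kt_single by (intro ext) (simp add: Lam_gens)
qed

abbreviation "RP' n \<equiv> resP m n :: ('k, 'k lam, 'k pel) bimodule"

text \<open>Summands of P^n exist only for indices in one period. The index is reduced modulo
  \<open>m\<close> before the component is read, which makes the coordinates periodic.\<close>

definition crd :: "nat \<Rightarrow> 'k pel \<Rightarrow> 'k pm" where
  "crd n x i r = (if 0 \<le> r \<and> r \<le> int n then 
     tc (i mod int m) (i mod int m + int n - 2 * r) (x (i mod int m, r)) else 0)"

lemma resP_simps: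
  "carrier (RP' n) = (\<Pi>\<^sub>E j\<in>idx m n. carrier (PB (fst j) (fst j + int n - 2 * snd j)))"
  "zero (RP' n) = (\<lambda>j\<in>idx m n. \<zero>\<^bsub>PB (fst j) (fst j + int n - 2 * snd j)\<^esub>)"
  "add (RP' n) = (\<lambda>x y. \<lambda>j\<in>idx m n. x j \<oplus>\<^bsub>PB (fst j) (fst j + int n - 2 * snd j)\<^esub> y j)"
  "smult (RP' n) = (\<lambda>c x. \<lambda>j\<in>idx m n. c \<odot>\<^bsub>PB (fst j) (fst j + int n - 2 * snd j)\<^esub> x j)"
  "lact (RP' n) = (\<lambda>l x. \<lambda>j\<in>idx m n. lact (PB (fst j) (fst j + int n - 2 * snd j)) l (x j))"
  "ract (RP' n) = (\<lambda>x l. \<lambda>j\<in>idx m n. ract (PB (fst j) (fst j + int n - 2 * snd j)) (x j) l)"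
  by (simp_all add: resP_def direct_sum_def case_prod_beta')

lemma idx_mod: "0 \<le> r \<Longrightarrow> r \<le> int n \<Longrightarrow> (i mod int m, r) \<in> idx m n"
  using m_pos by (simp add: idx_def)

lemma resP_component:
  assumes "x \<in> carrier (RP' n)" "0 \<le> r" "r \<le> int n"
  shows "x (i mod int m, r) \<in> carrier (PB (i mod int m) (i mod int m + int n - 2 * r))"
  using PiE_mem[OF assms(1)[unfolded resP_simps] idx_mod[OF assms(2,3)], of i] by simp

lemma crd_eqI:
  assumes "0 \<le> r \<Longrightarrow> r \<le> int n \<Longrightarrow> tc (i mod int m) (i mod int m + int n - 2 * r) (x (i mod int m, r)) = f"
    "r < 0 \<or> int n < r \<Longrightarrow> f = 0"
  shows "crd n x i r = f"
  using assms by (auto simp: crd_def not_le)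

lemma resP_add:
  assumes "x \<in> carrier (RP' n)" "y \<in> carrier (RP' n)"
  shows "x \<oplus>\<^bsub>RP' n\<^esub> y \<in> carrier (RP' n)" "crd n (x \<oplus>\<^bsub>RP' n\<^esub> y) = crd n x + crd n y"
proof -
  show "x \<oplus>\<^bsub>RP' n\<^esub> y \<in> carrier (RP' n)"
    using assms unfolding resP_simps by (auto intro!: PB_add(1) dest: PiE_mem)
  show "crd n (x \<oplus>\<^bsub>RP' n\<^esub> y) = crd n x + crd n y"
  proof (intro fun4_eqI)
    fix i r s t
    show "crd n (x \<oplus>\<^bsub>RP' n\<^esub> y) i r s t = (crd n x + crd n y) i r s t"
      using PB_add(2)[OF resP_component[OF assms(1), of r i] resP_component[OF assms(2), of r i]]
      by (auto simp: resP_simps(3) idx_mod crd_def)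
  qed
qed

lemma resP_smult:
  assumes "x \<in> carrier (RP' n)"
  shows "c \<odot>\<^bsub>RP' n\<^esub> x \<in> carrier (RP' n)" "crd n (c \<odot>\<^bsub>RP' n\<^esub> x) = psc c (crd n x)"
proof -
  show "c \<odot>\<^bsub>RP' n\<^esub> x \<in> carrier (RP' n)"
    using assms unfolding resP_simps by (auto intro!: PB_smult(1) dest: PiE_mem)
  show "crd n (c \<odot>\<^bsub>RP' n\<^esub> x) = psc c (crd n x)"
  proof (intro fun4_eqI)
    fix i r s t
    show "crd n (c \<odot>\<^bsub>RP' n\<^esub> x) i r s t = psc c (crd n x) i r s t"
      using PB_smult(2)[OF resP_component[OF assms, of r i], of c]
      by (auto simp: resP_simps(4) idx_mod crd_def psc_def)
  qed
qed

lemma resP_zero: "\<zero>\<^bsub>RP' n\<^esub> \<in> carrier (RP' n)" "crd n \<zero>\<^bsub>RP' n\<^esub> = 0"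
proof -
  show "\<zero>\<^bsub>RP' n\<^esub> \<in> carrier (RP' n)"
    unfolding resP_simps by (auto intro!: PB_zero)
  show "crd n \<zero>\<^bsub>RP' n\<^esub> = 0"
    by (intro fun4_eqI) (auto simp: resP_simps(2) idx_mod crd_def PB_zero)
qed

lemma resP_lact:
  assumes l: "l \<in> carrier \<Lambda>" and x: "x \<in> carrier (RP' n)"
  shows "lact (RP' n) l x \<in> carrier (RP' n)" "crd n (lact (RP' n) l x) = plact (rho l) (crd n x)"
proof -
  show "lact (RP' n) l x \<in> carrier (RP' n)"
    using x unfolding resP_simps by (auto intro!: PB_lact(1)[OF l] dest: PiE_mem)
  show "crd n (lact (RP' n) l x) = plact (rho l) (crd n x)"
  proof (intro fun4_eqI)
    fix i r s t
    have L: "rho l \<in> LM m" by (rule rho_LM[OF l])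
    have "rho l (i mod int m + c) = rho l (i + c)" for c
      by (rule LM_cong[OF L]) (simp add: mod_eq_dvd_iff[symmetric])
    from this[of 0] this[of 1] this[of "- 1"]
    have "cmul (rho l) y (i mod int m) s = cmul (rho l) y i s" for y
      by (cases s) (simp_all add: cmul_def)
    moreover have "cmul (rho l) (\<lambda>s. 0) i s = 0"
      by (cases s) (simp_all add: cmul_def)
    ultimately show "crd n (lact (RP' n) l x) i r s t = plact (rho l) (crd n x) i r s t"
      using PB_lact(2)[OF l resP_component[OF x, of r i]]
      by (simp add: resP_simps(5) idx_mod crd_def plact_def)
  qed
qed

lemma resP_ract:
  assumes l: "l \<in> carrier \<Lambda>" and x: "x \<in> carrier (RP' n)"
  shows "ract (RP' n) x l \<in> carrier (RP' n)" "crd n (ract (RP' n) x l) = pract n (crd n x) (rho l)"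
proof -
  show "ract (RP' n) x l \<in> carrier (RP' n)"
    using x unfolding resP_simps by (auto intro!: PB_ract(1)[OF l] dest: PiE_mem)
  show "crd n (ract (RP' n) x l) = pract n (crd n x) (rho l)"
  proof (intro fun4_eqI)
    fix i r s t
    have L: "rho l \<in> LM m" by (rule rho_LM[OF l])
    have "int m dvd (i mod int m + int n - 2 * r + c) - (i + int n - 2 * r + c)" for c
    proof -
      have "(i mod int m + int n - 2 * r + c) - (i + int n - 2 * r + c) = i mod int m - i"
        by simp
      also have "int m dvd \<dots>"
        by (simp add: mod_eq_dvd_iff[symmetric])
      finally show ?thesis .
    qed
    from LM_cong[OF L this[of 0]] LM_cong[OF L this[of 1]] LM_cong[OF L this[of "- 1"]]
    have "rmul y (rho l) (i mod int m + int n - 2 * r) t = rmul y (rho l) (i + int n - 2 * r) t" for y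
      by (cases t) (simp_all add: rmul_def)
    moreover have "rmul 0 (rho l) j t = 0" for j
      by (cases t) (simp_all add: rmul_def)
    ultimately show "crd n (ract (RP' n) x l) i r s t = pract n (crd n x) (rho l) i r s t"
      using PB_ract(2)[OF l resP_component[OF x, of r i]]
      by (simp add: resP_simps(6) idx_mod crd_def pract_def)
  qed
qed

lemma crd_PM: "crd n x \<in> PM m n"
  by (rule PM_I) (auto simp: crd_def)

lemma crd_bij: "bij_betw (crd n) (carrier (RP' n)) (PM m n :: 'k pm set)"
proof (rule bij_betw_imageI)
  show "inj_on (crd n) (carrier (RP' n))"
  proof (rule inj_onI)
    fix x y assume xy: "x \<in> carrier (RP' n)" "y \<in> carrier (RP' n)" "crd n x = crd n y"
    have "x j = y j" if j: "j \<in> idx m n" for j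
    proof -
      obtain i r where ir: "j = (i, r)" "0 \<le> i" "i < int m" "0 \<le> r" "r \<le> int n"
        using j by (cases j) (auto simp: idx_def)
      then have "tc i (i + int n - 2 * r) (x j) = tc i (i + int n - 2 * r) (y j)"
        using fun_cong[OF fun_cong[OF xy(3), of i], of r] by (simp add: crd_def)
      moreover have "x j \<in> carrier (PB i (i + int n - 2 * r))" "y j \<in> carrier (PB i (i + int n - 2 * r))"
        using resP_component[OF xy(1) ir(4,5), of i] resP_component[OF xy(2) ir(4,5), of i] ir by simp_all
      ultimately show ?thesis
        using PB_bij by (auto simp: bij_betw_def dest: inj_onD)
    qed
    then show "x = y"
      using xy(1,2) unfolding resP_simps by (intro PiE_ext)
  qed
  show "crd n ` carrier (RP' n) = (PM m n :: 'k pm set)"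
  proof (intro equalityI subsetI)
    fix f :: "'k pm" assume f: "f \<in> PM m n"
    define x where "x = (\<lambda>j\<in>idx m n. inv_into (carrier (PB (fst j) (fst j + int n - 2 * snd j)))
       (tc (fst j) (fst j + int n - 2 * snd j)) (f (fst j) (snd j)))"
    have inv: "inv_into (carrier (PB i j)) (tc i j) g \<in> carrier (PB i j)" 
       "tc i j (inv_into (carrier (PB i j)) (tc i j) g) = g" for i j g
      using bij_betw_inv_into_right[OF PB_bij, of g i j] inv_into_into[of g "tc i j"] PB_bij[of i j]
      by (auto simp: bij_betw_def)
    have "x \<in> carrier (RP' n)"
      unfolding resP_simps x_def by (auto intro!: inv)
    moreover have "crd n x = f"
    proof (intro ext[of "crd n x"] ext[of "crd n x _"] crd_eqI)
      fix i r
      show "f i r = 0" if "r < 0 \<or> int n < r"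
        using that f by (auto simp: PM_def)
      have "f (i mod int m) = f i"
        by (rule PM_cong[OF f]) (simp add: mod_eq_dvd_iff[symmetric])
      then show "tc (i mod int m) (i mod int m + int n - 2 * r) (x (i mod int m, r)) = f i r" if "0 \<le> r" "r \<le> int n"
        using idx_mod[OF that] inv(2) by (simp add: x_def)
    qed
    ultimately show "f \<in> crd n ` carrier (RP' n)"
      by blast
  qed (auto simp: crd_PM)
qed

lemma rgen_closed: "rgen m n i r \<in> carrier (RP' n)"
  unfolding resP_simps rgen_def
  by (auto simp: Let_def intro!: tc_gen(1) PB_zero(1)[unfolded PB_simps(3)])

lemma crd_rgen: "crd n (rgen m n i r) = pgen m n i r"
proof (intro fun4_eqI)
  fix i' r' s t
  have "i' mod int m = i mod int m \<longleftrightarrow> int m dvd i' - i"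
    by (simp add: mod_eq_dvd_iff)
  then show "crd n (rgen m n i r) i' r' s t = pgen m n i r i' r' s t"
    using tc_gen(2) PB_zero(2) 
    by (auto simp: crd_def rgen_def Let_def idx_mod pgen_def PB_simps(3)[symmetric])
qed

end

section \<open>Homomorphisms out of the resolution\<close>

text \<open>Links an actual bimodule \<open>M\<close> with a coordinate model \<open>S\<close>. With
  the instances \<Lambda> and P^n, homomorphisms out of P^n into either of them are constructed
  once.\<close>

locale coord_bimod = zigzag m K + model_bimod m sc l r S
  for m and K :: "'k::field itself" and sc :: "'k \<Rightarrow> 'n::ab_group_add \<Rightarrow> 'n" and l r S +
  fixes M :: "('k, 'k lam, 'v) bimodule" and \<rho> :: "'v \<Rightarrow> 'n"
  assumes bij: "bij_betw \<rho> (carrier M) S"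
    and M_add: "x \<in> carrier M \<Longrightarrow> y \<in> carrier M \<Longrightarrow> x \<oplus>\<^bsub>M\<^esub> y \<in> carrier M"
      "x \<in> carrier M \<Longrightarrow> y \<in> carrier M \<Longrightarrow> \<rho> (x \<oplus>\<^bsub>M\<^esub> y) = \<rho> x + \<rho> y"
    and M_zero: "\<zero>\<^bsub>M\<^esub> \<in> carrier M" "\<rho> \<zero>\<^bsub>M\<^esub> = 0"
    and M_smult: "x \<in> carrier M \<Longrightarrow> c \<odot>\<^bsub>M\<^esub> x \<in> carrier M" "x \<in> carrier M \<Longrightarrow> \<rho> (c \<odot>\<^bsub>M\<^esub> x) = sc c (\<rho> x)"
    and M_lact: "a \<in> carrier \<Lambda> \<Longrightarrow> x \<in> carrier M \<Longrightarrow> lact M a x \<in> carrier M"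
      "a \<in> carrier \<Lambda> \<Longrightarrow> x \<in> carrier M \<Longrightarrow> \<rho> (lact M a x) = l (rho a) (\<rho> x)"
    and M_ract: "a \<in> carrier \<Lambda> \<Longrightarrow> x \<in> carrier M \<Longrightarrow> ract M x a \<in> carrier M"
      "a \<in> carrier \<Lambda> \<Longrightarrow> x \<in> carrier M \<Longrightarrow> \<rho> (ract M x a) = r (\<rho> x) (rho a)"
begin

lemma M_eqI: "x \<in> carrier M \<Longrightarrow> y \<in> carrier M \<Longrightarrow> \<rho> x = \<rho> y \<Longrightarrow> x = y"
  using bij by (auto simp: bij_betw_def dest: inj_onD)

lemma M_S: "x \<in> carrier M \<Longrightarrow> \<rho> x \<in> S"
  using bij by (auto simp: bij_betw_def)

definition unrep :: "'n \<Rightarrow> 'v" where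
  "unrep f = inv_into (carrier M) \<rho> f"

lemma unrep: "f \<in> S \<Longrightarrow> unrep f \<in> carrier M" "f \<in> S \<Longrightarrow> \<rho> (unrep f) = f"
  using bij bij_betw_inv_into_right[OF bij, of f] inv_into_into[of f \<rho> "carrier M"] by (auto simp: unrep_def bij_betw_def)

lemma bimod: "bimod \<Lambda> M"
proof (intro bimod.intro bimod_axioms.intro)
  show "abelian_group M"
  proof (rule abelian_groupI)
    show "\<exists>y\<in>carrier M. y \<oplus>\<^bsub>M\<^esub> x = \<zero>\<^bsub>M\<^esub>" if x: "x \<in> carrier M" for x
    proof (intro bexI M_eqI)
      show "unrep (- \<rho> x) \<in> carrier M"
        by (intro unrep S_minus M_S x)
      then show "unrep (- \<rho> x) \<oplus>\<^bsub>M\<^esub> x \<in> carrier M"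
        by (intro M_add x)
      show "\<rho> (unrep (- \<rho> x) \<oplus>\<^bsub>M\<^esub> x) = \<rho> \<zero>\<^bsub>M\<^esub>"
        using \<open>unrep (- \<rho> x) \<in> carrier M\<close> x M_S by (simp add: M_add M_zero unrep S_minus)
    qed (rule M_zero)
  qed (auto intro!: M_eqI simp: M_add M_zero algebra_simps)
qed (auto intro!: M_eqI simp: M_add M_zero M_smult M_lact M_ract sc_add sc_mult sc_one l_add l_sc r_add r_sc)

text \<open>Transports a map between coordinate models back to the actual bimodules, as an
  extensional function.\<close>

definition tr :: "nat \<Rightarrow> ('k pm \<Rightarrow> 'n) \<Rightarrow> 'k pel \<Rightarrow> 'v" where
  "tr n F = (\<lambda>x\<in>carrier (RP' n). unrep (F (crd n x)))"

lemma tr_hom: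
  assumes F: "\<And>x. x \<in> PM m n \<Longrightarrow> F x \<in> S"
    and "\<And>x y. x \<in> PM m n \<Longrightarrow> y \<in> PM m n \<Longrightarrow> F (x + y) = F x + F y"
    and "\<And>c x. x \<in> PM m n \<Longrightarrow> F (psc c x) = sc c (F x)"
    and "\<And>a x. a \<in> LM m \<Longrightarrow> x \<in> PM m n \<Longrightarrow> F (plact a x) = l a (F x)"
    and "\<And>a x. a \<in> LM m \<Longrightarrow> x \<in> PM m n \<Longrightarrow> F (pract n x a) = r (F x) a"
  shows "tr n F \<in> bimodule_hom \<Lambda> (RP' n) M" "x \<in> carrier (RP' n) \<Longrightarrow> \<rho> (tr n F x) = F (crd n x)"
proof -
  have u: "tr n F x \<in> carrier M" "\<rho> (tr n F x) = F (crd n x)" if "x \<in> carrier (RP' n)" for x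
    using that unrep[OF F[OF crd_PM]] by (auto simp: tr_def)
  show "tr n F \<in> bimodule_hom \<Lambda> (RP' n) M"
  proof (rule homI)
    show "tr n F \<in> extensional (carrier (RP' n))"
      by (simp add: tr_def)
  qed (auto intro!: M_eqI simp: u resP_add resP_smult resP_lact resP_ract M_add M_smult M_lact M_ract assms crd_PM rho_LM)
  show "x \<in> carrier (RP' n) \<Longrightarrow> \<rho> (tr n F x) = F (crd n x)"
    by (rule u)
qed

lemma hom_unique:
  assumes f: "f \<in> bimodule_hom \<Lambda> (RP' n) M" and g: "g \<in> bimodule_hom \<Lambda> (RP' n) M"
    and eq: "\<And>i j. (i, j) \<in> idx m n \<Longrightarrow> f (rgen m n i j) = g (rgen m n i j)"
  shows "f = g"
proof (rule hom_eqI[OF f g])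
  fix x assume x: "x \<in> carrier (RP' n)"
  \<comment> \<open>\<open>Q\<close> consists of the coordinates of the elements on which
    \<open>f\<close> and \<open>g\<close> agree; it contains the generators and is closed under all
    operations, so \<open>PM_induct\<close> applies.\<close>
  define Q where "Q = crd n ` {y \<in> carrier (RP' n). f y = g y}"
  have "crd n x \<in> Q"
  proof (rule PM_induct[OF crd_PM m_pos])
    show "pgen m n i j \<in> Q" if "0 \<le> i" "i < int m" "0 \<le> j" "j \<le> int n" for i j
      using eq[of i j] rgen_closed[of n i j] crd_rgen[of n i j] that unfolding Q_def by (intro image_eqI) (auto simp: idx_def)
    show "a + b \<in> Q" if ab: "a \<in> Q" "b \<in> Q" for a b
    proof -
      obtain y z where "y \<in> carrier (RP' n)" "f y = g y" "a = crd n y" "z \<in> carrier (RP' n)" "f z = g z" "b = crd n z"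
        using ab unfolding Q_def by blast
      then show ?thesis
        unfolding Q_def by (intro image_eqI[of _ _ "y \<oplus>\<^bsub>RP' n\<^esub> z"]) (auto simp: resP_add homD(3)[OF f] homD(3)[OF g])
    qed
    show "psc c a \<in> Q" if a: "a \<in> Q" for c a
    proof -
      obtain y where "y \<in> carrier (RP' n)" "f y = g y" "a = crd n y"
        using a unfolding Q_def by blast
      then show ?thesis
        unfolding Q_def by (intro image_eqI[of _ _ "c \<odot>\<^bsub>RP' n\<^esub> y"]) (auto simp: resP_smult homD(4)[OF f] homD(4)[OF g])
    qed
    show "plact b a \<in> Q" if a: "b \<in> LM m" "a \<in> Q" for b a
    proof -
      obtain y where "y \<in> carrier (RP' n)" "f y = g y" "a = crd n y"
        using a unfolding Q_def by blast
      then show ?thesis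
        using lamb[OF a(1)]
        unfolding Q_def by (intro image_eqI[of _ _ "lact (RP' n) (lamb b) y"]) (auto simp: resP_lact homD(5)[OF f] homD(5)[OF g])
    qed
    show "pract n a b \<in> Q" if a: "b \<in> LM m" "a \<in> Q" for b a
    proof -
      obtain y where "y \<in> carrier (RP' n)" "f y = g y" "a = crd n y"
        using a unfolding Q_def by blast
      then show ?thesis
        using lamb[OF a(1)]
        unfolding Q_def by (intro image_eqI[of _ _ "ract (RP' n) y (lamb b)"]) (auto simp: resP_ract homD(6)[OF f] homD(6)[OF g])
    qed
  qed
  then show "f x = g x"
    using x crd_bij[of n] unfolding Q_def by (auto simp: bij_betw_def dest: inj_onD)
qed

text \<open>Resolves the definite description: \<open>f\<close> is a witness, and it is the only one
  by \<open>hom_unique\<close>.\<close>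

lemma hom_by_gens_eq:
  assumes "f \<in> bimodule_hom \<Lambda> (RP' n) M" "\<And>i j. (i, j) \<in> idx m n \<Longrightarrow> f (rgen m n i j) = w (i, j)"
  shows "hom_by_gens \<Lambda> (RP' n) M (idx m n) (\<lambda>(i, r). rgen m n i r) w = f"
  unfolding hom_by_gens_def
proof (rule the_equality)
  fix g assume g: "g \<in> bimodule_hom \<Lambda> (RP' n) M \<and> (\<forall>j\<in>idx m n. g (case j of (i, r) \<Rightarrow> rgen m n i r) = w j)"
  show "g = f"
  proof (rule hom_unique)
    fix i j assume ij: "(i, j) \<in> idx m n"
    then show "g (rgen m n i j) = f (rgen m n i j)"
      using g assms(2)[OF ij] by fastforce
  qed (use g assms in auto)
qed (use assms in auto)

text \<open>The conditions say that \<open>w (i, j)\<close> lies in e_i M e_{i+n-2j}. No relations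
  bind the generators beyond their idempotents, so any such choice extends.\<close>

lemma hom_exists:
  assumes w: "\<And>i j. (i, j) \<in> idx m n \<Longrightarrow> w (i, j) \<in> carrier M"
    "\<And>i j. (i, j) \<in> idx m n \<Longrightarrow> lact M (eL m i) (w (i, j)) = w (i, j)"
    "\<And>i j. (i, j) \<in> idx m n \<Longrightarrow> ract M (w (i, j)) (eL m (i + int n - 2 * j)) = w (i, j)"
  shows "\<exists>f\<in>bimodule_hom \<Lambda> (RP' n) M. \<forall>i j. (i, j) \<in> idx m n \<longrightarrow> f (rgen m n i j) = w (i, j)"
proof -
  define F where "F = gen_hom n (\<lambda>i j. \<rho> (w (i, j)))"
  have FS: "F x \<in> S" for x
    unfolding F_def by (intro gen_hom_S M_S w) (simp add: idx_def)
  note F = gen_hom_add[of n "\<lambda>i j. \<rho> (w (i, j))", folded F_def] gen_hom_sc[of n "\<lambda>i j. \<rho> (w (i, j))", folded F_def]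
    gen_hom_plact[of _ n "\<lambda>i j. \<rho> (w (i, j))", folded F_def] gen_hom_pract[of _ n "\<lambda>i j. \<rho> (w (i, j))", folded F_def]
  have h: "tr n F \<in> bimodule_hom \<Lambda> (RP' n) M" "\<And>x. x \<in> carrier (RP' n) \<Longrightarrow> \<rho> (tr n F x) = F (crd n x)"
    by (rule tr_hom; simp add: FS F)+
  show ?thesis
  proof (intro bexI[of _ "tr n F"] allI impI M_eqI)
    fix i j assume ij: "(i, j) \<in> idx m n"
    show "\<rho> (tr n F (rgen m n i j)) = \<rho> (w (i, j))"
      unfolding h(2)[OF rgen_closed] crd_rgen unfolding F_def
    proof (rule gen_hom_pgen)
      show "l (bas m i Vx) (\<rho> (w (i, j))) = \<rho> (w (i, j))"
        using M_lact(2)[OF Lam_gens(1) w(1)[OF ij], of i] w(2)[OF ij] by (simp add: Lam_gens)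
      show "r (\<rho> (w (i, j))) (bas m (i + int n - 2 * j) Vx) = \<rho> (w (i, j))"
        using M_ract(2)[OF Lam_gens(1) w(1)[OF ij], of "i + int n - 2 * j"] w(3)[OF ij] by (simp add: Lam_gens)
    qed (use ij in \<open>auto simp: idx_def\<close>)
    show "tr n F (rgen m n i j) \<in> carrier M"
      by (rule homD(1)[OF h(1) rgen_closed])
  qed (use h(1) w(1) in auto)
qed

end

lemma plact_pgen: "plact (bas m i Vx) (pgen m n i r) = (pgen m n i r :: 'k::field pm)"
proof (rule fun4_eqI)
  fix i' r' s t
  show "plact (bas m i Vx) (pgen m n i r) i' r' s t = (pgen m n i r i' r' s t :: 'k)"
    by (cases s) (auto simp: plact_def cmul_def bas_def pgen_def)
qed

lemma pract_pgen: "pract n (pgen m n i r) (bas m (i + int n - 2 * r) Vx) = (pgen m n i r :: 'k::field pm)"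
proof (rule fun4_eqI)
  fix i' r' s t
  have "i' + int n - 2 * r - (i + int n - 2 * r) = i' - i"
    by simp
  then show "pract n (pgen m n i r) (bas m (i + int n - 2 * r) Vx) i' r' s t = (pgen m n i r i' r' s t :: 'k)"
    by (cases t) (auto simp: pract_def rmul_def bas_def pgen_def)
qed

context zigzag
begin

lemma coord_L: "coord_bimod m lsc lmul lmul (LM m) (regular_bimodule \<Lambda>) rho"
  by (intro coord_bimod.intro zigzag_axioms model_bimod_LM coord_bimod_axioms.intro)
    (simp_all add: rho_bij Lam_add Lam_zero Lam_smult Lam_mult)

lemma coord_P: "coord_bimod m psc plact (pract n) (PM m n) (RP' n) (crd n)"
  by (intro coord_bimod.intro zigzag_axioms model_bimod_PM coord_bimod_axioms.intro)
    (simp_all add: crd_bij resP_add resP_zero resP_smult resP_lact resP_ract)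

lemma rgen_idem: 
  "lact (RP' n) (eL m i) (rgen m n i r) = rgen m n i r"
  "ract (RP' n) (rgen m n i r) (eL m (i + int n - 2 * r)) = rgen m n i r"
proof -
  interpret P: coord_bimod m K psc plact "pract n" "PM m n" "RP' n" "crd n"
    by (rule coord_P)
  show "lact (RP' n) (eL m i) (rgen m n i r) = rgen m n i r"
    by (rule P.M_eqI) (simp_all add: resP_lact Lam_gens rgen_closed crd_rgen plact_pgen)
  show "ract (RP' n) (rgen m n i r) (eL m (i + int n - 2 * r)) = rgen m n i r"
    by (rule P.M_eqI) (simp_all add: resP_ract Lam_gens rgen_closed crd_rgen pract_pgen)
qed

text \<open>Projectivity of P^n: preimages are chosen for the generators only, made compatible with
  the idempotents, and extended; the composite then agrees with \<open>h\<close> on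
  generators.\<close>

lemma hom_lift:
  assumes "coord_bimod m sM lM rM SM M \<rho>M" and "coord_bimod m sN lN rN SN N \<rho>N"
    and \<phi>: "\<phi> \<in> bimodule_hom \<Lambda> M N" and h: "h \<in> bimodule_hom \<Lambda> (RP' n) N"
    and ex: "\<And>x. x \<in> carrier (RP' n) \<Longrightarrow> \<exists>y\<in>carrier M. \<phi> y = h x"
  shows "\<exists>H\<in>bimodule_hom \<Lambda> (RP' n) M. \<forall>x\<in>carrier (RP' n). \<phi> (H x) = h x"
proof -
  interpret M: coord_bimod m K sM lM rM SM M \<rho>M by fact
  interpret N: coord_bimod m K sN lN rN SN N \<rho>N by fact
  interpret P: coord_bimod m K psc plact "pract n" "PM m n" "RP' n" "crd n"
    by (rule coord_P)
  define y where "y i j = (SOME y. y \<in> carrier M \<and> \<phi> y = h (rgen m n i j))" for i j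
  have y: "y i j \<in> carrier M \<and> \<phi> (y i j) = h (rgen m n i j)" for i j
    unfolding y_def by (rule someI_ex) (use ex[OF rgen_closed] in blast)
  define e where "e i = (eL m i :: 'k lam)" for i
  have e: "e i \<in> carrier \<Lambda>" "rho (e i) = bas m i Vx" for i
    by (simp_all add: e_def Lam_gens)
  \<comment> \<open>The idempotents on both sides turn an arbitrary preimage into an admissible
    image of a generator. Its image under \<open>\<phi>\<close> is unchanged, because the generator
    itself is fixed by these idempotents.\<close>
  define w where "w = (\<lambda>(i, j). ract M (lact M (e i) (y i j)) (e (i + int n - 2 * j)))"
  have w: "w (i, j) \<in> carrier M" for i j
    using y e by (simp add: w_def M.M_lact M.M_ract)
  have ee: "lM (bas m i Vx) (lM (bas m i Vx) z) = lM (bas m i Vx) z" "rM (rM z (bas m i Vx)) (bas m i Vx) = rM z (bas m i Vx)" for i z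
    using M.l_mul[of "bas m i Vx" "bas m i Vx" z] M.r_mul[of z "bas m i Vx" "bas m i Vx"] by (simp_all add: bas_mult_Vx)
  have "lact M (eL m i) (w (i, j)) = w (i, j)" for i j
    using y e w[of i j] by (intro M.M_eqI) (simp_all add: w_def M.M_lact M.M_ract M.lr ee Lam_gens)
  moreover have "ract M (w (i, j)) (eL m (i + int n - 2 * j)) = w (i, j)" for i j
    using y e w[of i j] by (intro M.M_eqI) (simp_all add: w_def M.M_lact M.M_ract ee Lam_gens)
  ultimately obtain H where H: "H \<in> bimodule_hom \<Lambda> (RP' n) M" "\<And>i j. (i, j) \<in> idx m n \<Longrightarrow> H (rgen m n i j) = w (i, j)"
    using M.hom_exists[of n w] w by blast
  have "(\<lambda>x\<in>carrier (RP' n). \<phi> (H x)) = h"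
  proof (rule N.hom_unique[OF hom_comp[OF P.bimod H(1) \<phi>] h])
    fix i j assume ij: "(i, j) \<in> idx m n"
    have "\<phi> (w (i, j)) = ract N (lact N (e i) (h (rgen m n i j))) (e (i + int n - 2 * j))"
      using y e by (simp add: w_def homD(5)[OF \<phi>] homD(6)[OF \<phi>] M.M_lact)
    also have "\<dots> = h (ract (RP' n) (lact (RP' n) (e i) (rgen m n i j)) (e (i + int n - 2 * j)))"
      using e rgen_closed by (simp add: homD(5)[OF h] homD(6)[OF h] P.M_lact)
    also have "\<dots> = h (rgen m n i j)"
      by (simp add: e_def rgen_idem)
    finally show "(\<lambda>x\<in>carrier (RP' n). \<phi> (H x)) (rgen m n i j) = h (rgen m n i j)"
      using H(2)[OF ij] rgen_closed by simp
  qed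
  then show ?thesis
    using H(1) by (intro bexI[of _ H] ballI) (auto dest: fun_cong simp: restrict_def split: if_splits)
qed

end

section \<open>The complex is a projective resolution\<close>

text \<open>Checks the transposed formula \<open>pdiff\<close> against the prescribed values on
  generators; only the rows r and r - 1 contribute.\<close>

lemma pdiff_pgen:
  assumes "0 \<le> r" "r \<le> int (Suc n)"
  shows "pdiff (Suc n) (pgen m (Suc n) i r) = 
     (pract n (pgen m n i r) (bas m (i + int (Suc n) - 2 * r - 1) Fw)
      + psc (sg (int (Suc n))) (pract n (pgen m n i (r - 1)) (bas m (i + int (Suc n) - 2 * r + 1) Bw))
      + psc (sg (int (Suc n) + r)) (plact (bas m i Fw) (pgen m n (i + 1) r) + plact (bas m i Bw) (pgen m n (i - 1) (r - 1)))
      :: 'k::field pm)" (is "?L = ?R")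
proof (rule fun4_eqI)
  fix i' r' s t
  have d: "int m dvd i' - 1 - i \<longleftrightarrow> int m dvd i' - (i + 1)" "int m dvd i' + 1 - i \<longleftrightarrow> int m dvd i' - (i - 1)"
    "i' + int n - 2 * r - (i + int (Suc n) - 2 * r - 1) = i' - i"
    "i' + int n - 2 * (r - 1) - (i + int (Suc n) - 2 * r + 1) = i' - i"
    "r' + 1 = r \<longleftrightarrow> r' = r - 1"
    by (auto simp: algebra_simps)
  have sgd: "sg (1 + int n + r) = (- sg (int n + r) :: 'k)"
    by (simp add: sg_def)
  show "?L i' r' s t = ?R i' r' s t"
  proof (cases "0 \<le> r' \<and> r' \<le> int n")
    case False
    have "rmul (\<lambda>_. 0) l j t = 0" "cmul l (\<lambda>_. 0) j s = 0" for l :: "'k lm" and j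
      by (cases t, simp_all add: rmul_def) (cases s, simp_all add: cmul_def)
    moreover have "pgen m n j k i' r' = (\<lambda>_ _. 0 :: 'k)" for j k
      using False by (auto simp: pgen_def fun_eq_iff)
    moreover have "?L i' r' s t = 0"
      unfolding pdiff_def by (rule if_not_P) (use False in auto)
    ultimately show ?thesis
      by (simp add: psc_def pract_def plact_def)
  next
    case True
    then have g: "0 \<le> r' \<and> r' < int (Suc n)"
      by simp
    show ?thesis
    proof (cases "r' = r")
      case r: True
      then show ?thesis
        using True g
        by (cases s; cases t) (simp_all add: pdiff_def psc_def pract_def plact_def mul_defs bas_def pgen_def d(1-4)[simplified] d(5))
    next
      case r: False
      show ?thesis
      proof (cases "r' = r - 1")
        case r: True
        then show ?thesis
          using True g
          by (cases s; cases t) (simp_all add: pdiff_def psc_def pract_def plact_def mul_defs bas_def pgen_def d(1-4)[simplified] sgd)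
      next
        case False
        then have "pgen m (Suc n) i r j r' = (\<lambda>_ _. 0 :: 'k)" "pgen m (Suc n) i r j (r' + 1) = (\<lambda>_ _. 0 :: 'k)"
           "pgen m n j r j' r' = (\<lambda>_ _. 0 :: 'k)" "pgen m n j (r - 1) j' r' = (\<lambda>_ _. 0 :: 'k)" for j j'
          using r by (auto simp: pgen_def fun_eq_iff)
        then show ?thesis
          by (cases s; cases t) (simp_all add: pdiff_def psc_def pract_def plact_def mul_defs)
      qed
    qed
  qed
qed

lemma paug_pgen: "paug (pgen m 0 i 0) = (lmul (bas m i Vx) (bas m i Vx) :: 'k::field lm)"
  by (rule fun2_eqI, case_tac t) (simp_all add: paug_def pgen_def bas_mult_Vx, simp_all add: bas_def)

context zigzag
begin

interpretation L: coord_bimod m K lsc lmul lmul "LM m" "regular_bimodule \<Lambda>" rho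
  by (rule coord_L)

interpretation P: coord_bimod m K psc plact "pract n" "PM m n" "RP' n" "crd n" for n
  by (rule coord_P)

text \<open>Identifies the differential given by values on generators with the coordinate map
  \<open>pdiff\<close>, so that d d = 0 and exactness can be read off from coordinates.\<close>

lemma resd_hom: 
  "resd m (Suc n) \<in> bimodule_hom \<Lambda> (RP' (Suc n)) (RP' n)"
  "x \<in> carrier (RP' (Suc n)) \<Longrightarrow> crd n (resd m (Suc n) x) = pdiff (Suc n) (crd (Suc n) x)"
  and resd_rgen: "(i, r) \<in> idx m (Suc n) \<Longrightarrow> resd m (Suc n) (rgen m (Suc n) i r) =
       ract (RP' n) (rgen m n i r) (aL m (i + int (Suc n) - 2 * r - 1))
          \<oplus>\<^bsub>RP' n\<^esub> (- 1) ^ Suc n \<odot>\<^bsub>RP' n\<^esub> ract (RP' n) (rgen m n i (r - 1)) (abarL m (i + int (Suc n) - 2 * r))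
          \<oplus>\<^bsub>RP' n\<^esub> (- 1) ^ (Suc n + nat r) \<odot>\<^bsub>RP' n\<^esub>
               (lact (RP' n) (aL m i) (rgen m n (i + 1) r) \<oplus>\<^bsub>RP' n\<^esub> lact (RP' n) (abarL m (i - 1)) (rgen m n (i - 1) (r - 1)))"
proof -
  let ?D = "P.tr n (Suc n) (pdiff (Suc n))"
  let ?w = "\<lambda>(i, r). ract (RP' n) (rgen m n i r) (aL m (i + int (Suc n) - 2 * r - 1))
          \<oplus>\<^bsub>RP' n\<^esub> (- 1) ^ Suc n \<odot>\<^bsub>RP' n\<^esub> ract (RP' n) (rgen m n i (r - 1)) (abarL m (i + int (Suc n) - 2 * r))
          \<oplus>\<^bsub>RP' n\<^esub> (- 1) ^ (Suc n + nat r) \<odot>\<^bsub>RP' n\<^esub>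
               (lact (RP' n) (aL m i) (rgen m n (i + 1) r) \<oplus>\<^bsub>RP' n\<^esub> lact (RP' n) (abarL m (i - 1)) (rgen m n (i - 1) (r - 1)))"
  have D: "?D \<in> bimodule_hom \<Lambda> (RP' (Suc n)) (RP' n)" 
    "\<And>x. x \<in> carrier (RP' (Suc n)) \<Longrightarrow> crd n (?D x) = pdiff (Suc n) (crd (Suc n) x)"
    by (rule P.tr_hom; simp add: pdiff_PM pdiff_add pdiff_psc pdiff_plact pdiff_pract)+
  have gen: "?D (rgen m (Suc n) i r) = ?w (i, r)" if ir: "(i, r) \<in> idx m (Suc n)" for i r
  proof (rule P.M_eqI)
    have r: "0 \<le> r" "r \<le> int (Suc n)"
      using ir by (auto simp: idx_def)
    have sgs: "(- 1) ^ Suc n = (sg (int (Suc n)) :: 'k)" "(- 1) ^ (Suc n + nat r) = (sg (int (Suc n) + r) :: 'k)"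
      unfolding power_m1_sg using r by (simp_all add: add.assoc)
    show "crd n (?D (rgen m (Suc n) i r)) = crd n (?w (i, r))"
      unfolding D(2)[OF rgen_closed] crd_rgen pdiff_pgen[OF r] case_prod_conv sgs
      by (simp add: resP_add resP_smult resP_lact resP_ract rgen_closed crd_rgen Lam_gens del: of_nat_Suc)
  qed (auto simp: resP_add resP_smult resP_lact resP_ract rgen_closed Lam_gens homD(1)[OF D(1)])
  have "resd m (Suc n) = ?D"
    unfolding resd_def Let_def diff_Suc_1 by (rule P.hom_by_gens_eq[OF D(1) gen])
  then show "resd m (Suc n) \<in> bimodule_hom \<Lambda> (RP' (Suc n)) (RP' n)"
    "x \<in> carrier (RP' (Suc n)) \<Longrightarrow> crd n (resd m (Suc n) x) = pdiff (Suc n) (crd (Suc n) x)"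
    "(i, r) \<in> idx m (Suc n) \<Longrightarrow> resd m (Suc n) (rgen m (Suc n) i r) =
       ract (RP' n) (rgen m n i r) (aL m (i + int (Suc n) - 2 * r - 1))
          \<oplus>\<^bsub>RP' n\<^esub> (- 1) ^ Suc n \<odot>\<^bsub>RP' n\<^esub> ract (RP' n) (rgen m n i (r - 1)) (abarL m (i + int (Suc n) - 2 * r))
          \<oplus>\<^bsub>RP' n\<^esub> (- 1) ^ (Suc n + nat r) \<odot>\<^bsub>RP' n\<^esub>
               (lact (RP' n) (aL m i) (rgen m n (i + 1) r) \<oplus>\<^bsub>RP' n\<^esub> lact (RP' n) (abarL m (i - 1)) (rgen m n (i - 1) (r - 1)))"
    using D gen by simp_all
qed

lemma resaug_hom:
  "resaug m \<in> bimodule_hom \<Lambda> (RP' 0) (regular_bimodule \<Lambda>)"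
  "x \<in> carrier (RP' 0) \<Longrightarrow> rho (resaug m x) = paug (crd 0 x)"
proof -
  let ?D = "L.tr 0 paug"
  have D: "?D \<in> bimodule_hom \<Lambda> (RP' 0) (regular_bimodule \<Lambda>)" 
    "\<And>x. x \<in> carrier (RP' 0) \<Longrightarrow> rho (?D x) = paug (crd 0 x)"
    by (rule L.tr_hom; simp add: paug_LM paug_add paug_psc paug_plact paug_pract)+
  have "resaug m = ?D"
    unfolding resaug_def
  proof (rule L.hom_by_gens_eq[OF D(1)])
    fix i j assume "(i, j) \<in> idx m 0"
    then have j: "j = 0"
      by (simp add: idx_def)
    show "?D (rgen m 0 i j) = (case (i, j) of (i, r) \<Rightarrow> eL m i \<otimes>\<^bsub>\<Lambda>\<^esub> eL m i)"
    proof (rule rho_eqI)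
      show "?D (rgen m 0 i j) \<in> carrier \<Lambda>"
        using homD(1)[OF D(1) rgen_closed] by simp
    qed (simp_all add: j D(2)[OF rgen_closed] crd_rgen paug_pgen Lam_mult Lam_gens)
  qed
  then show "resaug m \<in> bimodule_hom \<Lambda> (RP' 0) (regular_bimodule \<Lambda>)"
    "x \<in> carrier (RP' 0) \<Longrightarrow> rho (resaug m x) = paug (crd 0 x)"
    using D by simp_all
qed

lemma phtp_zero: "phtp n 0 = 0" "psec 0 = 0"
  by (rule fun4_eqI, case_tac s, simp_all add: phtp_def psec_def mulF_def split: bt.split)+

text \<open>For a cycle one term of the homotopy identity vanishes, so it is the boundary of its
  image under \<open>phtp\<close>. The homotopy supplies preimages of single elements only;
  \<open>hom_lift\<close> turns these into bimodule homomorphisms.\<close>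

lemma ext_resolution: "ext_resolution \<Lambda> RP' (resd m) (resaug m)"
proof (intro ext_resolution.intro)
  show "bimod \<Lambda> (regular_bimodule \<Lambda>)" "bimod \<Lambda> (RP' n)" for n
    by (rule L.bimod P.bimod)+
  show "resd m (Suc n) \<in> bimodule_hom \<Lambda> (RP' (Suc n)) (RP' n)" for n
    by (rule resd_hom)
  show "resaug m \<in> bimodule_hom \<Lambda> (RP' 0) (regular_bimodule \<Lambda>)"
    by (rule resaug_hom)
  have dc: "resd m (Suc n) x \<in> carrier (RP' n)" if "x \<in> carrier (RP' (Suc n))" for x n
    using homD(1)[OF resd_hom(1) that] .
  show "resd m (Suc n) (resd m (Suc (Suc n)) x) = \<zero>\<^bsub>RP' n\<^esub>" if "x \<in> carrier (RP' (Suc (Suc n)))" for x n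
    using that by (intro P.M_eqI[where n = n]) (simp_all add: dc resd_hom(2) resP_zero pdiff_pdiff)
  show "resaug m (resd m (Suc 0) x) = \<zero>\<^bsub>\<Lambda>\<^esub>" if x: "x \<in> carrier (RP' (Suc 0))" for x
  proof (rule rho_eqI)
    show "resaug m (resd m (Suc 0) x) \<in> carrier \<Lambda>"
      using homD(1)[OF resaug_hom(1) dc[OF x]] by simp
    show "rho (resaug m (resd m (Suc 0) x)) = rho \<zero>\<^bsub>\<Lambda>\<^esub>"
      using paug_pdiff by (simp add: resaug_hom(2)[OF dc[OF x]] resd_hom(2)[OF x] Lam_zero)
  qed (rule Lam_zero)
  show "\<exists>H\<in>bimodule_hom \<Lambda> (RP' n) (RP' 0). \<forall>x\<in>carrier (RP' n). resaug m (H x) = h x"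
    if h: "h \<in> bimodule_hom \<Lambda> (RP' n) (regular_bimodule \<Lambda>)" for h n
  proof (rule hom_lift[OF coord_P coord_L resaug_hom(1) h])
    fix x assume x: "x \<in> carrier (RP' n)"
    have hx: "h x \<in> carrier \<Lambda>"
      using homD(1)[OF h x] by simp
    have u: "psec (rho (h x)) \<in> PM m 0"
      by (intro psec_PM rho_LM hx)
    show "\<exists>y\<in>carrier (RP' 0). resaug m y = h x"
    proof (intro bexI rho_eqI)
      show y: "P.unrep 0 (psec (rho (h x))) \<in> carrier (RP' 0)"
        by (rule P.unrep(1)[OF u])
      show "resaug m (P.unrep 0 (psec (rho (h x)))) \<in> carrier \<Lambda>"
        using homD(1)[OF resaug_hom(1) y] by simp
      show "rho (resaug m (P.unrep 0 (psec (rho (h x))))) = rho (h x)"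
        unfolding resaug_hom(2)[OF y] P.unrep(2)[OF u] by (rule paug_psec)
    qed (rule hx)
  qed
  show "\<exists>H\<in>bimodule_hom \<Lambda> (RP' n) (RP' (Suc 0)). \<forall>x\<in>carrier (RP' n). resd m (Suc 0) (H x) = h x"
    if h: "h \<in> bimodule_hom \<Lambda> (RP' n) (RP' 0)" and z: "\<And>x. x \<in> carrier (RP' n) \<Longrightarrow> resaug m (h x) = \<zero>\<^bsub>\<Lambda>\<^esub>" for h n
  proof (rule hom_lift[OF coord_P coord_P resd_hom(1) h])
    fix x assume x: "x \<in> carrier (RP' n)"
    note hx = homD(1)[OF h x]
    have u: "phtp 0 (crd 0 (h x)) \<in> PM m (Suc 0)"
      by (intro phtp_PM crd_PM)
    have p: "paug (crd 0 (h x)) = 0"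
      using z[OF x] resaug_hom(2)[OF hx] by (simp add: Lam_zero)
    show "\<exists>y\<in>carrier (RP' (Suc 0)). resd m (Suc 0) y = h x"
    proof (intro bexI P.M_eqI)
      show y: "P.unrep (Suc 0) (phtp 0 (crd 0 (h x))) \<in> carrier (RP' (Suc 0))"
        by (rule P.unrep(1)[OF u])
      show "crd 0 (resd m (Suc 0) (P.unrep (Suc 0) (phtp 0 (crd 0 (h x))))) = crd 0 (h x)"
        unfolding resd_hom(2)[OF y] P.unrep(2)[OF u]
        using pdiff_phtp_0[OF crd_PM, of "h x"] p by (simp add: phtp_zero)
    qed (rule dc[OF P.unrep(1)[OF u]], rule hx)
  qed
  show "\<exists>H\<in>bimodule_hom \<Lambda> (RP' n) (RP' (Suc (Suc k))). \<forall>x\<in>carrier (RP' n). resd m (Suc (Suc k)) (H x) = h x"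
    if h: "h \<in> bimodule_hom \<Lambda> (RP' n) (RP' (Suc k))" 
      and z: "\<And>x. x \<in> carrier (RP' n) \<Longrightarrow> resd m (Suc k) (h x) = \<zero>\<^bsub>RP' k\<^esub>" for h n k
  proof (rule hom_lift[OF coord_P coord_P resd_hom(1) h])
    fix x assume x: "x \<in> carrier (RP' n)"
    note hx = homD(1)[OF h x]
    have u: "phtp (Suc k) (crd (Suc k) (h x)) \<in> PM m (Suc (Suc k))"
      by (intro phtp_PM crd_PM)
    have p: "pdiff (Suc k) (crd (Suc k) (h x)) = 0"
      using z[OF x] resd_hom(2)[OF hx] by (simp add: resP_zero)
    show "\<exists>y\<in>carrier (RP' (Suc (Suc k))). resd m (Suc (Suc k)) y = h x"
    proof (intro bexI P.M_eqI)
      show y: "P.unrep (Suc (Suc k)) (phtp (Suc k) (crd (Suc k) (h x))) \<in> carrier (RP' (Suc (Suc k)))"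
        by (rule P.unrep(1)[OF u])
      show "crd (Suc k) (resd m (Suc (Suc k)) (P.unrep (Suc (Suc k)) (phtp (Suc k) (crd (Suc k) (h x))))) = crd (Suc k) (h x)"
        unfolding resd_hom(2)[OF y] P.unrep(2)[OF u]
        using pdiff_phtp[OF crd_PM, of "Suc k" "h x"] p by (simp add: phtp_zero)
    qed (rule dc[OF P.unrep(1)[OF u]], rule hx)
  qed
qed

end

section \<open>Cochains in coordinates\<close>

lemma rgen_eqI: "zigzag m \<Longrightarrow> pgen m n i r = (pgen m n' i' r' :: 'k::field pm) \<Longrightarrow> n = n' \<Longrightarrow>
   rgen m n i r = (rgen m n' i' r' :: 'k pel)"
proof -
  assume z: "zigzag m" and *: "pgen m n i r = (pgen m n' i' r' :: 'k pm)" "n = n'"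
  interpret zigzag m "TYPE('k)" by fact
  interpret P: coord_bimod m "TYPE('k)" psc plact "pract n" "PM m n" "RP' n" "crd n"
    by (rule coord_P)
  show ?thesis
    using * by (intro P.M_eqI) (simp_all add: rgen_closed crd_rgen)
qed

text \<open>
  A cochain of degree \<open>n\<close> is determined by the coefficients \<open>c i r t\<close> of the value at the
  \<open>(i, r)\<close>-th generator; the basis element of type \<open>t\<close> that starts at \<open>i\<close> has to end at \<open>i + n - 2r\<close>.
\<close>

definition allowed :: "nat \<Rightarrow> nat \<Rightarrow> int \<Rightarrow> bt \<Rightarrow> bool" where
  "allowed m n r t = (case t of Vx \<Rightarrow> int m dvd int n - 2 * r | So \<Rightarrow> int m dvd int n - 2 * r
     | Fw \<Rightarrow> int m dvd int n - 2 * r - 1 | Bw \<Rightarrow> int m dvd int n - 2 * r + 1)"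

definition CM :: "nat \<Rightarrow> nat \<Rightarrow> (int \<Rightarrow> int \<Rightarrow> bt \<Rightarrow> 'k::field) set" where
  "CM m n = {c. (\<forall>i. c (i + int m) = c i) \<and> (\<forall>i r t. (r < 0 \<or> int n < r \<or> \<not> allowed m n r t) \<longrightarrow> c i r t = 0)}"

text \<open>The value of a cochain at the generator (i, r) is a combination of paths starting at
  \<open>i\<close>. Its four coefficients are turned into a periodic coefficient function supported
  on the residue class of \<open>i\<close>.\<close>

definition spread :: "nat \<Rightarrow> int \<Rightarrow> (bt \<Rightarrow> 'k::field) \<Rightarrow> 'k lm" where
  "spread m i y = (\<lambda>i' t. if int m dvd i' - i then y t else 0)"

text \<open>Coefficients of the composite of a cochain with the differential of degree n + 1. Vertex
  coefficients produce arrows and arrow coefficients produce socle elements; socle coefficients are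
  killed.\<close>

definition cdiff :: "nat \<Rightarrow> (int \<Rightarrow> int \<Rightarrow> bt \<Rightarrow> 'k::field) \<Rightarrow> int \<Rightarrow> int \<Rightarrow> bt \<Rightarrow> 'k" where
  "cdiff n c i r t = (case t of Vx \<Rightarrow> 0
     | Fw \<Rightarrow> c i r Vx + sg (int n + 1 + r) * c (i + 1) r Vx
     | Bw \<Rightarrow> sg (int n + 1) * c i (r - 1) Vx + sg (int n + 1 + r) * c (i - 1) (r - 1) Vx
     | So \<Rightarrow> c i r Bw + sg (int n + 1) * c i (r - 1) Fw + sg (int n + 1 + r) * (c (i + 1) r Bw + c (i - 1) (r - 1) Fw))"

lemma dvd_neg_diff: "int m dvd a - b \<longleftrightarrow> int m dvd b - a"
  by (metis dvd_minus_iff minus_diff_eq)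

lemma CM_D: "c \<in> CM m n \<Longrightarrow> c (i + int m) = c i" "c \<in> CM m n \<Longrightarrow> r < 0 \<or> int n < r \<or> \<not> allowed m n r t \<Longrightarrow> c i r t = 0"
  by (auto simp: CM_def)

lemma CM_cong: 
  assumes "c \<in> CM m n" "int m dvd i - j" shows "c i = c j"
proof -
  have "(\<lambda>i t. c i r t) \<in> LM m" for r
    using assms(1) by (intro LM_I) (auto simp: CM_def)
  from LM_cong[OF this assms(2)] show ?thesis
    by (auto simp: fun_eq_iff)
qed

lemma CM_add: "c \<in> CM m n \<Longrightarrow> c' \<in> CM m n \<Longrightarrow> (\<lambda>i r t. c i r t + c' i r t) \<in> CM m n"
  by (auto simp: CM_def fun_eq_iff)

lemma CM_sc: "c \<in> CM m n \<Longrightarrow> (\<lambda>i r t. a * c i r t) \<in> CM m n"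
  by (auto simp: CM_def fun_eq_iff)

lemma spread_LM: "spread m i y \<in> LM m"
  by (rule LM_I) (auto simp: spread_def dvd_shift fun_eq_iff)

lemma spread_left: "lmul (bas m i Vx) (spread m i y) = spread m i y"
  unfolding bas_Vx_mult by (rule fun2_eqI) (simp add: spread_def)

lemma spread_right:
  assumes "\<And>t. \<not> allowed m n r t \<Longrightarrow> y t = 0"
  shows "lmul (spread m i y) (bas m (i + int n - 2 * r) Vx) = spread m i y"
proof (rule fun2_eqI)
  fix i' t
  let ?j = "i + int n - 2 * r"
  show "lmul (spread m i y) (bas m ?j Vx) i' t = spread m i y i' t"
  proof (cases "int m dvd i' - i")
    case True
    have d: "int m dvd i' + c - ?j \<longleftrightarrow> int m dvd int n - 2 * r - c" for c
      using dvd_diff_cong[OF True, of "c - ?j"] dvd_neg_diff[of m "i + c" ?j] by (simp add: algebra_simps)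
    show ?thesis
      using assms[of t] True d[of 0] d[of 1] d[of "- 1"]
      by (cases t) (auto simp: mul_defs spread_def bas_def allowed_def)
  next
    case False
    then show ?thesis
      by (cases t) (auto simp: mul_defs spread_def)
  qed
qed

text \<open>The lift of the cocycle \<open>e\<^sub>i \<otimes>\<^bsub>r0\<^esub> e\<^sub>i \<mapsto> (-1)\<^bsup>r0 i\<^esup> e\<^sub>i\<close> shifts the index \<open>r\<close> by \<open>r0\<close>.\<close>

definition plift :: "nat \<Rightarrow> int \<Rightarrow> 'k::field pm \<Rightarrow> 'k pm" where
  "plift n r0 x i r s t = (if 0 \<le> r \<and> r \<le> int n then sg (r0 * i) * x i (r + r0) s t else 0)"

lemma plift_hom:
  "plift n r0 (x + y) = plift n r0 x + plift n r0 y" "plift n r0 (psc c x) = psc c (plift n r0 x)"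
  "plift n r0 (plact a x) = plact a (plift n r0 x)"
proof -
  show "plift n r0 (plact a x) = plact a (plift n r0 x)"
    by (rule fun4_eqI, case_tac s) (simp_all add: plift_def plact_def cmul_def algebra_simps)
qed (rule fun4_eqI, simp add: plift_def psc_def algebra_simps)+

text \<open>The right factors in the (i, r + r0)-summand in degree q + n and in the (i, r)-summand
  in degree n start at congruent vertices; this is the content of the divisibility
  hypothesis.\<close>

lemma plift_pract:
  assumes a: "a \<in> LM m" and q: "int m dvd int q - 2 * r0"
  shows "plift n r0 (pract (q + n) x a) = pract n (plift n r0 x) a"
proof (rule fun4_eqI)
  fix i r s t
  have "int m dvd (i + int (q + n) - 2 * (r + r0) + c) - (i + int n - 2 * r + c)" for c
    using q by (simp add: algebra_simps)
  from LM_cong[OF a this[of 0]] LM_cong[OF a this[of 1]] LM_cong[OF a this[of "- 1"]]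
  have "rmul y a (i + int (q + n) - 2 * (r + r0)) t = rmul y a (i + int n - 2 * r) t" for y
    by (cases t) (simp_all add: rmul_def)
  then show "plift n r0 (pract (q + n) x a) i r s t = pract n (plift n r0 x) a i r s t"
    by (cases t) (simp_all add: plift_def pract_def rmul_def algebra_simps)
qed

text \<open>An even modulus preserves parity, so signs such as (-1)^(r i) are well defined on
  residue classes.\<close>

lemma sg_period: "even m \<Longrightarrow> int m dvd i - j \<Longrightarrow> sg (r * i) = sg (r * j)"
proof -
  assume "even m" "int m dvd i - j"
  then have "even (i - j)"
    by (meson dvd_trans even_of_nat)
  then have "even (r * i) \<longleftrightarrow> even (r * j)"
    by auto
  then show ?thesis
    by (simp add: sg_def)
qed

lemma plift_PM:
  fixes x :: "'k::field pm"
  assumes "x \<in> PM m (q + n)" "even m"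
  shows "plift n r0 x \<in> PM m n"
proof (rule PM_I)
  fix i r s t
  have "sg (r0 * (i + int m)) = (sg (r0 * i) :: 'k)"
    by (rule sg_period[OF assms(2)]) simp
  then show "plift n r0 x (i + int m) r s t = plift n r0 x i r s t"
    using PM_D(1)[OF assms(1)] by (simp add: plift_def)
qed (auto simp: plift_def)

text \<open>The shift of \<open>r\<close> by \<open>r0\<close> changes the sign of the left-hand
  terms of the differential by (-1)^r0. The factor \<open>sg (r0 * i)\<close> changes by the same
  sign when i moves to a neighbour, and compensates. The sign (-1)^n of the right-hand terms is kept
  because \<open>q\<close> is even.\<close>

lemma pdiff_plift:
  assumes q: "even q" and r0: "0 \<le> r0" "r0 \<le> int q"
  shows "pdiff (Suc n) (plift (Suc n) r0 x) = plift n r0 (pdiff (Suc (q + n)) x)"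
proof (rule fun4_eqI)
  fix i r s t
  show "pdiff (Suc n) (plift (Suc n) r0 x) i r s t = plift n r0 (pdiff (Suc (q + n)) x) i r s t"
  proof (cases "0 \<le> r \<and> r \<le> int n")
    case True
    have sq: "sg (int (Suc (q + n))) = sg (int (Suc n))" "sg (int (Suc (q + n)) + (r + r0)) = sg (int (Suc n) + r) * sg r0"
      using q by (auto simp: sg_def)
    have si: "sg (r0 * (i - 1)) = sg r0 * sg (r0 * i)" "sg (r0 * (i + 1)) = sg r0 * sg (r0 * i)"
      by (auto simp: sg_def algebra_simps)
    have g: "0 \<le> r" "r < int (Suc n)" "0 \<le> r + r0" "r + r0 < int (Suc (q + n))"
      using True r0 by auto
    have row: "plift (Suc n) r0 x i r s = (\<lambda>t. sg (r0 * i) * x i (r + r0) s t)" if "0 \<le> r" "r \<le> int (Suc n)" for i r s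
      using that by (simp add: plift_def fun_eq_iff)
    have "pdiff (Suc n) (plift (Suc n) r0 x) i r s t = 
      sg (r0 * i) * mulF (x i (r + r0) s) t + sg (int (Suc n)) * (sg (r0 * i) * mulB (x i (r + 1 + r0) s) t)
       + sg (int (Suc n) + r) * (sg (r0 * (i - 1)) * mulF (\<lambda>s. x (i - 1) (r + r0) s t) s - sg (r0 * (i + 1)) * mulB (\<lambda>s. x (i + 1) (r + 1 + r0) s t) s)"
      unfolding pdiff_row[OF g(1,2)] using True by (simp add: row mul_linear del: of_nat_Suc)
    also have "\<dots> = sg (r0 * i) * pdiff (Suc (q + n)) x i (r + r0) s t"
      unfolding pdiff_row[OF g(3,4)] sq si by (simp add: algebra_simps del: of_nat_Suc)
    finally show ?thesis
      using True by (simp add: plift_def)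
  next
    case False
    then show ?thesis
      by (auto simp: pdiff_def plift_def)
  qed
qed

lemma plift_pgen:
  assumes "even m" and r0: "0 \<le> r0" "r0 \<le> int q"
  shows "plift n r0 (pgen m (q + n) i r) = psc (sg (r0 * i)) (pgen m n i (r - r0))"
proof (rule fun4_eqI)
  fix i' r' s t
  show "plift n r0 (pgen m (q + n) i r) i' r' s t = psc (sg (r0 * i)) (pgen m n i (r - r0)) i' r' s t"
    using sg_period[OF assms(1), of i' i r0] r0 by (auto simp: plift_def pgen_def psc_def)
qed

locale zigzag_even = zigzag m K for m and K :: "'k::field itself" +
  assumes m_even: "even m" and m_char: "of_nat m \<noteq> (0 :: 'k)"
begin

interpretation L: coord_bimod m K lsc lmul lmul "LM m" "regular_bimodule \<Lambda>" rho
  by (rule coord_L)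

interpretation P: coord_bimod m K psc plact "pract n" "PM m n" "RP' n" "crd n" for n
  by (rule coord_P)

sublocale X: ext_resolution \<Lambda> RP' "resd m" "resaug m"
  by (rule ext_resolution)

section \<open>Cochains of the resolution and their coefficients\<close>

abbreviation "CC n \<equiv> bimodule_hom \<Lambda> (RP' n) (regular_bimodule \<Lambda>)"

definition cf :: "nat \<Rightarrow> ('k pel \<Rightarrow> 'k lam) \<Rightarrow> int \<Rightarrow> int \<Rightarrow> bt \<Rightarrow> 'k" where
  "cf n f i r t = rho (f (rgen m n i r)) i t"

lemma CC_closed: "f \<in> CC n \<Longrightarrow> f (rgen m n i r) \<in> carrier \<Lambda>"
  using homD(1)[of f _ _ "regular_bimodule \<Lambda>", OF _ rgen_closed] by simp

lemma rgen_period: "int m dvd i - j \<Longrightarrow> rgen m n i r = (rgen m n j r :: 'k pel)"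
proof (rule rgen_eqI[OF zigzag_axioms])
  assume "int m dvd i - j"
  then have "int m dvd i' - i \<longleftrightarrow> int m dvd i' - j" for i'
    by (metis diff_add_cancel diff_diff_eq2 dvd_add_left_iff add_diff_eq)
  then show "pgen m n i r = (pgen m n j r :: 'k pm)"
    by (simp add: pgen_def)
qed simp

lemma rgen_outside: "r < 0 \<or> int n < r \<Longrightarrow> rgen m n i r = (\<zero>\<^bsub>RP' n\<^esub> :: 'k pel)"
  by (rule P.M_eqI[where n = n]) (auto simp: rgen_closed resP_zero crd_rgen pgen_def fun_eq_iff)

text \<open>The generator is fixed by an idempotent on each side, hence so is its image. The left
  idempotent yields the support, the right one restricts the path types to the allowed ones.\<close>

lemma cf_spread:
  assumes f: "f \<in> CC n"
  shows "rho (f (rgen m n i r)) = spread m i (cf n f i r)" "\<not> allowed m n r t \<Longrightarrow> cf n f i r t = 0"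
proof -
  let ?F = "rho (f (rgen m n i r))"
  have F: "?F \<in> LM m"
    by (intro rho_LM CC_closed f)
  have "f (rgen m n i r) = eL m i \<otimes>\<^bsub>\<Lambda>\<^esub> f (rgen m n i r)"
    using homD(5)[OF f Lam_gens(1)[of i] rgen_closed[of n i r]] by (simp add: rgen_idem)
  then have "?F = lmul (bas m i Vx) ?F"
    using Lam_mult(2)[OF Lam_gens(1)[of i] CC_closed[OF f, of i r]] by (simp add: Lam_gens)
  then have 1: "?F i' t = (if int m dvd i' - i then ?F i' t else 0)" for i' t
    unfolding bas_Vx_mult by (metis (mono_tags, lifting))
  show "?F = spread m i (cf n f i r)"
  proof (rule fun2_eqI)
    fix i' t
    show "?F i' t = spread m i (cf n f i r) i' t"
      using 1[of i' t] LM_cong[OF F, of i' i] by (auto simp: spread_def cf_def)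
  qed
  let ?j = "i + int n - 2 * r"
  have "f (rgen m n i r) = f (rgen m n i r) \<otimes>\<^bsub>\<Lambda>\<^esub> eL m ?j"
    using homD(6)[OF f Lam_gens(1)[of ?j] rgen_closed[of n i r]] by (simp add: rgen_idem)
  then have 2: "?F = lmul ?F (bas m ?j Vx)"
    using Lam_mult(2)[OF CC_closed[OF f, of i r] Lam_gens(1)[of ?j]] by (simp add: Lam_gens)
  have d: "int m dvd i + c - ?j \<longleftrightarrow> int m dvd int n - 2 * r - c" for c
    using dvd_neg_diff[of m "i + c" ?j] by (simp add: algebra_simps)
  show "cf n f i r t = 0" if "\<not> allowed m n r t"
    using fun_cong[OF fun_cong[OF 2, of i], of t] that d[of 0] d[of 1] d[of "- 1"]
    by (cases t) (auto simp: cf_def mul_defs bas_def allowed_def)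
qed

lemma cf_CM: "f \<in> CC n \<Longrightarrow> cf n f \<in> CM m n"
proof -
  assume f: "f \<in> CC n"
  have "cf n f (i + int m) = cf n f i" for i
    by (intro ext) (simp add: cf_def rgen_period[of "i + int m" i n] LM_D[OF rho_LM[OF CC_closed[OF f]]])
  moreover have "cf n f i r t = 0" if "r < 0 \<or> int n < r" for i r t
  proof -
    have "f (rgen m n i r) = \<zero>\<^bsub>\<Lambda>\<^esub>"
      using bimod_pair.hom_of_zero[OF bimod_pair.intro[OF P.bimod L.bimod] f] rgen_outside[OF that] by simp
    then show ?thesis
      by (simp add: cf_def Lam_zero)
  qed
  ultimately show ?thesis
    using cf_spread(2)[OF f] by (auto simp: CM_def)
qed

lemma cf_inj: "f \<in> CC n \<Longrightarrow> g \<in> CC n \<Longrightarrow> cf n f = cf n g \<Longrightarrow> f = g"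
  by (rule L.hom_unique, assumption, assumption, rule rho_eqI) (simp_all add: CC_closed cf_spread(1))

lemma cf_surj:
  assumes c: "c \<in> CM m n"
  shows "\<exists>f\<in>CC n. cf n f = c"
proof -
  define w where "w = (\<lambda>(i, r). lamb (spread m i (c i r)))"
  have w: "w (i, r) \<in> carrier \<Lambda>" "rho (w (i, r)) = spread m i (c i r)" for i r
    by (simp_all add: w_def lamb spread_LM)
  have "eL m i \<otimes>\<^bsub>\<Lambda>\<^esub> w (i, r) = w (i, r)" for i r
    by (rule rho_eqI) (simp_all add: Lam_mult Lam_gens w spread_left)
  moreover have "w (i, r) \<otimes>\<^bsub>\<Lambda>\<^esub> eL m (i + int n - 2 * r) = w (i, r)" for i r
    using CM_D(2)[OF c] by (intro rho_eqI) (simp_all add: Lam_mult Lam_gens w spread_right)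
  ultimately obtain f where f: "f \<in> CC n" "\<And>i r. (i, r) \<in> idx m n \<Longrightarrow> f (rgen m n i r) = w (i, r)"
    using L.hom_exists[of n w] w by auto
  have "cf n f i r t = c i r t" for i r t
  proof (cases "0 \<le> r \<and> r \<le> int n")
    case True
    have d: "int m dvd i - i mod int m" "int m dvd i mod int m - i"
      by (simp_all add: mod_eq_dvd_iff[symmetric])
    have "f (rgen m n i r) = w (i mod int m, r)"
      using f(2)[OF idx_mod, of r i] True rgen_period[OF d(1)] by simp
    then show ?thesis
      using d CM_cong[OF c d(2)] by (simp add: cf_def w spread_def)
  next
    case False
    then show ?thesis
      using CM_D(2)[OF cf_CM[OF f(1)], of r t i] CM_D(2)[OF c, of r t i] by auto
  qed
  then show ?thesis
    using f(1) by (intro bexI[of _ f] ext) auto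
qed

definition coch :: "nat \<Rightarrow> (int \<Rightarrow> int \<Rightarrow> bt \<Rightarrow> 'k) \<Rightarrow> 'k pel \<Rightarrow> 'k lam" where
  "coch n c = (SOME f. f \<in> CC n \<and> cf n f = c)"

lemma coch: "c \<in> CM m n \<Longrightarrow> coch n c \<in> CC n" "c \<in> CM m n \<Longrightarrow> cf n (coch n c) = c"
  using someI_ex[of "\<lambda>f. f \<in> CC n \<and> cf n f = c"] cf_surj[of c n] unfolding coch_def by blast+

lemma coch_eqI: "f \<in> CC n \<Longrightarrow> cf n f = c \<Longrightarrow> coch n c = f"
  using coch[of c n] cf_CM[of f n] cf_inj[of "coch n c" n f] by auto

lemma cf_add: "f \<in> CC n \<Longrightarrow> g \<in> CC n \<Longrightarrow> cf n (f \<oplus>\<^bsub>X.cochains n\<^esub> g) = (\<lambda>i r t. cf n f i r t + cf n g i r t)"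
  by (intro ext) (simp add: cf_def X.cochains_simps rgen_closed Lam_add CC_closed)

lemma cf_smult: "f \<in> CC n \<Longrightarrow> cf n (a \<odot>\<^bsub>X.cochains n\<^esub> f) = (\<lambda>i r t. a * cf n f i r t)"
  by (intro ext) (simp add: cf_def X.cochains_simps rgen_closed Lam_smult CC_closed lsc_def)

lemma cf_diff:
  assumes f: "f \<in> CC n"
  shows "cf (Suc n) (\<lambda>x\<in>carrier (RP' (Suc n)). f (resd m (Suc n) x)) = cdiff n (cf n f)"
proof (intro ext)
  fix i r t
  let ?g = "\<lambda>x\<in>carrier (RP' (Suc n)). f (resd m (Suc n) x)"
  have g: "?g \<in> CC (Suc n)"
    by (rule X.hom_comp_d[OF f])
  note cf0 = CM_D(2)[OF cf_CM[OF f]]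
  show "cf (Suc n) ?g i r t = cdiff n (cf n f) i r t"
  proof (cases "0 \<le> r \<and> r \<le> int (Suc n)")
    case False
    then have "cf (Suc n) ?g i r t = 0"
      using CM_D(2)[OF cf_CM[OF g], of r t i] by auto
    moreover have "cdiff n (cf n f) i r t = 0"
      using False cf0[of r] cf0[of "r - 1"] by (cases t) (auto simp: cdiff_def)
    ultimately show ?thesis by simp
  next
    case True
    \<comment> \<open>The values of the differential are prescribed only for generators with index
      in one period, so \<open>i\<close> is replaced by its residue and periodicity gives back the
      general case.\<close>
    define k where "k = i mod int m"
    have k: "(k, r) \<in> idx m (Suc n)" "int m dvd i - k"
      using True idx_mod[of r "Suc n" i] by (auto simp: k_def mod_eq_dvd_iff[symmetric])
    let ?j = "k + int (Suc n) - 2 * r"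
    have pw: "(- 1) ^ Suc n = (sg (int n + 1) :: 'k)" "(- 1) ^ (Suc n + nat r) = (sg (int n + 1 + r) :: 'k)"
      "(- 1) ^ Suc (n + nat r) = (sg (int n + 1 + r) :: 'k)"
      unfolding power_m1_sg using True by (simp_all add: add_ac)
    have "rho (?g (rgen m (Suc n) k r)) = 
        lmul (spread m k (cf n f k r)) (bas m (?j - 1) Fw)
        + lsc (sg (int n + 1)) (lmul (spread m k (cf n f k (r - 1))) (bas m (?j + 1) Bw))
        + lsc (sg (int n + 1 + r)) (lmul (bas m k Fw) (spread m (k + 1) (cf n f (k + 1) r))
             + lmul (bas m k Bw) (spread m (k - 1) (cf n f (k - 1) (r - 1))))"
      unfolding cf_spread(1)[OF f, symmetric]
      by (simp add: rgen_closed resd_rgen[OF k(1)] homD(3-6)[OF f] resP_add resP_smult resP_lact resP_ract Lam_gens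
            Lam_add Lam_smult Lam_mult CC_closed[OF f] pw del: of_nat_Suc power_Suc)
    then have "rho (?g (rgen m (Suc n) k r)) k t = 
        (lmul (spread m k (cf n f k r)) (bas m (?j - 1) Fw)
        + lsc (sg (int n + 1)) (lmul (spread m k (cf n f k (r - 1))) (bas m (?j + 1) Bw))
        + lsc (sg (int n + 1 + r)) (lmul (bas m k Fw) (spread m (k + 1) (cf n f (k + 1) r))
             + lmul (bas m k Bw) (spread m (k - 1) (cf n f (k - 1) (r - 1))))) k t"
      by (rule arg_cong)
    also have "\<dots> = cdiff n (cf n f) k r t"
    proof -
      have d: "int m dvd k + c - (?j - 1) \<longleftrightarrow> int m dvd int n - 2 * r - c" 
         "int m dvd k + c - (?j + 1) \<longleftrightarrow> int m dvd int n - 2 * (r - 1) - c" for c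
        using dvd_neg_diff[of m "k + c" "?j - 1"] dvd_neg_diff[of m "k + c" "?j + 1"] by (simp_all add: algebra_simps)
      note c = cf0[of r Vx k] cf0[of r Bw k] cf0[of "r - 1" Vx k] cf0[of "r - 1" Fw k]
      \<comment> \<open>The products with arrows come with tests for matching end vertices. Where
        such a test fails, the type is not allowed and the coefficient is zero anyway.\<close>
      have e: "cf n f k r Vx * (if int m dvd k - (?j - 1) then 1 else 0) = cf n f k r Vx"
        "cf n f k r Bw * (if int m dvd k - 1 - (?j - 1) then 1 else 0) = cf n f k r Bw"
        "cf n f k (r - 1) Vx * (if int m dvd k - (?j + 1) then 1 else 0) = cf n f k (r - 1) Vx"
        "cf n f k (r - 1) Fw * (if int m dvd k + 1 - (?j + 1) then 1 else 0) = cf n f k (r - 1) Fw"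
        using c d(1)[of 0] d(1)[of "- 1"] d(2)[of 0] d(2)[of 1] by (auto simp: allowed_def)
      show ?thesis
        using e by (cases t) (auto simp: mul_defs lsc_def spread_def bas_def cdiff_def simp del: of_nat_Suc split: if_splits)
    qed
    finally have "cf (Suc n) ?g k r t = cdiff n (cf n f) k r t"
      by (simp add: cf_def)
    moreover have "cf (Suc n) ?g i = cf (Suc n) ?g k"
      by (rule CM_cong[OF cf_CM[OF g] k(2)])
    moreover have "cf n f (i + a) = cf n f (k + a)" for a
      by (rule CM_cong[OF cf_CM[OF f]]) (use k(2) in simp)
    from this[of 0] this[of 1] this[of "- 1"] have "cdiff n (cf n f) i r t = cdiff n (cf n f) k r t"
      by (cases t) (simp_all add: cdiff_def)
    ultimately show ?thesis
      by simp
  qed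
qed

lemma cocyc_iff_cf: "f \<in> X.cocyc n \<longleftrightarrow> f \<in> CC n \<and> cdiff n (cf n f) = 0"
proof -
  have "(\<forall>x\<in>carrier (RP' (Suc n)). f (resd m (Suc n) x) = \<zero>\<^bsub>\<Lambda>\<^esub>) \<longleftrightarrow> cdiff n (cf n f) = 0" if f: "f \<in> CC n"
  proof -
    let ?g = "\<lambda>x\<in>carrier (RP' (Suc n)). f (resd m (Suc n) x)"
    have z: "(\<lambda>x\<in>carrier (RP' (Suc n)). \<zero>\<^bsub>\<Lambda>\<^esub>) \<in> CC (Suc n)"
      using bimod_pair.hom_zero[OF bimod_pair.intro[OF P.bimod L.bimod]] by simp
    have "cf (Suc n) (\<lambda>x\<in>carrier (RP' (Suc n)). \<zero>\<^bsub>\<Lambda>\<^esub>) = 0"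
      by (simp add: cf_def fun_eq_iff rgen_closed Lam_zero)
    then have "?g = (\<lambda>x\<in>carrier (RP' (Suc n)). \<zero>\<^bsub>\<Lambda>\<^esub>) \<longleftrightarrow> cdiff n (cf n f) = 0"
      using cf_inj[OF X.hom_comp_d[OF f] z] cf_diff[OF f] by auto
    moreover have "?g = (\<lambda>x\<in>carrier (RP' (Suc n)). \<zero>\<^bsub>\<Lambda>\<^esub>) \<longleftrightarrow> (\<forall>x\<in>carrier (RP' (Suc n)). f (resd m (Suc n) x) = \<zero>\<^bsub>\<Lambda>\<^esub>)"
      by (auto simp: restrict_def fun_eq_iff)
    ultimately show ?thesis
      by simp
  qed
  then show ?thesis
    by (auto simp: X.cocyc_iff)
qed

text \<open>
  The cocycle \<open>e\<^sub>i \<otimes>\<^bsub>r0\<^esub> e\<^sub>i \<mapsto> (-1)\<^bsup>r0 i\<^esup> e\<^sub>i\<close> exists in the degrees \<open>q\<close> that satisfy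
  \<open>chi_degree q r0\<close>; all of these are products of \<open>\<chi>\<^bsub>2,0\<^esub>\<close>, \<open>\<chi>\<^bsub>m,1\<^esub>\<close> and \<open>\<chi>\<^bsub>m,-1\<^esub>\<close>.
\<close>

definition chi_coeffs :: "int \<Rightarrow> int \<Rightarrow> int \<Rightarrow> bt \<Rightarrow> 'k" where
  "chi_coeffs r0 i r t = (if r = r0 \<and> t = Vx then sg (r0 * i) else 0)"

definition chi_degree :: "nat \<Rightarrow> int \<Rightarrow> bool" where
  "chi_degree q r0 \<longleftrightarrow> even q \<and> 0 \<le> r0 \<and> r0 \<le> int q \<and> int m dvd int q - 2 * r0"

text \<open>The cocycle is obtained from its lift, as the augmentation composed with
  \<open>G 0\<close>. It vanishes on boundaries because \<open>G\<close> is a chain map and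
  \<epsilon> d = 0.\<close>

lemma chi_lift:
  assumes "chi_degree q r0"
  obtains G where "X.is_lift q (coch q (chi_coeffs r0)) G" "coch q (chi_coeffs r0) \<in> X.cocyc q" "cf q (coch q (chi_coeffs r0)) = chi_coeffs r0"
    "\<And>n i r. G n (rgen m (q + n) i r) = sg (r0 * i) \<odot>\<^bsub>RP' n\<^esub> rgen m n i (r - r0)"
proof -
  have q: "even q" "0 \<le> r0" "r0 \<le> int q" "int m dvd int q - 2 * r0"
    using assms by (auto simp: chi_degree_def)
  define G where "G n = P.tr n (q + n) (plift n r0)" for n
  have G: "G n \<in> bimodule_hom \<Lambda> (RP' (q + n)) (RP' n)" 
    "\<And>x. x \<in> carrier (RP' (q + n)) \<Longrightarrow> crd n (G n x) = plift n r0 (crd (q + n) x)" for n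
    unfolding G_def by (rule P.tr_hom; simp add: plift_hom plift_PM[OF _ m_even] plift_pract q)+
  have dG: "resd m (Suc n) (G (Suc n) x) = G n (resd m (Suc (q + n)) x)" if x: "x \<in> carrier (RP' (Suc (q + n)))" for n x
  proof (rule P.M_eqI)
    have Gx: "G (Suc n) x \<in> carrier (RP' (Suc n))"
      using homD(1)[OF G(1)[of "Suc n"]] x by simp
    have dx: "resd m (Suc (q + n)) x \<in> carrier (RP' (q + n))"
      by (rule homD(1)[OF resd_hom(1) x])
    show "resd m (Suc n) (G (Suc n) x) \<in> carrier (RP' n)"
      by (rule homD(1)[OF resd_hom(1) Gx])
    show "G n (resd m (Suc (q + n)) x) \<in> carrier (RP' n)"
      by (rule homD(1)[OF G(1) dx])
    show "crd n (resd m (Suc n) (G (Suc n) x)) = crd n (G n (resd m (Suc (q + n)) x))"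
      using G(2)[of x "Suc n"] x by (simp add: resd_hom(2)[OF Gx] G(2)[OF dx] resd_hom(2)[OF x] pdiff_plift q)
  qed
  define f where "f = (\<lambda>x\<in>carrier (RP' q). resaug m (G 0 x))"
  have f: "f \<in> CC q"
    unfolding f_def using G(1)[of 0] by (intro hom_comp[OF P.bimod _ resaug_hom(1)]) simp
  have lift: "X.is_lift q f G"
    using G(1) dG by (simp add: X.is_lift_def f_def)
  have fc: "f \<in> X.cocyc q"
  proof -
    have "f (resd m (Suc q) x) = \<zero>\<^bsub>\<Lambda>\<^esub>" if x: "x \<in> carrier (RP' (Suc q))" for x
    proof -
      have "G (Suc 0) x \<in> carrier (RP' (Suc 0))"
        using homD(1)[OF G(1)[of "Suc 0"]] x by simp
      then show ?thesis
        using dG[of x 0] x X.aug_d[of "G (Suc 0) x"] X.d_closed[of x q] by (simp add: f_def)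
    qed
    then show ?thesis
      using f by (simp add: X.cocyc_iff)
  qed
  have Gg: "G n (rgen m (q + n) i r) = sg (r0 * i) \<odot>\<^bsub>RP' n\<^esub> rgen m n i (r - r0)" for n i r
    by (rule P.M_eqI[where n = n]) (simp_all add: homD(1)[OF G(1) rgen_closed] resP_smult rgen_closed G(2) crd_rgen plift_pgen[OF m_even q(2,3)])
  have "cf q f = chi_coeffs r0"
  proof (intro ext)
    fix i r t
    have "G 0 (rgen m q i r) \<in> carrier (RP' 0)"
      using homD(1)[OF G(1)[of 0], of "rgen m q i r"] rgen_closed by simp
    then have "cf q f i r t = paug (plift 0 r0 (pgen m q i r)) i t"
      using G(2)[of "rgen m q i r" 0] rgen_closed[of q i r] by (simp add: cf_def f_def resaug_hom(2) crd_rgen)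
    also have "\<dots> = paug (psc (sg (r0 * i)) (pgen m 0 i (r - r0))) i t"
      by (simp add: plift_pgen[OF m_even q(2,3), of 0 i r, simplified])
    also have "\<dots> = chi_coeffs r0 i r t"
      by (cases t) (auto simp: paug_def psc_def pgen_def chi_coeffs_def)
    finally show "cf q f i r t = chi_coeffs r0 i r t" .
  qed
  then have "coch q (chi_coeffs r0) = f"
    by (rule coch_eqI[OF f])
  then show ?thesis
    using that[of G] lift fc Gg \<open>cf q f = chi_coeffs r0\<close> by simp
qed

subsection \<open>Generation\<close>

abbreviation "gens \<equiv> HH_generators m :: 'k hh set"

lemma HH_EA: "HH m = X.EA"
  by (simp add: HH_def)

definition generated :: "nat \<Rightarrow> (int \<Rightarrow> int \<Rightarrow> bt \<Rightarrow> 'k) \<Rightarrow> bool" where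
  "generated n c \<longleftrightarrow> c \<in> CM m n \<and> cdiff n c = 0 \<and> X.hclass n (coch n c) \<in> subalgebra_gen X.EA gens"

lemma coch_cocyc: "c \<in> CM m n \<Longrightarrow> cdiff n c = 0 \<Longrightarrow> coch n c \<in> X.cocyc n"
  by (simp add: cocyc_iff_cf coch)

lemma generated_cocyc: "generated n c \<Longrightarrow> coch n c \<in> X.cocyc n"
  by (simp add: generated_def coch_cocyc)

lemma cdiff_add: "cdiff n (\<lambda>i r t. c i r t + c' i r t) = (\<lambda>i r t. cdiff n c i r t + cdiff n c' i r t)"
  by (intro ext) (rename_tac i r t, case_tac t, simp_all add: cdiff_def algebra_simps)

lemma cdiff_sc: "cdiff n (\<lambda>i r t. a * c i r t) = (\<lambda>i r t. a * cdiff n c i r t)"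
  by (intro ext) (rename_tac i r t, case_tac t, simp_all add: cdiff_def algebra_simps)

lemma generated_add:
  assumes "generated n c" "generated n c'"
  shows "generated n (\<lambda>i r t. c i r t + c' i r t)"
proof -
  have c: "c \<in> CM m n" "c' \<in> CM m n" "cdiff n c = 0" "cdiff n c' = 0"
    using assms by (auto simp: generated_def)
  have "coch n (\<lambda>i r t. c i r t + c' i r t) = coch n c \<oplus>\<^bsub>X.cochains n\<^esub> coch n c'"
  proof (rule coch_eqI)
    show "coch n c \<oplus>\<^bsub>X.cochains n\<^esub> coch n c' \<in> CC n"
      using X.cocyc_add[OF generated_cocyc[OF assms(1)] generated_cocyc[OF assms(2)]] by (simp add: X.cocyc_iff)
    show "cf n (coch n c \<oplus>\<^bsub>X.cochains n\<^esub> coch n c') = (\<lambda>i r t. c i r t + c' i r t)"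
      by (simp only: cf_add[OF coch(1) coch(1)] coch(2) c)
  qed
  then have "X.hclass n (coch n (\<lambda>i r t. c i r t + c' i r t)) = X.hclass n (coch n c) \<oplus>\<^bsub>X.EA\<^esub> X.hclass n (coch n c')"
    using X.hclass_add[OF generated_cocyc[OF assms(1)] generated_cocyc[OF assms(2)]] by simp
  moreover have "cdiff n (\<lambda>i r t. c i r t + c' i r t) = 0"
    unfolding cdiff_add c by (simp add: fun_eq_iff)
  ultimately show ?thesis
    using assms CM_add[OF c(1,2)] by (simp add: generated_def subalgebra_gen.add)
qed

lemma generated_sc:
  assumes "generated n c"
  shows "generated n (\<lambda>i r t. a * c i r t)"
proof -
  have c: "c \<in> CM m n" "cdiff n c = 0"
    using assms by (auto simp: generated_def)
  have "coch n (\<lambda>i r t. a * c i r t) = a \<odot>\<^bsub>X.cochains n\<^esub> coch n c"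
  proof (rule coch_eqI)
    show "a \<odot>\<^bsub>X.cochains n\<^esub> coch n c \<in> CC n"
      using X.cocyc_smult[OF generated_cocyc[OF assms]] by (simp add: X.cocyc_iff)
    show "cf n (a \<odot>\<^bsub>X.cochains n\<^esub> coch n c) = (\<lambda>i r t. a * c i r t)"
      by (simp only: cf_smult[OF coch(1)] coch(2) c)
  qed
  then have "X.hclass n (coch n (\<lambda>i r t. a * c i r t)) = a \<odot>\<^bsub>X.EA\<^esub> X.hclass n (coch n c)"
    using X.hclass_smult[OF generated_cocyc[OF assms]] by simp
  moreover have "cdiff n (\<lambda>i r t. a * c i r t) = 0"
    unfolding cdiff_sc c by (simp add: fun_eq_iff)
  ultimately show ?thesis
    using assms CM_sc[OF c(1)] by (simp add: generated_def subalgebra_gen.smult)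
qed

text \<open>The right factor is the one that is lifted. With a chi class on the right the lift is a
  shift, so any cocycle on the left is moved by \<open>r0\<close> rows and twisted by a
  sign.\<close>

lemma generated_mult:
  assumes c: "generated p c" and X: "chi_degree q r0" "generated q (chi_coeffs r0)"
  shows "generated (p + q) (\<lambda>i r t. sg (r0 * i) * c i (r - r0) t)"
proof -
  obtain G where G: "X.is_lift q (coch q (chi_coeffs r0)) G"
    and "coch q (chi_coeffs r0) \<in> X.cocyc q" "cf q (coch q (chi_coeffs r0)) = chi_coeffs r0"
    and Gg: "\<And>n i r. G n (rgen m (q + n) i r) = sg (r0 * i) \<odot>\<^bsub>RP' n\<^esub> rgen m n i (r - r0)"
    by (rule chi_lift[OF X(1)]) (rule that)
  let ?f = "coch p c"
  let ?h = "X.comp_lift p q ?f G"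
  have cp: "c \<in> CM m p"
    using c by (simp add: generated_def)
  note f = generated_cocyc[OF c]
  have hc: "?h \<in> X.cocyc (p + q)"
    by (rule X.comp_lift_cocyc[OF f G])
  have "cf (p + q) ?h = (\<lambda>i r t. sg (r0 * i) * c i (r - r0) t)"
  proof (intro ext)
    fix i r t
    have "?h (rgen m (p + q) i r) = ?f (sg (r0 * i) \<odot>\<^bsub>RP' p\<^esub> rgen m p i (r - r0))"
      using Gg[of p i r] rgen_closed[of "p + q" i r] by (simp add: X.comp_lift_def add.commute)
    also have "\<dots> = sg (r0 * i) \<odot>\<^bsub>\<Lambda>\<^esub> ?f (rgen m p i (r - r0))"
      using homD(4)[OF coch(1)[OF cp] rgen_closed] by simp
    finally show "cf (p + q) ?h i r t = sg (r0 * i) * c i (r - r0) t"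
      using fun_cong[OF fun_cong[OF fun_cong[OF coch(2)[OF cp], of i], of "r - r0"], of t]
      by (simp add: cf_def Lam_smult CC_closed[OF coch(1)[OF cp]] lsc_def)
  qed
  moreover have "X.hclass p ?f \<otimes>\<^bsub>X.EA\<^esub> X.hclass q (coch q (chi_coeffs r0)) = X.hclass (p + q) ?h"
    by (rule X.hclass_mult[OF f generated_cocyc[OF X(2)] G])
  ultimately show ?thesis
    using c X(2) hc cf_CM[of ?h "p + q"] coch_eqI[of ?h "p + q"] subalgebra_gen.mult[of "X.hclass p ?f" X.EA gens "X.hclass q (coch q (chi_coeffs r0))"]
    by (simp add: generated_def cocyc_iff_cf)
qed

text \<open>The class is zero, and zero belongs to the generated subalgebra as 0 times the
  identity.\<close>

lemma generated_coboundary: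
  assumes g: "g \<in> CM m n"
  shows "generated (Suc n) (cdiff n g)"
proof -
  let ?h = "\<lambda>x\<in>carrier (RP' (Suc n)). coch n g (resd m (Suc n) x)"
  have h: "?h \<in> X.coboundaries (Suc n)"
    by (rule X.coboundaryI[OF coch(1)[OF g]])
  note hc = X.coboundary_cocyc[OF h]
  have cf: "cf (Suc n) ?h = cdiff n g"
    using cf_diff[OF coch(1)[OF g]] by (simp add: coch(2)[OF g])
  have z: "\<zero>\<^bsub>X.cochains (Suc n)\<^esub> \<in> X.cocyc (Suc n)"
    by (rule X.cocyc_zero)
  have "X.hclass (Suc n) ?h = X.hclass (Suc n) \<zero>\<^bsub>X.cochains (Suc n)\<^esub>"
  proof (rule X.hclass_cong[OF hc z])
    have "x \<ominus>\<^bsub>\<Lambda>\<^esub> \<zero>\<^bsub>\<Lambda>\<^esub> = x" if "x \<in> carrier \<Lambda>" for x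
      using bimod.axioms(1)[OF L.bimod] X.L_group that
      by (metis a_minus_def abelian_group.a_inv_closed abelian_group.minus_equality abelian_group.r_neg1 abelian_groupE(1,2,4) abelian_groupE(5) abelian_monoid.r_zero abelian_group.axioms(1) Lam_zero(1))
    then have "(\<lambda>x\<in>carrier (RP' (Suc n)). ?h x \<ominus>\<^bsub>\<Lambda>\<^esub> \<zero>\<^bsub>X.cochains (Suc n)\<^esub> x) = ?h"
      using X.cochain_closed[OF coch(1)[OF g]] X.d_closed by (auto simp: X.cochains_simps fun_eq_iff restrict_def)
    then show "(\<lambda>x\<in>carrier (RP' (Suc n)). ?h x \<ominus>\<^bsub>\<Lambda>\<^esub> \<zero>\<^bsub>X.cochains (Suc n)\<^esub> x) \<in> X.coboundaries (Suc n)"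
      using h by simp
  qed
  also have "\<dots> = 0 \<odot>\<^bsub>X.EA\<^esub> X.hclass (Suc n) \<zero>\<^bsub>X.cochains (Suc n)\<^esub>"
    unfolding X.hclass_smult[OF z] by (simp add: X.smult_zero_cochain)
  also have "\<dots> = 0 \<odot>\<^bsub>X.EA\<^esub> \<one>\<^bsub>X.EA\<^esub>"
  proof -
    have e: "resaug m \<in> X.cocyc 0"
      using X.aug_hom X.aug_d by (simp add: X.cocyc_iff)
    have "0 \<odot>\<^bsub>X.cochains 0\<^esub> resaug m = \<zero>\<^bsub>X.cochains 0\<^esub>"
      using bimod.zero_smult[OF L.bimod] X.cochain_closed[OF X.aug_hom] by (auto simp: X.cochains_simps fun_eq_iff restrict_def)
    then have "0 \<odot>\<^bsub>X.EA\<^esub> \<one>\<^bsub>X.EA\<^esub> = \<zero>\<^bsub>X.EA\<^esub>"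
      using X.hclass_smult[OF e, of 0] X.hclass_zero[of 0] by (simp add: X.EA_simps(3) X.hclass_def)
    then show ?thesis
      unfolding X.hclass_smult[OF z] by (simp add: X.smult_zero_cochain X.hclass_zero)
  qed
  also have "\<dots> \<in> subalgebra_gen X.EA gens"
    by (intro subalgebra_gen.smult subalgebra_gen.one)
  finally have "X.hclass (Suc n) ?h \<in> subalgebra_gen X.EA gens" .
  moreover have "coch (Suc n) (cdiff n g) = ?h"
    using hc by (intro coch_eqI cf) (simp add: X.cocyc_iff)
  ultimately show ?thesis
    using hc cf_CM[of ?h "Suc n"] by (simp add: generated_def cocyc_iff_cf cf)
qed

section \<open>The listed generators as classes of explicit cocycles\<close>

lemma generated_one: "generated 0 (chi_coeffs 0)"
proof -
  have e: "resaug m \<in> X.cocyc 0"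
    using X.aug_hom X.aug_d by (simp add: X.cocyc_iff)
  have "cf 0 (resaug m) = chi_coeffs 0"
  proof (intro ext)
    fix i r t
    have "cf 0 (resaug m) i r t = paug (pgen m 0 i r) i t"
      by (simp add: cf_def resaug_hom(2)[OF rgen_closed] crd_rgen)
    also have "\<dots> = chi_coeffs 0 i r t"
      by (cases t) (auto simp: paug_def pgen_def chi_coeffs_def)
    finally show "cf 0 (resaug m) i r t = chi_coeffs 0 i r t" .
  qed
  moreover from this have "coch 0 (chi_coeffs 0) = resaug m"
    by (intro coch_eqI resaug_hom(1))
  moreover have "X.hclass 0 (resaug m) \<in> subalgebra_gen X.EA gens"
    using subalgebra_gen.one[of X.EA gens] by (simp add: X.EA_simps(3) X.hclass_def)
  ultimately show ?thesis
    using e cf_CM[OF resaug_hom(1)] by (simp add: generated_def cocyc_iff_cf)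
qed

lemma hh_class_eq:
  assumes c: "c \<in> CM m n"
    and w: "\<And>i. 0 \<le> i \<Longrightarrow> i < int m \<Longrightarrow> w i \<in> carrier \<Lambda>"
      "\<And>i r. 0 \<le> i \<Longrightarrow> i < int m \<Longrightarrow> int n - 2 * r = k \<Longrightarrow> rho (w i) = spread m i (c i r)"
    and k: "\<And>i r t. int n - 2 * r \<noteq> k \<Longrightarrow> c i r t = 0"
  shows "hh_class m n k w = X.hclass n (coch n c)"
proof -
  have "hom_by_gens \<Lambda> (RP' n) (regular_bimodule \<Lambda>) (idx m n) (\<lambda>(i, r). rgen m n i r)
           (\<lambda>(i, r). if int n - 2 * r = k then w i else \<zero>\<^bsub>\<Lambda>\<^esub>) = coch n c"
  proof (rule L.hom_by_gens_eq[OF coch(1)[OF c]])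
    fix i r assume ir: "(i, r) \<in> idx m n"
    then have i: "0 \<le> i" "i < int m"
      by (auto simp: idx_def)
    have "spread m i (c i r) = 0" if "int n - 2 * r \<noteq> k"
      using k[OF that] by (simp add: spread_def fun_eq_iff)
    then have "rho (coch n c (rgen m n i r)) = rho (if int n - 2 * r = k then w i else \<zero>\<^bsub>\<Lambda>\<^esub>)"
      using w(2)[OF i, of r] by (simp add: cf_spread(1)[OF coch(1)[OF c]] coch(2)[OF c] Lam_zero)
    then show "coch n c (rgen m n i r) = (case (i, r) of (i, r) \<Rightarrow> if int n - 2 * r = k then w i else \<zero>\<^bsub>\<Lambda>\<^esub>)"
      using w(1)[OF i] by (intro rho_eqI) (simp_all add: CC_closed[OF coch(1)[OF c]] Lam_zero)
  qed
  then show ?thesis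
    by (simp add: hh_class_def X.hclass_def)
qed

text \<open>One row, one path type, and coefficients (-1)^(a i). All listed generators of positive
  degree have this shape, and so do the summands of an odd cocycle in normal form.\<close>

definition pure_coeffs :: "int \<Rightarrow> bt \<Rightarrow> int \<Rightarrow> int \<Rightarrow> int \<Rightarrow> bt \<Rightarrow> 'k" where
  "pure_coeffs r0 t0 a i r t = (if r = r0 \<and> t = t0 then sg (a * i) else 0)"

lemma chi_coeffs_eq: "chi_coeffs r0 = pure_coeffs r0 Vx r0"
  by (intro ext) (simp add: chi_coeffs_def pure_coeffs_def)

lemma pure_coeffs_CM:
  assumes "0 \<le> r0" "r0 \<le> int n" "allowed m n r0 t0"
  shows "pure_coeffs r0 t0 a \<in> CM m n"
proof -
  have "sg (a * (i + int m)) = (sg (a * i) :: 'k)" for i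
    by (rule sg_period[OF m_even]) simp
  then show ?thesis
    using assms by (auto simp: CM_def pure_coeffs_def fun_eq_iff)
qed

lemma sg_shift: "sg (a * (i + 1)) = sg a * sg (a * i)" "sg (a * (i - 1)) = sg a * sg (a * i)"
  by (auto simp: sg_def algebra_simps)

text \<open>Each nontrivial coefficient of the coboundary has contributions from two neighbouring
  vertices, and the parity condition makes them cancel. For backward arrows the analogous condition
  involves the degree.\<close>

lemma pure_coeffs_cocycle_Vx:
  assumes "even n" "even (r0 + a)"
  shows "cdiff n (pure_coeffs r0 Vx a) = 0"
proof (intro ext)
  fix i r t
  show "cdiff n (pure_coeffs r0 Vx a) i r t = 0 i r t"
    using assms by (cases t) (auto simp: cdiff_def pure_coeffs_def sg_shift, auto simp: sg_def)
qed

lemma pure_coeffs_cocycle_Fw: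
  assumes "even (r0 + a)"
  shows "cdiff n (pure_coeffs r0 Fw a) = 0"
proof (intro ext)
  fix i r t
  show "cdiff n (pure_coeffs r0 Fw a) i r t = 0 i r t"
    using assms by (cases t) (auto simp: cdiff_def pure_coeffs_def sg_shift, auto simp: sg_def)
qed

lemma pure_coeffs_cocycle_Bw:
  assumes "even (int n + r0 + a)"
  shows "cdiff n (pure_coeffs r0 Bw a) = 0"
proof (intro ext)
  fix i r t
  have "sg (int n + 1 + r0) * sg a = (- 1 :: 'k)"
    using assms by (auto simp: sg_def)
  then have "sg (int n + 1 + r0) * (sg a * sg (a * i)) = (- sg (a * i) :: 'k)"
    by (simp flip: mult.assoc)
  then show "cdiff n (pure_coeffs r0 Bw a) i r t = 0 i r t"
    by (cases t) (auto simp: cdiff_def pure_coeffs_def sg_shift)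
qed

lemma hh_class_pure_coeffs:
  assumes r0: "0 \<le> r0" "r0 \<le> int n" "allowed m n r0 t0" and k: "k = int n - 2 * r0"
    and w: "\<And>i. 0 \<le> i \<Longrightarrow> i < int m \<Longrightarrow> w i \<in> carrier \<Lambda>"
      "\<And>i. 0 \<le> i \<Longrightarrow> i < int m \<Longrightarrow> rho (w i) = lsc (sg (a * i)) (bas m i t0)"
  shows "hh_class m n k w = X.hclass n (coch n (pure_coeffs r0 t0 a))"
proof (rule hh_class_eq[OF pure_coeffs_CM[OF r0] w(1)])
  fix i r assume i: "0 \<le> i" "i < int m" and "int n - 2 * r = k"
  then have "r = r0"
    using k by simp
  then show "rho (w i) = spread m i (pure_coeffs r0 t0 a i r)"
    using w(2)[OF i] by (auto simp: fun_eq_iff spread_def pure_coeffs_def lsc_def bas_def)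
next
  show "pure_coeffs r0 t0 a i r t = 0" if "int n - 2 * r \<noteq> k" for i r t
    using that k by (auto simp: pure_coeffs_def)
qed

lemma lsc_1: "lsc 1 f = f"
  by (simp add: lsc_def fun_eq_iff)

text \<open>The row is found from n - 2 r = k. For instance, k = 1 - m in degree m - 1 gives r = m -
  1, while k = m - 1 in the same degree gives r = 0.\<close>

lemma generator_classes:
  "phi_1_0 m = X.hclass 1 (coch 1 (pure_coeffs 0 Fw 0))"
  "psi_1_0 m = X.hclass 1 (coch 1 (pure_coeffs 1 Bw 0))"
  "chi_2_0 m = X.hclass 2 (coch 2 (pure_coeffs 1 Vx 1))"
  "phi_m1_neg m = X.hclass (m - 1) (coch (m - 1) (pure_coeffs (int m - 1) Fw 1))"
  "psi_m1_pos m = X.hclass (m - 1) (coch (m - 1) (pure_coeffs 0 Bw 1))"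
  "chi_m_pos m = X.hclass m (coch m (pure_coeffs 0 Vx 0))"
  "chi_m_neg m = X.hclass m (coch m (pure_coeffs (int m) Vx (int m)))"
proof -
  have i: "int (m - 1) = int m - 1"
    using m_pos by simp
  have p: "(- 1) ^ nat i = (sg i :: 'k)" if "0 \<le> i" for i
    unfolding power_m1_sg using that by simp
  \<comment> \<open>chi_{m,-1} has trivial signs. It is written with the exponent \<open>m\<close>,
    which is even, so that it takes the form \<open>chi_coeffs (int m)\<close>.\<close>
  have s: "sg (int m * i) = (1 :: 'k)" for i
    by (rule sg_mult_eq_1) (simp add: m_even)
  show "phi_1_0 m = X.hclass 1 (coch 1 (pure_coeffs 0 Fw 0))"
    unfolding phi_1_0_def by (rule hh_class_pure_coeffs) (simp_all add: allowed_def Lam_gens lsc_1)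
  show "psi_1_0 m = X.hclass 1 (coch 1 (pure_coeffs 1 Bw 0))"
    unfolding psi_1_0_def by (rule hh_class_pure_coeffs) (simp_all add: allowed_def Lam_gens lsc_1)
  show "chi_2_0 m = X.hclass 2 (coch 2 (pure_coeffs 1 Vx 1))"
    unfolding chi_2_0_def by (rule hh_class_pure_coeffs) (simp_all add: allowed_def Lam_gens Lam_smult p)
  show "phi_m1_neg m = X.hclass (m - 1) (coch (m - 1) (pure_coeffs (int m - 1) Fw 1))"
    unfolding phi_m1_neg_def
    by (rule hh_class_pure_coeffs) (use m_pos in \<open>simp_all add: allowed_def Lam_gens Lam_smult p i\<close>)
  show "psi_m1_pos m = X.hclass (m - 1) (coch (m - 1) (pure_coeffs 0 Bw 1))"
    unfolding psi_m1_pos_def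
    by (rule hh_class_pure_coeffs) (use m_pos in \<open>simp_all add: allowed_def Lam_gens Lam_smult p i\<close>)
  show "chi_m_pos m = X.hclass m (coch m (pure_coeffs 0 Vx 0))"
    unfolding chi_m_pos_def by (rule hh_class_pure_coeffs) (simp_all add: allowed_def Lam_gens lsc_1)
  show "chi_m_neg m = X.hclass m (coch m (pure_coeffs (int m) Vx (int m)))"
    unfolding chi_m_neg_def by (rule hh_class_pure_coeffs) (simp_all add: allowed_def Lam_gens lsc_1 s)
qed

lemma generatedI: "c \<in> CM m n \<Longrightarrow> cdiff n c = 0 \<Longrightarrow> X.hclass n (coch n c) \<in> gens \<Longrightarrow> generated n c"
  by (simp add: generated_def subalgebra_gen.incl)

lemma generator_cocycles:
  "pure_coeffs 0 Fw 0 \<in> CM m 1 \<and> cdiff 1 (pure_coeffs 0 Fw 0) = 0"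
  "pure_coeffs 1 Bw 0 \<in> CM m 1 \<and> cdiff 1 (pure_coeffs 1 Bw 0) = 0"
  "pure_coeffs 1 Vx 1 \<in> CM m 2 \<and> cdiff 2 (pure_coeffs 1 Vx 1) = 0"
  "pure_coeffs (int m - 1) Fw 1 \<in> CM m (m - 1) \<and> cdiff (m - 1) (pure_coeffs (int m - 1) Fw 1) = 0"
  "pure_coeffs 0 Bw 1 \<in> CM m (m - 1) \<and> cdiff (m - 1) (pure_coeffs 0 Bw 1) = 0"
  "pure_coeffs 0 Vx 0 \<in> CM m m \<and> cdiff m (pure_coeffs 0 Vx 0) = 0"
  "pure_coeffs (int m) Vx (int m) \<in> CM m m \<and> cdiff m (pure_coeffs (int m) Vx (int m)) = 0"
  using m_pos m_even
  by (intro conjI pure_coeffs_CM pure_coeffs_cocycle_Fw pure_coeffs_cocycle_Bw pure_coeffs_cocycle_Vx; simp add: allowed_def of_nat_diff)+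

lemma generated_generators:
  "generated 1 (pure_coeffs 0 Fw 0)" "generated 1 (pure_coeffs 1 Bw 0)" "generated 2 (pure_coeffs 1 Vx 1)"
  "generated (m - 1) (pure_coeffs (int m - 1) Fw 1)" "generated (m - 1) (pure_coeffs 0 Bw 1)"
  "generated m (pure_coeffs 0 Vx 0)" "generated m (pure_coeffs (int m) Vx (int m))"
  using generator_cocycles
  by (auto intro!: generatedI simp: HH_generators_def generator_classes simp del: One_nat_def)

definition socle_coeffs :: "int \<Rightarrow> int \<Rightarrow> int \<Rightarrow> int \<Rightarrow> bt \<Rightarrow> 'k" where
  "socle_coeffs r0 i0 i r t = (if r = r0 \<and> t = So \<and> int m dvd i - i0 then 1 else 0)"

lemma central_class:
  assumes z: "z \<in> carrier \<Lambda>" "\<And>f. lmul (rho z) f = lmul f (rho z)"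
  defines "f \<equiv> \<lambda>x\<in>carrier (RP' 0). z \<otimes>\<^bsub>\<Lambda>\<^esub> resaug m x"
  shows "f \<in> CC 0" "cf 0 f i r = (if r = 0 then lmul (rho z) (bas m i Vx) i else 0)" "hh_central m z = X.hclass 0 f"
proof -
  have a: "resaug m x \<in> carrier \<Lambda>" if "x \<in> carrier (RP' 0)" for x
    using homD(1)[OF resaug_hom(1) that] by simp
  have c: "z \<otimes>\<^bsub>\<Lambda>\<^esub> x \<in> carrier \<Lambda>" "rho (z \<otimes>\<^bsub>\<Lambda>\<^esub> x) = lmul (rho z) (rho x)" if "x \<in> carrier \<Lambda>" for x
    using Lam_mult[OF z(1) that] by auto
  note h = homD[OF resaug_hom(1), simplified]
  have zl: "lmul (rho z) (lmul l y) = lmul l (lmul (rho z) y)" for l y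
    by (metis lmul_assoc z(2))
  show "f \<in> CC 0"
  proof (rule homI)
    show "f \<in> extensional (carrier (RP' 0))"
      by (simp add: f_def)
    show "f x \<in> carrier (regular_bimodule \<Lambda>)" if "x \<in> carrier (RP' 0)" for x
      using that by (simp add: f_def c a)
    show "f (x \<oplus>\<^bsub>RP' 0\<^esub> y) = f x \<oplus>\<^bsub>regular_bimodule \<Lambda>\<^esub> f y" if "x \<in> carrier (RP' 0)" "y \<in> carrier (RP' 0)" for x y
      using that by (intro rho_eqI) (simp_all add: f_def resP_add h(3) Lam_add c a lmul_add)
    show "f (b \<odot>\<^bsub>RP' 0\<^esub> x) = b \<odot>\<^bsub>regular_bimodule \<Lambda>\<^esub> f x" if "x \<in> carrier (RP' 0)" for b x
      using that by (intro rho_eqI) (simp_all add: f_def resP_smult h(4) Lam_smult c a lmul_sc)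
    show "f (lact (RP' 0) l x) = lact (regular_bimodule \<Lambda>) l (f x)" if "l \<in> carrier \<Lambda>" "x \<in> carrier (RP' 0)" for l x
      using that by (intro rho_eqI) (simp_all add: f_def resP_lact h(5) Lam_mult c a zl)
    show "f (ract (RP' 0) x l) = ract (regular_bimodule \<Lambda>) (f x) l" if "l \<in> carrier \<Lambda>" "x \<in> carrier (RP' 0)" for l x
      using that by (intro rho_eqI) (simp_all add: f_def resP_ract h(6) Lam_mult c a lmul_assoc)
  qed
  show "cf 0 f i r = (if r = 0 then lmul (rho z) (bas m i Vx) i else 0)"
  proof (rule ext)
    fix t
    have "cf 0 f i r t = lmul (rho z) (paug (pgen m 0 i r)) i t"
      by (simp add: cf_def f_def rgen_closed c a resaug_hom(2) crd_rgen)
    also have "paug (pgen m 0 i r) = (if r = 0 then bas m i Vx else 0 :: 'k lm)"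
    proof (cases "r = 0")
      case True
      then show ?thesis
        by (simp add: paug_pgen bas_mult_Vx)
    next
      case False
      then show ?thesis
        by (intro fun2_eqI) (simp add: paug_def pgen_def split: bt.split)
    qed
    finally have "cf 0 f i r t = lmul (rho z) (if r = 0 then bas m i Vx else 0) i t" .
    then show "cf 0 f i r t = (if r = 0 then lmul (rho z) (bas m i Vx) i else 0) t"
      by (cases "r = 0") (simp_all only: if_P if_not_P if_True if_False refl lmul_zero zero_fun_apply)
  qed
  show "hh_central m z = X.hclass 0 f"
    by (simp add: hh_central_def X.central_def X.hclass_def f_def)
qed

lemma socle_class:
  "hh_central m (aL m i0 \<otimes>\<^bsub>\<Lambda>\<^esub> abarL m i0) = X.hclass 0 (coch 0 (socle_coeffs 0 i0))"
  "socle_coeffs 0 i0 \<in> CM m 0" "cdiff 0 (socle_coeffs 0 i0) = 0"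
proof -
  let ?z = "aL m i0 \<otimes>\<^bsub>\<Lambda>\<^esub> abarL m i0"
  have z: "?z \<in> carrier \<Lambda>" "rho ?z = bas m i0 So"
    by (simp_all add: Lam_mult Lam_gens bas_mult_arrows)
  have cen: "lmul (rho ?z) f = lmul f (rho ?z)" for f
  proof (rule fun2_eqI)
    fix i t
    show "lmul (rho ?z) f i t = lmul f (rho ?z) i t"
      unfolding z by (cases t) (simp_all add: mul_defs bas_def)
  qed
  note cc = central_class[OF z(1) cen]
  have "cf 0 (\<lambda>x\<in>carrier (RP' 0). ?z \<otimes>\<^bsub>\<Lambda>\<^esub> resaug m x) = socle_coeffs 0 i0"
  proof (intro ext)
    fix i r t
    have "int m dvd i0 - i \<longleftrightarrow> int m dvd i - i0"
      by (rule dvd_neg_diff)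
    then show "cf 0 (\<lambda>x\<in>carrier (RP' 0). ?z \<otimes>\<^bsub>\<Lambda>\<^esub> resaug m x) i r t = socle_coeffs 0 i0 i r t"
      unfolding cc(2) z by (auto simp: bas_mult_Vx socle_coeffs_def, auto simp: bas_def)
  qed
  from coch_eqI[OF cc(1) this] cc(3) this cf_CM[OF cc(1)]
  show "hh_central m ?z = X.hclass 0 (coch 0 (socle_coeffs 0 i0))" "socle_coeffs 0 i0 \<in> CM m 0"
    by simp_all
  show "cdiff 0 (socle_coeffs 0 i0) = 0"
    by (intro ext) (rename_tac i r t, case_tac t, simp_all add: cdiff_def socle_coeffs_def)
qed

lemma one_class: "hh_central m \<one>\<^bsub>\<Lambda>\<^esub> = X.hclass 0 (resaug m)"
proof -
  have "(\<lambda>x\<in>carrier (RP' 0). \<one>\<^bsub>\<Lambda>\<^esub> \<otimes>\<^bsub>\<Lambda>\<^esub> resaug m x) = resaug m"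
  proof (rule extensionalityI[OF _ homD(2)[OF resaug_hom(1)]])
    fix x assume x: "x \<in> carrier (RP' 0)"
    have "resaug m x \<in> carrier \<Lambda>"
      using homD(1)[OF resaug_hom(1) x] by simp
    then have "\<one>\<^bsub>\<Lambda>\<^esub> \<otimes>\<^bsub>\<Lambda>\<^esub> resaug m x = resaug m x"
      by (intro rho_eqI) (simp_all add: Lam_mult Lam_one)
    then show "(\<lambda>x\<in>carrier (RP' 0). \<one>\<^bsub>\<Lambda>\<^esub> \<otimes>\<^bsub>\<Lambda>\<^esub> resaug m x) x = resaug m x"
      using x by simp
  qed simp
  then show ?thesis
    by (simp add: hh_central_def X.central_def X.hclass_def)
qed

lemma gens_closed_EA: "gens \<subseteq> carrier X.EA"
proof -
  have cl: "X.hclass n (coch n c) \<in> carrier X.EA" if "c \<in> CM m n \<and> cdiff n c = 0" for n c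
    using that by (intro X.hclass_closed coch_cocyc) auto
  have "resaug m \<in> X.cocyc 0"
    using X.aug_hom X.aug_d by (simp add: X.cocyc_iff)
  from X.hclass_closed[OF this] cl[OF conjI[OF socle_class(2,3)]] generator_cocycles[THEN cl] show ?thesis
    by (auto simp: HH_generators_def generator_classes socle_class(1) one_class simp del: One_nat_def)
qed

lemma generated_socle: "i0 \<in> {0..<int m} \<Longrightarrow> generated 0 (socle_coeffs 0 i0)"
  by (rule generatedI[OF socle_class(2,3)]) (auto simp: socle_class(1)[symmetric] HH_generators_def)

lemma generated_zero: "generated n (\<lambda>i r t. 0)"
proof (cases n)
  case 0
  then show ?thesis
    using generated_sc[OF generated_one, of 0] by simp
next
  case (Suc k)
  have "(\<lambda>i r t. 0 :: 'k) \<in> CM m k"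
    by (simp add: CM_def)
  from generated_coboundary[OF this] show ?thesis
    using Suc cdiff_sc[of k 0 "\<lambda>i r t. 0 :: 'k"] by simp
qed

lemma generated_sum:
  assumes "finite A" "\<And>x. x \<in> A \<Longrightarrow> generated n (c x)"
  shows "generated n (\<lambda>i r t. \<Sum>x\<in>A. c x i r t)"
  using assms by (induction A) (simp_all add: generated_zero generated_add)

section \<open>Multiples of the generators by chi classes\<close>

lemma generated_mult_pure_coeffs:
  assumes "generated p (pure_coeffs r1 t a)" "chi_degree q r0" "generated q (chi_coeffs r0)" "n = p + q" "r = r1 + r0" "even (a + r0 - b)"
  shows "generated n (pure_coeffs r t b)"
proof -
  have "sg (r0 * i) * pure_coeffs r1 t a i (r' - r0) t' = pure_coeffs r t b i r' t'" for i r' t'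
    using assms(5,6) by (auto simp: pure_coeffs_def sg_def algebra_simps)
  then show ?thesis
    using generated_mult[OF assms(1-3)] by (simp add: assms(4))
qed

text \<open>Strong induction on the degree, splitting off chi_{2,0}, chi_{m,1} or chi_{m,-1}
  according to whether q - 2 r0 is zero, positive or negative. In the last two cases divisibility
  forces its absolute value to be at least m, and this keeps the row of the cofactor within its
  range.\<close>

lemma generated_chi_coeffs: "chi_degree q r0 \<Longrightarrow> generated q (chi_coeffs r0)"
proof (induction q arbitrary: r0 rule: less_induct)
  case (less q)
  then have X: "even q" "0 \<le> r0" "r0 \<le> int q" "int m dvd int q - 2 * r0"
    by (auto simp: chi_degree_def)
  consider "q = 0" | "q > 0" "int q = 2 * r0" | "int q > 2 * r0" | "int q < 2 * r0"
    by linarith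
  then show ?case
  proof cases
    case 1
    then show ?thesis
      using X generated_one by simp
  next
    case 2
    then have q: "chi_degree (q - 2) (r0 - 1)" "q - 2 < q" "q = 2 + (q - 2)"
      using X by (auto simp: chi_degree_def of_nat_diff)
    show ?thesis
      unfolding chi_coeffs_eq by (rule generated_mult_pure_coeffs[OF generated_generators(3) q(1) less.IH[OF q(2,1)] q(3)]) simp_all
  next
    case 3
    then have "int m \<le> int q - 2 * r0"
      using X zdvd_imp_le by simp
    moreover have "int m dvd int q - int m - 2 * r0"
      using dvd_diff[OF X(4) dvd_refl] by (simp add: algebra_simps)
    ultimately have q: "chi_degree (q - m) r0" "q - m < q" "q = m + (q - m)"
      using X m_pos m_even by (auto simp: chi_degree_def of_nat_diff)
    show ?thesis
      unfolding chi_coeffs_eq by (rule generated_mult_pure_coeffs[OF generated_generators(6) q(1) less.IH[OF q(2,1)] q(3)]) simp_all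
  next
    case 4
    moreover have "int m dvd 2 * r0 - int q"
      using X(4) dvd_neg_diff by blast
    ultimately have "int m \<le> 2 * r0 - int q"
      using zdvd_imp_le by simp
    moreover have "int m dvd int q - int m - 2 * (r0 - int m)"
      using dvd_add[OF X(4) dvd_refl] by (simp add: algebra_simps)
    ultimately have q: "chi_degree (q - m) (r0 - int m)" "q - m < q" "q = m + (q - m)"
      using X m_pos m_even by (auto simp: chi_degree_def of_nat_diff)
    show ?thesis
      unfolding chi_coeffs_eq by (rule generated_mult_pure_coeffs[OF generated_generators(7) q(1) less.IH[OF q(2,1)] q(3)]) simp_all
  qed
qed

lemma generated_socle_coeffs:
  assumes "chi_degree n r0" "i0 \<in> {0..<int m}"
  shows "generated n (socle_coeffs r0 i0)"
proof -
  \<comment> \<open>On the support, where i is congruent to i0, the product carries the sign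
    \<open>sg (r0 * i0)\<close>; scaling by the same sign removes it.\<close>
  have "generated n (\<lambda>i r t. sg (r0 * i0) * (sg (r0 * i) * socle_coeffs 0 i0 i (r - r0) t))"
    using generated_sc[OF generated_mult[OF generated_socle[OF assms(2)] assms(1) generated_chi_coeffs[OF assms(1)]]] by simp
  moreover have "sg (r0 * i0) * (sg (r0 * i) * socle_coeffs 0 i0 i (r - r0) t) = socle_coeffs r0 i0 i r t" for i r t
    using sg_period[OF m_even, of i i0 r0, where 'a = 'k] by (auto simp: socle_coeffs_def sg_def)
  ultimately show ?thesis
    by simp
qed

text \<open>phi_{1,0} lives in row 0, so its product with a chi class of degree n - 1 keeps the row
  of that class, which is at most n - 1. The row r = n is obtained from phi_{m-1,-1}, which lives in
  the last row of its degree.\<close>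

lemma generated_pure_coeffs_Fw:
  assumes "odd n" "0 \<le> r" "r \<le> int n" "int m dvd int n - 2 * r - 1"
  shows "generated n (pure_coeffs r Fw r)"
proof (cases "r = int n")
  case False
  then have "chi_degree (n - 1) r" "n = 1 + (n - 1)"
    using assms odd_pos[of n] by (auto simp: chi_degree_def of_nat_diff algebra_simps)
  then show ?thesis
    by (intro generated_mult_pure_coeffs[OF generated_generators(1) _ generated_chi_coeffs]) simp_all
next
  case True
  \<comment> \<open>In the row r = n the divisibility condition reads m | n + 1. So n is at least m
    - 1, and the cofactor has both degree and row n + 1 - m.\<close>
  then have e: "int n - 2 * r - 1 = - (int n + 1)"
    by simp
  have "int m dvd int n + 1"
    using assms(4) e by (simp only: dvd_minus_iff)
  moreover from this have "m \<le> n + 1"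
    by (metis Suc_eq_plus1 dvd_imp_le int_dvd_int_iff of_nat_Suc semiring_1_class.of_nat_simps(2) zero_less_Suc add.commute)
  moreover have "int m dvd - (int n + 1 - int m)"
    using calculation(1) by (intro dvd_minus_iff[THEN iffD2] dvd_diff dvd_refl)
  ultimately have "chi_degree (n + 1 - m) (int (n + 1 - m))" "n = m - 1 + (n + 1 - m)"
    using assms(1) m_pos m_even by (auto simp: chi_degree_def of_nat_diff algebra_simps)
  then show ?thesis
    using True \<open>m \<le> n + 1\<close> m_even
    by (intro generated_mult_pure_coeffs[OF generated_generators(4) _ generated_chi_coeffs]) (assumption | simp add: of_nat_diff)+
qed

text \<open>Mirror image of the forward case: psi_{1,0} lives in row 1, so its products with chi
  classes miss the row r = 0, which is supplied by psi_{m-1,1}.\<close>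

lemma generated_pure_coeffs_Bw:
  assumes "odd n" "0 \<le> r" "r \<le> int n" "int m dvd int n - 2 * r + 1"
  shows "generated n (pure_coeffs r Bw (r + 1))"
proof (cases "r = 0")
  case False
  then have "chi_degree (n - 1) (r - 1)" "n = 1 + (n - 1)"
    using assms odd_pos[of n] by (auto simp: chi_degree_def of_nat_diff algebra_simps)
  then show ?thesis
    by (intro generated_mult_pure_coeffs[OF generated_generators(2) _ generated_chi_coeffs]) (assumption | presburger)+
next
  case True
  then have "int m dvd int n + 1"
    using assms(4) by simp
  moreover from this have "m \<le> n + 1"
    by (metis Suc_eq_plus1 dvd_imp_le int_dvd_int_iff of_nat_Suc semiring_1_class.of_nat_simps(2) zero_less_Suc add.commute)
  moreover have "int m dvd int n + 1 - int m"
    using calculation(1) by (intro dvd_diff dvd_refl)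
  ultimately have "chi_degree (n + 1 - m) 0" "n = m - 1 + (n + 1 - m)"
    using assms(1) m_pos m_even by (auto simp: chi_degree_def of_nat_diff algebra_simps)
  then show ?thesis
    using True by (intro generated_mult_pure_coeffs[OF generated_generators(5) _ generated_chi_coeffs]) (assumption | simp)+
qed

section \<open>Normal forms of cocycles in even and odd degree\<close>

lemma sign_rule:
  assumes "\<And>i. f (i + 1) = sg a * f i"
  shows "f i = sg (a * i) * (f 0 :: 'k)"
proof (induction i rule: int_induct[where k = 0])
  case base
  then show ?case
    by (simp add: sg_def)
next
  case (step1 i)
  then show ?case
    using assms[of i] by (simp add: sg_shift)
next
  case (step2 i)
  have "sg a * sg a = (1 :: 'k)"
    by (simp add: sg_def)
  moreover have "sg a * f i = sg a * sg a * f (i - 1)"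
    using assms[of "i - 1"] by simp
  ultimately show ?case
    using step2 by (simp add: sg_shift mult.assoc)
qed

text \<open>Since \<open>m\<close> is even, each divisibility condition in \<open>allowed\<close>
  implies the same condition modulo 2, where 2 r drops out.\<close>

lemma allowed_parity: "allowed m n r t \<Longrightarrow> even n \<longleftrightarrow> t = Vx \<or> t = So"
proof -
  have d: "int m dvd x \<Longrightarrow> even x" for x
    using m_even by (meson dvd_trans even_of_nat)
  show "allowed m n r t \<Longrightarrow> even n \<longleftrightarrow> t = Vx \<or> t = So"
    by (cases t) (auto simp: allowed_def dest!: d)
qed

lemma CM_reduce: "c \<in> CM m n \<Longrightarrow> c i = c (i mod int m)"
  by (rule CM_cong, assumption) (metis minus_mod_eq_mult_div dvd_triv_left)

text \<open>The forward component of the cocycle condition makes the vertex coefficients of row r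
  alternate like (-1)^(r i), so they are a multiple of a chi class. The socle coefficients are
  unconstrained and are reached one by one through \<open>socle_coeffs\<close>.\<close>

lemma generated_even:
  assumes c: "c \<in> CM m n" "cdiff n c = 0" and n: "even n"
  shows "generated n c"
proof -
  have Vx: "c i r Vx = sg (r * i) * c 0 r Vx" for i r
  proof (rule sign_rule)
    fix i
    have "c i r Vx + sg (int n + 1 + r) * c (i + 1) r Vx = 0"
      using fun_cong[OF fun_cong[OF fun_cong[OF c(2), of i], of r], of Fw] by (simp add: cdiff_def)
    moreover have "sg (int n + 1 + r) = - (sg r :: 'k)"
      using n by (auto simp: sg_def)
    moreover have "sg r * sg r = (1 :: 'k)"
      by (simp add: sg_def)
    ultimately show "c (i + 1) r Vx = sg r * c i r Vx"
      by (metis add.right_neutral add_diff_cancel_right' diff_0 eq_neg_iff_add_eq_0 minus_mult_left mult.assoc mult.left_neutral minus_minus)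
  qed
  have fin: "finite {0..int n}" "finite {0..<int m}"
    by simp_all
  let ?b = "\<lambda>r0 i r t. c 0 r0 Vx * chi_coeffs r0 i r t + (\<Sum>i0\<in>{0..<int m}. c i0 r0 So * socle_coeffs r0 i0 i r t)"
  have "generated n (?b r0)" if r0: "r0 \<in> {0..int n}" for r0
  proof (cases "int m dvd int n - 2 * r0")
    case True
    then have "chi_degree n r0"
      using r0 n by (simp add: chi_degree_def)
    then show ?thesis
      by (intro generated_add generated_sum generated_sc generated_chi_coeffs generated_socle_coeffs fin)
  next
    case False
    then have "c i r0 t = 0" if "t = Vx \<or> t = So" for i t
      using that by (intro CM_D(2)[OF c(1)]) (auto simp: allowed_def)
    then show ?thesis
      by (simp add: generated_zero)
  qed
  then have g: "generated n (\<lambda>i r t. \<Sum>r0\<in>{0..int n}. ?b r0 i r t)"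
    by (intro generated_sum fin)
  have "c i r t = (\<Sum>r0\<in>{0..int n}. ?b r0 i r t)" for i r t
  proof (cases "r \<in> {0..int n}")
    case False
    then have "?b r0 i r t = 0" if "r0 \<in> {0..int n}" for r0
      using that by (auto simp: chi_coeffs_def socle_coeffs_def intro!: sum.neutral)
    then show ?thesis
      using False CM_D(2)[OF c(1), of r t i] by (subst sum.neutral) auto
  next
    case True
    have "(\<Sum>r0\<in>{0..int n}. ?b r0 i r t) = (\<Sum>r0\<in>{0..int n}. if r0 = r then ?b r i r t else 0)"
      by (intro sum.cong refl) (auto simp: chi_coeffs_def socle_coeffs_def intro!: sum.neutral)
    also have "\<dots> = ?b r i r t"
      using True by (simp add: sum.delta)
    also have "\<dots> = c i r t"
    proof (cases t)
      case Vx
      then show ?thesis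
        using \<open>\<And>i r. c i r Vx = _\<close>[of i r] by (simp add: chi_coeffs_def socle_coeffs_def mult.commute)
    next
      case So
      have m0: "i mod int m \<in> {0..<int m}"
        using m_pos by simp
      have iff: "int m dvd i - i0 \<longleftrightarrow> i0 = i mod int m" if "i0 \<in> {0..<int m}" for i0
        using that by (metis atLeastLessThan_iff mod_eq_dvd_iff mod_mod_trivial mod_pos_pos_trivial)
      have "(\<Sum>i0\<in>{0..<int m}. c i0 r So * socle_coeffs r i0 i r So)
          = (\<Sum>i0\<in>{0..<int m}. if i0 = i mod int m then c i0 r So else 0)"
        by (intro sum.cong refl) (simp add: socle_coeffs_def iff)
      also have "\<dots> = c (i mod int m) r So"
        using m0 by (simp add: sum.delta)
      finally show ?thesis
        using So CM_reduce[OF c(1), of i] by (simp add: chi_coeffs_def)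
    qed (use n allowed_parity[of n r t] CM_D(2)[OF c(1), of r t i] in \<open>auto simp: chi_coeffs_def socle_coeffs_def\<close>)
    finally show ?thesis
      by simp
  qed
  then have "c = (\<lambda>i r t. \<Sum>r0\<in>{0..int n}. ?b r0 i r t)"
    by (intro ext)
  then show ?thesis
    using g by metis
qed

lemma generated_odd_normal:
  assumes c: "c \<in> CM m n" "cdiff n c = 0" and n: "odd n"
    and Fw: "\<And>i r. c i r Fw = sg (r * i) * c 0 r Fw"
  shows "generated n c"
proof -
  have Bw: "c i r Bw = sg ((r + 1) * i) * c 0 r Bw" for i r
  proof (rule sign_rule)
    fix i
    have "c i r Bw + c i (r - 1) Fw + sg r * (c (i + 1) r Bw + c (i - 1) (r - 1) Fw) = 0"
      using fun_cong[OF fun_cong[OF fun_cong[OF c(2), of i], of r], of So] n by (simp add: cdiff_def sg_def)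
    \<comment> \<open>The assumed shape of the forward coefficients makes them drop out of the socle
      component of the cocycle condition. What remains is a recursion for the backward coefficients
      with sign (-1)^(r+1).\<close>
    moreover have "c i (r - 1) Fw + sg r * c (i - 1) (r - 1) Fw = 0"
      unfolding Fw[of i] Fw[of "i - 1"] sg_shift by (auto simp: sg_def)
    moreover have "c i r Bw + sg r * c (i + 1) r Bw
        = (c i r Bw + c i (r - 1) Fw + sg r * (c (i + 1) r Bw + c (i - 1) (r - 1) Fw))
          - (c i (r - 1) Fw + sg r * c (i - 1) (r - 1) Fw)"
      by (simp add: algebra_simps)
    ultimately have "c i r Bw + sg r * c (i + 1) r Bw = 0"
      by simp
    then show "c (i + 1) r Bw = sg (r + 1) * c i r Bw"
      by (cases "even r") (auto simp: sg_def add_eq_0_iff)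
  qed
  let ?b = "\<lambda>r0 i r t. c 0 r0 Fw * pure_coeffs r0 Fw r0 i r t + c 0 r0 Bw * pure_coeffs r0 Bw (r0 + 1) i r t"
  have "generated n (?b r0)" if r0: "r0 \<in> {0..int n}" for r0
  proof (rule generated_add)
    show "generated n (\<lambda>i r t. c 0 r0 Fw * pure_coeffs r0 Fw r0 i r t)"
    proof (cases "allowed m n r0 Fw")
      case True
      then show ?thesis
        using r0 n by (intro generated_sc generated_pure_coeffs_Fw) (simp_all add: allowed_def)
    qed (simp add: CM_D(2)[OF c(1)] generated_zero)
    show "generated n (\<lambda>i r t. c 0 r0 Bw * pure_coeffs r0 Bw (r0 + 1) i r t)"
    proof (cases "allowed m n r0 Bw")
      case True
      then show ?thesis
        using r0 n by (intro generated_sc generated_pure_coeffs_Bw) (simp_all add: allowed_def)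
    qed (simp add: CM_D(2)[OF c(1)] generated_zero)
  qed
  then have g: "generated n (\<lambda>i r t. \<Sum>r0\<in>{0..int n}. ?b r0 i r t)"
    by (intro generated_sum) simp_all
  have "c i r t = (\<Sum>r0\<in>{0..int n}. ?b r0 i r t)" for i r t
  proof (cases "r \<in> {0..int n}")
    case False
    then have "?b r0 i r t = 0" if "r0 \<in> {0..int n}" for r0
      using that by (auto simp: pure_coeffs_def)
    then show ?thesis
      using False CM_D(2)[OF c(1), of r t i] by (subst sum.neutral) auto
  next
    case True
    have "(\<Sum>r0\<in>{0..int n}. ?b r0 i r t) = (\<Sum>r0\<in>{0..int n}. if r0 = r then ?b r i r t else 0)"
      by (intro sum.cong refl) (auto simp: pure_coeffs_def)
    also have "\<dots> = ?b r i r t"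
      using True by (simp add: sum.delta)
    also have "\<dots> = c i r t"
      using Fw[of i r] Bw[of i r] n allowed_parity[of n r t] CM_D(2)[OF c(1), of r t i]
      by (cases t) (auto simp: pure_coeffs_def mult.commute)
    finally show ?thesis
      by simp
  qed
  then have "c = (\<lambda>i r t. \<Sum>r0\<in>{0..int n}. ?b r0 i r t)"
    by (intro ext)
  then show ?thesis
    using g by metis
qed

text \<open>Partial sums over one period are an antidifference. At the wrap-around the partial sum
  becomes the total sum, which is zero like the empty sum it has to match.\<close>

lemma periodic_antidifference:
  fixes p :: "int \<Rightarrow> 'k"
  assumes p: "\<And>i. p i = p (i mod int m)" and s: "(\<Sum>j\<in>{0..<int m}. p j) = 0"
  obtains u where "\<And>i. u (i + int m) = u i" "\<And>i. u (i + 1) = u i + p i"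
proof
  let ?u = "\<lambda>i. \<Sum>j\<in>{0..<i mod int m}. p j"
  show "?u (i + int m) = ?u i" for i
    by simp
  show "?u (i + 1) = ?u i + p i" for i
  proof -
    let ?k = "i mod int m"
    have k: "0 \<le> ?k" "?k < int m"
      using m_pos by simp_all
    have "{0..<?k + 1} = insert ?k {0..<?k}"
      using k(1) by auto
    then have e: "(\<Sum>j\<in>{0..<?k + 1}. p j) = ?u i + p i"
      using p[of i] by (simp add: add.commute)
    have i: "(i + 1) mod int m = (?k + 1) mod int m"
      by (simp add: mod_add_left_eq)
    show ?thesis
    proof (cases "?k + 1 = int m")
      case True
      then show ?thesis
        using e s i by simp
    next
      case False
      then show ?thesis
        using e i k by simp
    qed
  qed
qed

text \<open>\<open>\<beta>\<close> is a twisted average over \<open>\<int>/m\<close>; only here the characteristic of the field matters.\<close>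

lemma twisted_average:
  fixes f :: "int \<Rightarrow> 'k"
  assumes "\<And>i. f i = f (i mod int m)"
  shows "\<exists>\<beta> u. (\<forall>i. u (i + int m) = u i) \<and> (\<forall>i. f i = sg (r * i) * (\<beta> + u i - u (i + 1)))"
proof -
  define \<beta> where "\<beta> = (\<Sum>j\<in>{0..<int m}. sg (r * j) * f j) / of_nat m"
  let ?p = "\<lambda>i. \<beta> - sg (r * i) * f i"
  have "sg (r * i) = (sg (r * (i mod int m)) :: 'k)" for i
    by (rule sg_period[OF m_even]) (metis minus_mod_eq_mult_div dvd_triv_left)
  then have p: "?p i = ?p (i mod int m)" for i
    using assms[of i] by simp
  \<comment> \<open>The value of \<beta> is chosen for this: the deviations from the average sum to
    zero, hence are differences of a periodic function.\<close>
  have s: "(\<Sum>j\<in>{0..<int m}. ?p j) = 0"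
    using m_char by (simp add: sum_subtractf \<beta>_def)
  obtain u where u: "\<And>i. u (i + int m) = u i" "\<And>i. u (i + 1) = u i + ?p i"
    using periodic_antidifference[of ?p, OF p s] by blast
  have "f i = sg (r * i) * (\<beta> + u i - u (i + 1))" for i
    unfolding u(2) by (simp add: sg_def)
  then show ?thesis
    using u(1) by blast
qed

text \<open>The coboundary of the vertex coefficients (-1)^(r i) u_r(i) contributes (-1)^(r i)
  (u_r(i) - u_r(i+1)) to the coefficients of the a_i, and subtracting it leaves (-1)^(r i)
  \<beta>_r. Cochains of degree n - 1 have no row n; there the cocycle condition itself forces the
  alternating shape.\<close>

lemma generated_odd:
  assumes c: "c \<in> CM m n" "cdiff n c = 0" and n: "odd n"
  shows "generated n c"
proof -
  obtain k where k: "n = Suc k" "even k"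
    using n by (cases n) auto
  have "\<forall>r. \<exists>\<beta> u. (\<forall>i. u (i + int m) = u i) \<and> (\<forall>i. c i r Fw = sg (r * i) * (\<beta> + u i - u (i + 1)))"
    using CM_reduce[OF c(1)] by (intro allI twisted_average) metis
  then obtain \<beta> u where u: "\<And>r i. u r (i + int m) = u r i"
      "\<And>r i. c i r Fw = sg (r * i) * (\<beta> r + u r i - u r (i + 1))"
    by metis
  \<comment> \<open>The guards cut the solution \<open>u\<close> down to a cochain of degree n - 1:
    only existing rows, and only where a vertex coefficient is allowed.\<close>
  define g where "g i r t = (if t = Vx \<and> 0 \<le> r \<and> r \<le> int k \<and> allowed m k r Vx then sg (r * i) * u r i else 0)" for i r t
  have sp: "sg (r * (i + int m)) = (sg (r * i) :: 'k)" for r i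
    by (rule sg_period[OF m_even]) simp
  have g: "g \<in> CM m k"
    by (auto simp: CM_def g_def sp u(1) fun_eq_iff)
  define d where "d = cdiff k g"
  have d: "generated n d"
    unfolding d_def k by (rule generated_coboundary[OF g])
  have dFw: "d i r Fw = (if 0 \<le> r \<and> r \<le> int k \<and> allowed m k r Vx then sg (r * i) * (u r i - u r (i + 1)) else 0)" for i r
    using k(2) by (auto simp: d_def cdiff_def g_def sg_shift) (auto simp: sg_def)
  let ?c = "\<lambda>i r t. c i r t + (- 1) * d i r t"
  have "generated n ?c"
  proof (rule generated_odd_normal[OF _ _ n])
    have d': "d \<in> CM m n" "cdiff n d = 0"
      using d by (simp_all add: generated_def)
    show "?c \<in> CM m n"
      by (rule CM_add[OF c(1) CM_sc[OF d'(1)]])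
    show "cdiff n ?c = 0"
      unfolding cdiff_add cdiff_sc c d' by (simp add: fun_eq_iff)
    fix i r
    consider "r < 0 \<or> int n < r \<or> \<not> allowed m n r Fw" | "0 \<le> r" "r \<le> int k" "allowed m n r Fw" | "r = int n"
      using k(1) by force
    then show "?c i r Fw = sg (r * i) * ?c 0 r Fw"
    proof cases
      case 1
      then show ?thesis
        by (simp add: CM_D(2)[OF c(1)] CM_D(2)[OF d'(1)])
    next
      case 2
      then have "allowed m k r Vx"
        by (simp add: allowed_def k(1))
      then have "?c i r Fw = sg (r * i) * \<beta> r" for i
        using 2 unfolding u(2) dFw by (simp add: algebra_simps)
      from this[of i] this[of 0] show ?thesis
        by (simp add: sg_def)
    next
      case 3
      have cn: "c i n Fw = sg (int n * i) * c 0 n Fw" for i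
      proof (rule sign_rule)
        fix i
        \<comment> \<open>The socle component in row n + 1 involves backward coefficients of row n +
          1, which vanish, and the forward coefficients of row n at two neighbouring
          vertices.\<close>
        have "c (i + 1) n Fw + c i n Fw = 0"
          using fun_cong[OF fun_cong[OF fun_cong[OF c(2), of "i + 1"], of "int n + 1"], of So] n
          by (simp add: cdiff_def sg_def CM_D(2)[OF c(1)])
        then show "c (i + 1) n Fw = sg (int n) * c i n Fw"
          using n by (simp add: sg_def eq_neg_iff_add_eq_0)
      qed
      have "d i n Fw = 0" for i
        unfolding dFw by (simp add: k(1))
      then show ?thesis
        using cn[of i] by (simp add: 3)
    qed
  qed
  from generated_add[OF this d] show ?thesis
    by simp
qed

lemma HH_generated: "subalgebra_gen (HH m) gens = carrier (HH m)"
  unfolding HH_EA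
proof (rule X.subalgebra_gen_EA[OF gens_closed_EA])
  fix n f assume f: "f \<in> X.cocyc n"
  then have c: "f \<in> CC n" "cdiff n (cf n f) = 0"
    by (simp_all add: cocyc_iff_cf)
  have "generated n (cf n f)"
    using generated_even[OF cf_CM[OF c(1)] c(2)] generated_odd[OF cf_CM[OF c(1)] c(2)] by blast
  then show "X.hclass n f \<in> subalgebra_gen X.EA gens"
    by (simp add: generated_def coch_eqI[OF c(1) refl])
qed

end

theorem theorem4p4:
  fixes m :: nat
  assumes "m \<ge> 3" and "even m"
    and "of_nat m \<noteq> (0 :: 'k::field)"
  shows "finite (HH_generators m :: 'k hh set)
    \<and> subalgebra_gen (HH m :: ('k, 'k hh) module) (HH_generators m) = carrier (HH m)"
proof -
  interpret zigzag_even m "TYPE('k)"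
    using assms by unfold_locales
  show ?thesis
    using HH_generated by (simp add: HH_generators_def Setcompr_eq_image)
qed

end
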